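(* Fix $2<p<\infty$. There exist $c_4>0$ and $C$ depending only on $p$ such that the following holds. Let $Q$ be a square, $E_0\subset0.9Q$ finite with $\|E_0\|_{\dot B}\le c_4\delta_Q^{2/p-1}$, and $x_0\in\frac12Q$ with $d(x_0,E_0)\ge\frac1{100}\delta_Q$. Then there exist a linear operator $\widehat T_0:\{f_0:E_0\to\mathbb{R}\}\times P\to L^{2,p}(Q)$ and linear functionals $\lambda_1,\dots,\lambda_{N_0}$ on $\{f_0:E_0\to\mathbb{R}\}\times P$ with $N_0\le C(\#E_0)^2$ such that, setting $\widehat M_Q(f_0,L_0)=\big(\sum_{i=1}^{N_0}|\lambda_i(f_0,L_0)|^p\big)^{1/p}$, for all $f_0:E_0\to\mathbb{R}$ and $L_0\in P$: (1) $\widehat T_0(f_0,L_0)|_{E_0}=f_0$; (2) $J_{x_0}\widehat T_0(f_0,L_0)=L_0$; (3) $\|\widehat T_0(f_0,L_0)\|_{L^{2,p}(Q)}\le C\inf\{\|F\|_{L^{2,p}(Q)}:F|_{E_0}=f_0,\ J_{x_0}F=L_0\}$; (4) $C^{-1}\widehat M_Q(f_0,L_0)\le\|\widehat T_0(f_0,L_0)\|_{L^{2,p}(Q)}\le C\widehat M_Q(f_0,L_0)$.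
   Context: A square is a closed axis-parallel square with side length $\delta_Q$, center $c_Q$, and $AQ=\{A(x-c_Q)+c_Q:x\in Q\}$. $P$ is the space of affine functions $A\cdot x+b$ on $\mathbb{R}^2$; $J_xF(y)=F(x)+\nabla F(x)\cdot(y-x)$ is the 1-jet. $\|F\|_{L^{2,p}(Q)}=\|\nabla^2F\|_{L^p(Q)}$. $\|\Omega\|_{\dot B}=\inf\{\|\varphi\|_{\dot B(\mathbb{R})}\}$ over Euclidean coordinates $(z_1,z_2)$ and $\varphi$ with $\Omega\subset\{(z_1,\varphi(z_1))_{z_1z_2}\}$, $\|\varphi\|_{\dot B(\mathbb{R})}=\big(\iint\frac{|\varphi'(x)-\varphi'(y)|^p}{|x-y|^p}dxdy\big)^{1/p}$. *)

theory Defs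
  imports "HOL-Analysis.Analysis"
begin

text \<open>Closed axis-parallel square with center c and side length d; the dilate A Q
  of the square with center c and side d is the square with center c and side A*d.\<close>
definition square :: "real^2 \<Rightarrow> real \<Rightarrow> (real^2) set" where
  "square c d = {x. \<forall>i. \<bar>x$i - c$i\<bar> \<le> d / 2}"

definition pderiv2 :: "2 \<Rightarrow> (real^2 \<Rightarrow> real) \<Rightarrow> real^2 \<Rightarrow> real" where
  "pderiv2 i F x = frechet_derivative F (at x) (axis i 1)"

fun iter_partials :: "nat \<Rightarrow> (real^2 \<Rightarrow> real) \<Rightarrow> (real^2 \<Rightarrow> real) set" where
  "iter_partials 0 f = {f}"
| "iter_partials (Suc k) f = {pderiv2 i g | g i. g \<in> iter_partials k f}"

definition test_fun :: "(real^2) set \<Rightarrow> (real^2 \<Rightarrow> real) \<Rightarrow> bool" where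
  "test_fun U \<phi> \<longleftrightarrow>
     (\<forall>k. \<forall>g \<in> iter_partials k \<phi>. (\<forall>x. g differentiable (at x)) \<and> continuous_on UNIV g)
     \<and> compact (closure {x. \<phi> x \<noteq> 0}) \<and> closure {x. \<phi> x \<noteq> 0} \<subseteq> U"

definition weak_hessian :: "real \<Rightarrow> (real^2) set \<Rightarrow> (real^2 \<Rightarrow> real) \<Rightarrow> (2 \<Rightarrow> 2 \<Rightarrow> real^2 \<Rightarrow> real) \<Rightarrow> bool" where
  "weak_hessian p Q F g \<longleftrightarrow>
     (\<forall>i j. g i j \<in> borel_measurable lborel
        \<and> set_integrable lborel Q (\<lambda>x. \<bar>g i j x\<bar> powr p)
        \<and> (\<forall>\<phi>. test_fun (interior Q) \<phi> \<longrightarrow>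
             (LINT x:interior Q|lborel. pderiv2 j F x * pderiv2 i \<phi> x)
               = - (LINT x:interior Q|lborel. g i j x * \<phi> x)))"

text \<open>The homogeneous Sobolev space L^{2,p}(Q), using the C^1 representative
  (which exists by Sobolev embedding since p > 2).\<close>
definition L2p :: "real \<Rightarrow> (real^2) set \<Rightarrow> (real^2 \<Rightarrow> real) set" where
  "L2p p Q = {F. (\<forall>x\<in>interior Q. F differentiable (at x))
                \<and> (\<forall>i. continuous_on (interior Q) (pderiv2 i F))
                \<and> (\<exists>g. weak_hessian p Q F g)}"

text \<open>The seminorm of the Hessian in L^p(Q) (weak Hessian is unique a.e.).\<close>
definition L2p_norm :: "real \<Rightarrow> (real^2) set \<Rightarrow> (real^2 \<Rightarrow> real) \<Rightarrow> real" where
  "L2p_norm p Q F = Inf {(\<Sum>i\<in>UNIV. \<Sum>j\<in>UNIV. LINT x:Q|lborel. \<bar>g i j x\<bar> powr p) powr (1/p)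
                         | g. weak_hessian p Q F g}"

definition affine_poly :: "(real^2 \<Rightarrow> real) set" where
  "affine_poly = {L. \<exists>a b. \<forall>y. L y = a \<bullet> y + b}"

definition jet1 :: "(real^2 \<Rightarrow> real) \<Rightarrow> real^2 \<Rightarrow> real^2 \<Rightarrow> real" where
  "jet1 F x = (\<lambda>y. F x + frechet_derivative F (at x) (y - x))"

definition besov_int :: "real \<Rightarrow> (real \<Rightarrow> real) \<Rightarrow> ennreal" where
  "besov_int p \<phi> = (\<integral>\<^sup>+ x. \<integral>\<^sup>+ y. ennreal (\<bar>deriv \<phi> x - deriv \<phi> y\<bar> powr p / \<bar>x - y\<bar> powr p) \<partial>lborel \<partial>lborel)"

text \<open>Besov norm of a set: infimum over Euclidean coordinate systems (isometries R of
  the plane, z = R x) and differentiable phi with the set contained in the graph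
  z_2 = phi(z_1).  Only admissible pairs with finite seminorm contribute.\<close>
definition besov_set_norm :: "real \<Rightarrow> (real^2) set \<Rightarrow> real" where
  "besov_set_norm p E = Inf {(enn2real (besov_int p \<phi>)) powr (1/p) | R \<phi>.
      (\<forall>x y. dist ((R::real^2\<Rightarrow>real^2) x) (R y) = dist x y) \<and> surj R \<and>
      (\<forall>t. \<phi> differentiable (at t)) \<and>
      besov_int p \<phi> < \<infinity> \<and>
      (\<forall>x\<in>E. (R x)$2 = \<phi> ((R x)$1))}"

end

theory Submission
  imports Defs
begin

text \<open>After subtracting \<open>L0\<close> one needs a linear extension of the data with vanishing jet at \<open>x0\<close>,
  and functionals whose \<open>p\<close>-norm bounds the norm of this extension and is bounded by the norm of
  any competitor \<open>F\<close>.

  A small Besov norm makes \<open>E\<close> a Lipschitz graph in suitable orthonormal coordinates \<open>u, n\<close>. At the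
  dyadic scale \<open>s m\<close>, a partition of unity in the tangential coordinate glues the affine functions
  through a point of \<open>E\<close> and its nearest neighbour to a function \<open>G\<^sub>m\<close>; the extension is the sum of
  the differences \<open>G\<^sub>m - G\<^sub>m\<^sub>-\<^sub>1\<close>, cut off at distance about \<open>s m\<close> from \<open>E\<close>. Its Hessian at scale \<open>s m\<close> is
  controlled by the differences of affine functions attached to neighbouring intervals, and
  collecting these by pairs of points of \<open>E\<close> gives \<open>4 (card E)\<^sup>2\<close> functionals.

  Conversely, these are differences of difference quotients of \<open>F\<close> along the curve, hence bounded
  by the oscillation of the gradient of \<open>F\<close> and, by Morrey's inequality, by the norm of \<open>F\<close> times
  the oscillation of the slope of the curve. Both are estimated by integrals over a region of size
  \<open>s m\<close> with the weight \<open>dist\<^sup>\<theta>\<close>, \<open>\<theta> = (p - 2) / 2\<close>: the weight costs nothing as \<open>\<theta> < p - 2\<close>, and as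
  \<open>\<theta> > 0\<close> it makes the sum over all scales a geometric series at each point.\<close>

section \<open>Smooth steps and bumps\<close>

text \<open>The number of scales depends on the gaps in \<open>E\<close> and not only on its
  cardinality, so no estimate may lose a factor per scale. For the extension this is settled
  pointwise: at a given point all but four scales have a cutoff with value 0 or 1 and vanishing
  derivatives, and the coarse ones telescope. For the trace it is settled by the weight: windows of
  all scales overlap near the curve, but the weighted integral at scale \<open>s m\<close> carries
  the factor (dist / \<open>s m\<close>)^\<theta>. Smallness of the Besov norm is spent on the slope
  of the curve. After that only its order of magnitude counts: by Morrey and the jet at x0 the
  gradient of F - L is at most \<Gamma> near \<open>E\<close>, and \<Gamma>^p times the Besov
  energy, of order \<delta>^(2-p), is a multiple of the energy of F. The affine function through a
  point and its nearest neighbour is the same at all scales, which keeps the functionals few, and it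
  makes sense however sparse \<open>E\<close> is. All lengths are tied to \<open>s0\<close> =
  \<delta>/100000, small enough for the windows to stay inside Q and for the cutoffs to stay away
  from x0.\<close>

fun Ck :: "nat \<Rightarrow> (real \<Rightarrow> real) \<Rightarrow> bool" where
  "Ck 0 f \<longleftrightarrow> continuous_on UNIV f"
| "Ck (Suc n) f \<longleftrightarrow> (\<exists>f'. (\<forall>x. (f has_real_derivative f' x) (at x)) \<and> Ck n f')"

text \<open>\<open>Ck\<close> recurses on the order and asks for some derivative at each stage, so
  closure under sums, products and reciprocals is a plain induction on the order.\<close>

definition smooth :: "(real \<Rightarrow> real) \<Rightarrow> bool" where
  "smooth f \<longleftrightarrow> (\<forall>n. Ck n f)"

lemma Ck_SucI: "(\<And>x. (f has_real_derivative f' x) (at x)) \<Longrightarrow> Ck n f' \<Longrightarrow> Ck (Suc n) f"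
  by auto

lemma Ck_imp_continuous: "Ck n f \<Longrightarrow> continuous_on UNIV f"
proof (cases n)
  case (Suc m)
  assume "Ck n f"
  then obtain f' where "\<forall>x. (f has_real_derivative f' x) (at x)" using Suc by auto
  then show ?thesis using DERIV_isCont by (blast intro: continuous_at_imp_continuous_on)
qed auto

lemma Ck_Suc_imp: "Ck (Suc n) f \<Longrightarrow> Ck n f"
proof (induction n arbitrary: f)
  case 0
  then show ?case using Ck_imp_continuous[of "Suc 0" f] by simp
next
  case (Suc n)
  then obtain f' where d: "\<forall>x. (f has_real_derivative f' x) (at x)" "Ck (Suc n) f'"
    unfolding Ck.simps(2)[of "Suc n"] by blast
  from Suc.IH[OF d(2)] d(1) show ?case unfolding Ck.simps(2)[of n f] by blast
qed

lemma Ck_const: "Ck n (\<lambda>x. c)"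
  by (induction n arbitrary: c) (auto intro!: exI[of _ "\<lambda>x. 0"])

lemma Ck_add: "Ck n f \<Longrightarrow> Ck n g \<Longrightarrow> Ck n (\<lambda>x. f x + g x)"
proof (induction n arbitrary: f g)
  case 0
  then show ?case by (auto intro: continuous_intros)
next
  case (Suc n)
  then obtain f' g' where "\<forall>x. (f has_real_derivative f' x) (at x)" "Ck n f'"
    "\<forall>x. (g has_real_derivative g' x) (at x)" "Ck n g'" by auto
  then show ?case using Suc.IH[of f' g']
    by (auto intro!: exI[of _ "\<lambda>x. f' x + g' x"] derivative_eq_intros)
qed

lemma Ck_mult: "Ck n f \<Longrightarrow> Ck n g \<Longrightarrow> Ck n (\<lambda>x. f x * g x)"
proof (induction n arbitrary: f g)
  case 0
  then show ?case by (auto intro: continuous_intros)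
next
  case (Suc n)
  then obtain f' g' where d: "\<forall>x. (f has_real_derivative f' x) (at x)" "Ck n f'"
    "\<forall>x. (g has_real_derivative g' x) (at x)" "Ck n g'" by auto
  have "Ck n f" "Ck n g" using Suc.prems Ck_Suc_imp by blast+
  then have "Ck n (\<lambda>x. f' x * g x + f x * g' x)"
    using d Suc.IH by (intro Ck_add) auto
  then show ?case using d
    by (auto intro!: exI[of _ "\<lambda>x. f' x * g x + f x * g' x"] derivative_eq_intros)
qed

lemma Ck_compose_affine: "Ck n f \<Longrightarrow> Ck n (\<lambda>x. f (a * x + b))"
proof (induction n arbitrary: f)
  case 0
  then have f: "continuous_on UNIV f" by simp
  have "continuous_on UNIV (\<lambda>x. a * x + b)" by (intro continuous_intros)
  from continuous_on_compose2[OF f this] show ?case by simp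
next
  case (Suc n)
  then obtain f' where d: "\<forall>x. (f has_real_derivative f' x) (at x)" "Ck n f'" by auto
  have "((\<lambda>x. f (a * x + b)) has_real_derivative a * f' (a * x + b)) (at x)" for x
  proof -
    have "((\<lambda>x. a * x + b) has_real_derivative a) (at x)" by (auto intro!: derivative_eq_intros)
    from DERIV_chain2[OF d(1)[rule_format] this] show ?thesis by (simp add: mult.commute)
  qed
  moreover have "Ck n (\<lambda>x. a * f' (a * x + b))"
    using Suc.IH[OF d(2)] Ck_const[of n a] Ck_mult[of n "\<lambda>x. a"] by auto
  ultimately show ?case by (rule Ck_SucI)
qed

lemma Ck_inverse: "Ck n f \<Longrightarrow> (\<And>x. f x \<noteq> 0) \<Longrightarrow> Ck n (\<lambda>x. inverse (f x))"
proof (induction n)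
  case 0
  then show ?case by (auto intro: continuous_intros)
next
  case (Suc n)
  then obtain f' where d: "\<forall>x. (f has_real_derivative f' x) (at x)" "Ck n f'" by auto
  have i: "Ck n (\<lambda>x. inverse (f x))" using Suc Ck_Suc_imp by blast
  have "((\<lambda>x. inverse (f x)) has_real_derivative (-1) * (f' x * (inverse (f x) * inverse (f x)))) (at x)" for x
    using d(1) Suc.prems(2) by (auto intro!: derivative_eq_intros simp: mult_ac)
  moreover have "Ck n (\<lambda>x. (-1) * (f' x * (inverse (f x) * inverse (f x))))"
    using i d(2) by (intro Ck_mult Ck_const) auto
  ultimately show ?case by (rule Ck_SucI)
qed

lemma smooth_const: "smooth (\<lambda>x. c)" by (simp add: smooth_def Ck_const)
lemma smooth_add: "smooth f \<Longrightarrow> smooth g \<Longrightarrow> smooth (\<lambda>x. f x + g x)" by (simp add: smooth_def Ck_add)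
lemma smooth_mult: "smooth f \<Longrightarrow> smooth g \<Longrightarrow> smooth (\<lambda>x. f x * g x)" by (simp add: smooth_def Ck_mult)
lemma smooth_compose_affine: "smooth f \<Longrightarrow> smooth (\<lambda>x. f (a * x + b))" by (simp add: smooth_def Ck_compose_affine)

lemma smooth_sum: "(\<And>i. i \<in> I \<Longrightarrow> smooth (f i)) \<Longrightarrow> smooth (\<lambda>x. \<Sum>i\<in>I. f i x)"
  by (induction I rule: infinite_finite_induct) (auto intro: smooth_const smooth_add)

lemma smooth_continuous: "smooth f \<Longrightarrow> continuous_on UNIV f"
  using Ck.simps(1) smooth_def by blast

lemma smooth_has_derivative: "smooth f \<Longrightarrow> (f has_real_derivative deriv f x) (at x)"
proof -
  assume "smooth f"
  then have "Ck (Suc 0) f" unfolding smooth_def by blast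
  then obtain f' where "\<forall>x. (f has_real_derivative f' x) (at x)" by auto
  then show ?thesis using DERIV_imp_deriv by metis
qed

lemma smooth_deriv: "smooth f \<Longrightarrow> smooth (deriv f)"
  unfolding smooth_def
proof
  fix n assume "\<forall>n. Ck n f"
  then have "Ck (Suc n) f" by blast
  then obtain f' where "\<forall>x. (f has_real_derivative f' x) (at x)" "Ck n f'"
    by auto
  moreover then have "deriv f = f'" by (auto simp: DERIV_imp_deriv)
  ultimately show "Ck n (deriv f)" by simp
qed

text \<open>The functions P(1/x) exp(-1/x), extended by 0 to x \<le> 0, for all polynomials P at
  once: this family is closed under differentiation, so smoothness is an induction with P arbitrary.
  P = 1 is the usual flat function.\<close>

definition expflat :: "real poly \<Rightarrow> real \<Rightarrow> real" where
  "expflat P x = (if x > 0 then poly P (1/x) * exp (- (1/x)) else 0)"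

lemma poly_exp_tendsto_0: "((\<lambda>y::real. poly P y * exp (- y)) \<longlongrightarrow> 0) at_top"
proof -
  have "((\<lambda>y. \<Sum>i\<le>degree P. coeff P i * (y ^ i / exp y)) \<longlongrightarrow> (\<Sum>i\<le>degree P. coeff P i * 0)) at_top"
    by (intro tendsto_intros tendsto_power_div_exp_0)
  then show ?thesis
    by (simp add: poly_altdef sum_distrib_right exp_minus divide_inverse mult.assoc)
qed

text \<open>In terms of y = 1/h the quotient is y P(y) exp(-y), again a polynomial times the
  exponential; \<open>pCons 0 P\<close> is the polynomial y P(y).\<close>

lemma expflat_quotient_tendsto_0: "((\<lambda>h. expflat P h / h) \<longlongrightarrow> 0) (at 0)"
proof -
  have "((\<lambda>y. poly (pCons 0 P) y * exp (- y)) \<longlongrightarrow> 0) at_top" by (rule poly_exp_tendsto_0)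
  then have "((\<lambda>h. poly (pCons 0 P) (inverse h) * exp (- inverse h)) \<longlongrightarrow> 0) (at_right 0)"
    by (rule filterlim_compose[OF _ filterlim_inverse_at_top_right])
  then have r: "((\<lambda>h. expflat P h / h) \<longlongrightarrow> 0) (at_right 0)"
    by (rule Lim_transform_eventually)
       (auto simp: eventually_at_right_field expflat_def field_simps intro!: exI[of _ 1])
  have "((\<lambda>h::real. 0::real) \<longlongrightarrow> 0) (at_left 0)" by simp
  then have l: "((\<lambda>h. expflat P h / h) \<longlongrightarrow> 0) (at_left 0)"
    by (rule Lim_transform_eventually)
       (auto simp: eventually_at_left_field expflat_def intro!: exI[of _ "-1"])
  show ?thesis using l r by (simp add: filterlim_split_at)
qed

text \<open>With y = 1/x one has d/dx = - y^2 d/dy, which turns P(y) exp(-y) into y^2 (P(y) - P'(y))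
  exp(-y); \<open>[:0,0,1:]\<close> is y^2.\<close>

lemma expflat_has_derivative:
  "(expflat P has_real_derivative expflat ([:0,0,1:] * (P - pderiv P)) x) (at x)"
proof (cases x "0::real" rule: linorder_cases)
  case less
  have "((\<lambda>x. 0) has_real_derivative 0) (at x)" by simp
  then have "(expflat P has_real_derivative 0) (at x)"
    by (rule DERIV_cong_ev[OF refl _ refl, THEN iffD2, rotated])
       (use less in \<open>auto simp: expflat_def eventually_nhds intro!: exI[of _ "{..<0}"]\<close>)
  then show ?thesis using less by (simp add: expflat_def)
next
  case equal
  have "expflat P 0 = 0" by (simp add: expflat_def)
  then have "(expflat P has_real_derivative 0) (at 0)"
    using expflat_quotient_tendsto_0[of P] by (simp add: DERIV_def)
  then show ?thesis using equal by (simp add: expflat_def)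
next
  case greater
  have "((\<lambda>x. poly P (1/x) * exp (- (1/x))) has_real_derivative
      poly (pderiv P) (1/x) * (- (1 / x^2)) * exp (- (1/x)) + poly P (1/x) * (exp (- (1/x)) * (1/x^2))) (at x)"
    using greater
    by (auto intro!: derivative_eq_intros DERIV_chain2[OF poly_DERIV] simp: power2_eq_square)
  also have "poly (pderiv P) (1/x) * (- (1 / x^2)) * exp (- (1/x)) + poly P (1/x) * (exp (- (1/x)) * (1/x^2))
      = expflat ([:0,0,1:] * (P - pderiv P)) x"
    using greater by (simp add: expflat_def field_simps power2_eq_square)
  finally show ?thesis
    by (rule DERIV_cong_ev[OF refl _ refl, THEN iffD2, rotated])
       (use greater in \<open>auto simp: expflat_def eventually_nhds intro!: exI[of _ "{0<..}"]\<close>)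
qed

lemma smooth_expflat: "smooth (expflat P)"
proof -
  have "Ck n (expflat P)" for n
  proof (induction n arbitrary: P)
    case 0
    have "isCont (expflat P) x" for x using expflat_has_derivative DERIV_isCont by blast
    then show ?case by (simp add: continuous_at_imp_continuous_on)
  next
    case (Suc n)
    then show ?case using expflat_has_derivative by auto
  qed
  then show ?thesis by (simp add: smooth_def)
qed

text \<open>Constant outside \<open>[-1, 1]\<close>; all bumps and cutoffs are differences of its translates.\<close>

definition sstep :: "real \<Rightarrow> real" where
  "sstep x = expflat 1 (1 + x) * inverse (expflat 1 (1 + x) + expflat 1 (1 - x))"

lemma expflat_1_nonneg: "expflat 1 x \<ge> 0" by (simp add: expflat_def)

lemma sstep_denominator_pos: "expflat 1 (1 + x) + expflat 1 (1 - x) > 0"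
proof (cases "x > -1")
  case True
  then have "expflat 1 (1 + x) > 0" by (simp add: expflat_def)
  then show ?thesis using expflat_1_nonneg[of "1 - x"] by linarith
next
  case False
  then have "expflat 1 (1 - x) > 0" by (simp add: expflat_def)
  then show ?thesis using expflat_1_nonneg[of "1 + x"] by linarith
qed

lemma smooth_sstep: "smooth sstep"
proof -
  have a: "smooth (\<lambda>x. expflat 1 (1 + x))" using smooth_compose_affine[OF smooth_expflat, of 1 1 1] by (simp add: add.commute)
  have b: "smooth (\<lambda>x. expflat 1 (1 - x))" using smooth_compose_affine[OF smooth_expflat, of 1 "-1" 1] by simp
  have "smooth (\<lambda>x. inverse (expflat 1 (1 + x) + expflat 1 (1 - x)))"
    using smooth_add[OF a b] less_imp_neq[OF sstep_denominator_pos, symmetric]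
    unfolding smooth_def by (intro allI Ck_inverse) blast+
  then have "smooth (\<lambda>x. expflat 1 (1 + x) * inverse (expflat 1 (1 + x) + expflat 1 (1 - x)))"
    by (rule smooth_mult[OF a])
  then show ?thesis unfolding sstep_def[abs_def] .
qed

lemma sstep_left: "x \<le> -1 \<Longrightarrow> sstep x = 0" by (simp add: sstep_def expflat_def)

lemma sstep_right: "x \<ge> 1 \<Longrightarrow> sstep x = 1"
  using sstep_denominator_pos[of x] by (simp add: sstep_def expflat_def)

lemma sstep_bounds: "0 \<le> sstep x" "sstep x \<le> 1"
  using sstep_denominator_pos[of x] expflat_1_nonneg[of "1 - x"] expflat_1_nonneg[of "1 + x"]
  by (auto simp: sstep_def field_simps)

section \<open>Derivatives of the step function and their bounds\<close>

definition ds :: "nat \<Rightarrow> real \<Rightarrow> real" where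
  "ds i = (deriv ^^ i) sstep"

lemma ds_0: "ds 0 = sstep" by (simp add: ds_def)

lemma smooth_ds: "smooth (ds i)"
  by (induction i) (auto simp: ds_def smooth_sstep smooth_deriv)

lemma ds_has_derivative: "(ds i has_real_derivative ds (Suc i) x) (at x)"
  using smooth_has_derivative[OF smooth_ds] by (simp add: ds_def)

lemma ds_continuous: "continuous_on S (ds i)"
  using smooth_continuous[OF smooth_ds] continuous_on_subset by blast

lemma DERIV_locally_const:
  fixes f :: "real \<Rightarrow> real"
  assumes "open U" "x \<in> U" "\<And>y. y \<in> U \<Longrightarrow> f y = c"
  shows "(f has_real_derivative 0) (at x)"
  by (rule has_field_derivative_transform_within_open[OF DERIV_const assms(1,2)]) (simp add: assms(3))

lemma ds_outside_open: "\<bar>x\<bar> > 1 \<Longrightarrow> ds (Suc i) x = 0"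
proof (induction i arbitrary: x)
  case 0
  have "(ds 0 has_real_derivative 0) (at x)"
  proof (cases "x > 1")
    case True
    then show ?thesis
      by (intro DERIV_locally_const[of "{1<..}" _ _ 1]) (auto simp: ds_0 sstep_right)
  next
    case False
    then show ?thesis using 0
      by (intro DERIV_locally_const[of "{..<-1}" _ _ 0]) (auto simp: ds_0 sstep_left)
  qed
  then show ?case using ds_has_derivative[of 0 x] DERIV_unique by blast
next
  case (Suc i)
  have o: "open {y::real. 1 < \<bar>y\<bar>}" by (intro open_Collect_less continuous_intros)
  have "(ds (Suc i) has_real_derivative 0) (at x)"
    by (rule DERIV_locally_const[OF o]) (use Suc in auto)
  then show ?case using ds_has_derivative[of "Suc i" x] DERIV_unique by blast
qed

text \<open>Continuity carries the vanishing to the end points, so that supports can later be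
  described by non-strict inequalities.\<close>

lemma ds_outside: "\<bar>x\<bar> \<ge> 1 \<Longrightarrow> ds (Suc i) x = 0"
proof (rule ccontr)
  assume x: "\<bar>x\<bar> \<ge> 1" and n: "ds (Suc i) x \<noteq> 0"
  have "isCont (ds (Suc i)) x" using ds_has_derivative DERIV_isCont by blast
  then obtain d where d: "d > 0" "\<And>y. \<bar>y - x\<bar> < d \<Longrightarrow> \<bar>ds (Suc i) y - ds (Suc i) x\<bar> < \<bar>ds (Suc i) x\<bar>"
    using n unfolding continuous_at_real_range real_norm_def by (meson zero_less_abs_iff)
  define y where "y = (if x > 0 then x + d/2 else x - d/2)"
  have "\<bar>y\<bar> > 1" "\<bar>y - x\<bar> < d" using x d(1) by (auto simp: y_def abs_if split: if_splits)
  then show False using d(2)[of y] ds_outside_open[of y i] by simp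
qed

lemma ds_bounded: "\<exists>B. \<forall>x. \<bar>ds i x\<bar> \<le> B"
proof (cases i)
  case 0
  then show ?thesis using sstep_bounds by (intro exI[of _ 1]) (simp add: ds_0)
next
  case (Suc j)
  have "compact (ds i ` {-1..1})" by (intro compact_continuous_image ds_continuous) auto
  then obtain B where B: "\<And>x. x \<in> {-1..1} \<Longrightarrow> \<bar>ds i x\<bar> \<le> B"
    using compact_imp_bounded bounded_iff by (metis imageI real_norm_def)
  have "\<bar>ds i x\<bar> \<le> max B 0" for x
    using B[of x] ds_outside[of x j] Suc by (cases "\<bar>x\<bar> \<le> 1") (auto simp: abs_le_iff)
  then show ?thesis by blast
qed

text \<open>One bound for the step and its first two derivatives, which is all that a Hessian sees.
  It is an absolute constant, independent of p and of the set.\<close>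

definition KB :: real where
  "KB = (SOME B. B \<ge> 1 \<and> (\<forall>i\<le>2. \<forall>x. \<bar>ds i x\<bar> \<le> B))"

lemma KB: "KB \<ge> 1" "i \<le> 2 \<Longrightarrow> \<bar>ds i x\<bar> \<le> KB"
proof -
  obtain B0 B1 B2 where B: "\<And>x. \<bar>ds 0 x\<bar> \<le> B0" "\<And>x. \<bar>ds 1 x\<bar> \<le> B1" "\<And>x. \<bar>ds 2 x\<bar> \<le> B2"
    using ds_bounded[of 0] ds_bounded[of 1] ds_bounded[of 2] by auto
  have "\<bar>ds i x\<bar> \<le> max 1 (max B0 (max B1 B2))" if "i \<le> 2" for i x
  proof -
    have "i = 0 \<or> i = 1 \<or> i = 2" using that by linarith
    then show ?thesis using B[of x] by (elim disjE) (simp_all add: le_max_iff_disj)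
  qed
  then have "\<exists>B. B \<ge> 1 \<and> (\<forall>i\<le>2. \<forall>x. \<bar>ds i x\<bar> \<le> B)"
    by (intro exI[of _ "max 1 (max B0 (max B1 B2))"]) auto
  from someI_ex[OF this] show "KB \<ge> 1" "i \<le> 2 \<Longrightarrow> \<bar>ds i x\<bar> \<le> KB"
    by (auto simp: KB_def)
qed

section \<open>Test functions in the plane\<close>

definition vec2 :: "real \<times> real \<Rightarrow> real^2" where
  "vec2 z = (\<chi> i. if i = 1 then fst z else snd z)"

lemma vec2_nth [simp]: "vec2 z $ 1 = fst z" "vec2 z $ 2 = snd z"
  by (simp_all add: vec2_def)

lemma measurable_vec2 [measurable]: "vec2 \<in> measurable (lborel \<Otimes>\<^sub>M lborel) borel"
proof -
  have "continuous_on UNIV (\<lambda>z. if i = 1 then fst z else snd z :: real)" for i :: 2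
    by (cases "i = 1") (auto intro: continuous_intros)
  then have "continuous_on UNIV vec2"
    unfolding vec2_def[abs_def] by (intro continuous_on_vec_lambda)
  then show ?thesis
    by (simp add: borel_measurable_continuous_onI lborel_prod)
qed

text \<open>Lebesgue measure is characterised by its values on boxes, so it suffices to compare
  these. The identification with the product measure opens the way to Fubini in
  \<open>integral_tensor\<close>.\<close>

lemma lborel_real2_eq_distr:
  "(lborel :: (real^2) measure) = distr (lborel \<Otimes>\<^sub>M lborel) borel vec2"
proof (rule lborel_eqI)
  fix l u :: "real^2"
  assume le: "\<And>b. b \<in> Basis \<Longrightarrow> l \<bullet> b \<le> u \<bullet> b"
  have lu: "l $ i \<le> u $ i" for i
    using le[of "axis i 1"] by (auto simp: inner_axis Basis_vec_def)
  have "vec2 -` box l u \<inter> space (lborel \<Otimes>\<^sub>M lborel) = {l$1<..<u$1} \<times> {l$2<..<u$2}"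
    by (auto simp: mem_box_cart forall_2 space_pair_measure)
  then have "emeasure (distr (lborel \<Otimes>\<^sub>M lborel) borel vec2) (box l u)
      = emeasure (lborel \<Otimes>\<^sub>M lborel) ({l$1<..<u$1} \<times> {l$2<..<u$2})"
    by (simp add: emeasure_distr)
  also have "\<dots> = emeasure lborel {l$1<..<u$1} * emeasure lborel {l$2<..<u$2}"
    by (intro lborel.emeasure_pair_measure_Times) auto
  also have "\<dots> = ennreal ((u$1 - l$1) * (u$2 - l$2))"
    using lu by (simp add: ennreal_mult)
  also have "(u$1 - l$1) * (u$2 - l$2) = (\<Prod>b\<in>Basis. (u - l) \<bullet> b)"
  proof -
    have b: "(Basis :: (real^2) set) = (\<lambda>i. axis i 1) ` UNIV" by (auto simp: Basis_vec_def)
    have "inj (\<lambda>i::2. axis i (1::real))" by (auto simp: inj_on_def axis_eq_axis)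
    then show ?thesis unfolding b
      by (simp add: prod.reindex inner_axis UNIV_2)
  qed
  finally show "emeasure (distr (lborel \<Otimes>\<^sub>M lborel) borel vec2) (box l u) = ennreal (\<Prod>b\<in>Basis. (u - l) \<bullet> b)" .
qed simp

section \<open>Products of functions of one variable\<close>

lemma integral_tensor:
  fixes a b :: "real \<Rightarrow> real"
  assumes [measurable]: "a \<in> borel_measurable borel" "b \<in> borel_measurable borel"
    and "integrable lborel a" "integrable lborel b"
  shows "(LINT x|lborel. a ((x::real^2)$1) * b (x$2)) = (LINT t|lborel. a t) * (LINT t|lborel. b t)"
proof -
  have c: "(\<lambda>x::real^2. a (x$1) * b (x$2)) \<in> borel_measurable borel"
    by measurable
  have "(LINT x|lborel. a ((x::real^2)$1) * b (x$2)) = (LINT (s,t)|(lborel \<Otimes>\<^sub>M lborel). a s * b t)"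
    by (subst lborel_real2_eq_distr, subst integral_distr[OF measurable_vec2 c]) (simp add: case_prod_beta')
  also have "\<dots> = (LINT s|lborel. LINT t|lborel. a s * b t)"
  proof -
    have "integrable (lborel \<Otimes>\<^sub>M lborel) (\<lambda>(s,t). a s * b t)"
      using lborel_pair.Fubini_integrable[of "\<lambda>(s,t). a s * b t"] assms(3,4)
      by (simp add: abs_mult integrable_mult_left)
    from lborel_pair.integral_fst[OF this] show ?thesis by simp
  qed
  finally show ?thesis by simp
qed

text \<open>The derivative of the rescaled step. Hence its integral is exactly 1 for every
  \<open>s > 0\<close>, and the difference of two bumps is the derivative of a compactly supported
  function bounded by 1; \<open>avg_diff1\<close> and \<open>avg_diff2\<close> rest on this.\<close>

definition bump :: "real \<Rightarrow> real \<Rightarrow> real \<Rightarrow> real" where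
  "bump c s t = ds 1 ((t - c) / s) / s"

lemma bump_continuous: "continuous_on S (bump c s)"
proof -
  have "continuous_on UNIV (\<lambda>t. ds 1 ((t - c) * inverse s) * inverse s)"
    by (intro continuous_intros continuous_on_compose2[OF ds_continuous[of UNIV 1]]) auto
  then show ?thesis by (auto simp: bump_def[abs_def] divide_inverse intro: continuous_on_subset)
qed

lemma bump_bound: "s > 0 \<Longrightarrow> \<bar>bump c s t\<bar> \<le> KB / s"
  using KB(2)[of 1] by (simp add: bump_def divide_right_mono)

lemma bump_outside: "s > 0 \<Longrightarrow> \<bar>t - c\<bar> \<ge> s \<Longrightarrow> bump c s t = 0"
  using ds_outside[of "(t - c) / s" 0] by (simp add: bump_def)

lemma step_has_derivative: "((\<lambda>t. ds 0 ((t - c) / s)) has_real_derivative bump c s t) (at t)"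
proof -
  have "((\<lambda>t. (t - c) / s) has_real_derivative 1 / s) (at t)"
    by (cases "s = 0") (auto intro!: derivative_eq_intros)
  from DERIV_chain2[OF ds_has_derivative[of 0] this] show ?thesis by (simp add: bump_def)
qed

lemma smooth_bump: "smooth (bump c s)"
proof -
  have "smooth (\<lambda>t. inverse s * ds 1 (inverse s * t + (- c * inverse s)))"
    by (intro smooth_mult smooth_const smooth_compose_affine smooth_ds)
  moreover have "(\<lambda>t. inverse s * ds 1 (inverse s * t + (- c * inverse s))) = bump c s"
    by (auto simp: bump_def fun_eq_iff field_simps)
  ultimately show ?thesis by simp
qed

lemma smooth_step: "smooth (\<lambda>t. ds 0 ((t - c) / s))"
proof -
  have "smooth (\<lambda>t. ds 0 (inverse s * t + (- c * inverse s)))"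
    by (intro smooth_compose_affine smooth_ds)
  moreover have "(\<lambda>t. ds 0 (inverse s * t + (- c * inverse s))) = (\<lambda>t. ds 0 ((t - c) / s))"
    by (simp add: fun_eq_iff divide_inverse algebra_simps)
  ultimately show ?thesis by simp
qed

lemma has_bochner_integral_bump:
  assumes "s > 0"
  shows "has_bochner_integral lborel (bump c s) 1"
proof -
  have "has_bochner_integral lborel (\<lambda>x. bump c s x * indicator {c-s..c+s} x)
    (ds 0 ((c + s - c) / s) - ds 0 ((c - s - c) / s))"
    using assms
    by (intro has_bochner_integral_FTC_Icc_real step_has_derivative)
       (auto intro: continuous_on_interior[OF bump_continuous[of UNIV]])
  moreover have "(\<lambda>x. bump c s x * indicator {c-s..c+s} x) = bump c s"
  proof
    fix x show "bump c s x * indicator {c-s..c+s} x = bump c s x"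
      using bump_outside[OF assms, of x c] by (cases "x \<in> {c-s..c+s}") auto
  qed
  moreover have "ds 0 ((c + s - c) / s) - ds 0 ((c - s - c) / s) = 1"
    using assms by (simp add: ds_0 sstep_left sstep_right)
  ultimately show ?thesis by simp
qed

lemma integrable_bump: "s > 0 \<Longrightarrow> integrable lborel (bump c s)"
  and integral_bump: "s > 0 \<Longrightarrow> (LINT t|lborel. bump c s t) = 1"
  using has_bochner_integral_bump has_bochner_integral_iff by blast+

definition tens :: "(real \<Rightarrow> real) \<Rightarrow> (real \<Rightarrow> real) \<Rightarrow> real^2 \<Rightarrow> real" where
  "tens a b x = a (x$1) * b (x$2)"

lemma tens_has_derivative:
  assumes "smooth a" "smooth b"
  shows "(tens a b has_derivative (\<lambda>d. deriv a (x$1) * b (x$2) * d$1 + a (x$1) * deriv b (x$2) * d$2)) (at x)"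
proof -
  have 1: "((\<lambda>x::real^2. x$i) has_derivative (\<lambda>d. d$i)) (at x)" for i :: 2
    by (rule bounded_linear_imp_has_derivative) (rule bounded_linear_vec_nth)
  have "(a has_derivative (*) (deriv a (x$1))) (at (x$1))" "(b has_derivative (*) (deriv b (x$2))) (at (x$2))"
    using smooth_has_derivative assms unfolding has_field_derivative_def by blast+
  from has_derivative_compose[OF 1 this(1)] has_derivative_compose[OF 1 this(2)]
  have "((\<lambda>x. a (x$1) * b (x$2)) has_derivative
     (\<lambda>d. a (x$1) * (deriv b (x$2) * d$2) + (deriv a (x$1) * d$1) * b (x$2))) (at x)"
    by (rule has_derivative_mult)
  then show ?thesis by (simp add: tens_def[abs_def] algebra_simps)
qed

lemma pderiv2_tens:
  assumes "smooth a" "smooth b"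
  shows "pderiv2 1 (tens a b) = tens (deriv a) b" "pderiv2 2 (tens a b) = tens a (deriv b)"
proof -
  have "frechet_derivative (tens a b) (at x) =
    (\<lambda>d. deriv a (x$1) * b (x$2) * d$1 + a (x$1) * deriv b (x$2) * d$2)" for x
    using frechet_derivative_at[OF tens_has_derivative[OF assms]] by simp
  then show "pderiv2 1 (tens a b) = tens (deriv a) b" "pderiv2 2 (tens a b) = tens a (deriv b)"
    by (auto simp: fun_eq_iff pderiv2_def tens_def axis_def)
qed

text \<open>Closure of products under partial derivatives reduces the condition on all iterated
  partials in \<open>test_fun\<close> to one variable.\<close>

lemma iter_partials_tens:
  assumes "smooth a" "smooth b" "g \<in> iter_partials k (tens a b)"
  shows "\<exists>a' b'. smooth a' \<and> smooth b' \<and> g = tens a' b'"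
  using assms(3)
proof (induction k arbitrary: g)
  case 0
  then show ?case using assms by auto
next
  case (Suc k)
  then obtain i g' where g: "g' \<in> iter_partials k (tens a b)" "g = pderiv2 i g'" by auto
  then obtain a' b' where ab: "smooth a'" "smooth b'" "g' = tens a' b'" using Suc.IH by blast
  have "i = 1 \<or> i = 2" using exhaust_2 by blast
  then show ?case using ab g pderiv2_tens[OF ab(1,2)] smooth_deriv by metis
qed

lemma test_fun_tens:
  assumes "smooth a" "smooth b" "\<And>t. t \<notin> {a1..a2} \<Longrightarrow> a t = 0" "\<And>t. t \<notin> {b1..b2} \<Longrightarrow> b t = 0"
    and sub: "\<And>x. x$1 \<in> {a1..a2} \<Longrightarrow> x$2 \<in> {b1..b2} \<Longrightarrow> x \<in> U"
  shows "test_fun U (tens a b)"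
proof -
  have 1: "g differentiable (at x) \<and> continuous_on UNIV g" if g: "g \<in> iter_partials k (tens a b)" for g k x
  proof -
    obtain a' b' where ab: "smooth a'" "smooth b'" "g = tens a' b'"
      using iter_partials_tens[OF assms(1,2) g] by blast
    then have "g differentiable (at x)" for x using tens_has_derivative differentiable_def by blast
    then show ?thesis by (simp add: continuous_at_imp_continuous_on differentiable_imp_continuous_within)
  qed
  have s: "{x. tens a b x \<noteq> 0} \<subseteq> cbox (vec2 (a1,b1)) (vec2 (a2,b2))"
  proof
    fix x assume "x \<in> {x. tens a b x \<noteq> 0}"
    then have "x$1 \<in> {a1..a2}" "x$2 \<in> {b1..b2}" using assms(3,4) by (auto simp: tens_def)
    then show "x \<in> cbox (vec2 (a1,b1)) (vec2 (a2,b2))" by (simp add: mem_box_cart forall_2)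
  qed
  then have c: "closure {x. tens a b x \<noteq> 0} \<subseteq> cbox (vec2 (a1,b1)) (vec2 (a2,b2))"
    by (rule closure_minimal) (rule closed_cbox)
  have "compact (closure {x. tens a b x \<noteq> 0})"
    unfolding compact_closure by (rule bounded_subset[OF bounded_cbox s])
  moreover have "cbox (vec2 (a1,b1)) (vec2 (a2,b2)) \<subseteq> U"
    using sub by (auto simp: mem_box_cart forall_2)
  ultimately show ?thesis unfolding test_fun_def using 1 c by blast
qed

text \<open>Translation invariance makes the integral of every difference quotient zero, and
  dominated convergence passes to the derivative in the direction \<open>e\<close>.\<close>

lemma integral_partial_eq_0:
  fixes H :: "real^2 \<Rightarrow> real"
  assumes d: "\<And>x. (H has_derivative H' x) (at x)" and c: "continuous_on UNIV (\<lambda>x. H' x e)"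
    and k: "bounded S" "\<And>x. x \<notin> S \<Longrightarrow> H x = 0" and e: "norm e \<le> 1"
  shows "(LINT x|lborel. H' x e) = 0"
proof -
  have Hc: "continuous_on UNIV H"
    using d has_derivative_continuous by (blast intro: continuous_at_imp_continuous_on)
  obtain R where R: "R > 0" "S \<subseteq> cball 0 R"
    using k(1) unfolding bounded_pos by (auto simp: subset_iff)
  \<comment> \<open>Difference quotients of step at most 1 vanish for norm x > R + 1; otherwise the
    segments they use stay in this ball, where the derivative is bounded.\<close>
  define K :: "(real^2) set" where "K = cball 0 (R + 2)"
  have K0: "H x = 0" if "norm x > R" for x using k(2)[of x] R that by force
  obtain B where B: "\<And>x. x \<in> K \<Longrightarrow> \<bar>H' x e\<bar> \<le> B" "B > 0"
  proof -
    have "compact ((\<lambda>x. H' x e) ` K)"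
      by (intro compact_continuous_image continuous_on_subset[OF c]) (auto simp: K_def)
    then obtain B where "\<And>x. x \<in> K \<Longrightarrow> \<bar>H' x e\<bar> \<le> B" using compact_imp_bounded bounded_iff by (metis imageI real_norm_def)
    then show ?thesis using that[of "max B 1"] by (metis less_max_iff_disj max.coboundedI1 zero_less_one)
  qed
  define D where "D n x = (H (x + (1 / real (Suc n)) *\<^sub>R e) - H x) * real (Suc n)" for n x
  have lim: "(\<lambda>n. D n x) \<longlonglongrightarrow> H' x e" for x
  proof -
    have "((\<lambda>t. H (x + t *\<^sub>R e)) has_vector_derivative H' x e) (at 0)"
    proof -
      have "((\<lambda>t::real. x + t *\<^sub>R e) has_derivative (\<lambda>t. t *\<^sub>R e)) (at 0)" by (auto intro!: derivative_eq_intros)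
      from has_derivative_compose[OF this, of H "H' x"] d[of x]
      have "((\<lambda>t. H (x + t *\<^sub>R e)) has_derivative (\<lambda>t. H' x (t *\<^sub>R e))) (at 0)" by simp
      then show ?thesis
        using linear_scale[OF has_derivative_linear[OF d[of x]]] by (simp add: has_vector_derivative_def)
    qed
    then have "((\<lambda>t. (H (x + t *\<^sub>R e) - H x) / t) \<longlongrightarrow> H' x e) (at 0)"
      by (simp add: has_real_derivative_iff_has_vector_derivative[symmetric] DERIV_def)
    moreover have "filterlim (\<lambda>n. 1 / real (Suc n)) (at 0) sequentially" (is "filterlim ?t _ _")
      unfolding filterlim_at using LIMSEQ_inverse_real_of_nat by (auto simp: inverse_eq_divide)
    ultimately have "((\<lambda>n. (H (x + ?t n *\<^sub>R e) - H x) / ?t n) \<longlongrightarrow> H' x e) sequentially"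
      by (rule filterlim_compose)
    then show ?thesis by (simp add: D_def)
  qed
  have bnd: "\<bar>D n x\<bar> \<le> B * indicator K x" for n x
  proof -
    define t where "t = 1 / real (Suc n)"
    have t: "0 < t" "t \<le> 1" by (auto simp: t_def)
    show ?thesis
    proof (cases "norm x \<le> R + 1")
      case True
      have "norm (H (x + t *\<^sub>R e) - H x) \<le> B * norm (t::real)"
      proof -
        have dd: "((\<lambda>r. H (x + r *\<^sub>R e)) has_derivative (\<lambda>h. H' (x + r *\<^sub>R e) (h *\<^sub>R e))) (at r within {0..t})" for r
        proof -
          have "((\<lambda>r::real. x + r *\<^sub>R e) has_derivative (\<lambda>t. t *\<^sub>R e)) (at r within {0..t})" by (auto intro!: derivative_eq_intros)
          from has_derivative_compose[OF this d] show ?thesis .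
        qed
        have on: "onorm (\<lambda>h. H' (x + r *\<^sub>R e) (h *\<^sub>R e)) \<le> B" if "r \<in> {0..t}" for r
        proof (rule onorm_le)
          fix h :: real
          have "norm (x + r *\<^sub>R e) \<le> norm x + \<bar>r\<bar> * norm e" by (metis norm_triangle_ineq norm_scaleR)
          also have "\<dots> \<le> (R + 1) + 1 * 1" using True that t e by (intro add_mono mult_mono) auto
          finally have "x + r *\<^sub>R e \<in> K" by (simp add: K_def)
          then have "\<bar>H' (x + r *\<^sub>R e) e\<bar> \<le> B" by (rule B)
          then show "norm (H' (x + r *\<^sub>R e) (h *\<^sub>R e)) \<le> B * norm h"
            using linear_scale[OF has_derivative_linear[OF d[of "x + r *\<^sub>R e"]]]
            by (simp add: abs_mult mult.commute[of B] mult_left_mono)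
        qed
        from differentiable_bound[OF convex_real_interval(5)[of 0 t] dd on, of t 0] t
        show ?thesis by simp
      qed
      then have "\<bar>H (x + t *\<^sub>R e) - H x\<bar> / t \<le> B" using t by (simp add: field_simps)
      then show ?thesis using True by (simp add: D_def t_def K_def abs_mult)
    next
      case False
      have "norm (t *\<^sub>R e) \<le> 1" using t e by (simp add: mult_le_one)
      then have "norm (x + t *\<^sub>R e) > R" using False norm_diff_ineq[of x "t *\<^sub>R e"] by linarith
      then have "D n x = 0" using K0[of x] K0[of "x + t *\<^sub>R e"] False by (simp add: D_def t_def)
      then show ?thesis using B(2) by simp
    qed
  qed
  have Hi: "integrable lborel H"
  proof -
    have "integrable lborel (\<lambda>x. indicator (cball 0 R) x *\<^sub>R H x)"
      by (intro borel_integrable_compact continuous_on_subset[OF Hc]) auto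
    moreover have "(\<lambda>x. indicator (cball 0 R) x *\<^sub>R H x) = H"
      using K0 by (auto simp: fun_eq_iff indicator_def)
    ultimately show ?thesis by simp
  qed
  have D0: "(LINT x|lborel. D n x) = 0" for n
  proof -
    have tr: "integrable lborel (\<lambda>x. H (x + (1 / real (Suc n)) *\<^sub>R e))"
        "(LINT x|lborel. H (x + (1 / real (Suc n)) *\<^sub>R e)) = (LINT x|lborel. H x)"
    proof -
      have eq: "lborel = distr lborel borel ((+) ((1 / real (Suc n)) *\<^sub>R e))" by (simp add: lborel_distr_plus)
      have Hm: "H \<in> borel_measurable borel" using Hc by (rule borel_measurable_continuous_onI)
      have "integrable (distr lborel borel ((+) ((1 / real (Suc n)) *\<^sub>R e))) H" using Hi eq by simp
      then show "integrable lborel (\<lambda>x. H (x + (1 / real (Suc n)) *\<^sub>R e))"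
        using Hm by (subst (asm) integrable_distr_eq) (auto simp: add.commute)
      have "(LINT x|lborel. H x) = (LINT x|distr lborel borel ((+) ((1 / real (Suc n)) *\<^sub>R e)). H x)" using eq by simp
      also have "\<dots> = (LINT x|lborel. H (x + (1 / real (Suc n)) *\<^sub>R e))"
        using Hm by (subst integral_distr) (auto simp: add.commute)
      finally show "(LINT x|lborel. H (x + (1 / real (Suc n)) *\<^sub>R e)) = (LINT x|lborel. H x)" by simp
    qed
    then show ?thesis using Hi by (simp add: D_def)
  qed
  have "(\<lambda>n. LINT x|lborel. D n x) \<longlonglongrightarrow> (LINT x|lborel. H' x e)"
  proof (rule integral_dominated_convergence[where w = "\<lambda>x. B * indicator K x"])
    show "(\<lambda>x. H' x e) \<in> borel_measurable lborel" using c by (simp add: borel_measurable_continuous_onI)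
    show "D n \<in> borel_measurable lborel" for n
    proof -
      have "continuous_on UNIV (\<lambda>x. H (x + (1 / real (Suc n)) *\<^sub>R e))"
        by (rule continuous_on_compose2[OF Hc]) (auto intro!: continuous_intros)
      then have "continuous_on UNIV (D n)" unfolding D_def using Hc by (intro continuous_intros)
      then show ?thesis by (simp add: borel_measurable_continuous_onI)
    qed
    show "integrable lborel (\<lambda>x. B * indicator K x)"
      by (auto simp: K_def intro!: emeasure_lborel_cball_finite)
  qed (simp_all add: lim bnd)
  then have "(\<lambda>n. 0) \<longlonglongrightarrow> (LINT x|lborel. H' x e)" by (simp add: D0)
  from LIMSEQ_unique[OF this tendsto_const] show ?thesis .
qed

section \<open>Second derivatives in an orthonormal frame\<close>

lemma square_eq_cbox: "square c d = cbox (\<chi> i. c$i - d/2) (\<chi> i. c$i + d/2)"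
proof -
  have "\<bar>x$i - c$i\<bar> \<le> d/2 \<longleftrightarrow> c$i - d/2 \<le> x$i \<and> x$i \<le> c$i + d/2" for x :: "real^2" and i by linarith
  then show ?thesis by (simp add: square_def mem_box_cart set_eq_iff)
qed

lemma interior_square: "interior (square c d) = {x. \<forall>i. \<bar>x$i - c$i\<bar> < d/2}"
proof -
  have "interior (square c d) = box (\<chi> i. c$i - d/2) (\<chi> i. c$i + d/2)"
    unfolding square_eq_cbox by (rule interior_cbox)
  moreover have "\<bar>x$i - c$i\<bar> < d/2 \<longleftrightarrow> c$i - d/2 < x$i \<and> x$i < c$i + d/2" for x :: "real^2" and i by linarith
  ultimately show ?thesis by (simp add: mem_box_cart set_eq_iff)
qed

definition hess_energy :: "real \<Rightarrow> (real^2) set \<Rightarrow> (2 \<Rightarrow> 2 \<Rightarrow> real^2 \<Rightarrow> real) \<Rightarrow> real" where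
  "hess_energy p Q g = (\<Sum>i\<in>UNIV. \<Sum>j\<in>UNIV. LINT x:Q|lborel. \<bar>g i j x\<bar> powr p)"

lemma L2p_norm_le: "weak_hessian p Q F g \<Longrightarrow> L2p_norm p Q F \<le> hess_energy p Q g powr (1/p)"
  unfolding L2p_norm_def hess_energy_def
  by (rule cInf_lower) (auto intro!: bdd_belowI[of _ 0])

lemma L2p_norm_ge:
  assumes "F \<in> L2p p Q" "\<And>g. weak_hessian p Q F g \<Longrightarrow> K \<le> hess_energy p Q g powr (1/p)"
  shows "K \<le> L2p_norm p Q F"
  unfolding L2p_norm_def
  by (rule cInf_greatest) (use assms in \<open>auto simp: L2p_def hess_energy_def\<close>)

text \<open>The gradient of \<open>f\<close> is \<open>f1 u + f2 n\<close>. All calculus is done in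
  the frame \<open>u\<close>, \<open>n\<close> adapted to the curve; \<open>gradf_pderiv2\<close>
  and \<open>hessf\<close> return to the coordinate axes used in the definitions.\<close>

definition gradf :: "real^2 \<Rightarrow> real^2 \<Rightarrow> (real^2 \<Rightarrow> real) \<Rightarrow> (real^2 \<Rightarrow> real) \<Rightarrow> (real^2 \<Rightarrow> real) \<Rightarrow> bool" where
  "gradf u n f f1 f2 \<longleftrightarrow> (\<forall>x. (f has_derivative (\<lambda>d. f1 x * (u \<bullet> d) + f2 x * (n \<bullet> d))) (at x))"

lemma gradf_pderiv2: "gradf u n f f1 f2 \<Longrightarrow> pderiv2 i f x = f1 x * u$i + f2 x * n$i"
proof -
  assume "gradf u n f f1 f2"
  then have "(f has_derivative (\<lambda>d. f1 x * (u \<bullet> d) + f2 x * (n \<bullet> d))) (at x)" by (simp add: gradf_def)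
  from frechet_derivative_at[OF this] show ?thesis
    by (metis (no_types, lifting) cart_eq_inner_axis pderiv2_def)
qed

lemma gradf_continuous: "gradf u n f f1 f2 \<Longrightarrow> continuous_on S f"
  unfolding gradf_def using has_derivative_continuous
  by (blast intro: continuous_at_imp_continuous_on)

lemma gradf_const: "gradf u n (\<lambda>x. c) (\<lambda>x. 0) (\<lambda>x. 0)"
  by (simp add: gradf_def)

lemma gradf_add: "gradf u n f f1 f2 \<Longrightarrow> gradf u n g g1 g2 \<Longrightarrow>
    gradf u n (\<lambda>x. f x + g x) (\<lambda>x. f1 x + g1 x) (\<lambda>x. f2 x + g2 x)"
  unfolding gradf_def
proof
  fix x assume a: "\<forall>x. (f has_derivative (\<lambda>d. f1 x * (u \<bullet> d) + f2 x * (n \<bullet> d))) (at x)"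
    "\<forall>x. (g has_derivative (\<lambda>d. g1 x * (u \<bullet> d) + g2 x * (n \<bullet> d))) (at x)"
  show "((\<lambda>x. f x + g x) has_derivative (\<lambda>d. (f1 x + g1 x) * (u \<bullet> d) + (f2 x + g2 x) * (n \<bullet> d))) (at x)"
    by (rule has_derivative_eq_rhs[OF has_derivative_add[OF a(1)[rule_format] a(2)[rule_format]]])
       (simp add: fun_eq_iff algebra_simps)
qed

lemma gradf_mult: "gradf u n f f1 f2 \<Longrightarrow> gradf u n g g1 g2 \<Longrightarrow>
    gradf u n (\<lambda>x. f x * g x) (\<lambda>x. f1 x * g x + f x * g1 x) (\<lambda>x. f2 x * g x + f x * g2 x)"
  unfolding gradf_def
proof
  fix x assume a: "\<forall>x. (f has_derivative (\<lambda>d. f1 x * (u \<bullet> d) + f2 x * (n \<bullet> d))) (at x)"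
    "\<forall>x. (g has_derivative (\<lambda>d. g1 x * (u \<bullet> d) + g2 x * (n \<bullet> d))) (at x)"
  show "((\<lambda>x. f x * g x) has_derivative (\<lambda>d. (f1 x * g x + f x * g1 x) * (u \<bullet> d) + (f2 x * g x + f x * g2 x) * (n \<bullet> d))) (at x)"
    by (rule has_derivative_eq_rhs[OF has_derivative_mult[OF a(1)[rule_format] a(2)[rule_format]]])
       (simp add: fun_eq_iff algebra_simps)
qed

lemma gradf_sum: "(\<And>i. i \<in> I \<Longrightarrow> gradf u n (f i) (f1 i) (f2 i)) \<Longrightarrow>
    gradf u n (\<lambda>x. \<Sum>i\<in>I. f i x) (\<lambda>x. \<Sum>i\<in>I. f1 i x) (\<lambda>x. \<Sum>i\<in>I. f2 i x)"
  by (induction I rule: infinite_finite_induct) (auto intro: gradf_const gradf_add)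

lemma gradf_fst: "(\<And>t. (a has_real_derivative a' t) (at t)) \<Longrightarrow>
    gradf u n (\<lambda>x. a (u \<bullet> x)) (\<lambda>x. a' (u \<bullet> x)) (\<lambda>x. 0)"
  unfolding gradf_def
proof
  fix x assume a: "\<And>t. (a has_real_derivative a' t) (at t)"
  have "((\<lambda>x. u \<bullet> x) has_derivative (\<lambda>d. u \<bullet> d)) (at x)" by (auto intro!: derivative_eq_intros)
  from has_derivative_compose[OF this a[unfolded has_field_derivative_def]]
  show "((\<lambda>x. a (u \<bullet> x)) has_derivative (\<lambda>d. a' (u \<bullet> x) * (u \<bullet> d) + 0 * (n \<bullet> d))) (at x)" by simp
qed

lemma gradf_snd: "(\<And>t. (a has_real_derivative a' t) (at t)) \<Longrightarrow>
    gradf u n (\<lambda>x. a (n \<bullet> x)) (\<lambda>x. 0) (\<lambda>x. a' (n \<bullet> x))"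
  using gradf_fst[of a a' n u] by (simp add: gradf_def)

text \<open>\<open>h * \<phi>\<close> is differentiable on the whole plane with bounded support, so
  \<open>integral_partial_eq_0\<close> applies to it; integrals over \<open>U\<close> and over the
  plane agree because the support lies in \<open>U\<close>.\<close>

lemma integral_by_parts_test:
  fixes h \<phi> :: "real^2 \<Rightarrow> real"
  assumes h: "\<And>x. (h has_derivative h' x) (at x)" and hc: "continuous_on UNIV (\<lambda>x. h' x (axis i 1))"
    and t: "test_fun U \<phi>"
  shows "(LINT x:U|lborel. h x * pderiv2 i \<phi> x) = - (LINT x:U|lborel. h' x (axis i 1) * \<phi> x)"
proof -
  define S where "S = closure {x. \<phi> x \<noteq> 0}"
  have S: "compact S" "S \<subseteq> U" using t by (simp_all add: test_fun_def S_def)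
  have "\<phi> \<in> iter_partials 0 \<phi>" by simp
  then have d: "\<phi> differentiable (at x)" and c: "continuous_on UNIV \<phi>" for x
    using t unfolding test_fun_def by blast+
  have "pderiv2 i \<phi> \<in> iter_partials (Suc 0) \<phi>" by auto
  then have pc: "continuous_on UNIV (pderiv2 i \<phi>)" using t unfolding test_fun_def by blast
  have hcont: "continuous_on UNIV h" using h has_derivative_continuous
    by (blast intro: continuous_at_imp_continuous_on)
  have z: "\<phi> x = 0" if "x \<notin> S" for x using that closure_subset[of "{x. \<phi> x \<noteq> 0}"] unfolding S_def by blast
  have pz: "pderiv2 i \<phi> x = 0" if x: "x \<notin> S" for x
  proof -
    have "open (- S)" using S(1) by (simp add: open_Compl compact_imp_closed)
    then have "(\<phi> has_derivative (\<lambda>d. 0)) (at x)"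
      by (rule has_derivative_transform_within_open[OF has_derivative_const[of 0]]) (simp_all add: x z)
    then show ?thesis unfolding pderiv2_def using frechet_derivative_at by metis
  qed
  let ?H' = "\<lambda>x d. h x * frechet_derivative \<phi> (at x) d + h' x d * \<phi> x"
  have 0: "(LINT x|lborel. ?H' x (axis i 1)) = 0"
  proof (rule integral_partial_eq_0[where H = "\<lambda>x. h x * \<phi> x" and S = S])
    show "((\<lambda>x. h x * \<phi> x) has_derivative ?H' x) (at x)" for x
      by (rule has_derivative_mult[OF h d[unfolded frechet_derivative_works]])
    show "continuous_on UNIV (\<lambda>x. ?H' x (axis i 1))"
      using pc unfolding pderiv2_def[symmetric] by (intro continuous_intros hcont hc c)
  qed (use S z in \<open>auto simp: compact_imp_bounded norm_axis_1\<close>)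
  have int: "integrable lborel k" if k: "continuous_on UNIV k" "\<And>x. x \<notin> S \<Longrightarrow> k x = 0" for k :: "real^2 \<Rightarrow> real"
  proof -
    have "integrable lborel (\<lambda>x. indicator S x *\<^sub>R k x)"
      by (intro borel_integrable_compact S continuous_on_subset[OF k(1)]) auto
    moreover have "(\<lambda>x. indicator S x *\<^sub>R k x) = k" using k(2) by (auto simp: fun_eq_iff indicator_def)
    ultimately show ?thesis by simp
  qed
  have U: "(LINT x:U|lborel. k x) = (LINT x|lborel. k x)" if "\<And>x. x \<notin> S \<Longrightarrow> k x = 0" for k :: "real^2 \<Rightarrow> real"
    unfolding set_lebesgue_integral_def
    by (rule Bochner_Integration.integral_cong) (use that S(2) in \<open>auto simp: indicator_def\<close>)
  have "0 = (LINT x|lborel. h x * pderiv2 i \<phi> x + h' x (axis i 1) * \<phi> x)"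
    using 0 by (simp add: pderiv2_def)
  also have "\<dots> = (LINT x|lborel. h x * pderiv2 i \<phi> x) + (LINT x|lborel. h' x (axis i 1) * \<phi> x)"
    by (intro Bochner_Integration.integral_add int)
       (auto simp: pz z intro!: continuous_intros hcont hc c pc)
  finally show ?thesis using U[of "\<lambda>x. h x * pderiv2 i \<phi> x"] U[of "\<lambda>x. h' x (axis i 1) * \<phi> x"]
    by (simp add: z pz)
qed

text \<open>Matrix entries of F11 u u^T + F12 (u n^T + n u^T) + F22 n n^T in the standard
  basis.\<close>

definition hessf :: "real^2 \<Rightarrow> real^2 \<Rightarrow> (real^2 \<Rightarrow> real) \<Rightarrow> (real^2 \<Rightarrow> real) \<Rightarrow> (real^2 \<Rightarrow> real)
    \<Rightarrow> 2 \<Rightarrow> 2 \<Rightarrow> real^2 \<Rightarrow> real" where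
  "hessf u n F11 F12 F22 i j x =
     F11 x * (u$i * u$j) + F12 x * (u$i * n$j + n$i * u$j) + F22 x * (n$i * n$j)"

lemma weak_hessian_C2:
  assumes F: "gradf u n F F1 F2" "gradf u n F1 F11 F12" "gradf u n F2 F12 F22"
    and c: "continuous_on UNIV F11" "continuous_on UNIV F12" "continuous_on UNIV F22" and "p > 0"
  shows "weak_hessian p (square c d) F (hessf u n F11 F12 F22)"
    and "F \<in> L2p p (square c d)"
proof -
  have hc: "continuous_on S (hessf u n F11 F12 F22 i j)" for i j S
    unfolding hessf_def[abs_def] by (intro continuous_intros continuous_on_subset[OF c(1)]
      continuous_on_subset[OF c(2)] continuous_on_subset[OF c(3)]) auto
  show w: "weak_hessian p (square c d) F (hessf u n F11 F12 F22)"
    unfolding weak_hessian_def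
  proof (intro allI conjI impI)
    fix i j
    show "hessf u n F11 F12 F22 i j \<in> borel_measurable lborel"
      using hc[of UNIV] by (simp add: borel_measurable_continuous_onI)
    show "set_integrable lborel (square c d) (\<lambda>x. \<bar>hessf u n F11 F12 F22 i j x\<bar> powr p)"
    proof -
      have "continuous_on (square c d) (\<lambda>x. \<bar>hessf u n F11 F12 F22 i j x\<bar> powr p)"
        using \<open>p > 0\<close> by (intro continuous_on_powr' continuous_intros hc) auto
      then show ?thesis unfolding set_integrable_def square_eq_cbox
        by (intro borel_integrable_compact) auto
    qed
    fix \<phi> assume t: "test_fun (interior (square c d)) \<phi>"
    let ?h' = "\<lambda>x e. (F11 x * (u \<bullet> e) + F12 x * (n \<bullet> e)) * u$j + (F12 x * (u \<bullet> e) + F22 x * (n \<bullet> e)) * n$j"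
    have h: "(pderiv2 j F has_derivative ?h' x) (at x)" for x
    proof -
      have "((\<lambda>x. F1 x * u$j + F2 x * n$j) has_derivative ?h' x) (at x)"
        using F(2,3) unfolding gradf_def by (intro has_derivative_add has_derivative_mult_left) blast+
      moreover have "pderiv2 j F = (\<lambda>x. F1 x * u$j + F2 x * n$j)" using gradf_pderiv2[OF F(1)] by blast
      ultimately show ?thesis by simp
    qed
    have e: "?h' x (axis i 1) = hessf u n F11 F12 F22 i j x" for x
      by (simp add: hessf_def inner_axis algebra_simps)
    have "continuous_on UNIV (\<lambda>x. ?h' x (axis i 1))" unfolding e by (rule hc)
    from integral_by_parts_test[OF h this t]
    show "(LINT x:interior (square c d)|lborel. pderiv2 j F x * pderiv2 i \<phi> x)
        = - (LINT x:interior (square c d)|lborel. hessf u n F11 F12 F22 i j x * \<phi> x)"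
      unfolding e .
  qed
  have "F differentiable (at x)" for x using F(1) by (auto simp: gradf_def differentiable_def)
  moreover have "continuous_on S (pderiv2 i F)" for i S
  proof -
    have "pderiv2 i F = (\<lambda>x. F1 x * u$i + F2 x * n$i)" using gradf_pderiv2[OF F(1)] by blast
    then show ?thesis using gradf_continuous[OF F(2)] gradf_continuous[OF F(3)]
      by (auto intro!: continuous_intros)
  qed
  ultimately show "F \<in> L2p p (square c d)" using w by (auto simp: L2p_def)
qed

section \<open>Averages of weakly differentiable functions\<close>

text \<open>A non-integrable function has integral 0 by convention, which covers the case left open
  by the usual norm bound.\<close>

lemma ennreal_abs_LINT_le: "ennreal \<bar>LINT x|M. f x\<bar> \<le> (\<integral>\<^sup>+x. ennreal \<bar>f x\<bar> \<partial>M)" for f :: "'a \<Rightarrow> real"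
  using integral_norm_bound_ennreal[of M f] by (cases "integrable M f") (auto simp: not_integrable_integral_eq)

text \<open>Integrates \<open>G \<le> t + G\<^sup>p t\<^sup>1\<^sup>-\<^sup>p\<close> with the optimal \<open>t\<close>.\<close>

lemma nn_integral_le_power_mean:
  fixes G :: "'a \<Rightarrow> real"
  assumes [measurable]: "G \<in> borel_measurable M" "R \<in> sets M"
    and A: "emeasure M R = ennreal A" "A > 0" and p: "p > 1"
    and G: "\<And>x. G x \<ge> 0" and X: "X \<ge> 0" "(\<integral>\<^sup>+x\<in>R. ennreal (G x powr p) \<partial>M) \<le> ennreal X"
  shows "(\<integral>\<^sup>+x\<in>R. ennreal (G x) \<partial>M) \<le> ennreal (2 * X powr (1/p) * A powr (1 - 1/p))"
proof -
  have key: "(\<integral>\<^sup>+x\<in>R. ennreal (G x) \<partial>M) \<le> ennreal (t * A + t powr (1 - p) * X)" if t: "t > 0" for t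
  proof -
    have pt: "G x \<le> t + t powr (1-p) * G x powr p" for x
    proof (cases "G x \<le> t")
      case False
      then have "G x > 0" using t by simp
      then have "G x = G x powr (1 - p) * G x powr p" by (simp add: powr_add[symmetric])
      also have "\<dots> \<le> t powr (1 - p) * G x powr p"
        using False p t by (intro mult_right_mono powr_mono2') auto
      finally show ?thesis using t by simp
    qed (simp add: add_increasing2)
    have "(\<integral>\<^sup>+x\<in>R. ennreal (G x) \<partial>M) \<le> (\<integral>\<^sup>+x\<in>R. ennreal t + ennreal (t powr (1-p)) * ennreal (G x powr p) \<partial>M)"
    proof (intro nn_integral_mono mult_right_mono)
      fix x show "ennreal (G x) \<le> ennreal t + ennreal (t powr (1-p)) * ennreal (G x powr p)"
        using pt[of x] t by (simp add: ennreal_mult[symmetric] ennreal_plus[symmetric] del: ennreal_plus)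
    qed simp
    also have "\<dots> = ennreal t * emeasure M R + ennreal (t powr (1-p)) * (\<integral>\<^sup>+x\<in>R. ennreal (G x powr p) \<partial>M)"
      by (simp add: distrib_right nn_integral_add nn_integral_cmult_indicator nn_integral_cmult mult.assoc)
    also have "\<dots> \<le> ennreal t * ennreal A + ennreal (t powr (1-p)) * ennreal X"
      unfolding A(1) by (intro add_mono mult_left_mono X) auto
    also have "\<dots> = ennreal (t * A + t powr (1 - p) * X)"
      using t A X by (simp add: ennreal_mult ennreal_plus)
    finally show ?thesis .
  qed
  show ?thesis
  proof (cases "X = 0")
    case True
    have "(\<integral>\<^sup>+x\<in>R. ennreal (G x) \<partial>M) \<le> 0"
    proof (rule ennreal_le_epsilon)
      fix e :: real assume e: "e > 0"
      then show "(\<integral>\<^sup>+x\<in>R. ennreal (G x) \<partial>M) \<le> 0 + ennreal e" using key[of "e / A"] A True by simp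
    qed
    then show ?thesis by simp
  next
    case False
    \<comment> \<open>This t makes the summands t A and t^(1-p) X equal, whence the factor
      2.\<close>
    define t where "t = (X / A) powr (1/p)"
    have t: "t > 0" using False X A by (simp add: t_def)
    have 1: "t * A = X powr (1/p) * A powr (1 - 1/p)"
      using False X A by (simp add: t_def powr_divide powr_diff)
    have "t powr (1-p) * X = (X / A) powr (1/p - 1) * X"
      using p by (simp add: t_def powr_powr field_simps)
    also have "\<dots> = X powr (1/p) * A powr (1 - 1/p)"
      using False X A by (simp add: powr_divide powr_diff field_simps)
    finally show ?thesis using key[OF t] 1 by (simp add: mult.assoc)
  qed
qed

lemma limit_dist_le_geometric:
  fixes a :: "nat \<Rightarrow> real"
  assumes lim: "a \<longlonglongrightarrow> L" and q: "0 \<le> q" "q < 1" and K: "K \<ge> 0" and d: "\<And>l. \<bar>a l - a (Suc l)\<bar> \<le> K * q ^ l"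
  shows "\<bar>L - a 0\<bar> \<le> K / (1 - q)"
proof -
  have "\<bar>a n - a 0\<bar> \<le> K * (\<Sum>l<n. q ^ l)" for n
  proof (induction n)
    case (Suc n)
    have "\<bar>a (Suc n) - a 0\<bar> \<le> \<bar>a n - a (Suc n)\<bar> + \<bar>a n - a 0\<bar>" by linarith
    then show ?case using Suc d[of n] by (simp add: algebra_simps)
  qed simp
  moreover have "(\<Sum>l<n. q ^ l) \<le> 1 / (1 - q)" for n
    using q by (simp add: sum_gp_strict divide_right_mono)
  ultimately have "\<bar>a n - a 0\<bar> \<le> K / (1 - q)" for n
    using K by (metis (no_types, opaque_lifting) mult_left_mono order_trans times_divide_eq_right mult.right_neutral)
  moreover have "(\<lambda>n. \<bar>a n - a 0\<bar>) \<longlonglongrightarrow> \<bar>L - a 0\<bar>" by (intro tendsto_intros lim)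
  ultimately show ?thesis by (meson LIMSEQ_le_const2)
qed

text \<open>Later \<open>h\<close> is a first partial derivative of F, \<open>g\<close> the matching
  column of the weak Hessian and \<open>G\<close> the function \<open>hess_norm1\<close>. One
  majorant for both entries lets the two coordinate directions be treated alike.\<close>

locale weakly_differentiable =
  fixes U :: "(real^2) set" and h :: "real^2 \<Rightarrow> real" and g :: "2 \<Rightarrow> real^2 \<Rightarrow> real" and G :: "real^2 \<Rightarrow> real"
  assumes open_U: "open U" and cont_h: "continuous_on U h"
    and weak: "test_fun U \<phi> \<Longrightarrow>
      (LINT x:U|lborel. h x * pderiv2 i \<phi> x) = - (LINT x:U|lborel. g i x * \<phi> x)"
    and G_measurable: "G \<in> borel_measurable lborel"
    and g_le_G: "\<bar>g i x\<bar> \<le> G x"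
begin

definition avg :: "real \<Rightarrow> real \<Rightarrow> real \<Rightarrow> real \<Rightarrow> real" where
  "avg c1 s1 c2 s2 = (LINT x:U|lborel. h x * tens (bump c1 s1) (bump c2 s2) x)"

lemma G_nonneg: "G x \<ge> 0" using g_le_G[of 1 x] by linarith

lemma integrable_tens:
  assumes "continuous_on UNIV a" "continuous_on UNIV b" "\<And>t. t \<notin> {a1..a2} \<Longrightarrow> a t = 0" "\<And>t. t \<notin> {b1..b2} \<Longrightarrow> b t = 0"
    and sub: "cbox (vec2 (a1,b1)) (vec2 (a2,b2)) \<subseteq> U"
  shows "set_integrable lborel U (\<lambda>x. h x * tens a b x)"
proof -
  let ?R = "cbox (vec2 (a1,b1)) (vec2 (a2,b2))"
  have "continuous_on ?R (\<lambda>x. h x * tens a b x)"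
    unfolding tens_def
    by (intro continuous_intros continuous_on_subset[OF cont_h sub]
         continuous_on_compose2[OF assms(1)] continuous_on_compose2[OF assms(2)]) auto
  then have "integrable lborel (\<lambda>x. indicator ?R x *\<^sub>R (h x * tens a b x))"
    by (intro borel_integrable_compact) auto
  moreover have "(\<lambda>x. indicator ?R x *\<^sub>R (h x * tens a b x)) = (\<lambda>x. indicator U x *\<^sub>R (h x * tens a b x))"
  proof
    fix x
    show "indicator ?R x *\<^sub>R (h x * tens a b x) = indicator U x *\<^sub>R (h x * tens a b x)"
    proof (cases "x \<in> ?R")
      case True
      then have "x \<in> U" using sub by blast
      then show ?thesis using True by simp
    next
      case False
      then have "tens a b x = 0" using assms(3)[of "x$1"] assms(4)[of "x$2"]
        by (auto simp: tens_def mem_box_cart forall_2)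
      then show ?thesis by simp
    qed
  qed
  ultimately show ?thesis by (simp add: set_integrable_def)
qed

lemma weak_tens_bound:
  assumes "smooth a" "smooth b" "\<And>t. t \<notin> {a1..a2} \<Longrightarrow> a t = 0" "\<And>t. t \<notin> {b1..b2} \<Longrightarrow> b t = 0"
    and sub: "cbox (vec2 (a1,b1)) (vec2 (a2,b2)) \<subseteq> U"
    and K: "\<And>t s. \<bar>a t * b s\<bar> \<le> K"
  shows "ennreal \<bar>LINT x:U|lborel. h x * pderiv2 i (tens a b) x\<bar>
    \<le> ennreal K * (\<integral>\<^sup>+x\<in>cbox (vec2 (a1,b1)) (vec2 (a2,b2)). ennreal (G x) \<partial>lborel)"
proof -
  let ?R = "cbox (vec2 (a1,b1)) (vec2 (a2,b2))"
  have K0: "K \<ge> 0" using K[of 0 0] by linarith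
  have "test_fun U (tens a b)"
    by (rule test_fun_tens[OF assms(1-4)]) (use sub in \<open>auto simp: mem_box_cart forall_2 subset_iff\<close>)
  then have "\<bar>LINT x:U|lborel. h x * pderiv2 i (tens a b) x\<bar> = \<bar>LINT x:U|lborel. g i x * tens a b x\<bar>"
    using weak by simp
  also have "ennreal \<dots> \<le> (\<integral>\<^sup>+x. ennreal \<bar>indicator U x *\<^sub>R (g i x * tens a b x)\<bar> \<partial>lborel)"
    unfolding set_lebesgue_integral_def by (rule ennreal_abs_LINT_le)
  also have "\<dots> \<le> (\<integral>\<^sup>+x. ennreal K * (ennreal (G x) * indicator ?R x) \<partial>lborel)"
  proof (rule nn_integral_mono)
    fix x
    show "ennreal \<bar>indicator U x *\<^sub>R (g i x * tens a b x)\<bar> \<le> ennreal K * (ennreal (G x) * indicator ?R x)"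
    proof (cases "x \<in> ?R")
      case True
      have "\<bar>g i x * tens a b x\<bar> \<le> G x * K"
        unfolding abs_mult using g_le_G K[of "x$1" "x$2"] G_nonneg
        by (intro mult_mono) (auto simp: tens_def)
      moreover have "\<bar>indicator U x *\<^sub>R (g i x * tens a b x)\<bar> \<le> \<bar>g i x * tens a b x\<bar>"
        by (simp add: indicator_def)
      ultimately have "\<bar>indicator U x *\<^sub>R (g i x * tens a b x)\<bar> \<le> K * G x" by (simp add: mult.commute)
      then show ?thesis using True K0 G_nonneg by (simp add: ennreal_mult[symmetric])
    next
      case False
      then have "tens a b x = 0" using assms(3)[of "x$1"] assms(4)[of "x$2"]
        by (auto simp: tens_def mem_box_cart forall_2)
      then show ?thesis by simp
    qed
  qed
  also have "\<dots> = ennreal K * (\<integral>\<^sup>+x\<in>?R. ennreal (G x) \<partial>lborel)"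
    using G_measurable by (intro nn_integral_cmult) auto
  finally show ?thesis .
qed

text \<open>A difference of two bumps in the first variable is the derivative of a difference of
  steps, which is compactly supported. So the difference of the averages is a pairing of
  \<open>h\<close> with a partial derivative of a test function, and the weak identity bounds it by
  an integral of \<open>G\<close> over any box containing both supports.\<close>

lemma avg_diff1:
  assumes s: "s1 > 0" "s1' > 0" "s2 > 0"
    and r: "a1 \<le> c1 - s1" "c1 + s1 \<le> a2" "a1 \<le> c1' - s1'" "c1' + s1' \<le> a2" "b1 \<le> c2 - s2" "c2 + s2 \<le> b2"
    and sub: "cbox (vec2 (a1,b1)) (vec2 (a2,b2)) \<subseteq> U"
  shows "ennreal \<bar>avg c1 s1 c2 s2 - avg c1' s1' c2 s2\<bar>
    \<le> ennreal (KB / s2) * (\<integral>\<^sup>+x\<in>cbox (vec2 (a1,b1)) (vec2 (a2,b2)). ennreal (G x) \<partial>lborel)"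
proof -
  define a where "a t = ds 0 ((t - c1) / s1) + (-1) * ds 0 ((t - c1') / s1')" for t
  have a: "smooth a" unfolding a_def[abs_def]
    by (intro smooth_add smooth_mult smooth_const smooth_step)
  have "(a has_real_derivative bump c1 s1 t + (-1) * bump c1' s1' t) (at t)" for t
    unfolding a_def[abs_def] by (intro DERIV_add DERIV_cmult step_has_derivative)
  then have da: "deriv a = (\<lambda>t. bump c1 s1 t - bump c1' s1' t)" using DERIV_imp_deriv by force
  have bo: "bump c s t = 0" if "s > 0" "l \<le> c - s" "c + s \<le> r" "t \<notin> {l..r}" for c s t l r
    by (rule bump_outside) (use that in auto)
  have az: "a t = 0" if "t \<notin> {a1..a2}" for t
  proof (cases "t < a1")
    case True
    then have "(t - c1) / s1 \<le> -1" "(t - c1') / s1' \<le> -1" using s r by (auto simp: field_simps)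
    then show ?thesis by (simp add: a_def ds_0 sstep_left)
  next
    case False
    then have "t > a2" using that by auto
    then have "(t - c1) / s1 \<ge> 1" "(t - c1') / s1' \<ge> 1" using s r by (auto simp: field_simps)
    then show ?thesis by (simp add: a_def ds_0 sstep_right)
  qed
  have bz: "bump c2 s2 t = 0" if "t \<notin> {b1..b2}" for t by (rule bo[OF s(3) r(5,6) that])
  have K: "\<bar>a t * bump c2 s2 s\<bar> \<le> KB / s2" for t s
  proof -
    have "\<bar>a t\<bar> \<le> 1" unfolding a_def ds_0
      using sstep_bounds[of "(t - c1) / s1"] sstep_bounds[of "(t - c1') / s1'"] by linarith
    then have "\<bar>a t\<bar> * \<bar>bump c2 s2 s\<bar> \<le> 1 * (KB / s2)" by (intro mult_mono bump_bound s) auto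
    then show ?thesis by (simp add: abs_mult)
  qed
  have "avg c1 s1 c2 s2 - avg c1' s1' c2 s2 =
      (LINT x:U|lborel. h x * tens (bump c1 s1) (bump c2 s2) x - h x * tens (bump c1' s1') (bump c2 s2) x)"
    unfolding avg_def
    by (rule set_integral_diff(2)[symmetric]; rule integrable_tens[OF bump_continuous bump_continuous _ bz sub])
       (use bo s r in blast)+
  also have "\<dots> = (LINT x:U|lborel. h x * pderiv2 1 (tens a (bump c2 s2)) x)"
    unfolding pderiv2_tens[OF a smooth_bump] da tens_def by (simp add: algebra_simps)
  finally show ?thesis using weak_tens_bound[OF a smooth_bump az bz sub K, of 1] by simp
qed

lemma avg_diff2:
  assumes s: "s1 > 0" "s2' > 0" "s2 > 0"
    and r: "a1 \<le> c1 - s1" "c1 + s1 \<le> a2" "b1 \<le> c2 - s2" "c2 + s2 \<le> b2" "b1 \<le> c2' - s2'" "c2' + s2' \<le> b2"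
    and sub: "cbox (vec2 (a1,b1)) (vec2 (a2,b2)) \<subseteq> U"
  shows "ennreal \<bar>avg c1 s1 c2 s2 - avg c1 s1 c2' s2'\<bar>
    \<le> ennreal (KB / s1) * (\<integral>\<^sup>+x\<in>cbox (vec2 (a1,b1)) (vec2 (a2,b2)). ennreal (G x) \<partial>lborel)"
proof -
  define b where "b t = ds 0 ((t - c2) / s2) + (-1) * ds 0 ((t - c2') / s2')" for t
  have b: "smooth b" unfolding b_def[abs_def]
    by (intro smooth_add smooth_mult smooth_const smooth_step)
  have "(b has_real_derivative bump c2 s2 t + (-1) * bump c2' s2' t) (at t)" for t
    unfolding b_def[abs_def] by (intro DERIV_add DERIV_cmult step_has_derivative)
  then have db: "deriv b = (\<lambda>t. bump c2 s2 t - bump c2' s2' t)" using DERIV_imp_deriv by force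
  have bo: "bump c s t = 0" if "s > 0" "l \<le> c - s" "c + s \<le> r" "t \<notin> {l..r}" for c s t l r
    by (rule bump_outside) (use that in auto)
  have bz: "b t = 0" if "t \<notin> {b1..b2}" for t
  proof (cases "t < b1")
    case True
    then have "(t - c2) / s2 \<le> -1" "(t - c2') / s2' \<le> -1" using s r by (auto simp: field_simps)
    then show ?thesis by (simp add: b_def ds_0 sstep_left)
  next
    case False
    then have "t > b2" using that by auto
    then have "(t - c2) / s2 \<ge> 1" "(t - c2') / s2' \<ge> 1" using s r by (auto simp: field_simps)
    then show ?thesis by (simp add: b_def ds_0 sstep_right)
  qed
  have az: "bump c1 s1 t = 0" if "t \<notin> {a1..a2}" for t by (rule bo[OF s(1) r(1,2) that])
  have K: "\<bar>bump c1 s1 s * b t\<bar> \<le> KB / s1" for t s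
  proof -
    have "\<bar>b t\<bar> \<le> 1" unfolding b_def ds_0
      using sstep_bounds[of "(t - c2) / s2"] sstep_bounds[of "(t - c2') / s2'"] by linarith
    then have "\<bar>bump c1 s1 s\<bar> * \<bar>b t\<bar> \<le> (KB / s1) * 1"
      by (intro mult_mono bump_bound s) (use s KB(1) in auto)
    then show ?thesis by (simp add: abs_mult)
  qed
  have "avg c1 s1 c2 s2 - avg c1 s1 c2' s2' =
      (LINT x:U|lborel. h x * tens (bump c1 s1) (bump c2 s2) x - h x * tens (bump c1 s1) (bump c2' s2') x)"
    unfolding avg_def
    by (rule set_integral_diff(2)[symmetric]; rule integrable_tens[OF bump_continuous bump_continuous az _ sub])
       (use bo s r in blast)+
  also have "\<dots> = (LINT x:U|lborel. h x * pderiv2 2 (tens (bump c1 s1) b) x)"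
    unfolding pderiv2_tens[OF smooth_bump b] db tens_def by (simp add: algebra_simps)
  finally show ?thesis using weak_tens_bound[OF smooth_bump b az bz sub K, of 2] by simp
qed

definition savg :: "real^2 \<Rightarrow> real \<Rightarrow> real" where
  "savg c s = avg (c$1) s (c$2) s"

lemma cbox_eq_coords: "cbox l u = cbox (vec2 (l$1, l$2)) (vec2 (u$1, u$2))"
  by (auto simp: mem_box_cart forall_2)

text \<open>One coordinate is changed at a time, through the box with centre (c'1, c2) and widths
  s', s. The first change costs KB/s and the second KB/s', by the width of the factor left
  unchanged.\<close>

lemma savg_diff:
  assumes s: "s > 0" "s' > 0" and sub: "cbox l u \<subseteq> U"
    and r: "\<And>i. l$i \<le> c$i - s" "\<And>i. c$i + s \<le> u$i" "\<And>i. l$i \<le> c'$i - s'" "\<And>i. c'$i + s' \<le> u$i"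
  shows "ennreal \<bar>savg c s - savg c' s'\<bar>
    \<le> ennreal (KB * (1/s + 1/s')) * (\<integral>\<^sup>+x\<in>cbox l u. ennreal (G x) \<partial>lborel)"
proof -
  let ?I = "\<integral>\<^sup>+x\<in>cbox l u. ennreal (G x) \<partial>lborel"
  have sub': "cbox (vec2 (l$1, l$2)) (vec2 (u$1, u$2)) \<subseteq> U" using sub cbox_eq_coords[of l u] by simp
  have "ennreal \<bar>savg c s - savg c' s'\<bar> \<le> ennreal (\<bar>avg (c$1) s (c$2) s - avg (c'$1) s' (c$2) s\<bar>
      + \<bar>avg (c'$1) s' (c$2) s - avg (c'$1) s' (c'$2) s'\<bar>)"
    unfolding savg_def by (intro ennreal_leI) linarith
  also have "\<dots> \<le> ennreal (KB / s) * ?I + ennreal (KB / s') * ?I"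
    unfolding cbox_eq_coords[of l u]
    by (subst ennreal_plus, simp, simp, intro add_mono avg_diff1 avg_diff2 sub') (use s r in auto)
  also have "\<dots> = ennreal (KB * (1/s + 1/s')) * ?I"
    using s KB(1) by (simp add: distrib_right[symmetric] ennreal_plus[symmetric] distrib_left del: ennreal_plus)
  finally show ?thesis .
qed

text \<open>The total mass 1 of the bumps lets \<open>y\<close> be moved under the integral; the
  constant is the sup bound (KB/s)^2 times the area (2s)^2 of the support.\<close>

lemma savg_close:
  assumes s: "s > 0" and sub: "cbox (\<chi> i. c$i - s) (\<chi> i. c$i + s) \<subseteq> U"
    and e: "\<And>w. w \<in> cbox (\<chi> i. c$i - s) (\<chi> i. c$i + s) \<Longrightarrow> \<bar>h w - y\<bar> \<le> e"
  shows "\<bar>savg c s - y\<bar> \<le> 4 * KB\<^sup>2 * e"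
proof -
  let ?R = "cbox (\<chi> i. c$i - s) (\<chi> i. c$i + s)"
  let ?t = "tens (bump (c$1) s) (bump (c$2) s)"
  have R: "?R = cbox (vec2 (c$1 - s, c$2 - s)) (vec2 (c$1 + s, c$2 + s))" using cbox_eq_coords[of "\<chi> i. c$i - s"] by simp
  have e0: "e \<ge> 0" using e[of c] s by (force simp: mem_box_cart)
  have z: "bump (c$i) s t = 0" if "t \<notin> {c$i - s..c$i + s}" for i t
    by (rule bump_outside) (use that s in auto)
  have tz: "?t x = 0" if "x \<notin> ?R" for x
    using that z[of "x$1" 1] z[of "x$2" 2] unfolding R by (auto simp: tens_def mem_box_cart forall_2)
  have tint: "integrable lborel ?t"
  proof -
    have "continuous_on UNIV ?t" unfolding tens_def[abs_def]
      by (intro continuous_intros continuous_on_compose2[OF bump_continuous[of UNIV]]) auto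
    then have "integrable lborel (\<lambda>x. indicator ?R x *\<^sub>R ?t x)"
      by (intro borel_integrable_compact) (auto intro: continuous_on_subset)
    moreover have "(\<lambda>x. indicator ?R x *\<^sub>R ?t x) = ?t" using tz by (auto simp: fun_eq_iff indicator_def)
    ultimately show ?thesis by simp
  qed
  have t1: "(LINT x|lborel. ?t x) = 1"
    unfolding tens_def
    by (subst integral_tensor) (use s in \<open>auto simp: integrable_bump integral_bump intro!: borel_measurable_continuous_onI bump_continuous\<close>)
  have hint: "set_integrable lborel U (\<lambda>x. h x * ?t x)"
    by (rule integrable_tens[OF bump_continuous bump_continuous z z]) (use sub in \<open>simp_all add: R\<close>)
  have "savg c s - y = (LINT x|lborel. indicator U x *\<^sub>R (h x * ?t x)) - (LINT x|lborel. y * ?t x)"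
    using t1 by (simp add: savg_def avg_def set_lebesgue_integral_def)
  also have "\<dots> = (LINT x|lborel. indicator U x *\<^sub>R (h x * ?t x) - y * ?t x)"
    by (rule Bochner_Integration.integral_diff[symmetric]) (use hint tint in \<open>auto simp: set_integrable_def\<close>)
  finally have eq: "savg c s - y = (LINT x|lborel. indicator U x *\<^sub>R (h x * ?t x) - y * ?t x)" .
  have "ennreal \<bar>savg c s - y\<bar> \<le> (\<integral>\<^sup>+x. ennreal \<bar>indicator U x *\<^sub>R (h x * ?t x) - y * ?t x\<bar> \<partial>lborel)"
    unfolding eq by (rule ennreal_abs_LINT_le)
  also have "\<dots> \<le> (\<integral>\<^sup>+x. ennreal (e * (KB/s)\<^sup>2) * indicator ?R x \<partial>lborel)"
  proof (rule nn_integral_mono)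
    fix x
    show "ennreal \<bar>indicator U x *\<^sub>R (h x * ?t x) - y * ?t x\<bar> \<le> ennreal (e * (KB/s)\<^sup>2) * indicator ?R x"
    proof (cases "x \<in> ?R")
      case True
      then have "x \<in> U" using sub by blast
      then have "\<bar>indicator U x *\<^sub>R (h x * ?t x) - y * ?t x\<bar> = \<bar>h x - y\<bar> * \<bar>?t x\<bar>"
        by (simp add: abs_mult[symmetric] algebra_simps)
      also have "\<dots> \<le> e * (KB/s * (KB/s))"
        unfolding tens_def abs_mult using e[OF True] s KB(1) e0
        by (intro mult_mono bump_bound) auto
      finally show ?thesis using True by (simp add: power2_eq_square ennreal_leI)
    qed (simp add: tz)
  qed
  also have "\<dots> = ennreal (e * (KB/s)\<^sup>2) * ennreal ((2 * s) * (2 * s))"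
  proof -
    have "emeasure lborel ?R = ennreal ((2 * s) * (2 * s))"
    proof -
      have b: "(Basis :: (real^2) set) = (\<lambda>i. axis i 1) ` UNIV" by (auto simp: Basis_vec_def)
      have "inj (\<lambda>i::2. axis i (1::real))" by (auto simp: inj_on_def axis_eq_axis)
      then show ?thesis using s
        by (subst emeasure_lborel_cbox) (auto simp: b prod.reindex inner_axis UNIV_2)
    qed
    then show ?thesis by (simp add: nn_integral_cmult_indicator)
  qed
  also have "\<dots> = ennreal (4 * KB\<^sup>2 * e)"
  proof -
    have "e * (KB/s)\<^sup>2 * ((2 * s) * (2 * s)) = 4 * KB\<^sup>2 * e" using s by (simp add: power2_eq_square field_simps)
    then show ?thesis using s e0 by (subst ennreal_mult[symmetric]) auto
  qed
  finally show ?thesis using e0 by (subst (asm) ennreal_le_iff) auto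
qed

lemma savg_tendsto:
  assumes x: "x \<in> U" and r: "r \<longlonglongrightarrow> 0" "\<And>l. r l > 0" and k: "k > 0"
    and c: "\<And>l i. \<bar>c l$i - x$i\<bar> \<le> r l"
  shows "(\<lambda>l. savg (c l) (k * r l)) \<longlonglongrightarrow> h x"
  unfolding LIMSEQ_iff
proof (intro allI impI)
  fix e :: real assume e: "e > 0"
  \<comment> \<open>\<open>savg_close\<close> loses the factor 4 KB^2; the remaining 2 makes the
    final inequality strict.\<close>
  define e' where "e' = e / (8 * KB\<^sup>2)"
  have KB0: "KB > 0" using KB(1) by linarith
  have e': "e' > 0" using e KB0 by (simp add: e'_def)
  have "isCont h x" using cont_h open_U x by (simp add: continuous_on_eq_continuous_at)
  then obtain d where d: "d > 0" "\<And>w. dist w x < d \<Longrightarrow> \<bar>h w - h x\<bar> < e'"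
    using e' unfolding continuous_at_eps_delta dist_real_def by metis
  obtain d' where d': "d' > 0" "ball x d' \<subseteq> U" using open_U x open_contains_ball by blast
  have "\<forall>\<^sub>F l in sequentially. r l < min d d' / (2 * (1 + k) * 2)"
    by (rule order_tendstoD(2)[OF r(1)]) (use d d' k in auto)
  then obtain N where N: "\<And>l. l \<ge> N \<Longrightarrow> r l < min d d' / (2 * (1 + k) * 2)"
    unfolding eventually_sequentially by blast
  show "\<exists>no. \<forall>l\<ge>no. norm (savg (c l) (k * r l) - h x) < e"
  proof (intro exI allI impI)
    fix l assume l: "l \<ge> N"
    have near: "dist w x < min d d'" if "w \<in> cbox (\<chi> i. c l$i - k * r l) (\<chi> i. c l$i + k * r l)" for w
    proof -
      have "\<bar>w$i - x$i\<bar> \<le> (1 + k) * r l" for i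
      proof -
        have "c l$i - k * r l \<le> w$i" "w$i \<le> c l$i + k * r l" using that by (auto simp: mem_box_cart)
        then show ?thesis using c[of l i] by (auto simp: abs_le_iff algebra_simps)
      qed
      then have "\<bar>w$1 - x$1\<bar> + \<bar>w$2 - x$2\<bar> \<le> 2 * ((1 + k) * r l)" by (metis add_mono mult_2)
      moreover have "dist w x \<le> \<bar>w$1 - x$1\<bar> + \<bar>w$2 - x$2\<bar>"
        using norm_le_l1_cart[of "w - x"] by (simp add: dist_norm sum_2)
      moreover have "2 * ((1 + k) * r l) < min d d'"
      proof -
        have "r l * (2 * (1 + k) * 2) < min d d'" using N[OF l] k by (subst (asm) less_divide_eq) auto
        moreover have "0 < r l * (1 + k)" using r(2)[of l] k by simp
        ultimately show ?thesis by (simp add: algebra_simps)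
      qed
      ultimately show ?thesis by linarith
    qed
    have "\<bar>savg (c l) (k * r l) - h x\<bar> \<le> 4 * KB\<^sup>2 * e'"
    proof (rule savg_close)
      show "cbox (\<chi> i. c l$i - k * r l) (\<chi> i. c l$i + k * r l) \<subseteq> U"
        using near d'(2) by (force simp: dist_commute subset_iff)
      show "\<bar>h w - h x\<bar> \<le> e'" if "w \<in> cbox (\<chi> i. c l$i - k * r l) (\<chi> i. c l$i + k * r l)" for w
        using near[OF that] d(2)[of w] by simp
    qed (use k r(2)[of l] in simp)
    also have "\<dots> < e" using e KB0 by (simp add: e'_def)
    finally show "norm (savg (c l) (k * r l) - h x) < e" by simp
  qed
qed


text \<open>Bookkeeping of exponents: on \<open>R\<close> the weight turns X into the bound X /
  (\<kappa> r^\<theta>) for the integral of G^p, the averages contribute 1/r, and the area, of order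
  r^2, contributes r^(2 - 2/p). Together this is the power (p - 2 - \<theta>)/p. The constant 192 is
  24, from the widths r/8 and at least r/16, times 2 times 4.\<close>

lemma savg_diff_weighted:
  assumes p: "p > 2" and r: "r > 0" and kp: "\<kappa> > 0"
    and R: "R = cbox (\<chi> i. c$i - 5/8 * r) (\<chi> i. c$i + 5/8 * r)"
    and V: "R \<subseteq> V" "V \<in> sets borel" and sub: "R \<subseteq> U"
    and wm: "w \<in> borel_measurable borel" and wR: "\<And>y. y \<in> R \<Longrightarrow> w y \<ge> \<kappa> * r powr \<theta>"
    and X: "X \<ge> 0" "(\<integral>\<^sup>+y\<in>V. ennreal (G y powr p * w y) \<partial>lborel) \<le> ennreal X"
    and s': "s' \<ge> r / 16" "\<And>i. \<bar>c'$i - c$i\<bar> + s' \<le> 5/8 * r"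
  shows "\<bar>savg c (1/8 * r) - savg c' s'\<bar>
    \<le> 192 * KB * \<kappa> powr (-1/p) * X powr (1/p) * r powr ((p - 2 - \<theta>) / p)"
proof -
  let ?Y = "X * (\<kappa> * r powr \<theta>) powr (-1)"
  have s'0: "s' > 0" using s' r by simp
  have area: "emeasure lborel R = ennreal ((5/4 * r)\<^sup>2)"
  proof -
    have b: "(Basis :: (real^2) set) = (\<lambda>i. axis i 1) ` UNIV" by (auto simp: Basis_vec_def)
    have "inj (\<lambda>i::2. axis i (1::real))" by (auto simp: inj_on_def axis_eq_axis)
    then show ?thesis using r unfolding R
      by (subst emeasure_lborel_cbox) (auto simp: b prod.reindex inner_axis UNIV_2 power2_eq_square)
  qed
  have kr: "\<kappa> * r powr \<theta> > 0" using kp r by simp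
  have "(\<integral>\<^sup>+y\<in>R. ennreal (G y powr p) \<partial>lborel)
      \<le> (\<integral>\<^sup>+y. ennreal ((\<kappa> * r powr \<theta>) powr (-1)) * (ennreal (G y powr p * w y) * indicator V y) \<partial>lborel)"
  proof (rule nn_integral_mono)
    fix y
    show "ennreal (G y powr p) * indicator R y \<le>
      ennreal ((\<kappa> * r powr \<theta>) powr (-1)) * (ennreal (G y powr p * w y) * indicator V y)"
    proof (cases "y \<in> R")
      case True
      have "G y powr p = (\<kappa> * r powr \<theta>) powr (-1) * (G y powr p * (\<kappa> * r powr \<theta>))"
        using kp r by (simp add: powr_minus_divide less_imp_neq[symmetric])
      also have "\<dots> \<le> (\<kappa> * r powr \<theta>) powr (-1) * (G y powr p * w y)"
        by (intro mult_left_mono wR True) auto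
      finally have "ennreal (G y powr p) \<le> ennreal ((\<kappa> * r powr \<theta>) powr (-1)) * ennreal (G y powr p * w y)"
        by (simp add: ennreal_mult'[symmetric] ennreal_leI)
      then show ?thesis using True V(1) by (auto simp: subset_iff)
    qed simp
  qed
  also have "\<dots> = ennreal ((\<kappa> * r powr \<theta>) powr (-1)) * (\<integral>\<^sup>+y\<in>V. ennreal (G y powr p * w y) \<partial>lborel)"
  proof (rule nn_integral_cmult)
    have [measurable]: "V \<in> sets borel" "G \<in> borel_measurable borel" "w \<in> borel_measurable borel"
      using G_measurable wm V by auto
    show "(\<lambda>y. ennreal (G y powr p * w y) * indicator V y) \<in> borel_measurable lborel"
      by measurable
  qed
  also have "\<dots> \<le> ennreal ((\<kappa> * r powr \<theta>) powr (-1)) * ennreal X"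
    by (intro mult_left_mono X) auto
  also have "\<dots> = ennreal ?Y" by (subst ennreal_mult'[symmetric]) (simp_all only: powr_ge_zero mult.commute)
  finally have Y: "(\<integral>\<^sup>+y\<in>R. ennreal (G y powr p) \<partial>lborel) \<le> ennreal ?Y" .
  have I: "(\<integral>\<^sup>+y\<in>R. ennreal (G y) \<partial>lborel) \<le> ennreal (2 * ?Y powr (1/p) * ((5/4 * r)\<^sup>2) powr (1 - 1/p))"
    by (rule nn_integral_le_power_mean[OF _ _ area _ _ _ _ Y]) (use G_measurable G_nonneg p X kr r R in auto)
  have "ennreal \<bar>savg c (1/8 * r) - savg c' s'\<bar> \<le> ennreal (KB * (1 / (1/8 * r) + 1 / s')) * (\<integral>\<^sup>+y\<in>R. ennreal (G y) \<partial>lborel)"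
    unfolding R
  proof (rule savg_diff)
    show "cbox (\<chi> i. c$i - 5/8 * r) (\<chi> i. c$i + 5/8 * r) \<subseteq> U" using sub R by simp
    fix i
    have "\<bar>c'$i - c$i\<bar> \<le> 5/8 * r - s'" using s'(2)[of i] by linarith
    then show "(\<chi> i. c$i - 5/8 * r)$i \<le> c'$i - s'" "c'$i + s' \<le> (\<chi> i. c$i + 5/8 * r)$i"
      unfolding abs_le_iff by auto
  qed (use r s'0 in auto)
  also have "\<dots> \<le> ennreal (24 * KB / r) * ennreal (2 * ?Y powr (1/p) * ((5/4 * r)\<^sup>2) powr (1 - 1/p))"
  proof (intro mult_mono I ennreal_leI)
    have "1 / s' \<le> 16 / r" using s'(1) r s'0 by (simp add: field_simps)
    then have "KB * (1 / (1/8 * r) + 1 / s') \<le> KB * (8 / r + 16 / r)" using KB(1) by (intro mult_left_mono) auto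
    then show "KB * (1 / (1/8 * r) + 1 / s') \<le> 24 * KB / r" by (simp add: field_simps)
  qed auto
  also have "\<dots> = ennreal (24 * KB / r * (2 * ?Y powr (1/p) * ((5/4 * r)\<^sup>2) powr (1 - 1/p)))"
  proof -
    have "24 * KB / r \<ge> 0" using KB(1) r by simp
    then show ?thesis by (simp only: ennreal_mult')
  qed
  finally have "\<bar>savg c (1/8 * r) - savg c' s'\<bar> \<le> 24 * KB / r * (2 * ?Y powr (1/p) * ((5/4 * r)\<^sup>2) powr (1 - 1/p))"
    using KB(1) r by (subst (asm) ennreal_le_iff) auto
  also have "\<dots> \<le> 24 * KB / r * (2 * (X powr (1/p) * \<kappa> powr (-1/p) * r powr (-\<theta>/p)) * (4 * r powr (2 - 2/p)))"
  proof (intro mult_left_mono mult_mono)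
    show "?Y powr (1/p) \<le> X powr (1/p) * \<kappa> powr (-1/p) * r powr (-\<theta>/p)"
    proof -
      have "?Y powr (1/p) = X powr (1/p) * ((\<kappa> * r powr \<theta>) powr (-1)) powr (1/p)"
        using X by (intro powr_mult)
      also have "((\<kappa> * r powr \<theta>) powr (-1)) powr (1/p) = (\<kappa> * r powr \<theta>) powr (-1/p)"
        by (simp only: powr_powr) simp
      also have "\<dots> = \<kappa> powr (-1/p) * (r powr \<theta>) powr (-1/p)"
        using kp by (intro powr_mult)
      also have "(r powr \<theta>) powr (-1/p) = r powr (-\<theta>/p)" by (simp only: powr_powr) simp
      finally show ?thesis by (simp only: mult.assoc order_refl)
    qed
    have "((5/4 * r)\<^sup>2) powr (1 - 1/p) \<le> (4 * r\<^sup>2) powr (1 - 1/p)"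
      using p r by (intro powr_mono2) (auto simp: power2_eq_square)
    also have "\<dots> = 4 powr (1 - 1/p) * r powr (2 - 2/p)"
    proof -
      have "(4 * r\<^sup>2) powr (1 - 1/p) = 4 powr (1 - 1/p) * (r powr 2) powr (1 - 1/p)"
        using r by (subst powr_mult) (simp_all add: powr_numeral)
      also have "(r powr 2) powr (1 - 1/p) = r powr (2 - 2/p)"
        unfolding powr_powr by (simp add: right_diff_distrib)
      finally show ?thesis .
    qed
    also have "\<dots> \<le> 4 powr 1 * r powr (2 - 2/p)" using p by (intro mult_right_mono powr_mono) auto
    finally show "((5/4 * r)\<^sup>2) powr (1 - 1/p) \<le> 4 * r powr (2 - 2/p)" by simp
  qed (use KB(1) r in auto)
  also have "\<dots> = 192 * KB * \<kappa> powr (-1/p) * X powr (1/p) * (r powr (-1) * r powr (-\<theta>/p) * r powr (2 - 2/p))"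
    using r by (simp add: powr_minus_divide mult_ac)
  also have "r powr (-1) * r powr (-\<theta>/p) * r powr (2 - 2/p) = r powr ((p - 2 - \<theta>) / p)"
  proof -
    have "-1 + -\<theta>/p + (2 - 2/p) = (p - 2 - \<theta>) / p" using p by (simp add: field_simps)
    then show ?thesis by (simp only: powr_add[symmetric])
  qed
  finally show ?thesis .
qed

text \<open>\<open>h x\<close> is compared with an average over a box displaced in direction \<open>n\<close>,
  through boxes shrinking towards \<open>x\<close>. On these the weight is at least \<open>r\<^sup>\<theta>\<close>; since \<open>\<theta> < p - 2\<close>,
  the geometric gain survives.\<close>

lemma abs_diff_savg_le:
  assumes p: "p > 2" and th: "0 \<le> \<theta>" "\<theta> < p - 2" and S: "S > 0" and n: "norm n \<le> 1" and kp: "\<kappa> > 0"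
    and sub: "{w. \<forall>i. \<bar>w$i - x$i\<bar> \<le> 2 * S} \<subseteq> U"
    and wm: "w \<in> borel_measurable borel"
    and w: "\<And>r y. 0 < r \<Longrightarrow> r \<le> S \<Longrightarrow> dist y (x + r *\<^sub>R n) \<le> 9/10 * r \<Longrightarrow> w y \<ge> \<kappa> * r powr \<theta>"
    and X: "X \<ge> 0" "(\<integral>\<^sup>+y\<in>{w. \<forall>i. \<bar>w$i - x$i\<bar> \<le> 2 * S}. ennreal (G y powr p * w y) \<partial>lborel) \<le> ennreal X"
  shows "\<bar>h x - savg (x + S *\<^sub>R n) (S / 8)\<bar>
    \<le> 192 * KB * \<kappa> powr (-1/p) / (1 - (1/2) powr ((p - 2 - \<theta>) / p)) * S powr ((p - 2 - \<theta>) / p) * X powr (1/p)"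
proof -
  define e where "e = (p - 2 - \<theta>) / p"
  have e: "e > 0" using p th by (simp add: e_def)
  define q where "q = (1/2::real) powr e"
  have q: "0 \<le> q" "q < 1" using e powr_less_mono2[of e "1/2" 1] by (auto simp: q_def)
  define r where "r l = S / 2 ^ l" for l :: nat
  have r: "r l > 0" "r l \<le> S" "r (Suc l) = r l / 2" for l
    using S by (auto simp: r_def field_simps)
  define c where "c l = x + r l *\<^sub>R n" for l
  define a where "a l = savg (c l) (1/8 * r l)" for l
  have ni: "\<bar>n$i\<bar> \<le> 1" for i using component_le_norm_cart[of n i] n by linarith
  have ci: "\<bar>c l$i - x$i\<bar> \<le> r l" for l i
    using mult_left_mono[OF ni[of i], of "r l"] r(1)[of l] by (simp add: c_def abs_mult)
  have xU: "x \<in> U" using sub S by auto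
  have lim: "a \<longlonglongrightarrow> h x"
    unfolding a_def
  proof (rule savg_tendsto[OF xU _ r(1) _ ci])
    have "(\<lambda>l. S * (1/2) ^ l) \<longlonglongrightarrow> S * 0" by (intro tendsto_intros LIMSEQ_power_zero) auto
    moreover have "r = (\<lambda>l. S * (1/2) ^ l)" by (rule ext) (simp add: r_def power_one_over)
    ultimately show "r \<longlonglongrightarrow> 0" by simp
  qed simp
  define K where "K = 192 * KB * \<kappa> powr (-1/p) * X powr (1/p) * S powr e"
  have K: "K \<ge> 0" using KB(1) by (simp add: K_def)
  have step: "\<bar>a l - a (Suc l)\<bar> \<le> K * q ^ l" for l
  proof -
    let ?r = "r l"
    let ?R = "cbox (\<chi> i. c l$i - 5/8 * ?r) (\<chi> i. c l$i + 5/8 * ?r)"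
    have Rsub: "?R \<subseteq> {w. \<forall>i. \<bar>w$i - x$i\<bar> \<le> 2 * S}"
    proof
      fix y assume y: "y \<in> ?R"
      have "\<bar>y$i - x$i\<bar> \<le> 2 * S" for i
      proof -
        have "c l$i - 5/8 * ?r \<le> y$i" "y$i \<le> c l$i + 5/8 * ?r" using y by (auto simp: mem_box_cart)
        then show ?thesis using ci[of l i] r(1,2)[of l] by linarith
      qed
      then show "y \<in> {w. \<forall>i. \<bar>w$i - x$i\<bar> \<le> 2 * S}" by simp
    qed
    have wR: "w y \<ge> \<kappa> * ?r powr \<theta>" if "y \<in> ?R" for y
    proof (rule w[OF r(1,2)])
      have "\<bar>y$i - c l$i\<bar> \<le> 5/8 * ?r" for i
      proof -
        have "c l$i - 5/8 * ?r \<le> y$i" "y$i \<le> c l$i + 5/8 * ?r" using that by (auto simp: mem_box_cart)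
        then show ?thesis by linarith
      qed
      then have sq: "(y$i - c l$i)\<^sup>2 \<le> (5/8 * ?r)\<^sup>2" for i by (metis abs_ge_zero power2_abs power_mono)
      \<comment> \<open>A box of half-side 5r/8 lies in the disc of radius 9r/10, where the lower
        bound for the weight is available, because 2 (5/8)^2 = 25/32 < 81/100.\<close>
      have "(y$1 - c l$1)\<^sup>2 + (y$2 - c l$2)\<^sup>2 \<le> 2 * (5/8 * ?r)\<^sup>2"
        using add_mono[OF sq[of 1] sq[of 2]] by simp
      also have "\<dots> = 25/32 * (?r * ?r)" by (simp add: power2_eq_square)
      also have "\<dots> \<le> 81/100 * (?r * ?r)" by (intro mult_right_mono) auto
      also have "\<dots> = (9/10 * ?r)\<^sup>2" by (simp add: power2_eq_square)
      finally have "(y$1 - c l$1)\<^sup>2 + (y$2 - c l$2)\<^sup>2 \<le> (9/10 * ?r)\<^sup>2" .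
      then show "dist y (x + ?r *\<^sub>R n) \<le> 9/10 * ?r"
        using r(1)[of l] unfolding c_def[symmetric] dist_norm norm_vec_def L2_set_def
        by (intro real_le_lsqrt) (auto simp: sum_2)
    qed
    have cl: "closed {w::real^2. \<forall>i. \<bar>w$i - x$i\<bar> \<le> 2 * S}"
      by (intro closed_Collect_all closed_Collect_le continuous_intros)
    have "\<bar>savg (c l) (1/8 * ?r) - savg (c (Suc l)) (1/8 * r (Suc l))\<bar> \<le> 192 * KB * \<kappa> powr (-1/p) * X powr (1/p) * ?r powr ((p - 2 - \<theta>) / p)"
    proof (rule savg_diff_weighted[OF p r(1) kp refl Rsub _ _ wm wR X])
      show "?R \<subseteq> U" using Rsub sub by blast
      fix i
      \<comment> \<open>Consecutive centres differ by at most r/2 and the next width is r/16; the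
        sum 9r/16 is below 5r/8.\<close>
      have "c (Suc l)$i - c l$i = - (1/2 * ?r * n$i)" by (simp add: c_def r(3))
      then have "\<bar>c (Suc l)$i - c l$i\<bar> = 1/2 * ?r * \<bar>n$i\<bar>" using r(1)[of l] by (simp add: abs_mult)
      also have "\<dots> \<le> 1/2 * ?r * 1" using r(1)[of l] ni by (intro mult_left_mono) auto
      finally show "\<bar>c (Suc l)$i - c l$i\<bar> + 1/8 * r (Suc l) \<le> 5/8 * ?r" using r(1)[of l] unfolding r(3) by simp
    qed (use cl r(1)[of l] r(3)[of l] in auto)
    then have "\<bar>a l - a (Suc l)\<bar> \<le> 192 * KB * \<kappa> powr (-1/p) * X powr (1/p) * ?r powr e" by (simp add: a_def e_def)
    also have "?r powr e = S powr e * q ^ l"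
    proof -
      have "?r = S * (1/2) ^ l" by (simp add: r_def power_one_over)
      also have "\<dots> = S * (1/2) powr real l" by (simp add: powr_realpow)
      finally show ?thesis using S
        by (simp add: powr_mult powr_powr q_def powr_realpow[symmetric] mult.commute)
    qed
    finally show ?thesis by (simp add: K_def mult_ac)
  qed
  from limit_dist_le_geometric[OF lim q K step]
  have "\<bar>h x - a 0\<bar> \<le> K / (1 - q)" .
  moreover have "a 0 = savg (x + S *\<^sub>R n) (S / 8)" by (simp add: a_def c_def r_def)
  ultimately show ?thesis by (simp add: K_def q_def e_def mult_ac)
qed

end

section \<open>Curves of finite Besov energy\<close>

text \<open>The integrand of the Besov seminorm times |x - y|^\<theta>, the analogue for pairs of
  parameters of the weight dist^\<theta> in the plane. On the diagonal its value is 0.\<close>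

definition besk :: "real \<Rightarrow> real \<Rightarrow> (real \<Rightarrow> real) \<Rightarrow> real \<times> real \<Rightarrow> real" where
  "besk p \<theta> \<psi> z = \<bar>deriv \<psi> (fst z) - deriv \<psi> (snd z)\<bar> powr p / \<bar>fst z - snd z\<bar> powr p * \<bar>fst z - snd z\<bar> powr \<theta>"

definition slope :: "(real \<Rightarrow> real) \<Rightarrow> real \<Rightarrow> real \<Rightarrow> real" where
  "slope \<psi> a b = (\<psi> b - \<psi> a) / (b - a)"

locale differentiable_fun =
  fixes \<psi> :: "real \<Rightarrow> real"
  assumes diff: "\<psi> differentiable (at t)"
begin

lemma DERIV: "(\<psi> has_real_derivative deriv \<psi> t) (at t)"
  using diff DERIV_deriv_iff_real_differentiable by blast

text \<open>The derivative may be discontinuous, but it is the pointwise limit of continuous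
  difference quotients.\<close>

lemma measurable_deriv: "deriv \<psi> \<in> borel_measurable borel"
proof (rule borel_measurable_LIMSEQ_real)
  fix x
  have "((\<lambda>t. (\<psi> (x + t) - \<psi> x) / t) \<longlongrightarrow> deriv \<psi> x) (at 0)" using DERIV by (simp add: DERIV_def)
  moreover have "filterlim (\<lambda>n. 1 / real (Suc n)) (at 0) sequentially" (is "filterlim ?t _ _")
    unfolding filterlim_at using LIMSEQ_inverse_real_of_nat by (auto simp: inverse_eq_divide)
  ultimately show "(\<lambda>n. (\<psi> (x + ?t n) - \<psi> x) / ?t n) \<longlonglongrightarrow> deriv \<psi> x"
    by (rule filterlim_compose)
next
  fix n
  have c: "continuous_on UNIV \<psi>" using DERIV DERIV_isCont by (blast intro: continuous_at_imp_continuous_on)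
  have "continuous_on UNIV (\<lambda>x. (\<psi> (x + 1 / real (Suc n)) - \<psi> x) / (1 / real (Suc n)))"
    by (intro continuous_intros c continuous_on_compose2[OF c]) auto
  then show "(\<lambda>x. (\<psi> (x + 1 / real (Suc n)) - \<psi> x) / (1 / real (Suc n))) \<in> borel_measurable borel"
    by (rule borel_measurable_continuous_onI)
qed

text \<open>If the right side is finite, the derivative is Lebesgue integrable on the interval, and
  the fundamental theorem for the gauge integral, valid for every everywhere differentiable
  function, identifies its integral. If it is infinite the bound is trivial.\<close>

lemma abs_increment_le:
  assumes "a \<le> b"
  shows "ennreal \<bar>\<psi> b - \<psi> a - c * (b - a)\<bar> \<le> (\<integral>\<^sup>+v\<in>{a..b}. ennreal \<bar>deriv \<psi> v - c\<bar> \<partial>lborel)"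
proof (cases "(\<integral>\<^sup>+v\<in>{a..b}. ennreal \<bar>deriv \<psi> v - c\<bar> \<partial>lborel) = \<infinity>")
  case False
  let ?f = "\<lambda>v. deriv \<psi> v - c"
  have m: "?f \<in> borel_measurable borel" using measurable_deriv by measurable
  have eq: "(\<integral>\<^sup>+v. ennreal \<bar>indicator {a..b} v *\<^sub>R ?f v\<bar> \<partial>lborel) = (\<integral>\<^sup>+v\<in>{a..b}. ennreal \<bar>?f v\<bar> \<partial>lborel)"
    by (rule nn_integral_cong) (simp add: indicator_def)
  have si: "set_integrable lborel {a..b} ?f"
    unfolding set_integrable_def
  proof (rule integrableI_bounded)
    show "(\<integral>\<^sup>+v. ennreal (norm (indicator {a..b} v *\<^sub>R ?f v)) \<partial>lborel) < \<infinity>"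
      using False unfolding real_norm_def eq by (simp add: less_top)
  qed (use m in measurable)
  have "(deriv \<psi> has_integral \<psi> b - \<psi> a) {a..b}"
    by (rule fundamental_theorem_of_calculus[OF assms])
       (use DERIV in \<open>simp add: has_real_derivative_iff_has_vector_derivative has_vector_derivative_at_within\<close>)
  from has_integral_diff[OF this has_integral_const_real[of c a b]]
  have "integral {a..b} ?f = \<psi> b - \<psi> a - c * (b - a)"
    using assms by (simp add: integral_unique mult.commute)
  then have "\<psi> b - \<psi> a - c * (b - a) = (LINT v:{a..b}|lborel. ?f v)"
    using set_borel_integral_eq_integral(2)[OF si] by simp
  then have "ennreal \<bar>\<psi> b - \<psi> a - c * (b - a)\<bar> \<le> (\<integral>\<^sup>+v. ennreal \<bar>indicator {a..b} v *\<^sub>R ?f v\<bar> \<partial>lborel)"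
    unfolding set_lebesgue_integral_def using ennreal_abs_LINT_le by metis
  then show ?thesis by (simp only: eq)
qed simp

lemma measurable_besk: "besk p \<theta> \<psi> \<in> borel_measurable (lborel \<Otimes>\<^sub>M lborel)"
proof -
  note measurable_deriv[measurable]
  show ?thesis unfolding besk_def[abs_def] by measurable
qed

lemma besov_int_eq: "besov_int p \<psi> = (\<integral>\<^sup>+z. ennreal (\<bar>deriv \<psi> (fst z) - deriv \<psi> (snd z)\<bar> powr p / \<bar>fst z - snd z\<bar> powr p) \<partial>(lborel \<Otimes>\<^sub>M lborel))"
proof -
  note measurable_deriv[measurable]
  have "(\<lambda>z. ennreal (\<bar>deriv \<psi> (fst z) - deriv \<psi> (snd z)\<bar> powr p / \<bar>fst z - snd z\<bar> powr p)) \<in> borel_measurable (lborel \<Otimes>\<^sub>M lborel)"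
    by measurable
  from lborel.nn_integral_fst[OF this] show ?thesis by (simp add: besov_int_def)
qed

text \<open>\<open>abs_increment_le\<close> twice: on [a', b'] with the slope over [a, b] as the
  constant, then for each w in [a', b'] on [a, b] with the constant
  \<open>deriv \<psi> w\<close>.\<close>

lemma slope_diff_le:
  assumes ab: "a < b" "a' < b'"
  shows "ennreal (\<bar>slope \<psi> a b - slope \<psi> a' b'\<bar> * ((b - a) * (b' - a')))
    \<le> (\<integral>\<^sup>+z\<in>{a'..b'} \<times> {a..b}. ennreal \<bar>deriv \<psi> (fst z) - deriv \<psi> (snd z)\<bar> \<partial>(lborel \<Otimes>\<^sub>M lborel))"
proof -
  note measurable_deriv[measurable]
  let ?q = "slope \<psi> a b"
  have q: "?q * (b - a) = \<psi> b - \<psi> a" "slope \<psi> a' b' * (b' - a') = \<psi> b' - \<psi> a'"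
    using ab by (auto simp: slope_def)
  have "\<psi> b' - \<psi> a' - ?q * (b' - a') = (slope \<psi> a' b' - ?q) * (b' - a')"
    by (simp add: q(2)[symmetric] left_diff_distrib)
  then have "\<bar>?q - slope \<psi> a' b'\<bar> * (b' - a') = \<bar>\<psi> b' - \<psi> a' - ?q * (b' - a')\<bar>"
    using ab by (simp add: abs_mult abs_minus_commute)
  then have "ennreal (\<bar>?q - slope \<psi> a' b'\<bar> * ((b - a) * (b' - a'))) = ennreal (b - a) * ennreal \<bar>\<psi> b' - \<psi> a' - ?q * (b' - a')\<bar>"
    using ab by (simp add: ennreal_mult'[symmetric] mult_ac)
  also have "\<dots> \<le> ennreal (b - a) * (\<integral>\<^sup>+w\<in>{a'..b'}. ennreal \<bar>deriv \<psi> w - ?q\<bar> \<partial>lborel)"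
    using ab by (intro mult_left_mono abs_increment_le) auto
  also have "\<dots> = (\<integral>\<^sup>+w. ennreal (b - a) * (ennreal \<bar>deriv \<psi> w - ?q\<bar> * indicator {a'..b'} w) \<partial>lborel)"
    by (intro nn_integral_cmult[symmetric]) measurable
  also have "\<dots> \<le> (\<integral>\<^sup>+w. (\<integral>\<^sup>+v. ennreal \<bar>deriv \<psi> w - deriv \<psi> v\<bar> * indicator ({a'..b'} \<times> {a..b}) (w, v) \<partial>lborel) \<partial>lborel)"
  proof (rule nn_integral_mono)
    fix w
    have "(b - a) * \<bar>deriv \<psi> w - ?q\<bar> = \<bar>\<psi> b - \<psi> a - deriv \<psi> w * (b - a)\<bar>"
    proof -
      have "\<psi> b - \<psi> a - deriv \<psi> w * (b - a) = (b - a) * (?q - deriv \<psi> w)" by (simp add: q(1)[symmetric] algebra_simps)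
      then show ?thesis using ab by (simp add: abs_mult abs_minus_commute)
    qed
    then have "ennreal (b - a) * ennreal \<bar>deriv \<psi> w - ?q\<bar> \<le> (\<integral>\<^sup>+v\<in>{a..b}. ennreal \<bar>deriv \<psi> v - deriv \<psi> w\<bar> \<partial>lborel)"
      using ab abs_increment_le[of a b "deriv \<psi> w"] by (simp add: ennreal_mult'[symmetric])
    moreover have "(\<integral>\<^sup>+v. ennreal \<bar>deriv \<psi> w - deriv \<psi> v\<bar> * indicator ({a'..b'} \<times> {a..b}) (w, v) \<partial>lborel)
        = (\<integral>\<^sup>+v\<in>{a..b}. ennreal \<bar>deriv \<psi> v - deriv \<psi> w\<bar> \<partial>lborel)" if "w \<in> {a'..b'}"
      using that by (intro nn_integral_cong) (simp add: indicator_def abs_minus_commute)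
    ultimately show "ennreal (b - a) * (ennreal \<bar>deriv \<psi> w - ?q\<bar> * indicator {a'..b'} w)
       \<le> (\<integral>\<^sup>+v. ennreal \<bar>deriv \<psi> w - deriv \<psi> v\<bar> * indicator ({a'..b'} \<times> {a..b}) (w, v) \<partial>lborel)"
      by (cases "w \<in> {a'..b'}") simp_all
  qed
  also have "\<dots> = (\<integral>\<^sup>+z\<in>{a'..b'} \<times> {a..b}. ennreal \<bar>deriv \<psi> (fst z) - deriv \<psi> (snd z)\<bar> \<partial>(lborel \<Otimes>\<^sub>M lborel))"
    by (subst lborel.nn_integral_fst[symmetric]) (simp_all, measurable)
  finally show ?thesis .
qed

text \<open>On the rectangle the distance of the parameters is at most D, so the p-th power of the
  difference of derivatives is at most D^(p - \<theta>) times \<open>besk\<close>; the power mean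
  inequality gives the rest.\<close>

lemma slope_diff_besk:
  assumes p: "p > 1" and th: "\<theta> \<le> p" and ab: "a < b" "a' < b'"
    and W: "{a..b} \<subseteq> W" "{a'..b'} \<subseteq> W"
    and D: "D > 0" "\<And>x y. x \<in> {a..b} \<Longrightarrow> y \<in> {a'..b'} \<Longrightarrow> \<bar>x - y\<bar> \<le> D"
    and X: "X \<ge> 0" "(\<integral>\<^sup>+z\<in>W \<times> W. ennreal (besk p \<theta> \<psi> z) \<partial>(lborel \<Otimes>\<^sub>M lborel)) \<le> ennreal X"
  shows "\<bar>slope \<psi> a b - slope \<psi> a' b'\<bar> \<le> 2 * X powr (1/p) * D powr (1 - \<theta>/p) * ((b - a) * (b' - a')) powr (-1/p)"
proof -
  note measurable_deriv[measurable] measurable_besk[measurable]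
  let ?P = "lborel \<Otimes>\<^sub>M lborel :: (real \<times> real) measure"
  let ?R = "{a'..b'} \<times> {a..b}"
  let ?A = "(b - a) * (b' - a')"
  let ?G = "\<lambda>z. \<bar>deriv \<psi> (fst z) - deriv \<psi> (snd z)\<bar>"
  have A: "emeasure ?P ?R = ennreal ?A" "?A > 0"
    using ab by (simp_all add: lborel.emeasure_pair_measure_Times ennreal_mult'[symmetric] mult.commute)
  have "(\<integral>\<^sup>+z\<in>?R. ennreal (?G z powr p) \<partial>?P) \<le> (\<integral>\<^sup>+z. ennreal (D powr (p - \<theta>)) * (ennreal (besk p \<theta> \<psi> z) * indicator ?R z) \<partial>?P)"
  proof (rule nn_integral_mono)
    fix z
    show "ennreal (?G z powr p) * indicator ?R z \<le> ennreal (D powr (p - \<theta>)) * (ennreal (besk p \<theta> \<psi> z) * indicator ?R z)"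
    proof (cases "z \<in> ?R")
      case True
      let ?d = "\<bar>fst z - snd z\<bar>"
      have d: "?d \<le> D" using True D(2)[of "snd z" "fst z"] by (auto simp: abs_minus_commute)
      have b0: "besk p \<theta> \<psi> z \<ge> 0" by (simp add: besk_def)
      have "?G z powr p \<le> D powr (p - \<theta>) * besk p \<theta> \<psi> z"
      proof (cases "?d = 0")
        case False
        then have "?G z powr p = ?d powr (p - \<theta>) * besk p \<theta> \<psi> z"
          by (simp add: besk_def powr_diff)
        also have "\<dots> \<le> D powr (p - \<theta>) * besk p \<theta> \<psi> z"
          using th d b0 by (intro mult_right_mono powr_mono2) auto
        finally show ?thesis .
      qed (simp add: b0)
      then show ?thesis using True by (simp add: ennreal_mult'[symmetric] ennreal_leI)
    qed simp
  qed
  also have "\<dots> = ennreal (D powr (p - \<theta>)) * (\<integral>\<^sup>+z\<in>?R. ennreal (besk p \<theta> \<psi> z) \<partial>?P)"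
    by (intro nn_integral_cmult) measurable
  also have "\<dots> \<le> ennreal (D powr (p - \<theta>)) * ennreal X"
  proof -
    have "(\<integral>\<^sup>+z\<in>?R. ennreal (besk p \<theta> \<psi> z) \<partial>?P) \<le> (\<integral>\<^sup>+z\<in>W \<times> W. ennreal (besk p \<theta> \<psi> z) \<partial>?P)"
    proof (rule nn_integral_mono)
      fix z show "ennreal (besk p \<theta> \<psi> z) * indicator ?R z \<le> ennreal (besk p \<theta> \<psi> z) * indicator (W \<times> W) z"
        using W by (intro mult_left_mono) (auto simp: indicator_def)
    qed
    from order_trans[OF this X(2)] show ?thesis by (rule mult_left_mono) simp
  qed
  also have "\<dots> = ennreal (D powr (p - \<theta>) * X)" by (simp add: ennreal_mult')
  finally have Y: "(\<integral>\<^sup>+z\<in>?R. ennreal (?G z powr p) \<partial>?P) \<le> ennreal (D powr (p - \<theta>) * X)" .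
  have "(\<integral>\<^sup>+z\<in>?R. ennreal (?G z) \<partial>?P) \<le> ennreal (2 * (D powr (p - \<theta>) * X) powr (1/p) * ?A powr (1 - 1/p))"
    by (rule nn_integral_le_power_mean[OF _ _ A p _ _ Y]) (use X in auto)
  from order_trans[OF slope_diff_le[OF ab] this]
  have "\<bar>slope \<psi> a b - slope \<psi> a' b'\<bar> * ?A \<le> 2 * (D powr (p - \<theta>) * X) powr (1/p) * ?A powr (1 - 1/p)"
    by (subst (asm) ennreal_le_iff) auto
  then have "\<bar>slope \<psi> a b - slope \<psi> a' b'\<bar> \<le> 2 * (D powr (p - \<theta>) * X) powr (1/p) * (?A powr (1 - 1/p) / ?A)"
    using A(2) by (simp add: pos_le_divide_eq)
  also have "?A powr (1 - 1/p) / ?A = ?A powr (-1/p)"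
    using A(2) by (simp add: powr_diff powr_minus_divide)
  also have "(D powr (p - \<theta>) * X) powr (1/p) = X powr (1/p) * D powr (1 - \<theta>/p)"
  proof -
    have "(D powr (p - \<theta>)) powr (1/p) = D powr (1 - \<theta>/p)"
      unfolding powr_powr using p by (simp add: diff_divide_distrib)
    then show ?thesis using X by (simp add: powr_mult mult.commute)
  qed
  finally show ?thesis by (simp add: mult_ac)
qed

text \<open>The slopes over the halved intervals converge to the derivative, and consecutive ones
  differ by a multiple of s^((p-2-\<theta>)/p), the exponent being 1 - \<theta>/p - 2/p > 0. So the
  differences sum geometrically: the one-dimensional counterpart of
  \<open>abs_diff_savg_le\<close>.\<close>

lemma deriv_slope_le:
  assumes p: "p > 2" and th: "0 \<le> \<theta>" "\<theta> < p - 2" and r: "r > 0" and W: "{v..v + r} \<subseteq> W"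
    and X: "X \<ge> 0" "(\<integral>\<^sup>+z\<in>W \<times> W. ennreal (besk p \<theta> \<psi> z) \<partial>(lborel \<Otimes>\<^sub>M lborel)) \<le> ennreal X"
  shows "\<bar>deriv \<psi> v - slope \<psi> v (v + r)\<bar>
    \<le> 4 / (1 - (1/2) powr ((p - 2 - \<theta>) / p)) * r powr ((p - 2 - \<theta>) / p) * X powr (1/p)"
proof -
  define e where "e = (p - 2 - \<theta>) / p"
  have e: "e > 0" using p th by (simp add: e_def)
  define q where "q = (1/2::real) powr e"
  have q: "0 \<le> q" "q < 1" using e powr_less_mono2[of e "1/2" 1] by (auto simp: q_def)
  define s where "s l = r * (1/2) ^ l" for l :: nat
  have s: "s l > 0" "s l \<le> r" "s (Suc l) = s l / 2" for l
    using r by (auto simp: s_def mult_left_le power_le_one)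
  define a where "a l = slope \<psi> v (v + s l)" for l
  have lim: "a \<longlonglongrightarrow> deriv \<psi> v"
  proof -
    have "((\<lambda>t. (\<psi> (v + t) - \<psi> v) / t) \<longlongrightarrow> deriv \<psi> v) (at 0)" using DERIV by (simp add: DERIV_def)
    moreover have "filterlim s (at 0) sequentially"
    proof -
      have "(\<lambda>l. r * (1/2) ^ l) \<longlonglongrightarrow> r * 0" by (intro tendsto_intros LIMSEQ_power_zero) auto
      moreover have "s = (\<lambda>l. r * (1/2) ^ l)" by (rule ext) (simp add: s_def)
      ultimately show ?thesis using s(1) r by (simp add: filterlim_at)
    qed
    ultimately have "(\<lambda>l. (\<psi> (v + s l) - \<psi> v) / s l) \<longlonglongrightarrow> deriv \<psi> v" by (rule filterlim_compose)
    then show ?thesis by (simp add: a_def[abs_def] slope_def)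
  qed
  define K where "K = 4 * X powr (1/p) * r powr e"
  have K: "K \<ge> 0" by (simp add: K_def)
  have step: "\<bar>a l - a (Suc l)\<bar> \<le> K * q ^ l" for l
  proof -
    have "\<bar>a l - a (Suc l)\<bar> \<le> 2 * X powr (1/p) * s l powr (1 - \<theta>/p) * ((v + s l - v) * (v + s (Suc l) - v)) powr (-1/p)"
      unfolding a_def
    proof (rule slope_diff_besk[OF _ _ _ _ _ _ s(1) _ X])
      show "{v..v + s l} \<subseteq> W" "{v..v + s (Suc l)} \<subseteq> W" using W s(2)[of l] s(2)[of "Suc l"] by force+
    qed (use p th s(1)[of l] s(1)[of "Suc l"] s(3)[of l] in auto)
    also have "((v + s l - v) * (v + s (Suc l) - v)) powr (-1/p) = s l powr (-2/p) * (1/2) powr (-1/p)"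
    proof -
      have "(v + s l - v) * (v + s (Suc l) - v) = s l powr 2 * (1/2)"
        using s(1)[of l] by (simp add: s(3) power2_eq_square powr_numeral)
      then show ?thesis by (simp only: powr_mult) (simp add: powr_powr)
    qed
    also have "2 * X powr (1/p) * s l powr (1 - \<theta>/p) * (s l powr (-2/p) * (1/2) powr (-1/p))
       = 2 * X powr (1/p) * (1/2) powr (-1/p) * s l powr e"
    proof -
      have "(1 - \<theta>/p) + (-2/p) = e" using p by (simp add: e_def field_simps)
      then have "s l powr (1 - \<theta>/p) * s l powr (-2/p) = s l powr e" by (simp only: powr_add[symmetric])
      then show ?thesis by (simp add: mult_ac)
    qed
    also have "\<dots> \<le> 2 * X powr (1/p) * 2 * s l powr e"
    proof (intro mult_right_mono mult_left_mono)
      have "(1/2::real) powr (-1/p) = 2 powr (1/p)" by (simp add: powr_divide powr_minus_divide)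
      also have "\<dots> \<le> 2 powr 1" using p by (intro powr_mono) auto
      finally show "(1/2::real) powr (-1/p) \<le> 2" by simp
    qed auto
    also have "s l powr e = r powr e * q ^ l"
    proof -
      have "s l = r * (1/2) powr real l" by (simp add: s_def powr_realpow)
      then show ?thesis using r by (simp add: powr_mult powr_powr q_def powr_realpow[symmetric] mult.commute)
    qed
    finally show ?thesis by (simp add: K_def mult_ac)
  qed
  from limit_dist_le_geometric[OF lim q K step]
  show ?thesis by (simp add: K_def q_def e_def a_def s_def mult_ac)
qed

text \<open>Both derivatives are replaced by slopes over intervals of length r to the right of their
  points, which lie in [v, v + 2r].\<close>

lemma deriv_diff_le:
  assumes p: "p > 2" and th: "0 \<le> \<theta>" "\<theta> < p - 2" and r: "r > 0" and v: "v \<le> v'" "v' \<le> v + r"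
    and X: "X \<ge> 0" "(\<integral>\<^sup>+z\<in>{v..v + 2 * r} \<times> {v..v + 2 * r}. ennreal (besk p \<theta> \<psi> z) \<partial>(lborel \<Otimes>\<^sub>M lborel)) \<le> ennreal X"
  shows "\<bar>deriv \<psi> v - deriv \<psi> v'\<bar>
    \<le> (8 / (1 - (1/2) powr ((p - 2 - \<theta>) / p)) + 4) * r powr ((p - 2 - \<theta>) / p) * X powr (1/p)"
proof -
  let ?W = "{v..v + 2 * r}"
  let ?e = "(p - 2 - \<theta>) / p"
  let ?C = "4 / (1 - (1/2) powr ?e) * r powr ?e * X powr (1/p)"
  have 1: "\<bar>deriv \<psi> v - slope \<psi> v (v + r)\<bar> \<le> ?C"
    by (rule deriv_slope_le[OF p th r _ X]) (use v r in auto)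
  have 2: "\<bar>deriv \<psi> v' - slope \<psi> v' (v' + r)\<bar> \<le> ?C"
    by (rule deriv_slope_le[OF p th r _ X]) (use v r in auto)
  have "\<bar>slope \<psi> v (v + r) - slope \<psi> v' (v' + r)\<bar>
      \<le> 2 * X powr (1/p) * (2 * r) powr (1 - \<theta>/p) * ((v + r - v) * (v' + r - v')) powr (-1/p)"
    by (rule slope_diff_besk[OF _ _ _ _ _ _ _ _ X]) (use p th r v in auto)
  also have "((v + r - v) * (v' + r - v')) powr (-1/p) = r powr (-2/p)"
  proof -
    have "(v + r - v) * (v' + r - v') = r powr 2" using r by (simp add: power2_eq_square powr_numeral)
    then show ?thesis by (simp add: powr_powr)
  qed
  also have "2 * X powr (1/p) * (2 * r) powr (1 - \<theta>/p) * r powr (-2/p) = 2 * X powr (1/p) * 2 powr (1 - \<theta>/p) * r powr ?e"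
  proof -
    have "(1 - \<theta>/p) + (-2/p) = ?e" using p by (simp add: field_simps)
    then have "r powr (1 - \<theta>/p) * r powr (-2/p) = r powr ?e" by (simp only: powr_add[symmetric])
    moreover have "(2 * r) powr (1 - \<theta>/p) = 2 powr (1 - \<theta>/p) * r powr (1 - \<theta>/p)" using r by (intro powr_mult)
    ultimately show ?thesis by (simp add: mult_ac)
  qed
  also have "\<dots> \<le> 2 * X powr (1/p) * 2 powr 1 * r powr ?e"
    using p th by (intro mult_right_mono mult_left_mono powr_mono) auto
  finally have 3: "\<bar>slope \<psi> v (v + r) - slope \<psi> v' (v' + r)\<bar> \<le> 4 * X powr (1/p) * r powr ?e" by simp
  have "\<bar>deriv \<psi> v - deriv \<psi> v'\<bar> \<le> ?C + 4 * X powr (1/p) * r powr ?e + ?C" using 1 2 3 by linarith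
  also have "\<dots> = (8 / (1 - (1/2) powr ?e) + 4) * r powr ?e * X powr (1/p)" by (simp add: algebra_simps)
  finally show ?thesis .
qed

end

section \<open>Normal form of a set with small Besov norm\<close>

lemma nn_integral_cauchy_kernel_finite: "(\<integral>\<^sup>+t. ennreal (1 / (1 + t\<^sup>2)) \<partial>lborel) < \<infinity>"
proof -
  let ?f = "\<lambda>t::real. ennreal (1 / (1 + t\<^sup>2))"
  have h: "(\<integral>\<^sup>+t. ?f t * indicator {0..} t \<partial>lborel) = ennreal (pi / 2 - arctan 0)"
    by (rule nn_integral_FTC_atLeast)
       (auto intro!: derivative_eq_intros tendsto_arctan_at_top simp: add_nonneg_nonneg inverse_eq_divide)
  have "(\<integral>\<^sup>+t. ?f t \<partial>lborel) \<le> (\<integral>\<^sup>+t. ?f t * indicator {0..} t + ?f t * indicator {..0} t \<partial>lborel)"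
    by (rule nn_integral_mono) (auto simp: indicator_def)
  also have "\<dots> = (\<integral>\<^sup>+t. ?f t * indicator {0..} t \<partial>lborel) + (\<integral>\<^sup>+t. ?f t * indicator {..0} t \<partial>lborel)"
    by (rule nn_integral_add) measurable
  also have "(\<integral>\<^sup>+t. ?f t * indicator {..0} t \<partial>lborel) = (\<integral>\<^sup>+t. ?f t * indicator {0..} t \<partial>lborel)"
    by (subst nn_integral_real_affine[of _ "-1" 0]) (auto simp: indicator_def intro!: nn_integral_cong)
  finally have "(\<integral>\<^sup>+t. ?f t \<partial>lborel) \<le> ennreal pi"
    unfolding h by (simp add: ennreal_plus[symmetric] del: ennreal_plus)
  then show ?thesis by (rule order.strict_trans1) (simp add: less_top)
qed

text \<open>Near the diagonal the Lipschitz bound, away from it boundedness and p \<ge> 2 give an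
  integrand of size C / (1 + |x - y|^2). It vanishes unless one of the variables lies in [-M, M],
  and integrating the kernel in the other variable leaves the length of that interval.\<close>

lemma besov_int_finite:
  assumes p: "p \<ge> 2" and diff: "\<And>t. \<phi> differentiable (at t)"
    and B: "\<And>t. \<bar>deriv \<phi> t\<bar> \<le> B" and L: "\<And>s t. \<bar>deriv \<phi> s - deriv \<phi> t\<bar> \<le> L * \<bar>s - t\<bar>"
    and M: "\<And>t. \<bar>t\<bar> > M \<Longrightarrow> deriv \<phi> t = 0"
  shows "besov_int p \<phi> < \<infinity>"
proof -
  interpret differentiable_fun \<phi> by unfold_locales (rule diff)
  let ?u = "deriv \<phi>"
  let ?k = "\<lambda>t::real. ennreal (1 / (1 + t\<^sup>2))"
  define C where "C = 2 * (max (max L (2 * B)) 0) powr p"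
  have C: "C \<ge> 0" by (simp add: C_def)
  let ?I = "\<lambda>x. indicator {-M..M} x :: ennreal"
  have pt: "ennreal (\<bar>?u x - ?u y\<bar> powr p / \<bar>x - y\<bar> powr p) \<le> ennreal C * (?I x * ?k (y - x)) + ennreal C * (?I y * ?k (x - y))" for x y
  proof (cases "x \<in> {-M..M} \<or> y \<in> {-M..M}")
    case True
    let ?d = "\<bar>x - y\<bar>"
    have "\<bar>?u x - ?u y\<bar> powr p / ?d powr p \<le> C * (1 / (1 + ?d\<^sup>2))"
    proof (cases "?d = 0")
      case nz: False
      define D where "D = max (max L (2 * B)) 0"
      have D: "D \<ge> 0" "L \<le> D" "2 * B \<le> D" by (auto simp: D_def)
      have du: "\<bar>?u x - ?u y\<bar> \<le> D * ?d" "\<bar>?u x - ?u y\<bar> \<le> D"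
      proof -
        have "L * ?d \<le> D * ?d" using D by (intro mult_right_mono) auto
        then show "\<bar>?u x - ?u y\<bar> \<le> D * ?d" using L[of x y] by linarith
        show "\<bar>?u x - ?u y\<bar> \<le> D" using B[of x] B[of y] D by linarith
      qed
      show ?thesis
      proof (cases "?d \<le> 1")
        case True
        have "\<bar>?u x - ?u y\<bar> powr p \<le> (D * ?d) powr p" using du p by (intro powr_mono2) auto
        also have "\<dots> = D powr p * ?d powr p" using D by (simp add: powr_mult)
        finally have "\<bar>?u x - ?u y\<bar> powr p / ?d powr p \<le> D powr p"
          using nz by (subst pos_divide_le_eq) auto
        also have "\<dots> \<le> D powr p * (2 / (1 + ?d\<^sup>2))"
        proof -
          have "?d\<^sup>2 \<le> 1" using True by (simp add: abs_square_le_1)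
          then have "1 \<le> 2 / (1 + ?d\<^sup>2)" by (subst le_divide_eq) (auto simp: add_pos_nonneg)
          then have "D powr p * 1 \<le> D powr p * (2 / (1 + ?d\<^sup>2))" by (intro mult_left_mono) auto
          then show ?thesis by simp
        qed
        finally show ?thesis by (simp add: C_def D_def mult_ac)
      next
        case False
        have "\<bar>?u x - ?u y\<bar> powr p / ?d powr p \<le> D powr p / ?d powr 2"
          using du p False by (intro frac_le powr_mono2 powr_mono) auto
        also have "\<dots> = D powr p * (1 / ?d\<^sup>2)" using nz by (simp add: powr_numeral)
        also have "\<dots> \<le> D powr p * (2 / (1 + ?d\<^sup>2))"
        proof (intro mult_left_mono)
          have "1 \<le> ?d\<^sup>2" using False power_mono[of 1 ?d 2] by simp
          then show "1 / ?d\<^sup>2 \<le> 2 / (1 + ?d\<^sup>2)" by (subst frac_le_eq) (auto simp: divide_le_0_iff add_pos_nonneg)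
        qed simp
        finally show ?thesis by (simp add: C_def D_def mult_ac)
      qed
    qed (use C in simp)
    then have "ennreal (\<bar>?u x - ?u y\<bar> powr p / ?d powr p) \<le> ennreal C * ?k (x - y)"
      using C by (simp add: ennreal_mult'[symmetric] ennreal_leI)
    moreover have "?k (y - x) = ?k (x - y)" by (simp add: power2_commute)
    ultimately show ?thesis using True by (auto simp: add_increasing add_increasing2)
  next
    case False
    then have "?u x = 0" "?u y = 0" using M[of x] M[of y] by auto
    then show ?thesis by simp
  qed
  define K where "K = (\<integral>\<^sup>+t. ?k t \<partial>lborel)"
  have K: "K < \<infinity>" unfolding K_def by (rule nn_integral_cauchy_kernel_finite)
  have tr: "(\<integral>\<^sup>+y. ?k (y - x) \<partial>lborel) = K" for x
    unfolding K_def by (subst nn_integral_real_affine[of ?k 1 "-x"]) auto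
  have 1: "(\<integral>\<^sup>+x. \<integral>\<^sup>+y. ennreal C * (?I x * ?k (y - x)) \<partial>lborel \<partial>lborel) = ennreal C * (K * emeasure lborel {-M..M})"
  proof -
    have "(\<integral>\<^sup>+y. ennreal C * (?I x * ?k (y - x)) \<partial>lborel) = ennreal C * K * ?I x" for x
      by (subst nn_integral_cmult, measurable)+ (simp add: tr mult_ac)
    then have "(\<integral>\<^sup>+x. \<integral>\<^sup>+y. ennreal C * (?I x * ?k (y - x)) \<partial>lborel \<partial>lborel) = ennreal C * K * emeasure lborel {-M..M}"
      by (simp only:) (rule nn_integral_cmult_indicator, simp)
    then show ?thesis by (simp only: mult.assoc)
  qed
  have 2: "(\<integral>\<^sup>+x. \<integral>\<^sup>+y. ennreal C * (?I y * ?k (x - y)) \<partial>lborel \<partial>lborel) = ennreal C * (K * emeasure lborel {-M..M})"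
    by (subst lborel_pair.Fubini'[symmetric]) (use 1 in simp_all)
  have "besov_int p \<phi> \<le> (\<integral>\<^sup>+x. \<integral>\<^sup>+y. ennreal C * (?I x * ?k (y - x)) + ennreal C * (?I y * ?k (x - y)) \<partial>lborel \<partial>lborel)"
    unfolding besov_int_def by (intro nn_integral_mono pt)
  also have "\<dots> = (\<integral>\<^sup>+x. (\<integral>\<^sup>+y. ennreal C * (?I x * ?k (y - x)) \<partial>lborel) + (\<integral>\<^sup>+y. ennreal C * (?I y * ?k (x - y)) \<partial>lborel) \<partial>lborel)"
    by (intro nn_integral_cong nn_integral_add) measurable
  also have "\<dots> = ennreal C * (K * emeasure lborel {-M..M}) + ennreal C * (K * emeasure lborel {-M..M})"
    by (subst nn_integral_add) (measurable, simp add: 1 2)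
  also have "\<dots> < \<infinity>" using K by (cases "-M \<le> M") (auto simp: ennreal_mult_less_top)
  finally show ?thesis .
qed

text \<open>The direction (1, k) is orthogonal to a difference of two distinct points for finitely
  many k only; any other k separates the points.\<close>

lemma ex_injective_direction:
  fixes E :: "(real^2) set"
  assumes "finite E"
  shows "\<exists>a b :: real^2. norm a = 1 \<and> norm b = 1 \<and> a \<bullet> b = 0 \<and> inj_on (\<lambda>e. a \<bullet> e) E"
proof -
  let ?bad = "(\<lambda>(e, e'). - (e$1 - e'$1) / (e$2 - e'$2)) ` (E \<times> E)"
  have "finite ?bad" using assms by simp
  then obtain k :: real where k: "k \<notin> ?bad" using ex_new_if_finite[OF infinite_UNIV_char_0] by blast
  define N where "N = sqrt (1 + k\<^sup>2)"
  have N: "N > 0" "N * N = 1 + k\<^sup>2" by (auto simp: N_def add_pos_nonneg real_sqrt_mult_self)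
  define a b :: "real^2" where "a = vec2 (1 / N, k / N)" and "b = vec2 (- k / N, 1 / N)"
  have ip: "x \<bullet> y = x$1 * y$1 + x$2 * y$2" for x y :: "real^2" by (simp add: inner_vec_def sum_2)
  have "a \<bullet> a = 1" "b \<bullet> b = 1" "a \<bullet> b = 0"
    using N by (auto simp: a_def b_def ip power2_eq_square add_divide_distrib[symmetric])
  moreover have "inj_on (\<lambda>e. a \<bullet> e) E"
  proof (rule inj_onI)
    fix e e' assume E: "e \<in> E" "e' \<in> E" "a \<bullet> e = a \<bullet> e'"
    then have eq: "(e$1 - e'$1) + k * (e$2 - e'$2) = 0"
      using N by (simp add: a_def ip field_simps)
    have "e$2 = e'$2"
    proof (rule ccontr)
      assume "e$2 \<noteq> e'$2"
      then have "k = - (e$1 - e'$1) / (e$2 - e'$2)" using eq by (simp add: field_simps)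
      then have "k \<in> ?bad" using E by (intro image_eqI[of _ _ "(e, e')"]) auto
      then show False using k by blast
    qed
    then show "e = e'" using eq by (simp add: vec_eq_iff forall_2)
  qed
  ultimately show ?thesis by (auto simp: norm_eq_sqrt_inner)
qed

lemma inner_vec2_decomp:
  fixes a b :: "real^2"
  assumes "norm a = 1" "norm b = 1" "a \<bullet> b = 0"
  shows "x \<bullet> y = (a \<bullet> x) * (a \<bullet> y) + (b \<bullet> x) * (b \<bullet> y)"
proof -
  have ip: "x \<bullet> y = x$1 * y$1 + x$2 * y$2" for x y :: "real^2" by (simp add: inner_vec_def sum_2)
  have 1: "a$1 * a$1 + a$2 * a$2 = 1" "b$1 * b$1 + b$2 * b$2 = 1" "a$1 * b$1 + a$2 * b$2 = 0"
    using assms by (auto simp: norm_eq_1 ip)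
  \<comment> \<open>A square matrix with orthonormal rows has orthonormal columns.\<close>
  have "a$1 * a$1 + b$1 * b$1 = 1 \<and> a$2 * a$2 + b$2 * b$2 = 1 \<and> a$1 * a$2 + b$1 * b$2 = 0"
    using 1 by algebra
  then show ?thesis unfolding ip by algebra
qed

text \<open>\<open>besov_set_norm\<close> is an \<open>Inf\<close> of reals, and the infimum of an
  empty set would carry no information; this makes the set of admissible pairs nonempty for finite
  \<open>E\<close>. In a direction that separates the points, bumps that each vanish at all other
  points interpolate the remaining coordinate.\<close>

lemma ex_isometry_graph:
  fixes E :: "(real^2) set"
  assumes E: "finite E" and p: "p \<ge> 2"
  shows "\<exists>R \<phi>. (\<forall>x y. dist ((R::real^2\<Rightarrow>real^2) x) (R y) = dist x y) \<and> surj R \<and>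
      (\<forall>t. \<phi> differentiable (at t)) \<and> besov_int p \<phi> < \<infinity> \<and> (\<forall>x\<in>E. (R x)$2 = \<phi> ((R x)$1))"
proof -
  obtain a b :: "real^2" where ab: "norm a = 1" "norm b = 1" "a \<bullet> b = 0" and inj: "inj_on (\<lambda>e. a \<bullet> e) E"
    using ex_injective_direction[OF E] by blast
  define R where "R x = vec2 (a \<bullet> x, b \<bullet> x)" for x
  have nR: "norm (vec2 (a \<bullet> x, b \<bullet> x)) = norm x" for x
    by (simp add: norm_eq_sqrt_inner inner_vec_def[of "vec2 _"] sum_2 inner_vec2_decomp[OF ab, of x x, symmetric])
  have iso: "dist (R x) (R y) = dist x y" for x y
  proof -
    have "R x - R y = vec2 (a \<bullet> (x - y), b \<bullet> (x - y))" by (simp add: R_def vec_eq_iff forall_2 inner_diff_right)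
    then show ?thesis by (simp add: dist_norm nR)
  qed
  have surj: "surj R"
  proof (rule surjI)
    fix y show "R (y$1 *\<^sub>R a + y$2 *\<^sub>R b) = y"
      using ab by (simp add: R_def vec_eq_iff forall_2 inner_add_right norm_eq_1 inner_commute[of b a])
  qed
  have "\<exists>r>0. \<forall>e\<in>E. \<forall>e'\<in>E. e \<noteq> e' \<longrightarrow> r \<le> \<bar>a \<bullet> e - a \<bullet> e'\<bar>"
  proof -
    let ?S = "(\<lambda>(e, e'). \<bar>a \<bullet> e - a \<bullet> e'\<bar>) ` (E \<times> E)"
    have "finite ?S" using E by simp
    from finite_set_avoid[OF this, of 0] obtain r where r: "r > 0" "\<forall>x\<in>?S. x \<noteq> 0 \<longrightarrow> r \<le> dist 0 x" by blast
    have "r \<le> \<bar>a \<bullet> e - a \<bullet> e'\<bar>" if "e \<in> E" "e' \<in> E" "e \<noteq> e'" for e e'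
    proof -
      have "a \<bullet> e \<noteq> a \<bullet> e'" using inj that by (auto simp: inj_on_def)
      moreover have "\<bar>a \<bullet> e - a \<bullet> e'\<bar> \<in> ?S" using that by (intro image_eqI[of _ _ "(e, e')"]) auto
      ultimately show ?thesis using r(2) by force
    qed
    then show ?thesis using r(1) by blast
  qed
  then obtain r where r: "r > 0" "\<And>e e'. e \<in> E \<Longrightarrow> e' \<in> E \<Longrightarrow> e \<noteq> e' \<Longrightarrow> r \<le> \<bar>a \<bullet> e - a \<bullet> e'\<bar>" by blast
  define \<beta> where "\<beta> t = sstep (2 * t + 1) + (-1) * sstep (2 * t + (-1))" for t
  have b0: "\<beta> 0 = 1" by (simp add: \<beta>_def sstep_left sstep_right)
  have bz: "\<beta> t = 0" if "\<bar>t\<bar> \<ge> 1" for t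
    using that by (cases "t > 0") (auto simp: \<beta>_def sstep_left sstep_right)
  have bs: "smooth \<beta>" unfolding \<beta>_def[abs_def]
    by (intro smooth_add smooth_mult smooth_const smooth_compose_affine smooth_sstep)
  define \<phi> where "\<phi> t = (\<Sum>e\<in>E. (b \<bullet> e) * \<beta> (inverse r * t + (- (a \<bullet> e) * inverse r)))" for t
  have ps: "smooth \<phi>" unfolding \<phi>_def[abs_def]
    by (intro smooth_sum smooth_mult smooth_const smooth_compose_affine bs)
  have arg: "inverse r * t + (- (a \<bullet> e) * inverse r) = (t - a \<bullet> e) / r" for t e by (simp add: divide_inverse algebra_simps)
  have val: "\<phi> (a \<bullet> e) = b \<bullet> e" if e: "e \<in> E" for e
  proof -
    have "\<phi> (a \<bullet> e) = (\<Sum>e'\<in>E. if e' = e then b \<bullet> e else 0)"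
      unfolding \<phi>_def arg
    proof (rule sum.cong)
      fix e' assume e': "e' \<in> E"
      show "(b \<bullet> e') * \<beta> ((a \<bullet> e - a \<bullet> e') / r) = (if e' = e then b \<bullet> e else 0)"
        using r(2)[OF e e'] r(1) bz[of "(a \<bullet> e - a \<bullet> e') / r"] b0 by auto
    qed simp
    then show ?thesis using E e by simp
  qed
  define M where "M = r + (\<Sum>e\<in>E. \<bar>a \<bullet> e\<bar>)"
  have M: "M > 0" using r(1) by (simp add: M_def add_pos_nonneg sum_nonneg)
  have pz: "\<phi> t = 0" if t: "\<bar>t\<bar> > M" for t
    unfolding \<phi>_def arg
  proof (rule sum.neutral, rule ballI)
    fix e assume e: "e \<in> E"
    have "\<bar>a \<bullet> e\<bar> \<le> (\<Sum>e\<in>E. \<bar>a \<bullet> e\<bar>)" using e E by (intro member_le_sum) auto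
    then have "\<bar>t - a \<bullet> e\<bar> \<ge> r" using t by (simp add: M_def)
    then show "(b \<bullet> e) * \<beta> ((t - a \<bullet> e) / r) = 0" using r(1) bz[of "(t - a \<bullet> e) / r"] by simp
  qed
  have der: "(\<phi> has_real_derivative deriv \<phi> t) (at t)" "(deriv \<phi> has_real_derivative deriv (deriv \<phi>) t) (at t)" for t
    using ps smooth_deriv smooth_has_derivative by blast+
  have o: "open {t::real. M < \<bar>t\<bar>}" by (intro open_Collect_less continuous_intros)
  have dz: "deriv \<phi> t = 0" if t: "\<bar>t\<bar> > M" for t
    using DERIV_unique[OF der(1) DERIV_locally_const[OF o, of t \<phi> 0]] t pz by simp
  have ddz: "deriv (deriv \<phi>) t = 0" if t: "\<bar>t\<bar> > M" for t
    using DERIV_unique[OF der(2) DERIV_locally_const[OF o, of t "deriv \<phi>" 0]] t dz by simp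
  have bd: "\<exists>B. \<forall>t. \<bar>k t\<bar> \<le> B" if k: "smooth k" "\<And>t. \<bar>t\<bar> > M \<Longrightarrow> k t = 0" for k
  proof -
    have "compact (k ` {-M..M})"
      by (intro compact_continuous_image continuous_on_subset[OF smooth_continuous[OF k(1)]]) auto
    then obtain B where B: "\<And>x. x \<in> {-M..M} \<Longrightarrow> \<bar>k x\<bar> \<le> B"
      using compact_imp_bounded bounded_iff by (metis imageI real_norm_def)
    have "\<bar>k t\<bar> \<le> max B 0" for t
      using B[of t] k(2)[of t] by (cases "\<bar>t\<bar> \<le> M") (auto simp: abs_le_iff)
    then show ?thesis by blast
  qed
  obtain B where B: "\<And>t. \<bar>deriv \<phi> t\<bar> \<le> B" using bd[OF smooth_deriv[OF ps] dz] by blast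
  obtain L where L: "\<And>t. \<bar>deriv (deriv \<phi>) t\<bar> \<le> L" using bd[OF smooth_deriv[OF smooth_deriv[OF ps]] ddz] by blast
  have lip: "\<bar>deriv \<phi> s - deriv \<phi> t\<bar> \<le> L * \<bar>s - t\<bar>" for s t
    using field_differentiable_bound[of UNIV "deriv \<phi>" "deriv (deriv \<phi>)" L s t] der(2) L
    by (auto simp: has_field_derivative_at_within)
  have "besov_int p \<phi> < \<infinity>"
    by (rule besov_int_finite[OF p _ B lip dz]) (use der(1) real_differentiable_def in blast)
  moreover have "\<phi> differentiable (at t)" for t using der(1) real_differentiable_def by blast
  moreover have "\<forall>x\<in>E. (R x)$2 = \<phi> ((R x)$1)" by (simp add: R_def val)
  ultimately show ?thesis using iso surj by blast
qed

text \<open>Substituting x -> N x in both variables produces the factor N^(2 - p), at most 1, and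
  the constant m drops out of the difference of derivatives.\<close>

lemma besov_int_rescale:
  assumes diff: "\<And>t. \<phi> differentiable (at t)" and N: "N \<ge> 1" and p: "p \<ge> 2"
    and d: "\<And>v. deriv \<psi> v = deriv \<phi> (v / N) - m"
  shows "besov_int p \<psi> \<le> besov_int p \<phi>"
proof -
  interpret differentiable_fun \<phi> by unfold_locales (rule diff)
  note measurable_deriv[measurable]
  let ?k = "\<lambda>x y. ennreal (\<bar>deriv \<phi> x - deriv \<phi> y\<bar> powr p / \<bar>x - y\<bar> powr p)"
  let ?k' = "\<lambda>x y. ennreal (\<bar>deriv \<psi> x - deriv \<psi> y\<bar> powr p / \<bar>x - y\<bar> powr p)"
  have k': "?k' (N * x) (N * y) = ennreal (N powr (-p)) * ?k x y" for x y
  proof -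
    have "\<bar>N * x - N * y\<bar> powr p = N powr p * \<bar>x - y\<bar> powr p"
      using N by (simp add: powr_mult right_diff_distrib[symmetric] abs_mult)
    then show ?thesis using N by (simp add: d ennreal_mult'[symmetric] powr_minus_divide)
  qed
  have dm[measurable]: "deriv \<psi> \<in> borel_measurable borel"
  proof -
    have "deriv \<psi> = (\<lambda>v. deriv \<phi> (v / N) - m)" by (rule ext) (rule d)
    then show ?thesis by simp
  qed
  have aff: "(\<integral>\<^sup>+x. f x \<partial>lborel) = ennreal N * (\<integral>\<^sup>+x. f (N * x) \<partial>lborel)"
    if "f \<in> borel_measurable borel" for f
    using nn_integral_real_affine[OF that, of N 0] N by simp
  have m1: "(\<lambda>y. ?k' x y) \<in> borel_measurable borel" for x by measurable
  have m2: "(\<lambda>x. \<integral>\<^sup>+y. ?k' x (N * y) \<partial>lborel) \<in> borel_measurable borel" by measurable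
  have m3: "(\<lambda>y. ?k x y) \<in> borel_measurable borel" for x by measurable
  have m4: "(\<lambda>x. \<integral>\<^sup>+y. ?k x y \<partial>lborel) \<in> borel_measurable borel" by measurable
  have "besov_int p \<psi> = (\<integral>\<^sup>+x. \<integral>\<^sup>+y. ?k' x y \<partial>lborel \<partial>lborel)" by (simp only: besov_int_def)
  also have "\<dots> = (\<integral>\<^sup>+x. ennreal N * (\<integral>\<^sup>+y. ?k' x (N * y) \<partial>lborel) \<partial>lborel)"
    by (rule nn_integral_cong) (rule aff[OF m1])
  also have "\<dots> = ennreal N * (\<integral>\<^sup>+x. (\<integral>\<^sup>+y. ?k' x (N * y) \<partial>lborel) \<partial>lborel)"
    by (rule nn_integral_cmult) (simp add: m2)
  also have "\<dots> = ennreal N * (ennreal N * (\<integral>\<^sup>+x. (\<integral>\<^sup>+y. ?k' (N * x) (N * y) \<partial>lborel) \<partial>lborel))"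
    by (subst aff[OF m2]) (rule refl)
  also have "\<dots> = ennreal N * (ennreal N * (\<integral>\<^sup>+x. ennreal (N powr (-p)) * (\<integral>\<^sup>+y. ?k x y \<partial>lborel) \<partial>lborel))"
  proof -
    have "(\<integral>\<^sup>+y. ?k' (N * x) (N * y) \<partial>lborel) = ennreal (N powr (-p)) * (\<integral>\<^sup>+y. ?k x y \<partial>lborel)" for x
      unfolding k' by (rule nn_integral_cmult) (simp add: m3)
    then show ?thesis by (simp only:)
  qed
  also have "\<dots> = ennreal N * (ennreal N * (ennreal (N powr (-p)) * (\<integral>\<^sup>+x. \<integral>\<^sup>+y. ?k x y \<partial>lborel \<partial>lborel)))"
    by (subst nn_integral_cmult) (simp_all add: m4)
  also have "\<dots> = ennreal (N * N * N powr (-p)) * besov_int p \<phi>"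
    using N by (simp add: besov_int_def ennreal_mult mult.assoc)
  also have "\<dots> \<le> 1 * besov_int p \<phi>"
  proof (rule mult_right_mono)
    have "N * N * N powr (-p) = N powr (2 - p)"
      using N by (simp add: powr_diff powr_minus_divide powr_numeral power2_eq_square)
    also have "\<dots> \<le> N powr 0" using N p by (intro powr_mono) auto
    finally show "ennreal (N * N * N powr (-p)) \<le> 1" using N by simp
  qed simp
  finally show ?thesis by simp
qed

text \<open>The constant of \<open>deriv_diff_le\<close>. Its value at \<theta> = 0 determines how
  small the Besov norm has to be.\<close>

definition CE :: "real \<Rightarrow> real \<Rightarrow> real" where
  "CE p \<theta> = 8 / (1 - (1/2) powr ((p - 2 - \<theta>) / p)) + 4"

lemma CE_pos: "p > 2 \<Longrightarrow> \<theta> < p - 2 \<Longrightarrow> CE p \<theta> > 0"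
  unfolding CE_def using powr_less_mono2[of "(p - 2 - \<theta>) / p" "1/2" 1]
  by (intro add_nonneg_pos divide_nonneg_pos) auto

text \<open>In coordinates \<open>u, n\<close> adapted to the tangent at one point, the graph is parametrised by
  \<open>v \<mapsto> (v + \<alpha> \<psi> v, \<beta> \<psi> v)\<close> with \<open>\<psi>'\<close> small.\<close>

lemma curve_normal_form:
  fixes E :: "(real^2) set"
  assumes p: "p > 2" and dl: "\<delta> > 0" and E: "finite E" "E \<noteq> {}" and c4: "c4 > 0"
    and diam: "\<And>x y. x \<in> E \<Longrightarrow> y \<in> E \<Longrightarrow> dist x y \<le> 2 * \<delta>"
    and bes: "besov_set_norm p E \<le> c4 * \<delta> powr (2/p - 1)"
  shows "\<exists>u n \<psi> \<alpha> \<beta> v1 v2 k1 k2. norm u = 1 \<and> norm n = 1 \<and> u \<bullet> n = 0 \<and> (\<forall>t. \<psi> differentiable (at t)) \<and>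
    \<bar>\<alpha>\<bar> \<le> 1 \<and> \<bar>\<beta>\<bar> \<le> 1 \<and> v1 \<le> v2 \<and>
    (\<forall>e\<in>E. \<exists>v\<in>{v1..v2}. u \<bullet> e = k1 + v + \<alpha> * \<psi> v \<and> n \<bullet> e = k2 + \<beta> * \<psi> v) \<and>
    (\<forall>v\<in>{v1..v2}. \<bar>deriv \<psi> v\<bar> \<le> 4 * CE p 0 * c4) \<and>
    besov_int p \<psi> \<le> ennreal ((2 * c4) powr p * \<delta> powr (2 - p))"
proof -
  let ?S = "{(enn2real (besov_int p \<phi>)) powr (1/p) | R \<phi>.
      (\<forall>x y. dist ((R::real^2\<Rightarrow>real^2) x) (R y) = dist x y) \<and> surj R \<and>
      (\<forall>t. \<phi> differentiable (at t)) \<and> besov_int p \<phi> < \<infinity> \<and> (\<forall>x\<in>E. (R x)$2 = \<phi> ((R x)$1))}"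
  have "?S \<noteq> {}" using ex_isometry_graph[OF E(1), of p] p by auto
  \<comment> \<open>The factor 2 leaves room for an admissible pair, as the infimum need not be
    attained.\<close>
  moreover have "Inf ?S < 2 * c4 * \<delta> powr (2/p - 1)"
  proof -
    have "c4 * \<delta> powr (2/p - 1) > 0" using c4 dl by simp
    then show ?thesis using bes unfolding besov_set_norm_def by linarith
  qed
  ultimately have "\<exists>s\<in>?S. s < 2 * c4 * \<delta> powr (2/p - 1)" by (rule cInf_lessD)
  then obtain R \<phi> where R: "\<And>x y. dist ((R::real^2\<Rightarrow>real^2) x) (R y) = dist x y" "surj R"
    and diff: "\<And>t. \<phi> differentiable (at t)" and fin: "besov_int p \<phi> < \<infinity>"
    and gr: "\<And>x. x \<in> E \<Longrightarrow> (R x)$2 = \<phi> ((R x)$1)"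
    and sm: "(enn2real (besov_int p \<phi>)) powr (1/p) < 2 * c4 * \<delta> powr (2/p - 1)" by blast
  define X where "X = (2 * c4) powr p * \<delta> powr (2 - p)"
  have X0: "X \<ge> 0" by (simp add: X_def)
  have Xr: "X powr (1/p) = 2 * c4 * \<delta> powr (2/p - 1)"
  proof -
    have "X powr (1/p) = (2 * c4) powr (p * (1/p)) * \<delta> powr ((2 - p) * (1/p))"
      unfolding X_def by (subst powr_mult) (simp_all only: powr_powr powr_ge_zero)
    also have "(2 - p) * (1/p) = 2/p - 1" using p by (simp add: field_simps)
    finally show ?thesis using p c4 by simp
  qed
  have bX: "besov_int p \<phi> \<le> ennreal X"
  proof -
    have "enn2real (besov_int p \<phi>) \<le> X"
    proof (rule ccontr)
      assume "\<not> ?thesis"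
      then have "X powr (1/p) \<le> (enn2real (besov_int p \<phi>)) powr (1/p)"
        using p X0 by (intro powr_mono2) auto
      then show False using sm Xr by simp
    qed
    then show ?thesis using fin by (metis X0 ennreal_enn2real ennreal_leI infinity_ennreal_def)
  qed
  interpret \<phi>: differentiable_fun \<phi> by unfold_locales (rule diff)
  define O' where "O' x = R x - R 0" for x
  have "orthogonal_transformation O'"
    unfolding orthogonal_transformation_isometry using R(1) by (simp add: O'_def dist_norm)
  then have O': "O' x \<bullet> O' y = x \<bullet> y" for x y by (simp add: orthogonal_transformation_def)
  have "surj O'"
  proof (rule surjI)
    fix y show "O' (inv R (y + R 0)) = y" by (simp add: O'_def surj_f_inv_f[OF R(2)])
  qed
  then obtain a b where ab': "O' a = axis 1 1" "O' b = axis 2 1" by (metis surjD)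
  have ab: "norm a = 1" "norm b = 1" "a \<bullet> b = 0"
    using O'[of a a] O'[of b b] O'[of a b] ab' by (simp_all add: norm_eq_1 inner_axis_axis)
  have R1: "(R x)$1 = (R 0)$1 + a \<bullet> x" and R2: "(R x)$2 = (R 0)$2 + b \<bullet> x" for x
    using O'[of a x] O'[of b x] ab' by (simp_all add: inner_axis' O'_def)
  let ?t = "\<lambda>e. (R e)$1"
  define t1 t2 where "t1 = Min (?t ` E)" and "t2 = Max (?t ` E)"
  have t12: "t1 \<le> ?t e" "?t e \<le> t2" if "e \<in> E" for e using that E by (auto simp: t1_def t2_def)
  have t1E: "t1 \<in> ?t ` E" "t2 \<in> ?t ` E" unfolding t1_def t2_def using E by (auto intro!: Min_in Max_in)
  have td: "t2 \<le> t1 + 2 * \<delta>"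
  proof -
    obtain e e' where e: "e \<in> E" "t1 = ?t e" "e' \<in> E" "t2 = ?t e'" using t1E by auto
    have "\<bar>?t e' - ?t e\<bar> \<le> dist (R e') (R e)" using component_le_norm_cart[of "R e' - R e" 1] by (simp add: dist_norm)
    also have "\<dots> \<le> 2 * \<delta>" using R(1) diam[OF e(3,1)] by simp
    finally show ?thesis using e by simp
  qed
  have t12': "t1 \<le> t2" using E t12 by fastforce
  \<comment> \<open>The slope at the leftmost parameter is the reference:
    \<open>deriv_diff_le\<close> compares it with points to its right, on an interval of length 4
    \<delta>.\<close>
  define m where "m = deriv \<phi> t1"
  have sl: "\<bar>deriv \<phi> t - m\<bar> \<le> 4 * CE p 0 * c4" if t: "t \<in> {t1..t2}" for t
  proof -
    let ?e = "(p - 2 - 0) / p"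
    have "(\<integral>\<^sup>+z\<in>{t1..t1 + 2 * (2 * \<delta>)} \<times> {t1..t1 + 2 * (2 * \<delta>)}. ennreal (besk p 0 \<phi> z) \<partial>(lborel \<Otimes>\<^sub>M lborel)) \<le> besov_int p \<phi>"
      unfolding \<phi>.besov_int_eq
      by (intro nn_integral_mono) (auto simp: indicator_def besk_def intro!: ennreal_leI)
    then have "\<bar>m - deriv \<phi> t\<bar> \<le> CE p 0 * (2 * \<delta>) powr ?e * X powr (1/p)"
      unfolding m_def CE_def
      by (intro \<phi>.deriv_diff_le[OF p]) (use p dl t td X0 bX in \<open>auto intro: order_trans\<close>)
    also have "\<dots> \<le> CE p 0 * (2 * \<delta> powr ?e) * X powr (1/p)"
    proof -
      have "(2 * \<delta>) powr ?e = 2 powr ?e * \<delta> powr ?e" using dl by (simp add: powr_mult)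
      also have "\<dots> \<le> 2 powr 1 * \<delta> powr ?e" using p by (intro mult_right_mono powr_mono) auto
      finally show ?thesis using CE_pos[OF p, of 0] p by (intro mult_right_mono mult_left_mono) auto
    qed
    also have "\<dots> = 4 * CE p 0 * c4 * (\<delta> powr ?e * \<delta> powr (2/p - 1))" unfolding Xr by simp
    also have "\<delta> powr ?e * \<delta> powr (2/p - 1) = 1"
    proof -
      have "?e + (2/p - 1) = 0" using p by (simp add: field_simps)
      then show ?thesis using dl by (simp only: powr_add[symmetric]) simp
    qed
    finally show ?thesis by (simp add: abs_minus_commute)
  qed
  define N where "N = sqrt (1 + m\<^sup>2)"
  have NN: "N * N = 1 + m\<^sup>2" by (simp add: N_def add_nonneg_nonneg)
  have N1: "N \<ge> 1" by (simp add: N_def)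
  have N0: "N > 0" using N1 by linarith
  define u n where "u = (1/N) *\<^sub>R (a + m *\<^sub>R b)" and "n = (1/N) *\<^sub>R (b - m *\<^sub>R a)"
  \<comment> \<open>With v = N t the point (t, \<phi> t) has rotated coordinates v + \<alpha> \<psi>
    v and \<beta> \<psi> v, up to translation. Keeping v as the parameter avoids inverting v +
    \<alpha> \<psi> v, and the derivative of \<psi> is that of \<phi> minus m, hence small.\<close>
  define \<psi> where "\<psi> v = N * \<phi> (v / N) - m * v" for v
  define \<alpha> \<beta> where "\<alpha> = m / (N * N)" and "\<beta> = 1 / (N * N)"
  have aa: "a \<bullet> a = 1" "b \<bullet> b = 1" "b \<bullet> a = 0" using ab by (simp_all add: norm_eq_1 inner_commute)
  have un: "u \<bullet> u = 1" "n \<bullet> n = 1" "u \<bullet> n = 0"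
    using N0 NN by (auto simp: u_def n_def inner_simps aa ab(3) power2_eq_square field_simps)
       (simp_all add: add_divide_distrib[symmetric] add_pos_nonneg less_imp_neq[symmetric])
  have uL: "u \<bullet> x = (a \<bullet> x + m * (b \<bullet> x)) / N" "n \<bullet> x = (b \<bullet> x - m * (a \<bullet> x)) / N" for x
    by (simp_all add: u_def n_def inner_simps)
  have dpsi: "(\<psi> has_real_derivative deriv \<phi> (v / N) - m) (at v)" for v
  proof -
    have "((\<lambda>v. v / N) has_real_derivative 1 / N) (at v)" using N0 by (auto intro!: derivative_eq_intros)
    from DERIV_chain2[OF \<phi>.DERIV this]
    have "((\<lambda>v. N * \<phi> (v / N) - m * v) has_real_derivative N * (deriv \<phi> (v / N) * (1 / N)) - m * 1) (at v)"
      by (intro DERIV_diff DERIV_cmult DERIV_ident)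
    then show ?thesis using N0 by (simp add: \<psi>_def[abs_def])
  qed
  have dpsi': "deriv \<psi> v = deriv \<phi> (v / N) - m" for v using dpsi DERIV_imp_deriv by blast
  have \<alpha>\<beta>: "\<bar>\<alpha>\<bar> \<le> 1" "\<bar>\<beta>\<bar> \<le> 1"
  proof -
    have "\<bar>m\<bar> \<le> N * N"
    proof -
      have "(\<bar>m\<bar> - 1)\<^sup>2 \<ge> 0" by simp
      then have "2 * \<bar>m\<bar> \<le> 1 + m\<^sup>2" by (simp add: power2_diff)
      then show ?thesis using NN by simp
    qed
    then show "\<bar>\<alpha>\<bar> \<le> 1" using N0 by (simp add: \<alpha>_def)
    have "1 \<le> N * N" using NN by simp
    then show "\<bar>\<beta>\<bar> \<le> 1" using N0 by (simp add: \<beta>_def)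
  qed
  have par: "\<exists>v\<in>{N * t1..N * t2}. u \<bullet> e = (- ((R 0)$1 + m * (R 0)$2) / N) + v + \<alpha> * \<psi> v
      \<and> n \<bullet> e = (- ((R 0)$2 - m * (R 0)$1) / N) + \<beta> * \<psi> v" if e: "e \<in> E" for e
  proof (rule bexI[of _ "N * ?t e"])
    let ?T = "?t e"
    have psi: "\<psi> (N * ?T) = N * (R e)$2 - m * (N * ?T)" using N0 gr[OF e] by (simp add: \<psi>_def)
    have a1: "a \<bullet> e = ?T - (R 0)$1" "b \<bullet> e = (R e)$2 - (R 0)$2" using R1[of e] R2[of e] by auto
    have mm: "m * m = N * N - 1" using NN by (simp add: power2_eq_square)
    have "N * ?T + \<alpha> * \<psi> (N * ?T) = (?T + m * (R e)$2) / N"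
    proof -
      have "N * ?T + \<alpha> * \<psi> (N * ?T) = (N * N * ?T + m * (R e)$2 - m * m * ?T) / N"
        unfolding psi \<alpha>_def using N0 by (simp add: field_simps)
      then show ?thesis unfolding mm by (simp add: algebra_simps)
    qed
    moreover have "\<beta> * \<psi> (N * ?T) = ((R e)$2 - m * ?T) / N"
      unfolding psi \<beta>_def using N0 by (simp add: field_simps)
    ultimately show "u \<bullet> e = (- ((R 0)$1 + m * (R 0)$2) / N) + N * ?T + \<alpha> * \<psi> (N * ?T)
      \<and> n \<bullet> e = (- ((R 0)$2 - m * (R 0)$1) / N) + \<beta> * \<psi> (N * ?T)"
      unfolding uL a1 add.assoc by (simp add: add_divide_distrib[symmetric] del: add_divide_distrib) (simp add: algebra_simps)
    show "N * ?T \<in> {N * t1..N * t2}" using t12[OF e] N0 by simp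
  qed
  have "\<forall>v\<in>{N * t1..N * t2}. \<bar>deriv \<psi> v\<bar> \<le> 4 * CE p 0 * c4"
    unfolding dpsi' using sl N0 by (auto simp: field_simps)
  moreover have "besov_int p \<psi> \<le> ennreal X"
    using besov_int_rescale[OF diff N1 _ dpsi', of p] bX p by (meson less_imp_le order_trans)
  moreover have "N * t1 \<le> N * t2" using t12' N0 by simp
  moreover have "\<forall>t. \<psi> differentiable (at t)" using dpsi real_differentiable_def by blast
  moreover have "norm u = 1" "norm n = 1" using un by (simp_all add: norm_eq_1)
  ultimately show ?thesis using un(3) \<alpha>\<beta> par unfolding X_def by blast
qed

section \<open>The multiscale extension operator\<close>

text \<open>\<open>ps 0\<close> is a bump with support in [-1, 1] whose integer translates sum to 1;
  \<open>ps i\<close> is its i-th derivative, which explains 2^i.\<close>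

definition ps :: "nat \<Rightarrow> real \<Rightarrow> real" where
  "ps i x = 2 ^ i * (ds i (2 * x + 1) - ds i (2 * x - 1))"

text \<open>\<open>ch 0\<close> is 1 on [-7, 7] and 0 outside [-9, 9], and \<open>ch i\<close> is
  its i-th derivative. The plateau has to contain 6, the height bound of \<open>near_eta\<close> in
  units of \<open>s m\<close>.\<close>

definition ch :: "nat \<Rightarrow> real \<Rightarrow> real" where
  "ch i x = ds i (x + 8) - ds i (x - 8)"

lemma ps_has_derivative: "(ps i has_real_derivative ps (Suc i) x) (at x)"
proof -
  have "((\<lambda>x. ds i (2 * x + 1)) has_real_derivative ds (Suc i) (2 * x + 1) * 2) (at x)"
    "((\<lambda>x. ds i (2 * x - 1)) has_real_derivative ds (Suc i) (2 * x - 1) * 2) (at x)"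
    by (rule DERIV_chain2[OF ds_has_derivative]; auto intro!: derivative_eq_intros)+
  from DERIV_cmult[OF DERIV_diff[OF this], of "2 ^ i"] show ?thesis
    by (simp add: ps_def[abs_def] algebra_simps)
qed

lemma ch_has_derivative: "(ch i has_real_derivative ch (Suc i) x) (at x)"
proof -
  have "((\<lambda>x. ds i (x + 8)) has_real_derivative ds (Suc i) (x + 8) * 1) (at x)"
    "((\<lambda>x. ds i (x - 8)) has_real_derivative ds (Suc i) (x - 8) * 1) (at x)"
    by (rule DERIV_chain2[OF ds_has_derivative]; auto intro!: derivative_eq_intros)+
  from DERIV_diff[OF this] show ?thesis by (simp add: ch_def[abs_def])
qed

lemma ds_eq_same_side: "(1 \<le> x \<and> 1 \<le> y) \<or> (x \<le> -1 \<and> y \<le> -1) \<Longrightarrow> ds i x = ds i y"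
  using ds_outside[of x "i - 1"] ds_outside[of y "i - 1"]
  by (cases i) (auto simp: ds_0 sstep_left sstep_right)

lemma ps_outside: "\<bar>x\<bar> \<ge> 1 \<Longrightarrow> ps i x = 0"
  by (cases "x > 0") (auto simp: ps_def intro!: ds_eq_same_side)

lemma ch_outside: "\<bar>x\<bar> \<ge> 9 \<Longrightarrow> ch i x = 0"
  by (cases "x > 0") (auto simp: ch_def intro!: ds_eq_same_side)

lemma ch_inside: "\<bar>x\<bar> \<le> 7 \<Longrightarrow> ch i x = (if i = 0 then 1 else 0)"
  using ds_outside[of "x + 8" "i - 1"] ds_outside[of "x - 8" "i - 1"]
  by (cases i) (auto simp: ch_def ds_0 sstep_left sstep_right)

text \<open>The term \<open>ds i (2 * x - 1)\<close> cancels between the two translates; what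
  remains is constant on [0, 1).\<close>

lemma ps_pair_sum: "0 \<le> x \<Longrightarrow> x < 1 \<Longrightarrow> ps i x + ps i (x - 1) = (if i = 0 then 1 else 0)"
proof -
  assume x: "0 \<le> x" "x < 1"
  have "ps i x + ps i (x - 1) = 2 ^ i * (ds i (2 * x + 1) - ds i (2 * x - 3))"
    by (simp add: ps_def algebra_simps)
  also have "\<dots> = (if i = 0 then 1 else 0)"
    using x ds_outside[of "2 * x + 1" "i - 1"] ds_outside[of "2 * x - 3" "i - 1"]
    by (cases i) (auto simp: ds_0 sstep_left sstep_right)
  finally show ?thesis .
qed

lemma ps_bound: "i \<le> 2 \<Longrightarrow> \<bar>ps i x\<bar> \<le> 8 * KB"
proof -
  assume i: "i \<le> 2"
  have "\<bar>ds i (2 * x + 1) - ds i (2 * x - 1)\<bar> \<le> 2 * KB"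
    using KB(2)[OF i, of "2 * x + 1"] KB(2)[OF i, of "2 * x - 1"] by linarith
  moreover have "(2::real) ^ i \<le> 2 ^ 2" using i by (intro power_increasing) auto
  ultimately have "2 ^ i * \<bar>ds i (2 * x + 1) - ds i (2 * x - 1)\<bar> \<le> 4 * (2 * KB)"
    by (intro mult_mono) auto
  then show ?thesis by (simp add: ps_def abs_mult)
qed

lemma ch_bound: "i \<le> 2 \<Longrightarrow> \<bar>ch i x\<bar> \<le> 2 * KB"
  using KB(2)[of i "x + 8"] KB(2)[of i "x - 8"] by (simp add: ch_def)

lemma sum_two_active:
  fixes f :: "int \<Rightarrow> real"
  assumes "finite J" "\<And>j. \<bar>y - real_of_int j\<bar> \<ge> 1 \<Longrightarrow> f j = 0"
  shows "(\<Sum>j\<in>J. f j) = (\<Sum>j\<in>J \<inter> {\<lfloor>y\<rfloor>, \<lfloor>y\<rfloor> + 1}. f j)"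
proof (rule sum.mono_neutral_right[OF assms(1)], simp, rule ballI, rule assms(2))
  fix j assume "j \<in> J - J \<inter> {\<lfloor>y\<rfloor>, \<lfloor>y\<rfloor> + 1}"
  then have "j < \<lfloor>y\<rfloor> \<or> j > \<lfloor>y\<rfloor> + 1" by auto
  then have "j + 1 \<le> \<lfloor>y\<rfloor> \<or> j \<ge> \<lfloor>y\<rfloor> + 2" by linarith
  then have "real_of_int (j + 1) \<le> y \<or> real_of_int j > y + 1"
    by (meson floor_less_iff le_floor_iff linorder_not_less) linarith
  then show "1 \<le> \<bar>y - real_of_int j\<bar>" by auto
qed

lemma abs_sum_two_active:
  fixes f :: "int \<Rightarrow> real"
  assumes "finite J" "\<And>j. \<bar>y - real_of_int j\<bar> \<ge> 1 \<Longrightarrow> f j = 0"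
    and "\<And>j. j \<in> J \<Longrightarrow> \<bar>y - real_of_int j\<bar> < 1 \<Longrightarrow> \<bar>f j\<bar> \<le> Z" and Z: "Z \<ge> 0"
  shows "\<bar>\<Sum>j\<in>J. f j\<bar> \<le> 2 * Z"
proof -
  have b: "\<bar>f j\<bar> \<le> Z" if "j \<in> J" for j using assms(2)[of j] assms(3)[OF that] Z by (cases "\<bar>y - real_of_int j\<bar> < 1") auto
  have "\<bar>\<Sum>j\<in>J \<inter> {\<lfloor>y\<rfloor>, \<lfloor>y\<rfloor> + 1}. f j\<bar> \<le> (\<Sum>j\<in>J \<inter> {\<lfloor>y\<rfloor>, \<lfloor>y\<rfloor> + 1}. \<bar>f j\<bar>)" by (rule sum_abs)
  also have "\<dots> \<le> of_nat (card (J \<inter> {\<lfloor>y\<rfloor>, \<lfloor>y\<rfloor> + 1})) * Z" by (rule sum_bounded_above) (use b in auto)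
  also have "\<dots> \<le> 2 * Z"
  proof (rule mult_right_mono[OF _ Z])
    have "card (J \<inter> {\<lfloor>y\<rfloor>, \<lfloor>y\<rfloor> + 1}) \<le> card {\<lfloor>y\<rfloor>, \<lfloor>y\<rfloor> + 1}" by (intro card_mono) auto
    then show "of_nat (card (J \<inter> {\<lfloor>y\<rfloor>, \<lfloor>y\<rfloor> + 1})) \<le> (2::real)" by simp
  qed
  finally show ?thesis using sum_two_active[of J y f] assms(1,2) by simp
qed

lemma sum_ps_partition:
  assumes "finite J" "\<And>j. \<bar>y - real_of_int j\<bar> < 1 \<Longrightarrow> j \<in> J"
  shows "(\<Sum>j\<in>J. ps i (y - real_of_int j)) = (if i = 0 then 1 else 0)"
proof -
  have z: "ps i (y - real_of_int j) = 0" if "j \<notin> J" for j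
    using assms(2)[of j] that ps_outside[of "y - real_of_int j" i] by force
  have "(\<Sum>j\<in>J. ps i (y - real_of_int j)) = (\<Sum>j\<in>J \<inter> {\<lfloor>y\<rfloor>, \<lfloor>y\<rfloor> + 1}. ps i (y - real_of_int j))"
    by (rule sum_two_active[OF assms(1)]) (rule ps_outside)
  also have "\<dots> = (\<Sum>j\<in>{\<lfloor>y\<rfloor>, \<lfloor>y\<rfloor> + 1}. ps i (y - real_of_int j))"
    by (rule sum.mono_neutral_left) (use z in auto)
  also have "\<dots> = ps i (frac y) + ps i (frac y - 1)" by (simp add: frac_def algebra_simps)
  also have "\<dots> = (if i = 0 then 1 else 0)" by (rule ps_pair_sum) (auto simp: frac_lt_1)
  finally show ?thesis .
qed

text \<open>The extension works for any finite set that is a 1-Lipschitz graph in the frame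
  \<open>u\<close>, \<open>n\<close>; the curve itself enters in the trace estimate.
  \<open>s0\<close> is the coarsest scale.\<close>

locale lipschitz_set =
  fixes E :: "(real^2) set" and u n :: "real^2" and s0 :: real
  assumes finE: "finite E" and neE: "E \<noteq> {}"
    and un: "norm u = 1" "norm n = 1" "u \<bullet> n = 0"
    and lip: "\<And>e e'. e \<in> E \<Longrightarrow> e' \<in> E \<Longrightarrow> \<bar>n \<bullet> e - n \<bullet> e'\<bar> \<le> \<bar>u \<bullet> e - u \<bullet> e'\<bar>"
    and s0: "s0 > 0"
begin

abbreviation tau :: "real^2 \<Rightarrow> real" where "tau e \<equiv> u \<bullet> e"
abbreviation eta :: "real^2 \<Rightarrow> real" where "eta e \<equiv> n \<bullet> e"

lemma tau_inj: "e \<in> E \<Longrightarrow> e' \<in> E \<Longrightarrow> e \<noteq> e' \<Longrightarrow> tau e \<noteq> tau e'"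
proof
  assume e: "e \<in> E" "e' \<in> E" "e \<noteq> e'" "tau e = tau e'"
  then have "eta e = eta e'" using lip[of e e'] by simp
  then have "(e - e') \<bullet> (e - e') = 0"
    unfolding inner_vec2_decomp[OF un, of "e - e'"] using e by (simp add: inner_diff_right)
  then show False using e by simp
qed

definition s :: "nat \<Rightarrow> real" where "s m = s0 / 2 ^ m"

lemma s_pos: "s m > 0" using s0 by (simp add: s_def)
lemma s_0: "s 0 = s0" by (simp add: s_def)
lemma s_Suc: "s m = 2 * s (Suc m)" by (simp add: s_def)
lemma s_pred: "m \<ge> 1 \<Longrightarrow> s (m - 1) = 2 * s m" using s_Suc[of "m - 1"] by simp
lemma s_add: "s (m + k) = s m / 2 ^ k" by (simp add: s_def power_add)
lemma s_mono: "m \<le> m' \<Longrightarrow> s m' \<le> s m" using s0 by (auto simp: s_def intro!: divide_left_mono power_increasing)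

text \<open>\<open>J\<close> indexes the gluing, \<open>J'\<close> the cutoffs. The gap between 3
  and 2 is one grid step: an index active at a point where the cutoff lives is adjacent to one in
  \<open>J'\<close>, hence lies in \<open>J\<close>, so the partition of unity over \<open>J\<close>
  is complete there.\<close>

definition J :: "nat \<Rightarrow> int set" where
  "J m = {j. \<exists>e\<in>E. \<bar>tau e - real_of_int j * s m\<bar> \<le> 3 * s m}"

definition J' :: "nat \<Rightarrow> int set" where
  "J' m = {j. \<exists>e\<in>E. \<bar>tau e - real_of_int j * s m\<bar> < 2 * s m}"

definition rep :: "nat \<Rightarrow> int \<Rightarrow> real^2" where
  "rep m j = (SOME e. e \<in> E \<and> \<bar>tau e - real_of_int j * s m\<bar> \<le> 3 * s m)"

lemma J'_subset: "J' m \<subseteq> J m"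
proof
  fix j assume "j \<in> J' m"
  then obtain e where "e \<in> E" "\<bar>tau e - real_of_int j * s m\<bar> < 2 * s m" by (auto simp: J'_def)
  then have "\<exists>e\<in>E. \<bar>tau e - real_of_int j * s m\<bar> \<le> 3 * s m"
    using s_pos[of m] by (intro bexI[of _ e]) auto
  then show "j \<in> J m" by (simp add: J_def)
qed

lemma rep: assumes "j \<in> J m" shows "rep m j \<in> E" "\<bar>tau (rep m j) - real_of_int j * s m\<bar> \<le> 3 * s m"
proof -
  have "\<exists>e. e \<in> E \<and> \<bar>tau e - real_of_int j * s m\<bar> \<le> 3 * s m" using assms by (auto simp: J_def)
  from someI_ex[OF this] show "rep m j \<in> E" "\<bar>tau (rep m j) - real_of_int j * s m\<bar> \<le> 3 * s m"
    by (auto simp: rep_def)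
qed

lemma finite_J: "finite (J m)"
proof -
  have "J m \<subseteq> (\<Union>e\<in>E. {\<lfloor>tau e / s m\<rfloor> - 4..\<lfloor>tau e / s m\<rfloor> + 4})"
  proof
    fix j assume "j \<in> J m"
    then obtain e where e: "e \<in> E" "\<bar>tau e - real_of_int j * s m\<bar> \<le> 3 * s m" by (auto simp: J_def)
    then have "\<bar>tau e / s m - real_of_int j\<bar> \<le> 3" using s_pos[of m] by (simp add: field_simps abs_le_iff)
    then have "j \<in> {\<lfloor>tau e / s m\<rfloor> - 4..\<lfloor>tau e / s m\<rfloor> + 4}" by (auto simp: abs_le_iff) linarith+
    then show "j \<in> (\<Union>e\<in>E. {\<lfloor>tau e / s m\<rfloor> - 4..\<lfloor>tau e / s m\<rfloor> + 4})" using e(1) by blast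
  qed
  then show ?thesis by (rule finite_subset) (use finE in auto)
qed

lemma finite_J': "finite (J' m)" using finite_subset[OF J'_subset finite_J] .

text \<open>Nearest in the coordinate \<open>tau\<close>, so any other point of \<open>E\<close>
  bounds the distance to the neighbour. For a pair of points in \<open>Lam_term\<close> the partner
  is that other point.\<close>

definition nb :: "real^2 \<Rightarrow> real^2" where
  "nb e = (SOME e'. e' \<in> E - {e} \<and> (\<forall>e''\<in>E - {e}. \<bar>tau e - tau e'\<bar> \<le> \<bar>tau e - tau e''\<bar>))"

lemma nb: assumes "E \<noteq> {e}" "e \<in> E"
  shows "nb e \<in> E" "nb e \<noteq> e" "\<And>e''. e'' \<in> E \<Longrightarrow> e'' \<noteq> e \<Longrightarrow> \<bar>tau e - tau (nb e)\<bar> \<le> \<bar>tau e - tau e''\<bar>"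
proof -
  have "E - {e} \<noteq> {}" "finite (E - {e})" using assms finE by auto
  then have "\<exists>e'. e' \<in> E - {e} \<and> (\<forall>e''\<in>E - {e}. \<bar>tau e - tau e'\<bar> \<le> \<bar>tau e - tau e''\<bar>)"
    using ex_min_if_finite[of "(\<lambda>e'. \<bar>tau e - tau e'\<bar>) ` (E - {e})"] by (auto simp: not_less)
  from someI_ex[OF this] have "nb e \<in> E - {e}" "\<forall>e''\<in>E - {e}. \<bar>tau e - tau (nb e)\<bar> \<le> \<bar>tau e - tau e''\<bar>"
    by (auto simp: nb_def)
  then show "nb e \<in> E" "nb e \<noteq> e" "\<And>e''. e'' \<in> E \<Longrightarrow> e'' \<noteq> e \<Longrightarrow> \<bar>tau e - tau (nb e)\<bar> \<le> \<bar>tau e - tau e''\<bar>"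
    by auto
qed

text \<open>\<open>P f e\<close> is the affine interpolant of the data at \<open>e\<close> and its nearest neighbour; \<open>nb e\<close> is junk
  if \<open>E = {e}\<close>.\<close>

definition A :: "(real^2 \<Rightarrow> real) \<Rightarrow> real^2 \<Rightarrow> real" where
  "A f e = (if E = {e} then 0 else (f e - f (nb e)) / (tau e - tau (nb e)))"

definition P :: "(real^2 \<Rightarrow> real) \<Rightarrow> real^2 \<Rightarrow> real \<Rightarrow> real" where
  "P f e t = f e + A f e * (t - tau e)"

lemma A_linear: "A (\<lambda>x. f x + a * f' x) e = A f e + a * A f' e"
  by (simp add: A_def add_divide_distrib diff_divide_distrib algebra_simps)

lemma P_linear: "P (\<lambda>x. f x + a * f' x) e t = P f e t + a * P f' e t"
  by (simp add: P_def A_linear algebra_simps)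

lemma A_cong: "(\<And>x. x \<in> E \<Longrightarrow> f x = f' x) \<Longrightarrow> e \<in> E \<Longrightarrow> A f e = A f' e"
  using nb(1)[of e] by (simp add: A_def)

lemma P_cong: "(\<And>x. x \<in> E \<Longrightarrow> f x = f' x) \<Longrightarrow> e \<in> E \<Longrightarrow> P f e t = P f' e t"
  using A_cong[of f f' e] by (simp add: P_def)

text \<open>The leading indices of \<open>w\<close> and \<open>cut\<close> and the digits in the names of the sums below count
  derivatives in the directions \<open>u\<close> and \<open>n\<close>.\<close>

definition w :: "nat \<Rightarrow> nat \<Rightarrow> int \<Rightarrow> real \<Rightarrow> real" where
  "w i m j t = ps i (t / s m - real_of_int j) / s m ^ i"

lemma w_has_derivative: "(w i m j has_real_derivative w (Suc i) m j t) (at t)"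
proof -
  have "((\<lambda>t. t / s m - real_of_int j) has_real_derivative 1 / s m) (at t)"
    using s_pos[of m] by (auto intro!: derivative_eq_intros)
  from DERIV_cdivide[OF DERIV_chain2[OF ps_has_derivative this], where c = "s m ^ i"]
  show ?thesis by (simp add: w_def[abs_def])
qed

definition G0 :: "(real^2 \<Rightarrow> real) \<Rightarrow> nat \<Rightarrow> real \<Rightarrow> real" where
  "G0 f m t = (\<Sum>j\<in>J m. w 0 m j t * P f (rep m j) t)"
definition G1 :: "(real^2 \<Rightarrow> real) \<Rightarrow> nat \<Rightarrow> real \<Rightarrow> real" where
  "G1 f m t = (\<Sum>j\<in>J m. w 1 m j t * P f (rep m j) t + w 0 m j t * A f (rep m j))"
definition G2 :: "(real^2 \<Rightarrow> real) \<Rightarrow> nat \<Rightarrow> real \<Rightarrow> real" where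
  "G2 f m t = (\<Sum>j\<in>J m. w 2 m j t * P f (rep m j) t + 2 * w 1 m j t * A f (rep m j))"

lemma P_has_derivative: "(P f e has_real_derivative A f e) (at t)"
  unfolding P_def[abs_def] by (auto intro!: derivative_eq_intros)

lemma G0_has_derivative: "(G0 f m has_real_derivative G1 f m t) (at t)"
  unfolding G0_def[abs_def] G1_def
  by (rule DERIV_sum)
     (auto intro!: DERIV_cong[OF DERIV_mult[OF w_has_derivative P_has_derivative]] simp: mult.commute)

lemma G1_has_derivative: "(G1 f m has_real_derivative G2 f m t) (at t)"
  unfolding G1_def[abs_def] G2_def
proof (rule DERIV_sum)
  fix j
  show "((\<lambda>t. w 1 m j t * P f (rep m j) t + w 0 m j t * A f (rep m j)) has_real_derivative
     w 2 m j t * P f (rep m j) t + 2 * w 1 m j t * A f (rep m j)) (at t)"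
    by (rule DERIV_cong[OF DERIV_add[OF DERIV_mult[OF w_has_derivative P_has_derivative] DERIV_cmult_right[OF w_has_derivative]]])
       (simp add: numeral_2_eq_2 algebra_simps)
qed

lemma G2_continuous: "continuous_on UNIV (G2 f m)"
proof -
  have w: "continuous_on UNIV (w i m j)" for i j
    using w_has_derivative DERIV_isCont by (blast intro: continuous_at_imp_continuous_on)
  have P: "continuous_on UNIV (P f e)" for e unfolding P_def[abs_def] by (intro continuous_intros)
  show ?thesis unfolding G2_def[abs_def] by (intro continuous_intros w P)
qed

text \<open>Below the coarsest level stands the zero function, so that the increments sum to the
  finest level.\<close>

definition pred :: "(nat \<Rightarrow> real \<Rightarrow> real) \<Rightarrow> nat \<Rightarrow> real \<Rightarrow> real" where
  "pred G m t = (if m = 0 then 0 else G (m - 1) t)"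

definition D0 :: "(real^2 \<Rightarrow> real) \<Rightarrow> nat \<Rightarrow> real \<Rightarrow> real" where "D0 f m t = G0 f m t - pred (G0 f) m t"
definition D1 :: "(real^2 \<Rightarrow> real) \<Rightarrow> nat \<Rightarrow> real \<Rightarrow> real" where "D1 f m t = G1 f m t - pred (G1 f) m t"
definition D2 :: "(real^2 \<Rightarrow> real) \<Rightarrow> nat \<Rightarrow> real \<Rightarrow> real" where "D2 f m t = G2 f m t - pred (G2 f) m t"

lemma D0_has_derivative: "(D0 f m has_real_derivative D1 f m t) (at t)"
  by (cases "m = 0") (simp_all add: D0_def[abs_def] D1_def pred_def G0_has_derivative DERIV_diff)

lemma D1_has_derivative: "(D1 f m has_real_derivative D2 f m t) (at t)"
  by (cases "m = 0") (simp_all add: D1_def[abs_def] D2_def pred_def G1_has_derivative DERIV_diff)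

lemma D2_continuous: "continuous_on UNIV (D2 f m)"
  by (cases "m = 0") (simp_all add: D2_def[abs_def] pred_def G2_continuous continuous_on_diff)

definition cut :: "nat \<Rightarrow> nat \<Rightarrow> nat \<Rightarrow> real^2 \<Rightarrow> real" where
  "cut a b m x = (\<Sum>j\<in>J' m. w a m j (tau x) * (ch b ((eta x - eta (rep m j)) / s m) / s m ^ b))"

lemma cut_gradf: "gradf u n (cut a b m) (cut (Suc a) b m) (cut a (Suc b) m)"
proof -
  have h: "((\<lambda>y. ch b ((y - c) / s m) / s m ^ b) has_real_derivative ch (Suc b) ((y - c) / s m) / s m ^ Suc b) (at y)" for c y b
  proof -
    have "((\<lambda>y. (y - c) / s m) has_real_derivative 1 / s m) (at y)"
      using s_pos[of m] by (auto intro!: derivative_eq_intros)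
    from DERIV_cdivide[OF DERIV_chain2[OF ch_has_derivative this], where c = "s m ^ b"]
    show ?thesis by simp
  qed
  have "gradf u n (cut a b m)
    (\<lambda>x. \<Sum>j\<in>J' m. w (Suc a) m j (tau x) * (ch b ((eta x - eta (rep m j)) / s m) / s m ^ b) + w a m j (tau x) * 0)
    (\<lambda>x. \<Sum>j\<in>J' m. 0 * (ch b ((eta x - eta (rep m j)) / s m) / s m ^ b) + w a m j (tau x) * (ch (Suc b) ((eta x - eta (rep m j)) / s m) / s m ^ Suc b))"
    unfolding cut_def[abs_def]
    by (intro gradf_sum gradf_mult gradf_fst[OF w_has_derivative] gradf_snd[OF h])
  then show ?thesis by (simp add: cut_def[abs_def])
qed

lemma ex_finest: "\<exists>N. \<forall>e\<in>E. \<forall>e'\<in>E. e \<noteq> e' \<longrightarrow> 8 * s N < \<bar>tau e - tau e'\<bar>"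
proof -
  let ?S = "(\<lambda>(e, e'). \<bar>tau e - tau e'\<bar>) ` (E \<times> E)"
  have "finite ?S" using finE by simp
  from finite_set_avoid[OF this, of 0] obtain r where r: "r > 0" "\<forall>x\<in>?S. x \<noteq> 0 \<longrightarrow> r \<le> dist 0 x" by blast
  obtain N where N: "(1/2::real) ^ N < r / (8 * s0)" using real_arch_pow_inv[of "r / (8 * s0)" "1/2"] r(1) s0 by auto
  have "8 * s N < r" using N s0 by (simp add: s_def field_simps power_one_over)
  moreover have "r \<le> \<bar>tau e - tau e'\<bar>" if "e \<in> E" "e' \<in> E" "e \<noteq> e'" for e e'
  proof -
    have "\<bar>tau e - tau e'\<bar> \<in> ?S" using that by (intro image_eqI[of _ _ "(e, e')"]) auto
    then show ?thesis using r(2) tau_inj[OF that] by force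
  qed
  ultimately show ?thesis by (intro exI[of _ N]) (auto intro: less_le_trans)
qed

text \<open>The finest level. There the representative of an active interval is within 4
  \<open>s N\<close> of a point of \<open>E\<close> in \<open>tau\<close>, hence equal to it. It
  depends on the smallest gap in \<open>E\<close>, so no constant may depend on it.\<close>

definition N :: nat where
  "N = (SOME N. \<forall>e\<in>E. \<forall>e'\<in>E. e \<noteq> e' \<longrightarrow> 8 * s N < \<bar>tau e - tau e'\<bar>)"

lemma N: "e \<in> E \<Longrightarrow> e' \<in> E \<Longrightarrow> e \<noteq> e' \<Longrightarrow> 8 * s N < \<bar>tau e - tau e'\<bar>"
  using someI_ex[OF ex_finest] unfolding N_def by blast

definition ext :: "(real^2 \<Rightarrow> real) \<Rightarrow> real^2 \<Rightarrow> real" where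
  "ext f x = (\<Sum>m\<le>N. cut 0 0 m x * D0 f m (tau x))"
definition ext1 :: "(real^2 \<Rightarrow> real) \<Rightarrow> real^2 \<Rightarrow> real" where
  "ext1 f x = (\<Sum>m\<le>N. cut 1 0 m x * D0 f m (tau x) + cut 0 0 m x * D1 f m (tau x))"
definition ext2 :: "(real^2 \<Rightarrow> real) \<Rightarrow> real^2 \<Rightarrow> real" where
  "ext2 f x = (\<Sum>m\<le>N. cut 0 1 m x * D0 f m (tau x))"
definition ext11 :: "(real^2 \<Rightarrow> real) \<Rightarrow> real^2 \<Rightarrow> real" where
  "ext11 f x = (\<Sum>m\<le>N. cut 2 0 m x * D0 f m (tau x) + 2 * cut 1 0 m x * D1 f m (tau x) + cut 0 0 m x * D2 f m (tau x))"
definition ext12 :: "(real^2 \<Rightarrow> real) \<Rightarrow> real^2 \<Rightarrow> real" where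
  "ext12 f x = (\<Sum>m\<le>N. cut 1 1 m x * D0 f m (tau x) + cut 0 1 m x * D1 f m (tau x))"
definition ext22 :: "(real^2 \<Rightarrow> real) \<Rightarrow> real^2 \<Rightarrow> real" where
  "ext22 f x = (\<Sum>m\<le>N. cut 0 2 m x * D0 f m (tau x))"

lemma ext_gradf:
  "gradf u n (ext f) (ext1 f) (ext2 f)"
  "gradf u n (ext1 f) (ext11 f) (ext12 f)"
  "gradf u n (ext2 f) (ext12 f) (ext22 f)"
proof -
  note d0 = gradf_fst[OF D0_has_derivative] and d1 = gradf_fst[OF D1_has_derivative]
  have "gradf u n (ext f)
      (\<lambda>x. \<Sum>m\<le>N. cut (Suc 0) 0 m x * D0 f m (tau x) + cut 0 0 m x * D1 f m (tau x))
      (\<lambda>x. \<Sum>m\<le>N. cut 0 (Suc 0) m x * D0 f m (tau x) + cut 0 0 m x * 0)"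
    unfolding ext_def[abs_def] by (intro gradf_sum gradf_mult cut_gradf d0)
  then show "gradf u n (ext f) (ext1 f) (ext2 f)" by (simp add: ext1_def[abs_def] ext2_def[abs_def])
  have "gradf u n (ext1 f)
      (\<lambda>x. \<Sum>m\<le>N. (cut (Suc 1) 0 m x * D0 f m (tau x) + cut 1 0 m x * D1 f m (tau x)) +
         (cut (Suc 0) 0 m x * D1 f m (tau x) + cut 0 0 m x * D2 f m (tau x)))
      (\<lambda>x. \<Sum>m\<le>N. (cut 1 (Suc 0) m x * D0 f m (tau x) + cut 1 0 m x * 0) +
         (cut 0 (Suc 0) m x * D1 f m (tau x) + cut 0 0 m x * 0))"
    unfolding ext1_def[abs_def] by (intro gradf_sum gradf_add gradf_mult cut_gradf d0 d1)
  moreover have "(\<lambda>x. \<Sum>m\<le>N. (cut (Suc 1) 0 m x * D0 f m (tau x) + cut 1 0 m x * D1 f m (tau x)) +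
         (cut (Suc 0) 0 m x * D1 f m (tau x) + cut 0 0 m x * D2 f m (tau x))) = ext11 f"
    unfolding ext11_def[abs_def] by (intro ext sum.cong refl) (simp add: numeral_2_eq_2 algebra_simps)
  ultimately show "gradf u n (ext1 f) (ext11 f) (ext12 f)" by (simp add: ext12_def[abs_def])
  have "gradf u n (ext2 f)
      (\<lambda>x. \<Sum>m\<le>N. cut (Suc 0) 1 m x * D0 f m (tau x) + cut 0 1 m x * D1 f m (tau x))
      (\<lambda>x. \<Sum>m\<le>N. cut 0 (Suc 1) m x * D0 f m (tau x) + cut 0 1 m x * 0)"
    unfolding ext2_def[abs_def] by (intro gradf_sum gradf_mult cut_gradf d0)
  then show "gradf u n (ext2 f) (ext12 f) (ext22 f)"
    by (simp add: ext12_def[abs_def] ext22_def[abs_def] numeral_2_eq_2)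
qed

lemma ext_continuous:
  "continuous_on UNIV (ext11 f)" "continuous_on UNIV (ext12 f)" "continuous_on UNIV (ext22 f)"
proof -
  have c: "continuous_on UNIV (cut a b m)" for a b m using gradf_continuous[OF cut_gradf] .
  have d0: "continuous_on UNIV (\<lambda>x. D0 f m (tau x))" for m using gradf_continuous[OF gradf_fst[OF D0_has_derivative]] .
  have d1: "continuous_on UNIV (\<lambda>x. D1 f m (tau x))" for m using gradf_continuous[OF gradf_fst[OF D1_has_derivative]] .
  have d2: "continuous_on UNIV (\<lambda>x. D2 f m (tau x))" for m
    by (rule continuous_on_compose2[OF D2_continuous]) (auto intro!: continuous_intros)
  show "continuous_on UNIV (ext11 f)" "continuous_on UNIV (ext12 f)" "continuous_on UNIV (ext22 f)"
    unfolding ext11_def[abs_def] ext12_def[abs_def] ext22_def[abs_def]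
    by (intro continuous_intros c d0 d1 d2)+
qed

lemma G_linear:
  "G0 (\<lambda>x. f x + a * f' x) m t = G0 f m t + a * G0 f' m t"
  by (simp add: G0_def P_linear sum_distrib_left sum.distrib[symmetric] algebra_simps)

lemma ext_linear: "ext (\<lambda>x. f x + a * f' x) x = ext f x + a * ext f' x"
proof -
  have "D0 (\<lambda>x. f x + a * f' x) m t = D0 f m t + a * D0 f' m t" for m t
    by (simp add: D0_def pred_def G_linear algebra_simps)
  then show ?thesis by (simp add: ext_def sum_distrib_left sum.distrib[symmetric] algebra_simps)
qed

lemma ext_cong: assumes "\<And>x. x \<in> E \<Longrightarrow> f x = f' x" shows "ext f = ext f'"
proof -
  have "G0 f m t = G0 f' m t" for m t
    unfolding G0_def by (intro sum.cong refl) (simp add: P_cong[OF assms rep(1)])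
  then have "D0 f m t = D0 f' m t" for m t by (simp add: D0_def pred_def)
  then show ?thesis by (simp add: ext_def[abs_def])
qed

end

section \<open>The Hessian of the extension\<close>

lemma abs_diff_triangle: "\<bar>a - b\<bar> \<le> p \<Longrightarrow> \<bar>b - c\<bar> \<le> q \<Longrightarrow> \<bar>a - c\<bar> \<le> p + q" for a b c :: real
  by linarith

context lipschitz_set
begin

text \<open>The offsets d - 1 and d - 4 both run over -1, 0, 1; \<open>j div 2\<close> is the
  approximate index of the same place in the grid of twice the width.\<close>

definition par :: "nat \<Rightarrow> int \<Rightarrow> nat \<Rightarrow> real^2" where
  "par m j d = (if d < 3 then rep m (j + int d - 1) else rep (m - 1) (j div 2 + int d - 4))"

text \<open>Index set of the pairs of neighbouring grid intervals: \<open>d < 3\<close> codes a neighbour at the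
  same level, \<open>3 \<le> d < 6\<close> a neighbour at the next coarser level.\<close>

definition Lam :: "(nat \<times> int \<times> nat) set" where
  "Lam = {(m, j, d). m \<le> N \<and> j \<in> J m \<and> d < 6 \<and>
     (if d < 3 then j + int d - 1 \<in> J m else m \<ge> 1 \<and> j div 2 + int d - 4 \<in> J (m - 1))}"

lemma finite_Lam: "finite Lam"
proof -
  have "Lam \<subseteq> (SIGMA m:{..N}. J m \<times> {..<6})" by (auto simp: Lam_def)
  then show ?thesis by (rule finite_subset) (auto intro: finite_J)
qed

lemma par_in_E: "(m, j, d) \<in> Lam \<Longrightarrow> par m j d \<in> E"
  by (auto simp: Lam_def par_def rep(1) split: if_splits)

definition dA :: "(real^2 \<Rightarrow> real) \<Rightarrow> nat \<Rightarrow> int \<Rightarrow> nat \<Rightarrow> real" where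
  "dA f m j d = A f (rep m j) - A f (par m j d)"
definition dP :: "(real^2 \<Rightarrow> real) \<Rightarrow> nat \<Rightarrow> int \<Rightarrow> nat \<Rightarrow> real" where
  "dP f m j d = f (rep m j) - P f (par m j d) (tau (rep m j))"

text \<open>20 covers the support of a level: heights up to 9 + 8 times \<open>s m\<close> occur in
  \<open>act_J\<close>, and in \<open>act_J_pred\<close> the offsets are smaller relative to the
  scale of the box.\<close>

definition box :: "nat \<Rightarrow> int \<Rightarrow> (real^2) set" where
  "box m j = {x. \<bar>tau x - tau (rep m j)\<bar> \<le> 20 * s m \<and> \<bar>eta x - eta (rep m j)\<bar> \<le> 20 * s m}"

text \<open>The p-th power of a local size of the data: all normalised differences whose box
  contains x. Its root \<open>T\<close> dominates the Hessian pointwise and its integral is bounded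
  by a multiple of \<open>energy\<close>. The last sum is the coarsest level, compared with 0
  instead of a predecessor.\<close>

definition Sp :: "real \<Rightarrow> (real^2 \<Rightarrow> real) \<Rightarrow> real^2 \<Rightarrow> real" where
  "Sp p f x =
    (\<Sum>(m, j, d)\<in>Lam. indicator (box m j) x * ((\<bar>dA f m j d\<bar> / s m) powr p + (\<bar>dP f m j d\<bar> / (s m)\<^sup>2) powr p))
    + (\<Sum>j\<in>J 0. indicator (box 0 j) x * ((\<bar>A f (rep 0 j)\<bar> / s 0) powr p + (\<bar>f (rep 0 j)\<bar> / (s 0)\<^sup>2) powr p))"

definition T :: "real \<Rightarrow> (real^2 \<Rightarrow> real) \<Rightarrow> real^2 \<Rightarrow> real" where
  "T p f x = Sp p f x powr (1/p)"

lemma T_nonneg: "T p f x \<ge> 0" by (simp add: T_def)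

lemma Sp_parts:
  shows "(m, j, d) \<in> Lam \<Longrightarrow> x \<in> box m j \<Longrightarrow>
      (\<bar>dA f m j d\<bar> / s m) powr p + (\<bar>dP f m j d\<bar> / (s m)\<^sup>2) powr p \<le> Sp p f x"
    and "j0 \<in> J 0 \<Longrightarrow> x \<in> box 0 j0 \<Longrightarrow>
      (\<bar>A f (rep 0 j0)\<bar> / s 0) powr p + (\<bar>f (rep 0 j0)\<bar> / (s 0)\<^sup>2) powr p \<le> Sp p f x"
proof -
  let ?g = "\<lambda>(m, j, d). indicator (box m j) x * ((\<bar>dA f m j d\<bar> / s m) powr p + (\<bar>dP f m j d\<bar> / (s m)\<^sup>2) powr p)"
  let ?h = "\<lambda>j. indicator (box 0 j) x * ((\<bar>A f (rep 0 j)\<bar> / s 0) powr p + (\<bar>f (rep 0 j)\<bar> / (s 0)\<^sup>2) powr p)"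
  have g0: "?g l \<ge> 0" for l by (cases l) simp
  have h0: "?h l \<ge> 0" for l by simp
  have S: "Sp p f x = sum ?g Lam + sum ?h (J 0)" by (simp add: Sp_def)
  { assume l: "(m, j, d) \<in> Lam" "x \<in> box m j"
    have "?g (m, j, d) \<le> sum ?g Lam" by (rule member_le_sum[OF l(1) _ finite_Lam]) (rule g0)
    then show "(\<bar>dA f m j d\<bar> / s m) powr p + (\<bar>dP f m j d\<bar> / (s m)\<^sup>2) powr p \<le> Sp p f x"
      using l(2) sum_nonneg[of "J 0" ?h] h0 unfolding S by simp }
  { assume l: "j0 \<in> J 0" "x \<in> box 0 j0"
    have "?h j0 \<le> sum ?h (J 0)" by (rule member_le_sum[OF l(1) _ finite_J]) simp
    moreover have "sum ?g Lam \<ge> 0" by (rule sum_nonneg) (rule g0)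
    ultimately show "(\<bar>A f (rep 0 j0)\<bar> / s 0) powr p + (\<bar>f (rep 0 j0)\<bar> / (s 0)\<^sup>2) powr p \<le> Sp p f x"
      using l(2) unfolding S by simp }
qed

lemma powr_le_imp: assumes "a \<ge> 0" "b \<ge> 0" "a powr p + b powr p \<le> S" "p > (0::real)"
  shows "a \<le> S powr (1/p)" "b \<le> S powr (1/p)"
proof -
  have "a powr p \<le> S" "b powr p \<le> S"
    using assms(3) powr_ge_zero[of a p] powr_ge_zero[of b p] by linarith+
  then have "(a powr p) powr (1/p) \<le> S powr (1/p)" "(b powr p) powr (1/p) \<le> S powr (1/p)"
    using assms by (auto intro!: powr_mono2)
  then show "a \<le> S powr (1/p)" "b \<le> S powr (1/p)" using assms by (auto simp: powr_powr)
qed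

lemma T_bounds:
  assumes "p > 0"
  shows "(m, j, d) \<in> Lam \<Longrightarrow> x \<in> box m j \<Longrightarrow> \<bar>dA f m j d\<bar> \<le> s m * T p f x"
    and "(m, j, d) \<in> Lam \<Longrightarrow> x \<in> box m j \<Longrightarrow> \<bar>dP f m j d\<bar> \<le> (s m)\<^sup>2 * T p f x"
    and "j0 \<in> J 0 \<Longrightarrow> x \<in> box 0 j0 \<Longrightarrow> \<bar>A f (rep 0 j0)\<bar> \<le> s 0 * T p f x"
    and "j0 \<in> J 0 \<Longrightarrow> x \<in> box 0 j0 \<Longrightarrow> \<bar>f (rep 0 j0)\<bar> \<le> (s 0)\<^sup>2 * T p f x"
proof -
  have sm: "s k > 0" "(s k)\<^sup>2 > 0" for k using s_pos[of k] by auto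
  { assume l: "(m, j, d) \<in> Lam" "x \<in> box m j"
    have "\<bar>dA f m j d\<bar> / s m \<le> T p f x" "\<bar>dP f m j d\<bar> / (s m)\<^sup>2 \<le> T p f x"
      unfolding T_def using powr_le_imp[OF _ _ Sp_parts(1)[OF l] assms] sm[of m] by auto
    then show "\<bar>dA f m j d\<bar> \<le> s m * T p f x" "\<bar>dP f m j d\<bar> \<le> (s m)\<^sup>2 * T p f x"
      using sm[of m] by (simp_all add: pos_divide_le_eq mult.commute) }
  { assume l: "j0 \<in> J 0" "x \<in> box 0 j0"
    have "\<bar>A f (rep 0 j0)\<bar> / s 0 \<le> T p f x" "\<bar>f (rep 0 j0)\<bar> / (s 0)\<^sup>2 \<le> T p f x"
      unfolding T_def using powr_le_imp[OF _ _ Sp_parts(2)[OF l] assms] sm[of 0] by auto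
    then show "\<bar>A f (rep 0 j0)\<bar> \<le> s 0 * T p f x" "\<bar>f (rep 0 j0)\<bar> \<le> (s 0)\<^sup>2 * T p f x"
      using sm[of 0] by (simp_all add: pos_divide_le_eq mult.commute) }
qed

lemma pair_bounds:
  assumes p: "p > 0" and l: "(m, j, d) \<in> Lam" and x: "x \<in> box m j"
  shows "\<bar>P f (rep m j) (tau x) - P f (par m j d) (tau x)\<bar> \<le> 21 * (s m)\<^sup>2 * T p f x"
    and "\<bar>A f (rep m j) - A f (par m j d)\<bar> \<le> s m * T p f x"
proof -
  show a: "\<bar>A f (rep m j) - A f (par m j d)\<bar> \<le> s m * T p f x"
    using T_bounds(1)[OF p l x, of f] by (simp add: dA_def)
  have "P f (rep m j) (tau x) - P f (par m j d) (tau x)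
      = dP f m j d + (A f (rep m j) - A f (par m j d)) * (tau x - tau (rep m j))"
    by (simp add: P_def dP_def algebra_simps)
  then have "\<bar>P f (rep m j) (tau x) - P f (par m j d) (tau x)\<bar>
      \<le> \<bar>dP f m j d\<bar> + \<bar>A f (rep m j) - A f (par m j d)\<bar> * \<bar>tau x - tau (rep m j)\<bar>"
    by (metis abs_mult abs_triangle_ineq)
  also have "\<dots> \<le> (s m)\<^sup>2 * T p f x + (s m * T p f x) * (20 * s m)"
    using T_bounds(2)[OF p l x, of f] a x s_pos[of m] T_nonneg[of p f x]
    by (intro add_mono mult_mono) (auto simp: box_def)
  also have "\<dots> = 21 * (s m)\<^sup>2 * T p f x" by (simp add: power2_eq_square algebra_simps)
  finally show "\<bar>P f (rep m j) (tau x) - P f (par m j d) (tau x)\<bar> \<le> 21 * (s m)\<^sup>2 * T p f x" .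
qed

lemma w_outside: "\<bar>t / s m - real_of_int j\<bar> \<ge> 1 \<Longrightarrow> w i m j t = 0"
  by (simp add: w_def ps_outside)

lemma w_bound: "i \<le> 2 \<Longrightarrow> \<bar>w i m j t\<bar> \<le> 8 * KB / s m ^ i"
  using ps_bound[of i "t / s m - real_of_int j"] s_pos[of m]
  by (simp add: w_def abs_divide divide_right_mono)

lemma w_sum:
  assumes "finite K" "\<And>j. \<bar>t / s m - real_of_int j\<bar> < 1 \<Longrightarrow> j \<in> K"
  shows "(\<Sum>j\<in>K. w i m j t) = (if i = 0 then 1 else 0)"
  using sum_ps_partition[of K "t / s m" i] assms by (simp add: w_def sum_divide_distrib[symmetric])

text \<open>The weights sum to 1 and their derivatives to 0, so an affine reference with value q at
  t and slope b can be subtracted under the sum. At most two indices are active, which doubles the 8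
  of \<open>w_bound\<close>.\<close>

lemma G_bounds:
  assumes act: "\<And>j. \<bar>t / s m - real_of_int j\<bar> < 1 \<Longrightarrow> j \<in> J m"
    and YZ: "\<And>j. \<bar>t / s m - real_of_int j\<bar> < 1 \<Longrightarrow> \<bar>P f (rep m j) t - q\<bar> \<le> Y"
      "\<And>j. \<bar>t / s m - real_of_int j\<bar> < 1 \<Longrightarrow> \<bar>A f (rep m j) - b\<bar> \<le> Z" "Y \<ge> 0" "Z \<ge> 0"
  shows "\<bar>G0 f m t - q\<bar> \<le> 16 * KB * Y"
    and "\<bar>G1 f m t - b\<bar> \<le> 16 * KB * (Y / s m + Z)"
    and "\<bar>G2 f m t\<bar> \<le> 16 * KB * (Y / (s m)\<^sup>2 + 2 * Z / s m)"
proof -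
  have ws: "(\<Sum>j\<in>J m. w i m j t) = (if i = 0 then 1 else 0)" for i by (rule w_sum[OF finite_J act])
  have sm: "s m > 0" by (rule s_pos)
  have K: "KB \<ge> 0" using KB(1) by linarith
  have wb: "\<bar>w i m j t * z\<bar> \<le> 8 * KB / s m ^ i * Z'" if "i \<le> 2" "\<bar>z\<bar> \<le> Z'" for i j z Z'
    unfolding abs_mult by (intro mult_mono w_bound that) (use sm K in auto)
  have "G0 f m t - q = (\<Sum>j\<in>J m. w 0 m j t * (P f (rep m j) t - q))"
    using ws[of 0] by (simp add: G0_def right_diff_distrib sum_subtractf sum_distrib_right[symmetric])
  moreover have "\<bar>\<Sum>j\<in>J m. w 0 m j t * (P f (rep m j) t - q)\<bar> \<le> 2 * (8 * KB * Y)"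
  proof (rule abs_sum_two_active[OF finite_J, of "t / s m"])
    fix j assume "\<bar>t / s m - real_of_int j\<bar> < 1"
    from wb[of 0 _ _ j, OF _ YZ(1)[OF this]] show "\<bar>w 0 m j t * (P f (rep m j) t - q)\<bar> \<le> 8 * KB * Y" by simp
  qed (use K YZ in \<open>auto simp: w_outside\<close>)
  ultimately show "\<bar>G0 f m t - q\<bar> \<le> 16 * KB * Y" by simp
  have "G1 f m t - b = (\<Sum>j\<in>J m. w 1 m j t * (P f (rep m j) t - q) + w 0 m j t * (A f (rep m j) - b))"
    using ws[of 0] ws[of 1] by (simp add: G1_def right_diff_distrib sum_subtractf sum.distrib sum_distrib_right[symmetric])
  moreover have "\<bar>\<Sum>j\<in>J m. w 1 m j t * (P f (rep m j) t - q) + w 0 m j t * (A f (rep m j) - b)\<bar> \<le> 2 * (8 * KB * (Y / s m + Z))"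
  proof (rule abs_sum_two_active[OF finite_J, of "t / s m"])
    fix j assume a: "\<bar>t / s m - real_of_int j\<bar> < 1"
    have "\<bar>w 1 m j t * (P f (rep m j) t - q)\<bar> \<le> 8 * KB / s m * Y"
      "\<bar>w 0 m j t * (A f (rep m j) - b)\<bar> \<le> 8 * KB * Z"
      using wb[of 1 _ _ j, OF _ YZ(1)[OF a]] wb[of 0 _ _ j, OF _ YZ(2)[OF a]] by simp_all
    then have "\<bar>w 1 m j t * (P f (rep m j) t - q)\<bar> + \<bar>w 0 m j t * (A f (rep m j) - b)\<bar> \<le> 8 * KB / s m * Y + 8 * KB * Z"
      by (rule add_mono)
    then show "\<bar>w 1 m j t * (P f (rep m j) t - q) + w 0 m j t * (A f (rep m j) - b)\<bar> \<le> 8 * KB * (Y / s m + Z)"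
      by (intro order_trans[OF abs_triangle_ineq]) (simp add: algebra_simps)
  qed (use K YZ sm in \<open>auto simp: w_outside\<close>)
  ultimately show "\<bar>G1 f m t - b\<bar> \<le> 16 * KB * (Y / s m + Z)" by simp
  have "G2 f m t = (\<Sum>j\<in>J m. w 2 m j t * (P f (rep m j) t - q) + 2 * (w 1 m j t * (A f (rep m j) - b)))"
    using ws[of 1] ws[of 2]
    by (simp add: G2_def right_diff_distrib sum_subtractf sum.distrib sum_distrib_right[symmetric] sum_distrib_left[symmetric] mult.assoc)
  moreover have "\<bar>\<Sum>j\<in>J m. w 2 m j t * (P f (rep m j) t - q) + 2 * (w 1 m j t * (A f (rep m j) - b))\<bar> \<le> 2 * (8 * KB * (Y / (s m)\<^sup>2 + 2 * Z / s m))"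
  proof (rule abs_sum_two_active[OF finite_J, of "t / s m"])
    fix j assume a: "\<bar>t / s m - real_of_int j\<bar> < 1"
    have "\<bar>w 2 m j t * (P f (rep m j) t - q)\<bar> \<le> 8 * KB / (s m)\<^sup>2 * Y"
      "\<bar>2 * (w 1 m j t * (A f (rep m j) - b))\<bar> \<le> 2 * (8 * KB / s m * Z)"
      using wb[of 2 _ _ j, OF _ YZ(1)[OF a]] wb[of 1 _ _ j, OF _ YZ(2)[OF a]] by simp_all
    then have "\<bar>w 2 m j t * (P f (rep m j) t - q)\<bar> + \<bar>2 * (w 1 m j t * (A f (rep m j) - b))\<bar> \<le> 8 * KB / (s m)\<^sup>2 * Y + 2 * (8 * KB / s m * Z)"
      by (rule add_mono)
    then show "\<bar>w 2 m j t * (P f (rep m j) t - q) + 2 * (w 1 m j t * (A f (rep m j) - b))\<bar> \<le> 8 * KB * (Y / (s m)\<^sup>2 + 2 * Z / s m)"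
      by (intro order_trans[OF abs_triangle_ineq]) (simp add: algebra_simps)
  qed (use K YZ sm in \<open>auto simp: w_outside\<close>)
  ultimately show "\<bar>G2 f m t\<bar> \<le> 16 * KB * (Y / (s m)\<^sup>2 + 2 * Z / s m)" by simp
qed

lemma scaled_less_1: "\<bar>t / s m - real_of_int j\<bar> < 1 \<longleftrightarrow> \<bar>t - real_of_int j * s m\<bar> < s m"
proof -
  have eq: "t / s m - real_of_int j = (t - real_of_int j * s m) / s m" using s_pos[of m] by (simp add: field_simps)
  show ?thesis unfolding eq abs_divide using s_pos[of m] by (simp add: pos_divide_less_eq)
qed

text \<open>\<open>near m x\<close> forces the cutoff of level m to be 1 with vanishing derivatives
  (\<open>near_cut\<close>), and failure of \<open>act m x\<close> forces all of them to vanish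
  (\<open>not_act_cut\<close>). The levels in between are transitional.\<close>

definition near :: "nat \<Rightarrow> real^2 \<Rightarrow> bool" where
  "near m x \<longleftrightarrow> (\<exists>e\<in>E. \<bar>tau x - tau e\<bar> < s m \<and> \<bar>eta x - eta e\<bar> < s m)"

definition act :: "nat \<Rightarrow> real^2 \<Rightarrow> bool" where
  "act m x \<longleftrightarrow> (\<exists>j\<in>J' m. \<bar>tau x / s m - real_of_int j\<bar> < 1 \<and> \<bar>eta x - eta (rep m j)\<bar> < 9 * s m)"

lemma near_J': "near m x \<Longrightarrow> \<bar>tau x / s m - real_of_int j\<bar> < 1 \<Longrightarrow> j \<in> J' m"
proof -
  assume a: "near m x" "\<bar>tau x / s m - real_of_int j\<bar> < 1"
  then obtain e where e: "e \<in> E" "\<bar>tau x - tau e\<bar> < s m" by (auto simp: near_def)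
  have "\<bar>tau x - real_of_int j * s m\<bar> < s m" using a(2) by (simp only: scaled_less_1)
  then have "\<bar>tau e - real_of_int j * s m\<bar> < 2 * s m" using e(2) by linarith
  then show ?thesis using e(1) by (auto simp: J'_def)
qed

lemma near_eta:
  assumes "near m x" "\<bar>tau x / s m - real_of_int j\<bar> < 1"
  shows "\<bar>eta x - eta (rep m j)\<bar> \<le> 6 * s m" "x \<in> box m j"
proof -
  obtain e where e: "e \<in> E" "\<bar>tau x - tau e\<bar> < s m" "\<bar>eta x - eta e\<bar> < s m" using assms(1) by (auto simp: near_def)
  have j: "j \<in> J m" using near_J'[OF assms] J'_subset by blast
  have a: "\<bar>tau x - real_of_int j * s m\<bar> < s m" using assms(2) by (simp add: scaled_less_1)
  have tx: "\<bar>tau x - tau (rep m j)\<bar> \<le> s m + 3 * s m"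
    by (rule abs_diff_triangle[of _ "real_of_int j * s m"]) (use a rep(2)[OF j] in \<open>simp_all add: abs_minus_commute\<close>)
  have "\<bar>tau e - tau (rep m j)\<bar> \<le> s m + (s m + 3 * s m)"
    by (rule abs_diff_triangle[of _ "tau x"]) (use e tx in \<open>simp_all add: abs_minus_commute\<close>)
  then have ee: "\<bar>eta e - eta (rep m j)\<bar> \<le> s m + (s m + 3 * s m)" using lip[OF e(1) rep(1)[OF j]] by (rule order_trans[rotated])
  have "\<bar>eta x - eta (rep m j)\<bar> \<le> s m + (s m + (s m + 3 * s m))"
    by (rule abs_diff_triangle[OF less_imp_le[OF e(3)] ee])
  then show 1: "\<bar>eta x - eta (rep m j)\<bar> \<le> 6 * s m" by simp
  show "x \<in> box m j" using 1 tx s_pos[of m] unfolding box_def by simp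
qed

lemma near_cut: assumes "near m x" shows "cut a b m x = (if a = 0 \<and> b = 0 then 1 else 0)"
proof -
  have "cut a b m x = (\<Sum>j\<in>J' m. w a m j (tau x) * (if b = 0 then 1 else 0))"
    unfolding cut_def
  proof (intro sum.cong refl)
    fix j
    show "w a m j (tau x) * (ch b ((eta x - eta (rep m j)) / s m) / s m ^ b) = w a m j (tau x) * (if b = 0 then 1 else 0)"
    proof (cases "\<bar>tau x / s m - real_of_int j\<bar> < 1")
      case True
      have "\<bar>(eta x - eta (rep m j)) / s m\<bar> \<le> 7"
        using near_eta(1)[OF assms True] s_pos[of m] by (simp add: abs_divide pos_divide_le_eq)
      then show ?thesis by (simp add: ch_inside)
    qed (simp add: w_outside)
  qed
  also have "\<dots> = (if a = 0 \<and> b = 0 then 1 else 0)"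
  proof -
    have "(\<Sum>j\<in>J' m. w a m j (tau x)) = (if a = 0 then 1 else 0)"
      by (rule w_sum[OF finite_J' near_J'[OF assms]])
    then show ?thesis by (simp add: sum_distrib_right[symmetric])
  qed
  finally show ?thesis .
qed

lemma not_act_cut: "\<not> act m x \<Longrightarrow> cut a b m x = 0"
  unfolding cut_def
proof (rule sum.neutral, rule ballI)
  fix j assume n: "\<not> act m x" and j: "j \<in> J' m"
  show "w a m j (tau x) * (ch b ((eta x - eta (rep m j)) / s m) / s m ^ b) = 0"
  proof (cases "\<bar>tau x / s m - real_of_int j\<bar> < 1")
    case True
    then have "\<bar>eta x - eta (rep m j)\<bar> \<ge> 9 * s m" using n j by (auto simp: act_def)
    then have "\<bar>(eta x - eta (rep m j)) / s m\<bar> \<ge> 9"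
      using s_pos[of m] by (simp add: abs_divide pos_le_divide_eq)
    then show ?thesis by (simp add: ch_outside)
  qed (simp add: w_outside)
qed

lemma cut_bound: assumes "a \<le> 2" "b \<le> 2" shows "\<bar>cut a b m x\<bar> \<le> 32 * KB\<^sup>2 / s m ^ (a + b)"
proof -
  have sm: "s m > 0" by (rule s_pos)
  have K: "KB \<ge> 0" using KB(1) by linarith
  have "\<bar>cut a b m x\<bar> \<le> 2 * (8 * KB / s m ^ a * (2 * KB / s m ^ b))"
    unfolding cut_def
  proof (rule abs_sum_two_active[OF finite_J', of "tau x / s m"])
    fix j
    have "\<bar>ch b ((eta x - eta (rep m j)) / s m) / s m ^ b\<bar> \<le> 2 * KB / s m ^ b"
      using ch_bound[OF assms(2)] sm by (simp add: abs_divide divide_right_mono)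
    then show "\<bar>w a m j (tau x) * (ch b ((eta x - eta (rep m j)) / s m) / s m ^ b)\<bar> \<le> 8 * KB / s m ^ a * (2 * KB / s m ^ b)"
      unfolding abs_mult by (intro mult_mono w_bound assms) (use sm K in auto)
  qed (use sm K in \<open>auto simp: w_outside\<close>)
  then show ?thesis by (simp add: power_add power2_eq_square field_simps)
qed

text \<open>An active index differs by at most 1 from the index in \<open>J'\<close> that witnesses
  \<open>act\<close>, whose point of \<open>E\<close> is then within 2 + 1 grid steps. Heights: 9
  from the cutoff plus 8 from the distance of the two representatives.\<close>

lemma act_J:
  assumes "act m x" "\<bar>tau x / s m - real_of_int j\<bar> < 1"
  shows "j \<in> J m" "x \<in> box m j"
proof -
  obtain j0 e where j0: "j0 \<in> J' m" "\<bar>tau x / s m - real_of_int j0\<bar> < 1" "\<bar>eta x - eta (rep m j0)\<bar> < 9 * s m"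
    and e: "e \<in> E" "\<bar>tau e - real_of_int j0 * s m\<bar> < 2 * s m" using assms(1) by (auto simp: act_def J'_def)
  have a: "\<bar>tau x - real_of_int j * s m\<bar> < s m" "\<bar>tau x - real_of_int j0 * s m\<bar> < s m"
    using assms(2) j0(2) by (simp_all add: scaled_less_1)
  have "\<bar>real_of_int j - real_of_int j0\<bar> < 2" using assms(2) j0(2) by linarith
  then have "\<bar>j - j0\<bar> \<le> 1" by linarith
  then have "\<bar>real_of_int (j - j0)\<bar> * s m \<le> 1 * s m" using s_pos[of m] by (intro mult_right_mono) auto
  then have "\<bar>real_of_int j * s m - real_of_int j0 * s m\<bar> \<le> s m"
    using s_pos[of m] by (simp add: left_diff_distrib[symmetric] abs_mult)
  then have "\<bar>tau e - real_of_int j * s m\<bar> \<le> 3 * s m" using e by linarith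
  then show j: "j \<in> J m" using e by (auto simp: J_def)
  have jj: "j0 \<in> J m" using j0 J'_subset by blast
  have tx: "\<bar>tau x - tau (rep m j)\<bar> \<le> s m + 3 * s m"
    by (rule abs_diff_triangle[of _ "real_of_int j * s m"]) (use a rep(2)[OF j] in \<open>simp_all add: abs_minus_commute\<close>)
  have tx0: "\<bar>tau x - tau (rep m j0)\<bar> \<le> s m + 3 * s m"
    by (rule abs_diff_triangle[of _ "real_of_int j0 * s m"]) (use a rep(2)[OF jj] in \<open>simp_all add: abs_minus_commute\<close>)
  have "\<bar>tau (rep m j0) - tau (rep m j)\<bar> \<le> (s m + 3 * s m) + (s m + 3 * s m)"
    by (rule abs_diff_triangle[of _ "tau x"]) (use tx tx0 in \<open>simp_all add: abs_minus_commute\<close>)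
  then have ee: "\<bar>eta (rep m j0) - eta (rep m j)\<bar> \<le> (s m + 3 * s m) + (s m + 3 * s m)"
    using lip[OF rep(1)[OF jj] rep(1)[OF j]] by (rule order_trans[rotated])
  have "\<bar>eta x - eta (rep m j)\<bar> \<le> 9 * s m + ((s m + 3 * s m) + (s m + 3 * s m))"
    by (rule abs_diff_triangle[OF less_imp_le[OF j0(3)] ee])
  then show "x \<in> box m j" using tx s_pos[of m] unfolding box_def by simp
qed

text \<open>Some point of \<open>E\<close> lies within 3 \<open>s m\<close> of x in the coordinate
  \<open>tau\<close>, hence within 5 \<open>s m\<close> of the coarser grid point, and 3
  \<open>s (m - 1)\<close> is 6 \<open>s m\<close>.\<close>

lemma act_J_pred:
  assumes "act m x" "m \<ge> 1" "\<bar>tau x / s (m - 1) - real_of_int i\<bar> < 1"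
  shows "i \<in> J (m - 1)" "x \<in> box (m - 1) i"
proof -
  obtain j0 e where j0: "j0 \<in> J' m" "\<bar>tau x / s m - real_of_int j0\<bar> < 1" "\<bar>eta x - eta (rep m j0)\<bar> < 9 * s m"
    and e: "e \<in> E" "\<bar>tau e - real_of_int j0 * s m\<bar> < 2 * s m" using assms(1) by (auto simp: act_def J'_def)
  have s2: "s (m - 1) = 2 * s m" using s_pred assms(2) by blast
  have a: "\<bar>tau x - real_of_int i * s (m - 1)\<bar> < s (m - 1)" "\<bar>tau x - real_of_int j0 * s m\<bar> < s m"
    using assms(3) j0(2) by (simp_all add: scaled_less_1)
  have "\<bar>tau e - tau x\<bar> \<le> 2 * s m + s m"
    by (rule abs_diff_triangle[of _ "real_of_int j0 * s m"]) (use a e in \<open>simp_all add: abs_minus_commute\<close>)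
  from abs_diff_triangle[OF this less_imp_le[OF a(1)]]
  have "\<bar>tau e - real_of_int i * s (m - 1)\<bar> \<le> 3 * s (m - 1)" using s2 s_pos[of m] by simp
  then show i: "i \<in> J (m - 1)" using e by (auto simp: J_def)
  have jj: "j0 \<in> J m" using j0 J'_subset by blast
  have tx: "\<bar>tau x - tau (rep (m - 1) i)\<bar> \<le> s (m - 1) + 3 * s (m - 1)"
    by (rule abs_diff_triangle[of _ "real_of_int i * s (m - 1)"]) (use a rep(2)[OF i] in \<open>simp_all add: abs_minus_commute\<close>)
  have tx0: "\<bar>tau x - tau (rep m j0)\<bar> \<le> s m + 3 * s m"
    by (rule abs_diff_triangle[of _ "real_of_int j0 * s m"]) (use a rep(2)[OF jj] in \<open>simp_all add: abs_minus_commute\<close>)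
  have "\<bar>tau (rep m j0) - tau (rep (m - 1) i)\<bar> \<le> (s m + 3 * s m) + (s (m - 1) + 3 * s (m - 1))"
    by (rule abs_diff_triangle[of _ "tau x"]) (use tx tx0 in \<open>simp_all add: abs_minus_commute\<close>)
  then have ee: "\<bar>eta (rep m j0) - eta (rep (m - 1) i)\<bar> \<le> (s m + 3 * s m) + (s (m - 1) + 3 * s (m - 1))"
    using lip[OF rep(1)[OF jj] rep(1)[OF i]] by (rule order_trans[rotated])
  have "\<bar>eta x - eta (rep (m - 1) i)\<bar> \<le> 9 * s m + ((s m + 3 * s m) + (s (m - 1) + 3 * s (m - 1)))"
    by (rule abs_diff_triangle[OF less_imp_le[OF j0(3)] ee])
  then show "x \<in> box (m - 1) i" using tx s2 s_pos[of m] unfolding box_def by simp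
qed

lemma same_level_Lam:
  assumes "m \<le> N" "j \<in> J m" "i \<in> J m" "\<bar>t / s m - real_of_int j\<bar> < 1" "\<bar>t / s m - real_of_int i\<bar> < 1"
  shows "\<exists>d. (m, j, d) \<in> Lam \<and> par m j d = rep m i"
proof -
  have "\<bar>real_of_int j - real_of_int i\<bar> < 2" using assms(4,5) by linarith
  then have "\<bar>j - i\<bar> \<le> 1" by linarith
  then have "nat (i - j + 1) < 3" "j + int (nat (i - j + 1)) - 1 = i" by auto
  then show ?thesis using assms by (intro exI[of _ "nat (i - j + 1)"]) (simp add: Lam_def par_def)
qed

lemma cross_level_Lam:
  assumes "1 \<le> m" "m \<le> N" "j \<in> J m" "i \<in> J (m - 1)" "\<bar>t / s m - real_of_int j\<bar> < 1" "\<bar>t / s (m - 1) - real_of_int i\<bar> < 1"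
  shows "\<exists>d. (m, j, d) \<in> Lam \<and> par m j d = rep (m - 1) i"
proof -
  \<comment> \<open>Doubling gives |j - 2 i| < 3, so \<open>j div 2\<close> and i differ by at most
    1 and the coarser neighbour is one of the three that are coded.\<close>
  have "t / s m = 2 * (t / s (m - 1))" using s_pred[OF assms(1)] by simp
  then have "\<bar>real_of_int j - 2 * real_of_int i\<bar> < 3" using assms(5,6) by linarith
  then have "\<bar>j - 2 * i\<bar> \<le> 2" by linarith
  then have "j div 2 - i \<le> 1" "i - j div 2 \<le> 1" by linarith+
  then have "\<not> nat (i - j div 2 + 4) < 3" "nat (i - j div 2 + 4) < 6" "j div 2 + int (nat (i - j div 2 + 4)) - 4 = i" by auto
  then show ?thesis using assms by (intro exI[of _ "nat (i - j div 2 + 4)"]) (simp add: Lam_def par_def)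
qed

lemma floor_active: "\<bar>y - real_of_int \<lfloor>y\<rfloor>\<bar> < 1" by linarith

lemma near_G2_bound:
  assumes p: "p > 0" and m: "m \<le> N" "near m x"
  shows "\<bar>G2 f m (tau x)\<bar> \<le> 368 * KB * T p f x"
proof -
  let ?i = "\<lfloor>tau x / s m\<rfloor>"
  have act: "j \<in> J m" if "\<bar>tau x / s m - real_of_int j\<bar> < 1" for j
    using near_J'[OF m(2) that] J'_subset by blast
  have sm: "s m > 0" by (rule s_pos)
  have pb: "\<bar>P f (rep m j) (tau x) - P f (rep m ?i) (tau x)\<bar> \<le> 21 * (s m)\<^sup>2 * T p f x \<and> \<bar>A f (rep m j) - A f (rep m ?i)\<bar> \<le> s m * T p f x"
    if j: "\<bar>tau x / s m - real_of_int j\<bar> < 1" for j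
  proof -
    obtain d where "(m, j, d) \<in> Lam" "par m j d = rep m ?i"
      using same_level_Lam[OF m(1) act[OF j] act[OF floor_active] j floor_active] by blast
    then show ?thesis using pair_bounds[OF p _ near_eta(2)[OF m(2) j], of d f] by simp
  qed
  have "\<bar>G2 f m (tau x)\<bar> \<le> 16 * KB * (21 * (s m)\<^sup>2 * T p f x / (s m)\<^sup>2 + 2 * (s m * T p f x) / s m)"
    by (rule G_bounds(3)[OF act conjunct1[OF pb] conjunct2[OF pb]]) (use T_nonneg[of p f x] sm in simp_all)
  then show ?thesis using sm by (simp add: algebra_simps)
qed

text \<open>Both levels are compared with a single affine function, that of the coarser grid
  interval containing \<open>tau x\<close>; at the coarsest level with 0. Since
  \<open>s (m - 1)\<close> squared is four times \<open>s m\<close> squared, the largest constant is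
  336 + 4 * 336 = 1680.\<close>

lemma act_D_bounds:
  assumes p: "p > 0" and m: "m \<le> N" "act m x"
  shows "\<bar>D0 f m (tau x)\<bar> \<le> 1680 * KB * (s m)\<^sup>2 * T p f x"
    and "\<bar>D1 f m (tau x)\<bar> \<le> 1680 * KB * s m * T p f x"
    and "\<bar>D2 f m (tau x)\<bar> \<le> 1680 * KB * T p f x"
proof -
  let ?t = "tau x" and ?T = "T p f x"
  have sm: "s m > 0" by (rule s_pos)
  have K: "KB \<ge> 0" using KB(1) by linarith
  have T0: "?T \<ge> 0" by (rule T_nonneg)
  note actm = act_J[OF m(2)]
  have pos: "KB * (s m)\<^sup>2 * ?T \<ge> 0" "KB * s m * ?T \<ge> 0" "KB * ?T \<ge> 0" using K sm T0 by auto
  have "\<bar>D0 f m ?t\<bar> \<le> 1680 * (KB * (s m)\<^sup>2 * ?T) \<and> \<bar>D1 f m ?t\<bar> \<le> 1680 * (KB * s m * ?T) \<and> \<bar>D2 f m ?t\<bar> \<le> 1680 * (KB * ?T)"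
  proof (cases "m = 0")
    case True
    have z: "\<bar>P f (rep m j) ?t - 0\<bar> \<le> 21 * (s m)\<^sup>2 * ?T \<and> \<bar>A f (rep m j) - 0\<bar> \<le> s m * ?T"
      if j: "\<bar>?t / s m - real_of_int j\<bar> < 1" for j
    proof -
      have b: "j \<in> J 0" "x \<in> box 0 j" using actm[OF j] True by auto
      have "\<bar>P f (rep m j) ?t\<bar> \<le> \<bar>f (rep m j)\<bar> + \<bar>A f (rep m j)\<bar> * \<bar>?t - tau (rep m j)\<bar>"
        unfolding P_def by (metis abs_mult abs_triangle_ineq)
      also have "\<dots> \<le> (s m)\<^sup>2 * ?T + (s m * ?T) * (20 * s m)"
        using T_bounds(3,4)[OF p b, of f] True b(2) sm T0 by (intro add_mono mult_mono) (auto simp: box_def)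
      also have "\<dots> = 21 * (s m)\<^sup>2 * ?T" by (simp add: power2_eq_square algebra_simps)
      finally show ?thesis using T_bounds(3)[OF p b, of f] True by simp
    qed
    have "\<bar>G0 f m ?t - 0\<bar> \<le> 16 * KB * (21 * (s m)\<^sup>2 * ?T)" "\<bar>G1 f m ?t - 0\<bar> \<le> 16 * KB * (21 * (s m)\<^sup>2 * ?T / s m + s m * ?T)"
      "\<bar>G2 f m ?t\<bar> \<le> 16 * KB * (21 * (s m)\<^sup>2 * ?T / (s m)\<^sup>2 + 2 * (s m * ?T) / s m)"
    proof -
      have YZ: "21 * (s m)\<^sup>2 * ?T \<ge> 0" "s m * ?T \<ge> 0" using T0 sm by simp_all
      note gb = G_bounds[where t = ?t and q = 0 and b = 0 and Y = "21 * (s m)\<^sup>2 * ?T" and Z = "s m * ?T", OF actm(1) conjunct1[OF z] conjunct2[OF z] YZ]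
      show "\<bar>G0 f m ?t - 0\<bar> \<le> 16 * KB * (21 * (s m)\<^sup>2 * ?T)" by (rule gb(1))
      show "\<bar>G1 f m ?t - 0\<bar> \<le> 16 * KB * (21 * (s m)\<^sup>2 * ?T / s m + s m * ?T)" by (rule gb(2))
      show "\<bar>G2 f m ?t\<bar> \<le> 16 * KB * (21 * (s m)\<^sup>2 * ?T / (s m)\<^sup>2 + 2 * (s m * ?T) / s m)" by (rule gb(3))
    qed
    then have "\<bar>G0 f m ?t\<bar> \<le> 336 * (KB * (s m)\<^sup>2 * ?T)" "\<bar>G1 f m ?t\<bar> \<le> 352 * (KB * s m * ?T)" "\<bar>G2 f m ?t\<bar> \<le> 368 * (KB * ?T)"
      using sm by (simp_all add: power2_eq_square algebra_simps)
    moreover have "336 * (KB * (s m)\<^sup>2 * ?T) \<le> 1680 * (KB * (s m)\<^sup>2 * ?T)" "352 * (KB * s m * ?T) \<le> 1680 * (KB * s m * ?T)"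
      "368 * (KB * ?T) \<le> 1680 * (KB * ?T)" using pos by simp_all
    ultimately have "\<bar>G0 f m ?t\<bar> \<le> 1680 * (KB * (s m)\<^sup>2 * ?T) \<and> \<bar>G1 f m ?t\<bar> \<le> 1680 * (KB * s m * ?T) \<and> \<bar>G2 f m ?t\<bar> \<le> 1680 * (KB * ?T)"
      by (blast intro: order_trans)
    then show ?thesis using True by (simp add: D0_def D1_def D2_def pred_def)
  next
    case False
    then have m1: "m \<ge> 1" "m - 1 \<le> N" using m by auto
    have s2: "s (m - 1) = 2 * s m" using s_pred m1 by blast
    let ?i = "\<lfloor>?t / s (m - 1)\<rfloor>"
    note actp = act_J_pred[OF m(2) m1(1)]
    let ?q = "P f (rep (m - 1) ?i) ?t" and ?b = "A f (rep (m - 1) ?i)"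
    have z: "\<bar>P f (rep m j) ?t - ?q\<bar> \<le> 21 * (s m)\<^sup>2 * ?T \<and> \<bar>A f (rep m j) - ?b\<bar> \<le> s m * ?T"
      if j: "\<bar>?t / s m - real_of_int j\<bar> < 1" for j
    proof -
      obtain d where "(m, j, d) \<in> Lam" "par m j d = rep (m - 1) ?i"
        using cross_level_Lam[OF m1(1) m(1) actm(1)[OF j] actp(1)[OF floor_active] j floor_active] by blast
      then show ?thesis using pair_bounds[OF p _ actm(2)[OF j], of d f] by simp
    qed
    have z': "\<bar>P f (rep (m - 1) j) ?t - ?q\<bar> \<le> 21 * (s (m - 1))\<^sup>2 * ?T \<and> \<bar>A f (rep (m - 1) j) - ?b\<bar> \<le> s (m - 1) * ?T"
      if j: "\<bar>?t / s (m - 1) - real_of_int j\<bar> < 1" for j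
    proof -
      obtain d where "(m - 1, j, d) \<in> Lam" "par (m - 1) j d = rep (m - 1) ?i"
        using same_level_Lam[OF m1(2) actp(1)[OF j] actp(1)[OF floor_active] j floor_active] by blast
      then show ?thesis using pair_bounds[OF p _ actp(2)[OF j], of d f] by simp
    qed
    have "\<bar>G0 f m ?t - ?q\<bar> \<le> 16 * KB * (21 * (s m)\<^sup>2 * ?T)" "\<bar>G1 f m ?t - ?b\<bar> \<le> 16 * KB * (21 * (s m)\<^sup>2 * ?T / s m + s m * ?T)"
      "\<bar>G2 f m ?t\<bar> \<le> 16 * KB * (21 * (s m)\<^sup>2 * ?T / (s m)\<^sup>2 + 2 * (s m * ?T) / s m)"
    proof -
      have YZ: "21 * (s m)\<^sup>2 * ?T \<ge> 0" "s m * ?T \<ge> 0" using T0 sm by simp_all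
      note gb = G_bounds[where t = ?t and q = ?q and b = ?b and Y = "21 * (s m)\<^sup>2 * ?T" and Z = "s m * ?T", OF actm(1) conjunct1[OF z] conjunct2[OF z] YZ]
      show "\<bar>G0 f m ?t - ?q\<bar> \<le> 16 * KB * (21 * (s m)\<^sup>2 * ?T)" by (rule gb(1))
      show "\<bar>G1 f m ?t - ?b\<bar> \<le> 16 * KB * (21 * (s m)\<^sup>2 * ?T / s m + s m * ?T)" by (rule gb(2))
      show "\<bar>G2 f m ?t\<bar> \<le> 16 * KB * (21 * (s m)\<^sup>2 * ?T / (s m)\<^sup>2 + 2 * (s m * ?T) / s m)" by (rule gb(3))
    qed
    then have 1: "\<bar>G0 f m ?t - ?q\<bar> \<le> 336 * (KB * (s m)\<^sup>2 * ?T)" "\<bar>G1 f m ?t - ?b\<bar> \<le> 352 * (KB * s m * ?T)" "\<bar>G2 f m ?t\<bar> \<le> 368 * (KB * ?T)"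
      using sm by (simp_all add: power2_eq_square algebra_simps)
    have sm': "s (m - 1) > 0" by (rule s_pos)
    have "\<bar>G0 f (m - 1) ?t - ?q\<bar> \<le> 16 * KB * (21 * (s (m - 1))\<^sup>2 * ?T)"
      "\<bar>G1 f (m - 1) ?t - ?b\<bar> \<le> 16 * KB * (21 * (s (m - 1))\<^sup>2 * ?T / s (m - 1) + s (m - 1) * ?T)"
      "\<bar>G2 f (m - 1) ?t\<bar> \<le> 16 * KB * (21 * (s (m - 1))\<^sup>2 * ?T / (s (m - 1))\<^sup>2 + 2 * (s (m - 1) * ?T) / s (m - 1))"
    proof -
      have YZ: "21 * (s (m - 1))\<^sup>2 * ?T \<ge> 0" "s (m - 1) * ?T \<ge> 0" using T0 sm' by simp_all
      note gb = G_bounds[where t = ?t and q = ?q and b = ?b and Y = "21 * (s (m - 1))\<^sup>2 * ?T" and Z = "s (m - 1) * ?T", OF actp(1) conjunct1[OF z'] conjunct2[OF z'] YZ]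
      show "\<bar>G0 f (m - 1) ?t - ?q\<bar> \<le> 16 * KB * (21 * (s (m - 1))\<^sup>2 * ?T)" by (rule gb(1))
      show "\<bar>G1 f (m - 1) ?t - ?b\<bar> \<le> 16 * KB * (21 * (s (m - 1))\<^sup>2 * ?T / s (m - 1) + s (m - 1) * ?T)" by (rule gb(2))
      show "\<bar>G2 f (m - 1) ?t\<bar> \<le> 16 * KB * (21 * (s (m - 1))\<^sup>2 * ?T / (s (m - 1))\<^sup>2 + 2 * (s (m - 1) * ?T) / s (m - 1))" by (rule gb(3))
    qed
    then have 2: "\<bar>G0 f (m - 1) ?t - ?q\<bar> \<le> 1344 * (KB * (s m)\<^sup>2 * ?T)" "\<bar>G1 f (m - 1) ?t - ?b\<bar> \<le> 704 * (KB * s m * ?T)"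
      "\<bar>G2 f (m - 1) ?t\<bar> \<le> 368 * (KB * ?T)"
      using sm unfolding s2 by (simp_all add: power2_eq_square algebra_simps)
    have tri: "\<bar>a - b\<bar> \<le> \<bar>a - c\<bar> + \<bar>b - c\<bar>" for a b c :: real by linarith
    have D: "D0 f m ?t = G0 f m ?t - G0 f (m - 1) ?t" "D1 f m ?t = G1 f m ?t - G1 f (m - 1) ?t"
      "D2 f m ?t = G2 f m ?t - G2 f (m - 1) ?t"
      using False by (simp_all add: D0_def D1_def D2_def pred_def)
    have "\<bar>D0 f m ?t\<bar> \<le> \<bar>G0 f m ?t - ?q\<bar> + \<bar>G0 f (m - 1) ?t - ?q\<bar>" "\<bar>D1 f m ?t\<bar> \<le> \<bar>G1 f m ?t - ?b\<bar> + \<bar>G1 f (m - 1) ?t - ?b\<bar>"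
      "\<bar>D2 f m ?t\<bar> \<le> \<bar>G2 f m ?t\<bar> + \<bar>G2 f (m - 1) ?t\<bar>"
      unfolding D by (rule tri, rule tri, rule abs_triangle_ineq4)
    note this(1)[THEN order_trans, OF add_mono[OF 1(1) 2(1)]] this(2)[THEN order_trans, OF add_mono[OF 1(2) 2(2)]]
      this(3)[THEN order_trans, OF add_mono[OF 1(3) 2(3)]]
    then show ?thesis using pos by (simp add: mult.assoc)
  qed
  then show "\<bar>D0 f m ?t\<bar> \<le> 1680 * KB * (s m)\<^sup>2 * ?T" "\<bar>D1 f m ?t\<bar> \<le> 1680 * KB * s m * ?T" "\<bar>D2 f m ?t\<bar> \<le> 1680 * KB * ?T"
    by (simp_all add: mult.assoc)
qed

text \<open>Each derivative on the cutoff costs 1 / \<open>s m\<close>, and each derivative not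
  falling on the increment gains \<open>s m\<close>, so the scale cancels in every term of the
  Hessian. 53760 is 32 * 1680.\<close>

lemma cut_D_bound:
  assumes p: "p > 0" and m: "m \<le> N" and ab: "a \<le> 2" "b \<le> 2"
  shows "a + b = 2 \<Longrightarrow> \<bar>cut a b m x * D0 f m (tau x)\<bar> \<le> 53760 * KB ^ 3 * T p f x"
    and "a + b = 1 \<Longrightarrow> \<bar>cut a b m x * D1 f m (tau x)\<bar> \<le> 53760 * KB ^ 3 * T p f x"
    and "a + b = 0 \<Longrightarrow> \<bar>cut a b m x * D2 f m (tau x)\<bar> \<le> 53760 * KB ^ 3 * T p f x"
proof -
  have sm: "s m > 0" by (rule s_pos)
  have K: "KB \<ge> 0" using KB(1) by linarith
  have T0: "T p f x \<ge> 0" by (rule T_nonneg)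
  have R: "53760 * KB ^ 3 * T p f x \<ge> 0" using K T0 by simp
  have main: "\<bar>cut a b m x * y\<bar> \<le> 53760 * KB ^ 3 * T p f x"
    if "act m x \<Longrightarrow> \<bar>y\<bar> \<le> 1680 * KB * s m ^ (a + b) * T p f x" for y
  proof (cases "act m x")
    case True
    have "\<bar>cut a b m x * y\<bar> \<le> 32 * KB\<^sup>2 / s m ^ (a + b) * (1680 * KB * s m ^ (a + b) * T p f x)"
      unfolding abs_mult using cut_bound[OF ab, of m x] that[OF True] K sm
      by (intro mult_mono) auto
    also have "\<dots> = 53760 * KB ^ 3 * T p f x" using sm by (simp add: power2_eq_square power3_eq_cube)
    finally show ?thesis .
  qed (use R not_act_cut in simp)
  show "a + b = 2 \<Longrightarrow> \<bar>cut a b m x * D0 f m (tau x)\<bar> \<le> 53760 * KB ^ 3 * T p f x"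
    by (rule main) (use act_D_bounds(1)[OF p m] in simp)
  show "a + b = 1 \<Longrightarrow> \<bar>cut a b m x * D1 f m (tau x)\<bar> \<le> 53760 * KB ^ 3 * T p f x"
    by (rule main) (use act_D_bounds(2)[OF p m] in simp)
  show "a + b = 0 \<Longrightarrow> \<bar>cut a b m x * D2 f m (tau x)\<bar> \<le> 53760 * KB ^ 3 * T p f x"
    by (rule main) (use act_D_bounds(3)[OF p m] in simp)
qed

text \<open>The first level at which x is too far from \<open>E\<close>, or N + 1. On coarser levels
  the cutoff is 1, and from four levels further on it vanishes at x by
  \<open>act_mono\<close>.\<close>

definition level :: "real^2 \<Rightarrow> nat" where
  "level x = (LEAST m. N < m \<or> \<not> near m x)"

lemma level: "N < level x \<or> \<not> near (level x) x" "m < level x \<Longrightarrow> m \<le> N \<and> near m x" "level x \<le> Suc N"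
proof -
  have "N < Suc N \<or> \<not> near (Suc N) x" by simp
  from LeastI[of "\<lambda>m. N < m \<or> \<not> near m x", OF this] Least_le[of "\<lambda>m. N < m \<or> \<not> near m x", OF this]
  show "N < level x \<or> \<not> near (level x) x" "level x \<le> Suc N" by (simp_all add: level_def)
  show "m < level x \<Longrightarrow> m \<le> N \<and> near m x"
    using not_less_Least[of m "\<lambda>m. N < m \<or> \<not> near m x"] by (auto simp: level_def)
qed

text \<open>Where the cutoff lives, x is within 4 and 9 times \<open>s (m + 4)\<close> of a
  representative in the two coordinates, and 16 \<open>s (m + 4)\<close> is
  \<open>s m\<close>.\<close>

lemma act_near_coarser: assumes "act (m + 4) x" shows "near m x"
proof -
  let ?m = "m + 4"
  obtain j where j: "j \<in> J' ?m" "\<bar>tau x / s ?m - real_of_int j\<bar> < 1" "\<bar>eta x - eta (rep ?m j)\<bar> < 9 * s ?m"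
    using assms by (auto simp: act_def)
  have jj: "j \<in> J ?m" using j J'_subset by blast
  have "\<bar>tau x - real_of_int j * s ?m\<bar> < s ?m" using j(2) by (simp only: scaled_less_1)
  moreover have "s ?m = s m / 16" by (simp add: s_add)
  ultimately have "\<bar>tau x - tau (rep ?m j)\<bar> < s m" "\<bar>eta x - eta (rep ?m j)\<bar> < s m"
    using rep(2)[OF jj] j(3) s_pos[of m] by linarith+
  then show ?thesis using rep(1)[OF jj] by (auto simp: near_def)
qed

lemma act_mono: assumes "act m' x" "m + 4 \<le> m'" shows "near m x"
proof -
  have "near (m' - 4) x" using act_near_coarser[of "m' - 4" x] assms by simp
  moreover have "s (m' - 4) \<le> s m" using assms by (intro s_mono) simp
  ultimately show ?thesis unfolding near_def by (meson less_le_trans)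
qed

text \<open>At most four levels are transitional, so the number of levels does not enter the
  bound.\<close>

lemma sum_levels_bound:
  fixes X :: "nat \<Rightarrow> real"
  assumes fine: "\<And>m. level x \<le> m \<Longrightarrow> m \<le> N \<Longrightarrow> \<bar>X m\<bar> \<le> B" "B \<ge> 0"
    and inact: "\<And>m. \<not> act m x \<Longrightarrow> X m = 0"
    and coarse: "\<bar>\<Sum>m<level x. X m\<bar> \<le> B'"
  shows "\<bar>\<Sum>m\<le>N. X m\<bar> \<le> B' + 4 * B"
proof -
  let ?M = "level x"
  have "{..N} = {..<?M} \<union> {?M..N}" using level(3)[of x] by auto
  moreover have "{..<?M} \<inter> {?M..N} = {}" by auto
  ultimately have "(\<Sum>m\<le>N. X m) = (\<Sum>m<?M. X m) + (\<Sum>m=?M..N. X m)" by (simp add: sum.union_disjoint)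
  moreover have "\<bar>\<Sum>m=?M..N. X m\<bar> \<le> 4 * B"
  proof -
    have "(\<Sum>m=?M..N. X m) = (\<Sum>m\<in>{?M..N} \<inter> {?M..<?M + 4}. X m)"
    proof (rule sum.mono_neutral_right, simp, simp, rule ballI, rule inact, rule notI)
      fix m assume "m \<in> {?M..N} - {?M..N} \<inter> {?M..<?M + 4}" "act m x"
      then show False using act_mono[of m x ?M] level(1)[of x] by auto
    qed
    then have "\<bar>\<Sum>m=?M..N. X m\<bar> = \<bar>\<Sum>m\<in>{?M..N} \<inter> {?M..<?M + 4}. X m\<bar>" by simp
    also have "\<dots> \<le> (\<Sum>m\<in>{?M..N} \<inter> {?M..<?M + 4}. \<bar>X m\<bar>)" by (rule sum_abs)
    also have "\<dots> \<le> of_nat (card ({?M..N} \<inter> {?M..<?M + 4})) * B" by (rule sum_bounded_above) (use fine in auto)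
    also have "\<dots> \<le> 4 * B"
    proof (rule mult_right_mono[OF _ fine(2)])
      have "card ({?M..N} \<inter> {?M..<?M + 4}) \<le> card {?M..<?M + 4}" by (intro card_mono) auto
      then show "of_nat (card ({?M..N} \<inter> {?M..<?M + 4})) \<le> (4::real)" by simp
    qed
    finally show ?thesis .
  qed
  ultimately show ?thesis using coarse by linarith
qed

lemma sum_D2_telescope: "(\<Sum>m<k. D2 f m t) = (if k = 0 then 0 else G2 f (k - 1) t)"
  by (induction k) (auto simp: D2_def pred_def)

text \<open>On the coarse levels only second derivatives of the increments survive, and they
  telescope to one \<open>G2\<close>; the mixed and normal entries have no coarse part. The largest
  total, 16 * 53760 + 368, is below 10^6.\<close>

theorem ext_hessian_bound:
  assumes p: "p > 0"
  shows "\<bar>ext11 f x\<bar> \<le> 1000000 * KB ^ 3 * T p f x" "\<bar>ext12 f x\<bar> \<le> 1000000 * KB ^ 3 * T p f x"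
    "\<bar>ext22 f x\<bar> \<le> 1000000 * KB ^ 3 * T p f x"
proof -
  let ?B = "53760 * KB ^ 3 * T p f x"
  have K: "KB ^ 3 \<ge> KB" using KB(1) by (intro self_le_power) auto
  have K0: "KB \<ge> 0" using KB(1) by linarith
  have T0: "T p f x \<ge> 0" by (rule T_nonneg)
  have B0: "?B \<ge> 0" using K0 T0 by simp
  have le: "368 * KB * T p f x \<le> 368 * KB ^ 3 * T p f x" using K T0 by (intro mult_right_mono) auto
  have KT: "KB ^ 3 * T p f x \<ge> 0" using K0 T0 by simp
  note cD = cut_D_bound[OF p]
  have "\<bar>ext11 f x\<bar> \<le> 368 * KB * T p f x + 4 * (4 * ?B)"
    unfolding ext11_def
  proof (rule sum_levels_bound)
    fix m assume m: "m \<le> N"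
    show "\<bar>cut 2 0 m x * D0 f m (tau x) + 2 * cut 1 0 m x * D1 f m (tau x) + cut 0 0 m x * D2 f m (tau x)\<bar> \<le> 4 * ?B"
      using cD(1)[OF m, of 2 0 x f] cD(2)[OF m, of 1 0 x f] cD(3)[OF m, of 0 0 x f] by simp
  next
    have "(\<Sum>m<level x. cut 2 0 m x * D0 f m (tau x) + 2 * cut 1 0 m x * D1 f m (tau x) + cut 0 0 m x * D2 f m (tau x))
        = (\<Sum>m<level x. D2 f m (tau x))"
      by (rule sum.cong) (use level(2) in \<open>auto simp: near_cut\<close>)
    also have "\<bar>\<dots>\<bar> \<le> 368 * KB * T p f x"
      unfolding sum_D2_telescope using near_G2_bound[OF p, of "level x - 1" x f] level(2)[of "level x - 1" x] K0 T0 by auto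
    finally show "\<bar>\<Sum>m<level x. cut 2 0 m x * D0 f m (tau x) + 2 * cut 1 0 m x * D1 f m (tau x) + cut 0 0 m x * D2 f m (tau x)\<bar>
      \<le> 368 * KB * T p f x" .
  qed (use B0 in \<open>auto simp: not_act_cut\<close>)
  then show "\<bar>ext11 f x\<bar> \<le> 1000000 * KB ^ 3 * T p f x" using le KT by linarith
  have "\<bar>ext12 f x\<bar> \<le> 0 + 4 * (2 * ?B)"
    unfolding ext12_def
  proof (rule sum_levels_bound)
    fix m assume m: "m \<le> N"
    show "\<bar>cut 1 1 m x * D0 f m (tau x) + cut 0 1 m x * D1 f m (tau x)\<bar> \<le> 2 * ?B"
      using cD(1)[OF m, of 1 1 x f] cD(2)[OF m, of 0 1 x f] by simp
  next
    have "(\<Sum>m<level x. cut 1 1 m x * D0 f m (tau x) + cut 0 1 m x * D1 f m (tau x)) = 0"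
      by (rule sum.neutral) (use level(2) in \<open>auto simp: near_cut\<close>)
    then show "\<bar>\<Sum>m<level x. cut 1 1 m x * D0 f m (tau x) + cut 0 1 m x * D1 f m (tau x)\<bar> \<le> 0" by simp
  qed (use B0 in \<open>auto simp: not_act_cut\<close>)
  then show "\<bar>ext12 f x\<bar> \<le> 1000000 * KB ^ 3 * T p f x" using KT by linarith
  have "\<bar>ext22 f x\<bar> \<le> 0 + 4 * ?B"
    unfolding ext22_def
  proof (rule sum_levels_bound)
    fix m assume m: "m \<le> N"
    show "\<bar>cut 0 2 m x * D0 f m (tau x)\<bar> \<le> ?B"
      using cD(1)[OF m, of 0 2 x f] by simp
  next
    have "(\<Sum>m<level x. cut 0 2 m x * D0 f m (tau x)) = 0"
      by (rule sum.neutral) (use level(2) in \<open>auto simp: near_cut\<close>)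
    then show "\<bar>\<Sum>m<level x. cut 0 2 m x * D0 f m (tau x)\<bar> \<le> 0" by simp
  qed (use B0 in \<open>auto simp: not_act_cut\<close>)
  then show "\<bar>ext22 f x\<bar> \<le> 1000000 * KB ^ 3 * T p f x" using KT by linarith
qed

text \<open>At the finest level only one point of \<open>E\<close> is seen, so the telescoping sum ends at the
  affine function attached to that point.\<close>

lemma ext_interpolates: assumes e: "e \<in> E" shows "ext f e = f e"
proof -
  have nr: "near m e" for m using e s_pos[of m] unfolding near_def by (intro bexI[of _ e]) auto
  have "ext f e = (\<Sum>m\<le>N. D0 f m (tau e))" unfolding ext_def by (simp add: near_cut[OF nr])
  also have "\<dots> = G0 f N (tau e)"
  proof -
    have "(\<Sum>m\<le>k. D0 f m (tau e)) = G0 f k (tau e)" for k by (induction k) (auto simp: D0_def pred_def)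
    then show ?thesis .
  qed
  also have "\<dots> = (\<Sum>j\<in>J N. w 0 N j (tau e) * f e)"
    unfolding G0_def
  proof (rule sum.cong[OF refl])
    fix j assume j: "j \<in> J N"
    show "w 0 N j (tau e) * P f (rep N j) (tau e) = w 0 N j (tau e) * f e"
    proof (cases "\<bar>tau e / s N - real_of_int j\<bar> < 1")
      case True
      then have "\<bar>tau e - real_of_int j * s N\<bar> < s N" by (simp add: scaled_less_1)
      then have "\<bar>tau e - tau (rep N j)\<bar> < 8 * s N" using rep(2)[OF j] s_pos[of N] by linarith
      then have "rep N j = e" using N[OF e rep(1)[OF j]] by force
      then show ?thesis by (simp add: P_def)
    qed (simp add: w_outside)
  qed
  also have "\<dots> = f e"
  proof -
    have "j \<in> J N" if "\<bar>tau e / s N - real_of_int j\<bar> < 1" for j using near_J'[OF nr that] J'_subset by blast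
    then have "(\<Sum>j\<in>J N. w 0 N j (tau e)) = (if 0 = (0::nat) then 1 else 0)" by (rule w_sum[OF finite_J])
    then show ?thesis by (simp add: sum_distrib_right[symmetric])
  qed
  finally show ?thesis .
qed

text \<open>A cutoff reaches at most 4 \<open>s m\<close> tangentially and 9 \<open>s m\<close>
  normally from a point of \<open>E\<close>; 13 is the sum.\<close>

lemma ext_vanishes:
  assumes far: "\<And>e. e \<in> E \<Longrightarrow> dist x e \<ge> 13 * s0"
  shows "ext f x = 0" "ext1 f x = 0" "ext2 f x = 0"
proof -
  have "\<not> act m x" for m
  proof
    assume "act m x"
    then obtain j where j: "j \<in> J' m" "\<bar>tau x / s m - real_of_int j\<bar> < 1" "\<bar>eta x - eta (rep m j)\<bar> < 9 * s m"
      by (auto simp: act_def)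
    have jj: "j \<in> J m" using j J'_subset by blast
    let ?e = "rep m j"
    have "\<bar>tau x - real_of_int j * s m\<bar> < s m" using j(2) by (simp only: scaled_less_1)
    then have t: "\<bar>tau x - tau ?e\<bar> \<le> 4 * s m" using rep(2)[OF jj] by linarith
    have "(dist x ?e)\<^sup>2 = (tau x - tau ?e)\<^sup>2 + (eta x - eta ?e)\<^sup>2"
      unfolding dist_norm power2_norm_eq_inner inner_vec2_decomp[OF un, of "x - ?e"]
      by (simp add: inner_diff_right power2_eq_square)
    also have "\<dots> \<le> (\<bar>tau x - tau ?e\<bar> + \<bar>eta x - eta ?e\<bar>)\<^sup>2" by (simp add: power2_sum)
    finally have "dist x ?e \<le> \<bar>tau x - tau ?e\<bar> + \<bar>eta x - eta ?e\<bar>" by (rule power2_le_imp_le) simp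
    then have "dist x ?e < 13 * s m" using t j(3) by linarith
    also have "\<dots> \<le> 13 * s0" using s_mono[of 0 m] by (simp add: s_0)
    finally show False using far[OF rep(1)[OF jj]] by simp
  qed
  then show "ext f x = 0" "ext1 f x = 0" "ext2 f x = 0"
    by (simp_all add: ext_def ext1_def ext2_def not_act_cut)
qed

section \<open>The discrete energy of the data\<close>

definition energy :: "real \<Rightarrow> (real^2 \<Rightarrow> real) \<Rightarrow> real" where
  "energy p f =
    (\<Sum>(m, j, d)\<in>Lam. (s m)\<^sup>2 * ((\<bar>dA f m j d\<bar> / s m) powr p + (\<bar>dP f m j d\<bar> / (s m)\<^sup>2) powr p))
    + (\<Sum>j\<in>J 0. (s 0)\<^sup>2 * ((\<bar>A f (rep 0 j)\<bar> / s 0) powr p + (\<bar>f (rep 0 j)\<bar> / (s 0)\<^sup>2) powr p))"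

lemma closed_box: "closed (box m j)"
  unfolding box_def by (intro closed_Collect_conj closed_Collect_le continuous_intros)

text \<open>In units of \<open>s m\<close>, a rotated box of half-side 20 lies in an axis-parallel
  square of side 80 with the same centre.\<close>

lemma emeasure_box_le: "emeasure lborel (box m j) \<le> ennreal (6400 * (s m)\<^sup>2)"
proof -
  let ?e = "rep m j"
  have sub: "box m j \<subseteq> square ?e (80 * s m)"
  proof
    fix x assume x: "x \<in> box m j"
    have "(dist x ?e)\<^sup>2 = (tau x - tau ?e)\<^sup>2 + (eta x - eta ?e)\<^sup>2"
      unfolding dist_norm power2_norm_eq_inner inner_vec2_decomp[OF un, of "x - ?e"]
      by (simp add: inner_diff_right power2_eq_square)
    also have "\<dots> \<le> (\<bar>tau x - tau ?e\<bar> + \<bar>eta x - eta ?e\<bar>)\<^sup>2" by (simp add: power2_sum)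
    finally have "dist x ?e \<le> \<bar>tau x - tau ?e\<bar> + \<bar>eta x - eta ?e\<bar>" by (rule power2_le_imp_le) simp
    then have "norm (x - ?e) \<le> 40 * s m" using x by (simp add: box_def dist_norm)
    then have "\<bar>x$i - ?e$i\<bar> \<le> 40 * s m" for i using component_le_norm_cart[of "x - ?e" i] by simp
    then show "x \<in> square ?e (80 * s m)" by (simp add: square_def)
  qed
  have "emeasure lborel (square ?e (80 * s m)) = ennreal ((80 * s m) * (80 * s m))"
  proof -
    have b: "(Basis :: (real^2) set) = (\<lambda>i. axis i 1) ` UNIV" by (auto simp: Basis_vec_def)
    have "inj (\<lambda>i::2. axis i (1::real))" by (auto simp: inj_on_def axis_eq_axis)
    then show ?thesis using s_pos[of m] unfolding square_eq_cbox
      by (subst emeasure_lborel_cbox) (auto simp: b prod.reindex inner_axis UNIV_2)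
  qed
  moreover have "emeasure lborel (box m j) \<le> emeasure lborel (square ?e (80 * s m))"
    by (rule emeasure_mono[OF sub]) (simp add: square_eq_cbox)
  ultimately show ?thesis by (simp add: power2_eq_square)
qed

lemma nn_integral_Sp_le: "(\<integral>\<^sup>+x. ennreal (Sp p f x) \<partial>lborel) \<le> ennreal (6400 * energy p f)"
proof -
  have [measurable]: "box m j \<in> sets borel" for m j using closed_box by simp
  define cc where "cc m j d = (\<bar>dA f m j d\<bar> / s m) powr p + (\<bar>dP f m j d\<bar> / (s m)\<^sup>2) powr p" for m j d
  define c0 where "c0 j = (\<bar>A f (rep 0 j)\<bar> / s 0) powr p + (\<bar>f (rep 0 j)\<bar> / (s 0)\<^sup>2) powr p" for j
  have cc0: "cc m j d \<ge> 0" "c0 j \<ge> 0" for m j d by (simp_all add: cc_def c0_def)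
  have Sp: "Sp p f x = (\<Sum>l\<in>Lam. (case l of (m, j, d) \<Rightarrow> indicator (box m j) x * cc m j d)) + (\<Sum>j\<in>J 0. indicator (box 0 j) x * c0 j)" for x
    by (simp add: Sp_def cc_def c0_def)
  have en: "energy p f = (\<Sum>l\<in>Lam. (case l of (m, j, d) \<Rightarrow> (s m)\<^sup>2 * cc m j d)) + (\<Sum>j\<in>J 0. (s 0)\<^sup>2 * c0 j)"
    by (simp add: energy_def cc_def c0_def)
  have one: "(\<integral>\<^sup>+x. ennreal (indicator (box m j) x * c) \<partial>lborel) \<le> ennreal (6400 * ((s m)\<^sup>2 * c))" if "c \<ge> 0" for m j c
  proof -
    have "(\<integral>\<^sup>+x. ennreal (indicator (box m j) x * c) \<partial>lborel) = (\<integral>\<^sup>+x. ennreal c * indicator (box m j) x \<partial>lborel)"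
      by (rule nn_integral_cong) (simp add: indicator_def)
    also have "\<dots> = ennreal c * emeasure lborel (box m j)" by (rule nn_integral_cmult_indicator) simp
    also have "\<dots> \<le> ennreal c * ennreal (6400 * (s m)\<^sup>2)" by (intro mult_left_mono emeasure_box_le) simp
    also have "\<dots> = ennreal (6400 * ((s m)\<^sup>2 * c))" using that by (simp add: ennreal_mult'[symmetric] mult_ac)
    finally show ?thesis .
  qed
  have "(\<integral>\<^sup>+x. ennreal (Sp p f x) \<partial>lborel) = (\<integral>\<^sup>+x. (\<Sum>l\<in>Lam. ennreal (case l of (m, j, d) \<Rightarrow> indicator (box m j) x * cc m j d))
      + (\<Sum>j\<in>J 0. ennreal (indicator (box 0 j) x * c0 j)) \<partial>lborel)"
  proof (rule nn_integral_cong)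
    fix x
    have "(case l of (m, j, d) \<Rightarrow> indicator (box m j) x * cc m j d) \<ge> (0::real)" for l by (cases l) (simp add: cc0)
    then show "ennreal (Sp p f x) = (\<Sum>l\<in>Lam. ennreal (case l of (m, j, d) \<Rightarrow> indicator (box m j) x * cc m j d))
      + (\<Sum>j\<in>J 0. ennreal (indicator (box 0 j) x * c0 j))"
      unfolding Sp by (subst ennreal_plus) (simp_all add: sum_nonneg cc0)
  qed
  also have "\<dots> = (\<Sum>l\<in>Lam. \<integral>\<^sup>+x. ennreal (case l of (m, j, d) \<Rightarrow> indicator (box m j) x * cc m j d) \<partial>lborel)
      + (\<Sum>j\<in>J 0. \<integral>\<^sup>+x. ennreal (indicator (box 0 j) x * c0 j) \<partial>lborel)"
  proof -
    have [measurable]: "(\<lambda>x. ennreal (case l of (m, j, d) \<Rightarrow> indicator (box m j) x * cc m j d)) \<in> borel_measurable lborel" for l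
      by (cases l) simp
    show ?thesis by (subst nn_integral_add) (simp_all add: nn_integral_sum)
  qed
  also have "\<dots> \<le> (\<Sum>l\<in>Lam. ennreal (case l of (m, j, d) \<Rightarrow> 6400 * ((s m)\<^sup>2 * cc m j d))) + (\<Sum>j\<in>J 0. ennreal (6400 * ((s 0)\<^sup>2 * c0 j)))"
    by (intro add_mono sum_mono) (auto intro!: one cc0 split: prod.splits)
  also have "\<dots> = ennreal (6400 * energy p f)"
  proof -
    have "(case l of (m, j, d) \<Rightarrow> 6400 * ((s m)\<^sup>2 * cc m j d)) \<ge> (0::real)" for l by (cases l) (simp add: cc0)
    then have "(\<Sum>l\<in>Lam. ennreal (case l of (m, j, d) \<Rightarrow> 6400 * ((s m)\<^sup>2 * cc m j d))) + (\<Sum>j\<in>J 0. ennreal (6400 * ((s 0)\<^sup>2 * c0 j)))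
      = ennreal ((\<Sum>l\<in>Lam. (case l of (m, j, d) \<Rightarrow> 6400 * ((s m)\<^sup>2 * cc m j d))) + (\<Sum>j\<in>J 0. 6400 * ((s 0)\<^sup>2 * c0 j)))"
      by (subst ennreal_plus) (simp_all add: sum_nonneg cc0)
    also have "(\<Sum>l\<in>Lam. (case l of (m, j, d) \<Rightarrow> 6400 * ((s m)\<^sup>2 * cc m j d))) + (\<Sum>j\<in>J 0. 6400 * ((s 0)\<^sup>2 * c0 j)) = 6400 * energy p f"
      by (simp add: en sum_distrib_left distrib_left case_prod_unfold)
    finally show ?thesis .
  qed
  finally show ?thesis .
qed

end

section \<open>Functionals and the norm of the extension\<close>

text \<open>Terms with the same key are merged into one functional; this is what bounds their number.\<close>

lemma sum_powr_regroup:
  fixes \<Phi> :: "'k \<Rightarrow> real"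
  assumes fin: "finite \<Lambda>" "finite K" and key: "\<And>l. l \<in> \<Lambda> \<Longrightarrow> key l \<in> K"
    and c: "\<And>l. l \<in> \<Lambda> \<Longrightarrow> c l \<ge> 0" and p: "p > 0"
  shows "(\<Sum>l\<in>\<Lambda>. c l * \<bar>\<Phi> (key l)\<bar> powr p)
    = (\<Sum>k\<in>K. \<bar>(\<Sum>l\<in>{l\<in>\<Lambda>. key l = k}. c l) powr (1/p) * \<Phi> k\<bar> powr p)"
proof -
  have "(\<Sum>l\<in>\<Lambda>. c l * \<bar>\<Phi> (key l)\<bar> powr p) = (\<Sum>k\<in>K. \<Sum>l\<in>{l\<in>\<Lambda>. key l = k}. c l * \<bar>\<Phi> (key l)\<bar> powr p)"
    by (rule sum.group[symmetric]) (use fin key in auto)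
  also have "\<dots> = (\<Sum>k\<in>K. \<bar>(\<Sum>l\<in>{l\<in>\<Lambda>. key l = k}. c l) powr (1/p) * \<Phi> k\<bar> powr p)"
  proof (rule sum.cong[OF refl])
    fix k
    let ?W = "\<Sum>l\<in>{l\<in>\<Lambda>. key l = k}. c l"
    have W: "?W \<ge> 0" using c by (intro sum_nonneg) auto
    have "(\<Sum>l\<in>{l\<in>\<Lambda>. key l = k}. c l * \<bar>\<Phi> (key l)\<bar> powr p) = ?W * \<bar>\<Phi> k\<bar> powr p"
      by (simp add: sum_distrib_right)
    also have "\<dots> = (?W powr (1/p)) powr p * \<bar>\<Phi> k\<bar> powr p"
      using W p by (simp add: powr_powr)
    also have "\<dots> = \<bar>?W powr (1/p) * \<Phi> k\<bar> powr p"
      by (simp add: abs_mult powr_mult)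
    finally show "(\<Sum>l\<in>{l\<in>\<Lambda>. key l = k}. c l * \<bar>\<Phi> (key l)\<bar> powr p) = \<bar>?W powr (1/p) * \<Phi> k\<bar> powr p" .
  qed
  finally show ?thesis .
qed

context lipschitz_set
begin

text \<open>t = 0, 1 are the two differences of a pair, t = 2, 3 slope and value on the coarsest
  level, where the second point is a dummy. The functional depends on the points and not on the
  level, which is what allows merging.\<close>

definition funct :: "nat \<times> (real^2) \<times> (real^2) \<Rightarrow> (real^2 \<Rightarrow> real) \<Rightarrow> real" where
  "funct k f = (case k of (t, e, e') \<Rightarrow>
     if t = 0 then A f e - A f e' else if t = 1 then f e - P f e' (tau e) else if t = 2 then A f e else f e)"

lemma funct_linear: "funct k (\<lambda>x. f x + a * f' x) = funct k f + a * funct k f'"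
  by (cases k) (simp add: funct_def A_linear P_linear algebra_simps)

lemma funct_cong:
  assumes "\<And>x. x \<in> E \<Longrightarrow> f x = f' x" "k \<in> {..<4} \<times> E \<times> E"
  shows "funct k f = funct k f'"
  using assms A_cong[OF assms(1)] P_cong[OF assms(1)] by (auto simp: funct_def)

definition idx :: "(nat \<times> nat \<times> int \<times> nat) set" where
  "idx = {..<2} \<times> Lam \<union> {2..<4} \<times> {0} \<times> J 0 \<times> {0}"

definition key :: "nat \<times> nat \<times> int \<times> nat \<Rightarrow> nat \<times> (real^2) \<times> (real^2)" where
  "key l = (case l of (t, m, j, d) \<Rightarrow> (t, rep m j, if t < 2 then par m j d else rep m j))"

definition coef :: "real \<Rightarrow> nat \<times> nat \<times> int \<times> nat \<Rightarrow> real" where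
  "coef p l = (case l of (t, m, j, d) \<Rightarrow> if even t then (s m)\<^sup>2 / s m powr p else (s m)\<^sup>2 / (s m)\<^sup>2 powr p)"

lemma energy_eq: "energy p f = (\<Sum>l\<in>idx. coef p l * \<bar>funct (key l) f\<bar> powr p)"
proof -
  let ?g = "\<lambda>l. coef p l * \<bar>funct (key l) f\<bar> powr p"
  have p1: "(\<bar>z\<bar> / s m) powr p = \<bar>z\<bar> powr p / s m powr p" "(\<bar>z\<bar> / (s m)\<^sup>2) powr p = \<bar>z\<bar> powr p / (s m)\<^sup>2 powr p" for z m
    using s_pos[of m] by (simp_all add: powr_divide)
  have "(\<Sum>l\<in>idx. ?g l) = (\<Sum>l\<in>{..<2} \<times> Lam. ?g l) + (\<Sum>l\<in>{2..<4} \<times> {0} \<times> J 0 \<times> {0}. ?g l)"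
    unfolding idx_def by (rule sum.union_disjoint) (auto simp: finite_Lam finite_J)
  also have "(\<Sum>l\<in>{..<2} \<times> Lam. ?g l) = (\<Sum>t<2. \<Sum>l\<in>Lam. ?g (t, l))"
    by (simp add: sum.cartesian_product)
  also have "\<dots> = (\<Sum>l\<in>Lam. ?g (0, l) + ?g (1, l))"
    by (simp add: numeral_2_eq_2 sum.distrib)
  also have "\<dots> = (\<Sum>(m, j, d)\<in>Lam. (s m)\<^sup>2 * ((\<bar>dA f m j d\<bar> / s m) powr p + (\<bar>dP f m j d\<bar> / (s m)\<^sup>2) powr p))"
  proof (rule sum.cong[OF refl])
    fix l assume "l \<in> Lam"
    obtain m j d where l: "l = (m, j, d)" by (cases l)
    show "?g (0, l) + ?g (1, l) = (case l of (m, j, d) \<Rightarrow> (s m)\<^sup>2 * ((\<bar>dA f m j d\<bar> / s m) powr p + (\<bar>dP f m j d\<bar> / (s m)\<^sup>2) powr p))"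
      unfolding l p1 prod.case by (simp add: coef_def key_def funct_def dA_def dP_def distrib_left)
  qed
  also have "(\<Sum>l\<in>{2..<4} \<times> {0} \<times> J 0 \<times> {0}. ?g l) = (\<Sum>t\<in>{2..<4}. \<Sum>j\<in>J 0. ?g (t, 0, j, 0))"
    by (simp add: sum.cartesian_product')
  also have "{2..<4} = {2, 3::nat}" by auto
  also have "(\<Sum>t\<in>{2, 3}. \<Sum>j\<in>J 0. ?g (t, 0, j, 0)) = (\<Sum>j\<in>J 0. ?g (2, 0, j, 0) + ?g (3, 0, j, 0))"
    by (simp add: sum.distrib)
  also have "\<dots> = (\<Sum>j\<in>J 0. (s 0)\<^sup>2 * ((\<bar>A f (rep 0 j)\<bar> / s 0) powr p + (\<bar>f (rep 0 j)\<bar> / (s 0)\<^sup>2) powr p))"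
    unfolding p1 by (simp add: coef_def key_def funct_def distrib_left)
  finally show ?thesis by (simp add: energy_def)
qed

lemma energy_functionals:
  assumes p: "p > 0"
  shows "\<exists>lam :: nat \<Rightarrow> (real^2 \<Rightarrow> real) \<Rightarrow> real.
    (\<forall>i f f' a. lam i (\<lambda>x. f x + a * f' x) = lam i f + a * lam i f') \<and>
    (\<forall>i<4 * (card E)\<^sup>2. \<forall>f f'. (\<forall>x\<in>E. f x = f' x) \<longrightarrow> lam i f = lam i f') \<and>
    (\<forall>f. (\<Sum>i<4 * (card E)\<^sup>2. \<bar>lam i f\<bar> powr p) = energy p f)"
proof -
  let ?K = "{..<4::nat} \<times> E \<times> E"
  have finK: "finite ?K" using finE by simp
  have fini: "finite idx" by (simp add: idx_def finite_Lam finite_J)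
  have cK: "card ?K = 4 * (card E)\<^sup>2" by (simp add: card_cartesian_product power2_eq_square)
  obtain h where h: "bij_betw h {..<4 * (card E)\<^sup>2} ?K"
    using ex_bij_betw_nat_finite[OF finK] unfolding cK atLeast0LessThan by blast
  \<comment> \<open>A key without index receives the empty sum, hence weight 0; so all 4 (card E)^2
    keys can be enumerated.\<close>
  define W where "W k = (\<Sum>l\<in>{l\<in>idx. key l = k}. coef p l) powr (1/p)" for k
  define lam where "lam i f = W (h i) * funct (h i) f" for i f
  have keyK: "key l \<in> ?K" if "l \<in> idx" for l
  proof -
    obtain t m j d where l: "l = (t, m, j, d)" by (cases l)
    have "(t < 2 \<and> (m, j, d) \<in> Lam) \<or> ((t = 2 \<or> t = 3) \<and> m = 0 \<and> j \<in> J 0)"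
      using that unfolding l idx_def by auto
    then show ?thesis
    proof
      assume a: "t < 2 \<and> (m, j, d) \<in> Lam"
      then have "j \<in> J m" by (auto simp: Lam_def)
      then show ?thesis using a par_in_E rep(1) by (auto simp: l key_def)
    qed (auto simp: l key_def rep(1))
  qed
  have c0: "coef p l \<ge> 0" for l by (cases l) (simp add: coef_def)
  have "(\<Sum>i<4 * (card E)\<^sup>2. \<bar>lam i f\<bar> powr p) = energy p f" for f
  proof -
    have "(\<Sum>i<4 * (card E)\<^sup>2. \<bar>lam i f\<bar> powr p) = (\<Sum>k\<in>?K. \<bar>W k * funct k f\<bar> powr p)"
      unfolding lam_def by (rule sum.reindex_bij_betw[OF h])
    also have "\<dots> = energy p f"
      unfolding energy_eq W_def
      by (rule sum_powr_regroup[OF fini finK keyK c0 p, symmetric])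
    finally show ?thesis .
  qed
  moreover have "lam i (\<lambda>x. f x + a * f' x) = lam i f + a * lam i f'" for i f f' a
    by (simp add: lam_def funct_linear algebra_simps)
  moreover have "lam i f = lam i f'" if "i < 4 * (card E)\<^sup>2" "\<forall>x\<in>E. f x = f' x" for i f f'
  proof -
    have "h i \<in> ?K" using h that(1) by (auto simp: bij_betw_def)
    then show ?thesis using funct_cong[of f f' "h i"] that(2) by (simp add: lam_def)
  qed
  ultimately show ?thesis by (intro exI[of _ lam]) blast
qed

lemma gradf_affine:
  assumes "\<And>y. L y = a \<bullet> y + b"
  shows "gradf u n L (\<lambda>_. u \<bullet> a) (\<lambda>_. n \<bullet> a)"
  unfolding gradf_def
proof
  fix x
  have "(L has_derivative (\<lambda>d. a \<bullet> d)) (at x)"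
    unfolding assms[abs_def] by (auto intro!: derivative_eq_intros)
  then show "(L has_derivative (\<lambda>d. (u \<bullet> a) * (u \<bullet> d) + (n \<bullet> a) * (n \<bullet> d))) (at x)"
    by (simp add: inner_vec2_decomp[OF un, of a])
qed

lemma measurable_Sp: "Sp p f \<in> borel_measurable borel"
proof -
  have [measurable]: "box m j \<in> sets borel" for m j using closed_box by simp
  have "(\<lambda>x. case l of (m, j, d) \<Rightarrow> indicator (box m j) x * ((\<bar>dA f m j d\<bar> / s m) powr p + (\<bar>dP f m j d\<bar> / (s m)\<^sup>2) powr p))
     \<in> borel_measurable borel" for l by (cases l) simp
  then show ?thesis unfolding Sp_def[abs_def] by measurable
qed

lemma Sp_nonneg: "Sp p f x \<ge> 0"
  unfolding Sp_def by (intro add_nonneg_nonneg sum_nonneg) (auto split: prod.splits)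

lemma energy_nonneg: "energy p f \<ge> 0"
  unfolding energy_def by (intro add_nonneg_nonneg sum_nonneg) (auto split: prod.splits)

lemma ext_L2p:
  assumes p: "p \<ge> 1" and L: "\<And>y. L y = a \<bullet> y + b"
  shows "(\<lambda>x. L x + ext f x) \<in> L2p p (square c d)"
    and "L2p_norm p (square c d) (\<lambda>x. L x + ext f x) \<le> 25600 * (4000000 * KB ^ 3) * energy p f powr (1/p)"
proof -
  let ?h = "hessf u n (ext11 f) (ext12 f) (ext22 f)"
  \<comment> \<open>An entry in standard coordinates is at most |ext11| + 2 |ext12| + |ext22|, since
    the components of \<open>u\<close> and \<open>n\<close> are at most 1. The 25600 below is four
    entries times 6400.\<close>
  let ?C = "4000000 * KB ^ 3"
  have p0: "p > 0" using p by simp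
  have KB0: "KB \<ge> 0" using KB(1) by linarith
  have gL: "gradf u n L (\<lambda>_. u \<bullet> a) (\<lambda>_. n \<bullet> a)" by (rule gradf_affine[OF L])
  have g: "gradf u n (\<lambda>x. L x + ext f x) (\<lambda>x. u \<bullet> a + ext1 f x) (\<lambda>x. n \<bullet> a + ext2 f x)"
    "gradf u n (\<lambda>x. u \<bullet> a + ext1 f x) (ext11 f) (ext12 f)"
    "gradf u n (\<lambda>x. n \<bullet> a + ext2 f x) (ext12 f) (ext22 f)"
    using gradf_add[OF gL ext_gradf(1)[of f]] gradf_add[OF gradf_const ext_gradf(2)[of f]]
      gradf_add[OF gradf_const ext_gradf(3)[of f]] by simp_all
  note w = weak_hessian_C2[OF g ext_continuous p0]
  show "(\<lambda>x. L x + ext f x) \<in> L2p p (square c d)" by (rule w(2))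
  have comp: "\<bar>u$i\<bar> \<le> 1" "\<bar>n$i\<bar> \<le> 1" for i
    using component_le_norm_cart[of u i] component_le_norm_cart[of n i] un by auto
  have hb: "\<bar>?h i j x\<bar> powr p \<le> ?C powr p * Sp p f x" for i j x
  proof -
    have pr: "\<bar>y * z\<bar> \<le> 1" if "\<bar>y\<bar> \<le> 1" "\<bar>z\<bar> \<le> 1" for y z :: real
      unfolding abs_mult using that by (intro mult_le_one) auto
    have "\<bar>?h i j x\<bar> \<le> \<bar>ext11 f x\<bar> * \<bar>u$i * u$j\<bar> + \<bar>ext12 f x\<bar> * \<bar>u$i * n$j + n$i * u$j\<bar> + \<bar>ext22 f x\<bar> * \<bar>n$i * n$j\<bar>"
      unfolding hessf_def abs_mult[symmetric] by linarith
    also have "\<dots> \<le> \<bar>ext11 f x\<bar> * 1 + \<bar>ext12 f x\<bar> * 2 + \<bar>ext22 f x\<bar> * 1"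
      using pr[OF comp(1)[of i] comp(1)[of j]] pr[OF comp(1)[of i] comp(2)[of j]]
        pr[OF comp(2)[of i] comp(1)[of j]] pr[OF comp(2)[of i] comp(2)[of j]]
      by (intro add_mono mult_left_mono) auto
    also have "\<dots> \<le> ?C * T p f x" using ext_hessian_bound[OF p0, of f x] by linarith
    finally have "\<bar>?h i j x\<bar> powr p \<le> (?C * T p f x) powr p" using p0 by (intro powr_mono2) auto
    also have "\<dots> = ?C powr p * T p f x powr p" using KB0 T_nonneg by (intro powr_mult)
    also have "T p f x powr p = Sp p f x" using p0 Sp_nonneg[of p f x] by (simp add: T_def powr_powr)
    finally show ?thesis .
  qed
  have each: "(LINT x:square c d|lborel. \<bar>?h i j x\<bar> powr p) \<le> ?C powr p * (6400 * energy p f)" for i j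
  proof -
    have si: "set_integrable lborel (square c d) (\<lambda>x. \<bar>?h i j x\<bar> powr p)"
      using w(1)[of c d] unfolding weak_hessian_def by blast
    have "(LINT x:square c d|lborel. \<bar>?h i j x\<bar> powr p)
      = enn2real (\<integral>\<^sup>+x. ennreal (indicator (square c d) x *\<^sub>R (\<bar>?h i j x\<bar> powr p)) \<partial>lborel)"
      unfolding set_lebesgue_integral_def
      by (rule integral_eq_nn_integral) (use si in \<open>auto simp: set_integrable_def\<close>)
    also have "\<dots> \<le> ?C powr p * (6400 * energy p f)"
    proof (rule enn2real_leI)
      have "(\<integral>\<^sup>+x. ennreal (indicator (square c d) x *\<^sub>R (\<bar>?h i j x\<bar> powr p)) \<partial>lborel)
        \<le> (\<integral>\<^sup>+x. ennreal (?C powr p) * ennreal (Sp p f x) \<partial>lborel)"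
        using hb Sp_nonneg by (intro nn_integral_mono) (auto simp: indicator_def ennreal_mult'[symmetric] intro!: ennreal_leI)
      also have "\<dots> = ennreal (?C powr p) * (\<integral>\<^sup>+x. ennreal (Sp p f x) \<partial>lborel)"
        using measurable_Sp by (intro nn_integral_cmult) simp
      also have "\<dots> \<le> ennreal (?C powr p) * ennreal (6400 * energy p f)"
        by (intro mult_left_mono nn_integral_Sp_le) simp
      also have "\<dots> = ennreal (?C powr p * (6400 * energy p f))" by (rule ennreal_mult'[symmetric]) simp
      finally show "(\<integral>\<^sup>+x. ennreal (indicator (square c d) x *\<^sub>R (\<bar>?h i j x\<bar> powr p)) \<partial>lborel) \<le> ennreal (?C powr p * (6400 * energy p f))" .
    qed (use energy_nonneg in simp)
    finally show ?thesis .
  qed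
  have "hess_energy p (square c d) ?h \<le> (\<Sum>i\<in>(UNIV::2 set). \<Sum>j\<in>(UNIV::2 set). ?C powr p * (6400 * energy p f))"
    unfolding hess_energy_def by (intro sum_mono each)
  also have "\<dots> = 25600 * ?C powr p * energy p f" by simp
  finally have he: "hess_energy p (square c d) ?h \<le> 25600 * ?C powr p * energy p f" .
  have "L2p_norm p (square c d) (\<lambda>x. L x + ext f x) \<le> hess_energy p (square c d) ?h powr (1/p)"
    by (rule L2p_norm_le[OF w(1)])
  also have "\<dots> \<le> (25600 * ?C powr p * energy p f) powr (1/p)"
  proof (rule powr_mono2)
    show "0 \<le> hess_energy p (square c d) ?h"
      unfolding hess_energy_def set_lebesgue_integral_def by (intro sum_nonneg Bochner_Integration.integral_nonneg) simp
  qed (use p0 he in auto)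
  also have "\<dots> = 25600 powr (1/p) * (?C powr p) powr (1/p) * energy p f powr (1/p)"
    using energy_nonneg by (simp add: powr_mult)
  also have "(?C powr p) powr (1/p) = ?C" using p0 KB0 by (simp add: powr_powr)
  also have "25600 powr (1/p) * ?C * energy p f powr (1/p) \<le> 25600 powr 1 * ?C * energy p f powr (1/p)"
    using p KB0 by (intro mult_right_mono powr_mono) auto
  finally show "L2p_norm p (square c d) (\<lambda>x. L x + ext f x) \<le> 25600 * (4000000 * KB ^ 3) * energy p f powr (1/p)"
    by simp
qed

lemma ext_jet:
  assumes far: "\<And>e. e \<in> E \<Longrightarrow> dist x e \<ge> 13 * s0" and L: "\<And>y. L y = a \<bullet> y + b"
  shows "jet1 (\<lambda>x. L x + ext f x) x = L"
proof -
  have "((\<lambda>x. L x + ext f x) has_derivative (\<lambda>d. a \<bullet> d + 0)) (at x)"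
  proof (rule has_derivative_add)
    show "(L has_derivative (\<lambda>d. a \<bullet> d)) (at x)"
      unfolding L[abs_def] by (auto intro!: derivative_eq_intros)
    show "(ext f has_derivative (\<lambda>d. 0)) (at x)"
      using ext_gradf(1)[of f, unfolded gradf_def, rule_format, of x] ext_vanishes[OF far] by simp
  qed
  then have "frechet_derivative (\<lambda>x. L x + ext f x) (at x) = (\<lambda>d. a \<bullet> d)"
    using frechet_derivative_at by fastforce
  then show ?thesis using ext_vanishes(1)[OF far] by (simp add: jet1_def L fun_eq_iff inner_diff_right)
qed

end

section \<open>Traces on a curve\<close>

lemma perturbation_abs:
  fixes d x y :: real
  assumes "d = x + y" "\<bar>y\<bar> \<le> 1/40 * \<bar>x\<bar>"
  shows "39/40 * \<bar>x\<bar> \<le> \<bar>d\<bar>" "\<bar>d\<bar> \<le> 41/40 * \<bar>x\<bar>" "x \<le> 0 \<Longrightarrow> d \<le> 0"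
proof -
  have "\<bar>x\<bar> \<le> \<bar>d\<bar> + \<bar>y\<bar>" "\<bar>d\<bar> \<le> \<bar>x\<bar> + \<bar>y\<bar>" using assms(1) by linarith+
  then show "39/40 * \<bar>x\<bar> \<le> \<bar>d\<bar>" "\<bar>d\<bar> \<le> 41/40 * \<bar>x\<bar>" using assms(2) by simp_all
  show "d \<le> 0" if "x \<le> 0"
  proof -
    have "y \<le> \<bar>y\<bar>" by simp
    then show ?thesis using assms that by simp
  qed
qed

text \<open>The parametrised curve supplied by \<open>curve_normal_form\<close>, with translations
  k1, k2. The bound 1/40 makes \<open>tv\<close> bi-Lipschitz with constants 39/40 and 41/40 and
  keeps \<open>ev\<close> flat.\<close>

locale curve = differentiable_fun \<psi> for \<psi> +
  fixes u n :: "real^2" and \<alpha> \<beta> v1 v2 k1 k2 :: real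
  assumes un: "norm u = 1" "norm n = 1" "u \<bullet> n = 0"
    and ab: "\<bar>\<alpha>\<bar> \<le> 1" "\<bar>\<beta>\<bar> \<le> 1" and v12: "v1 \<le> v2"
    and slope_small: "\<And>v. v \<in> {v1..v2} \<Longrightarrow> \<bar>deriv \<psi> v\<bar> \<le> 1/40"
begin

definition tv :: "real \<Rightarrow> real" where "tv v = k1 + v + \<alpha> * \<psi> v"
definition ev :: "real \<Rightarrow> real" where "ev v = k2 + \<beta> * \<psi> v"
definition gam :: "real \<Rightarrow> real^2" where "gam v = tv v *\<^sub>R u + ev v *\<^sub>R n"
definition Gam :: "(real^2) set" where "Gam = gam ` {v1..v2}"

lemma inner_gam: "u \<bullet> gam v = tv v" "n \<bullet> gam v = ev v"
  using un by (simp_all add: gam_def inner_add_right norm_eq_1 inner_commute[of n u])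

lemma inner_un_eq: "u \<bullet> x = u \<bullet> y \<Longrightarrow> n \<bullet> x = n \<bullet> y \<Longrightarrow> x = y"
proof -
  assume "u \<bullet> x = u \<bullet> y" "n \<bullet> x = n \<bullet> y"
  then have "(x - y) \<bullet> (x - y) = 0"
    unfolding inner_vec2_decomp[OF un, of "x - y"] by (simp add: inner_diff_right)
  then show "x = y" by simp
qed

lemma dist_le_un: "dist x y \<le> \<bar>u \<bullet> x - u \<bullet> y\<bar> + \<bar>n \<bullet> x - n \<bullet> y\<bar>"
proof -
  have "(dist x y)\<^sup>2 = (u \<bullet> x - u \<bullet> y)\<^sup>2 + (n \<bullet> x - n \<bullet> y)\<^sup>2"
    unfolding dist_norm power2_norm_eq_inner inner_vec2_decomp[OF un, of "x - y"]
    by (simp add: inner_diff_right power2_eq_square)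
  also have "\<dots> \<le> (\<bar>u \<bullet> x - u \<bullet> y\<bar> + \<bar>n \<bullet> x - n \<bullet> y\<bar>)\<^sup>2" by (simp add: power2_sum)
  finally show ?thesis by (rule power2_le_imp_le) simp
qed

lemma inner_le_dist: "\<bar>u \<bullet> x - u \<bullet> y\<bar> \<le> dist x y" "\<bar>n \<bullet> x - n \<bullet> y\<bar> \<le> dist x y"
  using Cauchy_Schwarz_ineq2[of u "x - y"] Cauchy_Schwarz_ineq2[of n "x - y"] un
  by (simp_all add: inner_diff_right dist_norm)

lemma psi_increment:
  assumes "{va..vb} \<subseteq> {v1..v2}" "v \<in> {va..vb}" "w \<in> {va..vb}" "\<And>x. x \<in> {va..vb} \<Longrightarrow> \<bar>deriv \<psi> x - q\<bar> \<le> B"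
  shows "\<bar>\<psi> v - \<psi> w - q * (v - w)\<bar> \<le> B * \<bar>v - w\<bar>"
proof -
  have d: "((\<lambda>x. \<psi> x - q * x) has_real_derivative deriv \<psi> x - q * 1) (at x within {va..vb})" for x
    by (intro DERIV_subset[OF DERIV_diff[OF DERIV DERIV_cmult[OF DERIV_ident]]]) simp
  have "norm ((\<psi> v - q * v) - (\<psi> w - q * w)) \<le> B * norm (v - w)"
    by (rule field_differentiable_bound[OF _ d]) (use assms in auto)
  then show ?thesis by (simp add: algebra_simps)
qed

lemma psi_lip: "v \<in> {v1..v2} \<Longrightarrow> w \<in> {v1..v2} \<Longrightarrow> \<bar>\<psi> v - \<psi> w\<bar> \<le> 1/40 * \<bar>v - w\<bar>"
  using psi_increment[of v1 v2 v w 0 "1/40"] slope_small by simp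

lemma mult_unit_le: "\<bar>a\<bar> \<le> 1 \<Longrightarrow> \<bar>a * x\<bar> \<le> \<bar>x\<bar>" for a x :: real
  by (simp add: abs_mult mult_left_le_one_le)

lemma tv_diff:
  assumes "v \<in> {v1..v2}" "w \<in> {v1..v2}"
  shows "39/40 * \<bar>v - w\<bar> \<le> \<bar>tv v - tv w\<bar>" "\<bar>tv v - tv w\<bar> \<le> 41/40 * \<bar>v - w\<bar>"
    "v \<le> w \<Longrightarrow> tv v \<le> tv w"
proof -
  have "tv v - tv w = (v - w) + \<alpha> * (\<psi> v - \<psi> w)" by (simp add: tv_def algebra_simps)
  moreover have "\<bar>\<alpha> * (\<psi> v - \<psi> w)\<bar> \<le> 1/40 * \<bar>v - w\<bar>"
    using mult_unit_le[OF ab(1), of "\<psi> v - \<psi> w"] psi_lip[OF assms] by linarith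
  ultimately show "39/40 * \<bar>v - w\<bar> \<le> \<bar>tv v - tv w\<bar>" "\<bar>tv v - tv w\<bar> \<le> 41/40 * \<bar>v - w\<bar>"
    "v \<le> w \<Longrightarrow> tv v \<le> tv w"
    using perturbation_abs[of "tv v - tv w" "v - w" "\<alpha> * (\<psi> v - \<psi> w)"] by simp_all
qed

lemma ev_diff:
  assumes "v \<in> {v1..v2}" "w \<in> {v1..v2}"
  shows "\<bar>ev v - ev w\<bar> \<le> 1/40 * \<bar>v - w\<bar>" "\<bar>ev v - ev w\<bar> \<le> 1/39 * \<bar>tv v - tv w\<bar>"
proof -
  have "ev v - ev w = \<beta> * (\<psi> v - \<psi> w)" by (simp add: ev_def algebra_simps)
  then show 1: "\<bar>ev v - ev w\<bar> \<le> 1/40 * \<bar>v - w\<bar>"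
    using mult_unit_le[OF ab(2), of "\<psi> v - \<psi> w"] psi_lip[OF assms] by linarith
  have "a \<le> 1/40 * b \<Longrightarrow> 39/40 * b \<le> c \<Longrightarrow> a \<le> 1/39 * c" for a b c :: real by simp
  from this[OF 1 tv_diff(1)[OF assms]] show "\<bar>ev v - ev w\<bar> \<le> 1/39 * \<bar>tv v - tv w\<bar>" .
qed

lemma dist_gam: "v \<in> {v1..v2} \<Longrightarrow> w \<in> {v1..v2} \<Longrightarrow> dist (gam v) (gam w) \<le> 2 * \<bar>v - w\<bar>"
proof -
  assume a: "v \<in> {v1..v2}" "w \<in> {v1..v2}"
  have "dist (gam v) (gam w) \<le> \<bar>tv v - tv w\<bar> + \<bar>ev v - ev w\<bar>"
    using dist_le_un[of "gam v" "gam w"] unfolding inner_gam .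
  also have "\<dots> \<le> 41/40 * \<bar>v - w\<bar> + 1/40 * \<bar>v - w\<bar>" by (intro add_mono tv_diff ev_diff a)
  also have "\<dots> \<le> 2 * \<bar>v - w\<bar>" by simp
  finally show ?thesis .
qed

text \<open>Points of the curve at tangential distance at most r from \<open>gam v\<close> differ
  from it in height by at most r/39, and r/10 - r/39 exceeds r/20; all others are at tangential
  distance at least r/10 from the disc. This yields the lower bound for the weight on displaced
  boxes.\<close>

lemma infdist_Gam_ge:
  assumes v: "v \<in> {v1..v2}" and r: "r > 0" and y: "dist y (gam v + r *\<^sub>R n) \<le> 9/10 * r"
  shows "infdist y Gam \<ge> r / 20"
proof -
  have ne: "Gam \<noteq> {}" using v12 by (auto simp: Gam_def)
  have "r / 20 \<le> dist y z" if z: "z \<in> Gam" for z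
  proof -
    obtain w where w: "w \<in> {v1..v2}" "z = gam w" using z by (auto simp: Gam_def)
    have yu: "\<bar>u \<bullet> y - tv v\<bar> \<le> 9/10 * r" and yn: "\<bar>n \<bullet> y - (ev v + r)\<bar> \<le> 9/10 * r"
      using inner_le_dist[of y "gam v + r *\<^sub>R n"] y un
      by (simp_all add: inner_add_right inner_gam norm_eq_1)
    have d: "\<bar>u \<bullet> y - tv w\<bar> \<le> dist y z" "\<bar>n \<bullet> y - ev w\<bar> \<le> dist y z"
      using inner_le_dist[of y z] by (simp_all add: w inner_gam)
    show ?thesis
    proof (cases "\<bar>tv v - tv w\<bar> \<le> r")
      case True
      have "\<bar>ev v - ev w\<bar> \<le> 1/39 * r"
        using ev_diff(2)[OF v w(1)] mult_left_mono[OF True, of "1/39"] by linarith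
      from abs_le_D2[OF this] have "ev v - ev w \<ge> - (1/39 * r)" by simp
      moreover have "n \<bullet> y - (ev v + r) \<ge> - (9/10 * r)" using abs_le_D2[OF yn] by simp
      moreover have "n \<bullet> y - ev w \<le> dist y z" using abs_le_D1[OF d(2)] .
      ultimately show ?thesis using r by simp
    next
      case False
      have "\<bar>tv v - tv w\<bar> \<le> 9/10 * r + dist y z"
        by (rule abs_diff_triangle[of _ "u \<bullet> y"]) (use yu d(1) in \<open>simp_all add: abs_minus_commute\<close>)
      then show ?thesis using False r by simp
    qed
  qed
  then show ?thesis unfolding infdist_notempty[OF ne] by (intro cINF_greatest[OF ne])
qed

text \<open>The normal part of the gradient only enters through the slope of the curve.\<close>

lemma window_slope:
  fixes F :: "real^2 \<Rightarrow> real" and grad :: "real^2 \<Rightarrow> real^2"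
  assumes I: "va \<le> vb" "{va..vb} \<subseteq> {v1..v2}"
    and F: "\<And>v. v \<in> {va..vb} \<Longrightarrow> (F has_derivative (\<lambda>d. grad (gam v) \<bullet> d)) (at (gam v))"
    and om: "\<And>v w. v \<in> {va..vb} \<Longrightarrow> w \<in> {va..vb} \<Longrightarrow> norm (grad (gam v) - grad (gam w)) \<le> \<omega>"
    and om': "\<And>v w. v \<in> {va..vb} \<Longrightarrow> w \<in> {va..vb} \<Longrightarrow> \<bar>deriv \<psi> v - deriv \<psi> w\<bar> \<le> \<omega>'"
    and Gm: "\<And>v. v \<in> {va..vb} \<Longrightarrow> norm (grad (gam v) - a0) \<le> \<Gamma>"
  shows "\<exists>\<sigma>. \<forall>v\<in>{va..vb}. \<forall>w\<in>{va..vb}.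
    \<bar>(F (gam v) - a0 \<bullet> gam v) - (F (gam w) - a0 \<bullet> gam w) - \<sigma> * (tv v - tv w)\<bar> \<le> 4 * (\<omega> + \<Gamma> * \<omega>') * \<bar>tv v - tv w\<bar>"
proof -
  define g0 where "g0 = grad (gam va)"
  define q where "q = deriv \<psi> va"
  define a where "a = g0 - a0"
  have va: "va \<in> {va..vb}" using I by simp
  have om0: "\<omega> \<ge> 0" "\<omega>' \<ge> 0" "\<Gamma> \<ge> 0" using om[OF va va] om'[OF va va] Gm[OF va] norm_ge_zero order_trans by (force, force, blast)
  have q: "\<bar>q\<bar> \<le> 1/40" using slope_small I va unfolding q_def by blast
  have aq: "1 + \<alpha> * q \<ge> 39/40" using mult_unit_le[OF ab(1), of q] q by linarith
  \<comment> \<open>The derivative of a . gam with respect to tv at \<open>va\<close>: the quotient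
    \<beta> q / (1 + \<alpha> q) is d ev / d tv there.\<close>
  define \<sigma> where "\<sigma> = a \<bullet> u + (\<beta> * q / (1 + \<alpha> * q)) * (a \<bullet> n)"
  have bound: "\<bar>(F (gam v) - a0 \<bullet> gam v) - (F (gam w) - a0 \<bullet> gam w) - \<sigma> * (tv v - tv w)\<bar> \<le> 4 * (\<omega> + \<Gamma> * \<omega>') * \<bar>tv v - tv w\<bar>"
    if v: "v \<in> {va..vb}" and w: "w \<in> {va..vb}" for v w
  proof -
    have vw: "v \<in> {v1..v2}" "w \<in> {v1..v2}" using v w I by auto
    \<comment> \<open>Subtracting g0 . gam leaves the oscillation of the gradient along the curve.
      The rest, a . gam, is explicit and deviates from its linear part only by the normal component
      of a times the oscillation of the slope.\<close>
    define H where "H x = F (gam x) - g0 \<bullet> gam x" for x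
    define g' where "g' x = (1 + \<alpha> * deriv \<psi> x) *\<^sub>R u + (\<beta> * deriv \<psi> x) *\<^sub>R n" for x
    have dH: "(H has_real_derivative (grad (gam x) - g0) \<bullet> g' x) (at x within {va..vb})" if x: "x \<in> {va..vb}" for x
    proof -
      have dt: "(tv has_derivative (\<lambda>h. h * (1 + \<alpha> * deriv \<psi> x))) (at x)"
      proof -
        have "(tv has_real_derivative 0 + 1 + \<alpha> * deriv \<psi> x) (at x)"
          unfolding tv_def[abs_def] by (intro DERIV_add DERIV_const DERIV_ident DERIV_cmult DERIV)
        then show ?thesis by (simp add: has_field_derivative_def mult.commute[of _ "1 + _"])
      qed
      have de: "(ev has_derivative (\<lambda>h. h * (\<beta> * deriv \<psi> x))) (at x)"
      proof -
        have "(ev has_real_derivative 0 + \<beta> * deriv \<psi> x) (at x)"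
          unfolding ev_def[abs_def] by (intro DERIV_add DERIV_const DERIV_cmult DERIV)
        then show ?thesis by (simp add: has_field_derivative_def mult.commute[of _ "\<beta> * _"])
      qed
      have dg: "(gam has_derivative (\<lambda>h. h *\<^sub>R g' x)) (at x)"
      proof -
        have "(gam has_derivative (\<lambda>h. (h * (1 + \<alpha> * deriv \<psi> x)) *\<^sub>R u + (h * (\<beta> * deriv \<psi> x)) *\<^sub>R n)) (at x)"
          unfolding gam_def[abs_def]
          by (intro has_derivative_add has_derivative_scaleR_left dt de)
        then show ?thesis by (simp add: g'_def scaleR_add_right)
      qed
      have "((\<lambda>y. F (gam y) - g0 \<bullet> gam y) has_derivative (\<lambda>h. grad (gam x) \<bullet> (h *\<^sub>R g' x) - g0 \<bullet> (h *\<^sub>R g' x))) (at x)"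
        by (intro has_derivative_diff has_derivative_compose[OF dg F[OF x]] has_derivative_inner_right dg)
      then have "(H has_real_derivative (grad (gam x) - g0) \<bullet> g' x) (at x)"
        unfolding has_field_derivative_def H_def[abs_def]
        by (rule has_derivative_eq_rhs) (simp add: fun_eq_iff inner_diff_left algebra_simps)
      then show ?thesis by (rule DERIV_subset) simp
    qed
    have "norm (H v - H w) \<le> (2 * \<omega>) * norm (v - w)"
    proof (rule field_differentiable_bound[OF _ dH _ v w])
      fix x assume x: "x \<in> {va..vb}"
      have dx: "\<bar>deriv \<psi> x\<bar> \<le> 1/40" using slope_small I x by blast
      have "norm (g' x) \<le> \<bar>1 + \<alpha> * deriv \<psi> x\<bar> * norm u + \<bar>\<beta> * deriv \<psi> x\<bar> * norm n"
        unfolding g'_def by (metis norm_triangle_ineq norm_scaleR)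
      also have "\<dots> \<le> 2" using mult_unit_le[OF ab(1), of "deriv \<psi> x"] mult_unit_le[OF ab(2), of "deriv \<psi> x"] dx un by simp
      finally have "norm (grad (gam x) - g0) * norm (g' x) \<le> \<omega> * 2"
        using om[OF x va] om0 unfolding g0_def by (intro mult_mono) auto
      then show "norm ((grad (gam x) - g0) \<bullet> g' x) \<le> 2 * \<omega>"
        using Cauchy_Schwarz_ineq2[of "grad (gam x) - g0" "g' x"] by simp
    qed simp
    then have H: "\<bar>H v - H w\<bar> \<le> 2 * \<omega> * \<bar>v - w\<bar>" by simp
    have dpsi: "\<bar>\<psi> v - \<psi> w - q * (v - w)\<bar> \<le> \<omega>' * \<bar>v - w\<bar>"
      by (rule psi_increment[OF I(2) v w]) (use om'[OF _ va] in \<open>simp add: q_def\<close>)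
    have eq: "(ev v - ev w) - \<beta> * q / (1 + \<alpha> * q) * (tv v - tv w) = \<beta> * (\<psi> v - \<psi> w - q * (v - w)) / (1 + \<alpha> * q)"
      using aq by (simp add: ev_def tv_def field_simps)
    have e1: "\<bar>(ev v - ev w) - \<beta> * q / (1 + \<alpha> * q) * (tv v - tv w)\<bar> \<le> 2 * \<omega>' * \<bar>v - w\<bar>"
    proof -
      have "\<bar>\<beta> * (\<psi> v - \<psi> w - q * (v - w))\<bar> / (1 + \<alpha> * q) \<le> (\<omega>' * \<bar>v - w\<bar>) / (1/2)"
        using mult_unit_le[OF ab(2), of "\<psi> v - \<psi> w - q * (v - w)"] dpsi aq om0 by (intro frac_le) auto
      then show ?thesis unfolding eq abs_divide using aq by simp
    qed
    have an: "\<bar>a \<bullet> n\<bar> \<le> \<Gamma>"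
      using Cauchy_Schwarz_ineq2[of a n] Gm[OF va] un by (simp add: a_def g0_def)
    have split: "(F (gam v) - a0 \<bullet> gam v) - (F (gam w) - a0 \<bullet> gam w) - \<sigma> * (tv v - tv w)
       = (H v - H w) + (a \<bullet> n) * ((ev v - ev w) - \<beta> * q / (1 + \<alpha> * q) * (tv v - tv w))"
    proof -
      have ag: "a \<bullet> gam x = (a \<bullet> u) * tv x + (a \<bullet> n) * ev x" for x by (simp add: gam_def inner_add_right mult.commute)
      have "F (gam x) - a0 \<bullet> gam x = H x + a \<bullet> gam x" for x by (simp add: H_def a_def inner_diff_left)
      then show ?thesis unfolding ag \<sigma>_def by (simp add: algebra_simps diff_divide_distrib)
    qed
    have "\<bar>(H v - H w) + (a \<bullet> n) * ((ev v - ev w) - \<beta> * q / (1 + \<alpha> * q) * (tv v - tv w))\<bar>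
      \<le> 2 * \<omega> * \<bar>v - w\<bar> + \<Gamma> * (2 * \<omega>' * \<bar>v - w\<bar>)"
      by (intro order_trans[OF abs_triangle_ineq] add_mono H)
         (unfold abs_mult, intro mult_mono an e1, use om0 in auto)
    also have "\<dots> = 2 * (\<omega> + \<Gamma> * \<omega>') * \<bar>v - w\<bar>" by (simp add: algebra_simps)
    also have "\<dots> \<le> 2 * (\<omega> + \<Gamma> * \<omega>') * (2 * \<bar>tv v - tv w\<bar>)"
    proof (rule mult_left_mono)
      have "39/40 * b \<le> c \<Longrightarrow> 0 \<le> c \<Longrightarrow> b \<le> 2 * c" for b c :: real by simp
      from this[OF tv_diff(1)[OF vw]] show "\<bar>v - w\<bar> \<le> 2 * \<bar>tv v - tv w\<bar>" by simp
    qed (use om0 in simp)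
    also have "2 * (\<omega> + \<Gamma> * \<omega>') * (2 * \<bar>tv v - tv w\<bar>) = 4 * (\<omega> + \<Gamma> * \<omega>') * \<bar>tv v - tv w\<bar>" by simp
    finally show ?thesis unfolding split .
  qed
  then show ?thesis by blast
qed

end

text \<open>Each scale contributes a geometric term, dominated by the coarsest admissible one.\<close>

lemma sum_dyadic_powr:
  fixes z K \<theta> :: real
  assumes z: "z \<ge> 0" and K: "K > 0" and th: "\<theta> > 0"
  shows "(\<Sum>m\<le>N. if 2 ^ m * z \<le> K then (2 ^ m * z) powr \<theta> else 0) \<le> (2 * K) powr \<theta> / (2 powr \<theta> - 1)"
proof -
  have c: "2 powr \<theta> - 1 > (0::real)" "1 \<le> (2::real) powr \<theta>"
    using ge_one_powr_ge_zero[of 2 \<theta>] th by simp_all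
  have full: "(\<Sum>m\<le>N. (2 ^ m * z) powr \<theta>) \<le> (2 ^ Suc N * z) powr \<theta> / (2 powr \<theta> - 1)" for N
  proof -
    have "(2 powr \<theta> - 1) * (\<Sum>m\<le>N. (2 ^ m * z) powr \<theta>) = (2 ^ Suc N * z) powr \<theta> - z powr \<theta>"
    proof (induction N)
      case 0
      then show ?case using z by (simp add: powr_mult algebra_simps)
    next
      case (Suc N)
      have "(2 ^ Suc (Suc N) * z) powr \<theta> = 2 powr \<theta> * (2 ^ Suc N * z) powr \<theta>"
      proof -
        have "2 ^ Suc (Suc N) * z = 2 * (2 ^ Suc N * z)" by simp
        then show ?thesis by (simp only: powr_mult)
      qed
      then show ?case using Suc unfolding sum.atMost_Suc by (simp only: distrib_left left_diff_distrib)
    qed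
    then have "(2 powr \<theta> - 1) * (\<Sum>m\<le>N. (2 ^ m * z) powr \<theta>) \<le> (2 ^ Suc N * z) powr \<theta>" by simp
    then show ?thesis using c by (simp add: pos_le_divide_eq mult.commute)
  qed
  show ?thesis
  proof (induction N)
    case 0
    show ?case
    proof (cases "z \<le> K")
      case True
      have "z powr \<theta> \<le> (2 ^ Suc 0 * z) powr \<theta> / (2 powr \<theta> - 1)" using full[of 0] by simp
      also have "\<dots> \<le> (2 * K) powr \<theta> / (2 powr \<theta> - 1)"
        using c z th True by (intro divide_right_mono powr_mono2) (auto simp: less_imp_le)
      finally show ?thesis using True by simp
    qed (use c in simp)
  next
    case (Suc N)
    show ?case
    proof (cases "2 ^ Suc N * z \<le> K")
      case True
      have le: "2 ^ m * z \<le> K" if "m \<le> Suc N" for m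
      proof -
        have "2 ^ m * z \<le> 2 ^ Suc N * z" using that z by (intro mult_right_mono power_increasing) auto
        then show ?thesis using True by linarith
      qed
      have "(\<Sum>m\<le>Suc N. if 2 ^ m * z \<le> K then (2 ^ m * z) powr \<theta> else 0) = (\<Sum>m\<le>Suc N. (2 ^ m * z) powr \<theta>)"
        by (rule sum.cong) (use le in auto)
      also have "\<dots> \<le> (2 ^ Suc (Suc N) * z) powr \<theta> / (2 powr \<theta> - 1)" by (rule full)
      also have "\<dots> \<le> (2 * K) powr \<theta> / (2 powr \<theta> - 1)"
        using c z th True by (intro divide_right_mono powr_mono2) (auto simp: less_imp_le mult_ac)
      finally show ?thesis .
    qed (use Suc in simp)
  qed
qed

section \<open>Bounded overlap of the windows\<close>

lemma card_int_near: "card {j::int. \<bar>x - real_of_int j\<bar> \<le> real K} \<le> 2 * K + 1" "finite {j::int. \<bar>x - real_of_int j\<bar> \<le> real K}"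
proof -
  have sub: "{j::int. \<bar>x - real_of_int j\<bar> \<le> real K} \<subseteq> {\<lceil>x - real K\<rceil>..\<lfloor>x + real K\<rfloor>}"
  proof
    fix j assume "j \<in> {j::int. \<bar>x - real_of_int j\<bar> \<le> real K}"
    then have "x - real K \<le> real_of_int j" "real_of_int j \<le> x + real K" by (auto simp: abs_le_iff)
    then show "j \<in> {\<lceil>x - real K\<rceil>..\<lfloor>x + real K\<rfloor>}" unfolding atLeastAtMost_iff ceiling_le_iff le_floor_iff by blast
  qed
  show "finite {j::int. \<bar>x - real_of_int j\<bar> \<le> real K}" by (rule finite_subset[OF sub]) simp
  have "card {j::int. \<bar>x - real_of_int j\<bar> \<le> real K} \<le> card {\<lceil>x - real K\<rceil>..\<lfloor>x + real K\<rfloor>}"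
    by (rule card_mono[OF _ sub]) simp
  also have "\<dots> = nat (\<lfloor>x + real K\<rfloor> - \<lceil>x - real K\<rceil> + 1)" by simp
  also have "\<dots> \<le> 2 * K + 1"
  proof -
    have "real_of_int \<lfloor>x + real K\<rfloor> - real_of_int \<lceil>x - real K\<rceil> \<le> 2 * real K" by linarith
    then have "\<lfloor>x + real K\<rfloor> - \<lceil>x - real K\<rceil> \<le> 2 * int K" by linarith
    then show ?thesis by linarith
  qed
  finally show "card {j::int. \<bar>x - real_of_int j\<bar> \<le> real K} \<le> 2 * K + 1" .
qed

definition CN :: "real \<Rightarrow> real" where
  "CN \<theta> = 6 * 4001 * (4000 powr \<theta> / (2 powr \<theta> - 1))"

context lipschitz_set
begin

text \<open>At each scale at most 4001 indices j and six codes d are counted, with the factor (y /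
  \<open>s m\<close>)^\<theta>. On the scales counted y / \<open>s m\<close> is at most 2000, so
  \<open>sum_dyadic_powr\<close> sums these factors uniformly in \<open>N\<close>.\<close>

lemma overlap_bound:
  assumes y: "y \<ge> 0" and th: "\<theta> > 0"
  shows "(\<Sum>(m, j, d)\<in>Lam. if \<bar>t - real_of_int j * s m\<bar> \<le> 2000 * s m \<and> y \<le> 2000 * s m then s m powr (-\<theta>) * y powr \<theta> else 0) \<le> CN \<theta>"
proof -
  let ?z = "y / s0"
  have z: "?z \<ge> 0" using y s0 by simp
  define g where "g m = (if 2 ^ m * ?z \<le> 2000 then (2 ^ m * ?z) powr \<theta> else 0)" for m :: nat
  define h where "h m j = (if \<bar>t - real_of_int j * s m\<bar> \<le> 2000 * s m then 1 else 0 :: real)" for m j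
  have g0: "g m \<ge> 0" and h0: "h m j \<ge> 0" for m j by (simp_all add: g_def h_def)
  have ym: "y / s m = 2 ^ m * ?z" for m by (simp add: s_def field_simps)
  have pt: "(if \<bar>t - real_of_int j * s m\<bar> \<le> 2000 * s m \<and> y \<le> 2000 * s m then s m powr (-\<theta>) * y powr \<theta> else 0) = g m * h m j" for m j
  proof -
    have "s m powr (-\<theta>) * y powr \<theta> = (2 ^ m * ?z) powr \<theta>"
      unfolding ym[symmetric] using s_pos[of m] y by (simp add: powr_divide powr_minus_divide)
    moreover have "y \<le> 2000 * s m \<longleftrightarrow> 2 ^ m * ?z \<le> 2000"
      unfolding ym[symmetric] using s_pos[of m] by (simp add: pos_divide_le_eq)
    ultimately show ?thesis by (simp add: g_def h_def)
  qed
  have sub: "Lam \<subseteq> (SIGMA m:{..N}. J m \<times> {..<6::nat})" by (auto simp: Lam_def)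
  have "(\<Sum>(m, j, d)\<in>Lam. if \<bar>t - real_of_int j * s m\<bar> \<le> 2000 * s m \<and> y \<le> 2000 * s m then s m powr (-\<theta>) * y powr \<theta> else 0)
     = (\<Sum>(m, j, d)\<in>Lam. g m * h m j)"
    unfolding pt ..
  also have "\<dots> \<le> (\<Sum>(m, j, d)\<in>(SIGMA m:{..N}. J m \<times> {..<6::nat}). g m * h m j)"
    by (rule sum_mono2[OF _ sub]) (auto intro!: finite_J mult_nonneg_nonneg g0 h0)
  also have "\<dots> = (\<Sum>m\<le>N. \<Sum>(j, d)\<in>J m \<times> {..<6::nat}. g m * h m j)"
    by (rule sum.Sigma[symmetric]) (auto intro: finite_J)
  also have "\<dots> = (\<Sum>m\<le>N. g m * (6 * (\<Sum>j\<in>J m. h m j)))"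
    by (simp add: sum.cartesian_product[symmetric] sum_distrib_left mult_ac)
  also have "\<dots> \<le> (\<Sum>m\<le>N. g m * (6 * 4001))"
  proof (intro sum_mono mult_left_mono g0)
    fix m
    have "(\<Sum>j\<in>J m. h m j) = real (card (J m \<inter> {j. \<bar>t - real_of_int j * s m\<bar> \<le> 2000 * s m}))"
      unfolding h_def using finite_J[of m] by (simp add: sum.If_cases)
    also have "\<dots> \<le> real (card {j. \<bar>t / s m - real_of_int j\<bar> \<le> real 2000})"
    proof -
      have eq: "t / s m - real_of_int j = (t - real_of_int j * s m) / s m" for j using s_pos[of m] by (simp add: field_simps)
      have "J m \<inter> {j. \<bar>t - real_of_int j * s m\<bar> \<le> 2000 * s m} \<subseteq> {j. \<bar>t / s m - real_of_int j\<bar> \<le> real 2000}"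
        unfolding eq abs_divide using s_pos[of m] by (auto simp: pos_divide_le_eq)
      then show ?thesis using card_int_near(2)[of "t / s m" 2000] by (intro of_nat_mono card_mono) auto
    qed
    also have "\<dots> \<le> 4001" using card_int_near(1)[of "t / s m" 2000] by simp
    finally show "(\<Sum>j\<in>J m. h m j) \<le> 4001" .
  qed simp
  also have "\<dots> = 6 * 4001 * (\<Sum>m\<le>N. g m)" by (simp add: sum_distrib_right mult.commute)
  also have "\<dots> \<le> CN \<theta>"
    unfolding CN_def g_def using sum_dyadic_powr[OF z _ th, of 2000 N] by (intro mult_left_mono) simp_all
  finally show ?thesis .
qed

end

section \<open>Oscillation of the gradient and of the slope on a window\<close>

definition grad :: "(real^2 \<Rightarrow> real) \<Rightarrow> real^2 \<Rightarrow> real^2" where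
  "grad F x = (\<chi> j. pderiv2 j F x)"

lemma has_derivative_grad:
  assumes "F differentiable (at x)"
  shows "(F has_derivative (\<lambda>d. grad F x \<bullet> d)) (at x)"
proof -
  let ?D = "frechet_derivative F (at x)"
  have D: "(F has_derivative ?D) (at x)" using assms frechet_derivative_works by blast
  have "?D d = grad F x \<bullet> d" for d
  proof -
    have lin: "linear ?D" using D has_derivative_linear by blast
    have "d = d$1 *\<^sub>R axis 1 1 + d$2 *\<^sub>R axis 2 1"
      by (simp add: vec_eq_iff forall_2 axis_def)
    then have "?D d = d$1 * ?D (axis 1 1) + d$2 * ?D (axis 2 1)"
      using linear_add[OF lin] linear_scale[OF lin] by (metis real_scaleR_def)
    then show ?thesis by (simp add: grad_def pderiv2_def inner_vec_def sum_2)
  qed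
  then have "?D = (\<lambda>d. grad F x \<bullet> d)" by (rule ext)
  then show ?thesis using D by simp
qed

definition hess_norm1 :: "(2 \<Rightarrow> 2 \<Rightarrow> real^2 \<Rightarrow> real) \<Rightarrow> real^2 \<Rightarrow> real" where
  "hess_norm1 g x = (\<Sum>i\<in>UNIV. \<Sum>j\<in>UNIV. \<bar>g i j x\<bar>)"

definition th :: "real \<Rightarrow> real" where "th p = (p - 2) / 2"

lemma th: "p > 2 \<Longrightarrow> th p > 0" "p > 2 \<Longrightarrow> th p < p - 2" "p - 2 - th p = th p"
  by (simp_all add: th_def field_simps)

text \<open>The constant of \<open>abs_diff_savg_le\<close> for \<kappa> = (1/20)^\<theta>, where
  1/20 comes from \<open>infdist_Gam_ge\<close>.\<close>

definition C1 :: "real \<Rightarrow> real" where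
  "C1 p = 192 * KB * ((1/20) powr th p) powr (-1/p) / (1 - (1/2) powr ((p - 2 - th p) / p))"

lemma C1_ge: assumes "p > 2"
  shows "192 * KB * ((1/20) powr th p) powr (-1/p) \<le> C1 p" "C1 p \<ge> 0"
proof -
  let ?q = "(1/2::real) powr ((p - 2 - th p) / p)"
  have q: "0 \<le> ?q" "?q < 1" using powr_less_mono2[of "(p - 2 - th p) / p" "1/2" 1] th[of p] assms by auto
  have K: "192 * KB * ((1/20) powr th p) powr (-1/p) \<ge> 0" using KB(1) by simp
  show "192 * KB * ((1/20) powr th p) powr (-1/p) \<le> C1 p"
    unfolding C1_def using q K by (simp add: pos_le_divide_eq mult_left_le)
  then show "C1 p \<ge> 0" using K by linarith
qed

definition CZ :: "real \<Rightarrow> real" where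
  "CZ p = 2 * 192 powr p * ((6 * C1 p) powr p + CE p (th p) powr p) * 256 powr (p - 2 - th p)"

lemma dist_le_l1: "dist x y \<le> \<bar>x$1 - y$1\<bar> + \<bar>x$2 - y$2\<bar>" for x y :: "real^2"
  using norm_le_l1_cart[of "x - y"] by (simp add: dist_norm sum_2)

lemma dist_le_of_coords:
  fixes y c :: "real^2"
  assumes "y \<in> cbox (\<chi> i. c$i - 5/8 * r) (\<chi> i. c$i + 5/8 * r)" "r > 0"
  shows "dist y c \<le> 9/10 * r"
proof -
  have "\<bar>y$i - c$i\<bar> \<le> 5/8 * r" for i
  proof -
    have "c$i - 5/8 * r \<le> y$i" "y$i \<le> c$i + 5/8 * r" using assms(1) by (auto simp: mem_box_cart)
    then show ?thesis by linarith
  qed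
  then have sq: "(y$i - c$i)\<^sup>2 \<le> (5/8 * r)\<^sup>2" for i by (metis abs_ge_zero power2_abs power_mono)
  have "(y$1 - c$1)\<^sup>2 + (y$2 - c$2)\<^sup>2 \<le> 2 * (5/8 * r)\<^sup>2"
    using add_mono[OF sq[of 1] sq[of 2]] by simp
  also have "\<dots> = 25/32 * (r * r)" by (simp add: power2_eq_square)
  also have "\<dots> \<le> 81/100 * (r * r)" by (intro mult_right_mono) auto
  also have "\<dots> = (9/10 * r)\<^sup>2" by (simp add: power2_eq_square)
  finally have "(y$1 - c$1)\<^sup>2 + (y$2 - c$2)\<^sup>2 \<le> (9/10 * r)\<^sup>2" .
  then show ?thesis
    using assms(2) unfolding dist_norm norm_vec_def L2_set_def
    by (intro real_le_lsqrt) (auto simp: sum_2)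
qed

text \<open>a0 . x + b0 is the prescribed jet, \<Gamma> the Morrey bound for the gradient of the
  difference, V bounds the energy of \<open>F\<close> and Bes that of the curve. The jet point
  enters through \<open>grad_close\<close>; \<open>room\<close> places the windows of all scales
  inside \<open>U\<close>.\<close>

locale trace_setting = c?: curve \<psi> u n \<alpha> \<beta> v1 v2 k1 k2 + l?: lipschitz_set E u n s0
  for \<psi> u n \<alpha> \<beta> v1 v2 k1 k2 E s0 +
  fixes p :: real and U :: "(real^2) set" and F :: "real^2 \<Rightarrow> real" and g :: "2 \<Rightarrow> 2 \<Rightarrow> real^2 \<Rightarrow> real"
    and a0 :: "real^2" and b0 V \<Gamma> Bes :: real
  assumes p: "p > 2"
    and par: "\<And>e. e \<in> E \<Longrightarrow> \<exists>v\<in>{v1..v2}. e = gam v"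
    and bes: "Bes \<ge> 0" "besov_int p \<psi> \<le> ennreal Bes"
    and wd: "\<And>j. weakly_differentiable U (pderiv2 j F) (\<lambda>i. g i j) (hess_norm1 g)"
    and diffF: "\<And>x. x \<in> U \<Longrightarrow> F differentiable (at x)"
    and V: "V \<ge> 0" "(\<integral>\<^sup>+x\<in>U. ennreal (hess_norm1 g x powr p) \<partial>lborel) \<le> ennreal V"
    and room: "\<And>e y. e \<in> E \<Longrightarrow> dist y e \<le> 2000 * s0 \<Longrightarrow> y \<in> U"
    and grad_close: "\<And>e y. e \<in> E \<Longrightarrow> dist y e \<le> 100 * s0 \<Longrightarrow> norm (grad F y - a0) \<le> \<Gamma>"
begin

definition wt :: "real^2 \<Rightarrow> real" where "wt y = infdist y Gam powr th p"

lemma wt_measurable [measurable]: "wt \<in> borel_measurable borel"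
proof -
  have "continuous_on UNIV (\<lambda>y. infdist y Gam)" by (intro continuous_intros)
  then have [measurable]: "(\<lambda>y. infdist y Gam) \<in> borel_measurable borel" by (rule borel_measurable_continuous_onI)
  show ?thesis unfolding wt_def[abs_def] by measurable
qed

lemma hess_norm1_measurable [measurable]: "hess_norm1 g \<in> borel_measurable borel"
  using wd[of 1] unfolding weakly_differentiable_def by simp

lemma open_U: "open U" using wd[of 1] unfolding weakly_differentiable_def by simp

text \<open>The window of an index. 2000 accommodates squares of half-side 512 \<open>s m\<close>
  around points of the curve within 22 \<open>s m\<close> of the grid point. The second cut is by
  the distance to the curve, the quantity whose power is the weight, as \<open>overlap_bound\<close>
  requires.\<close>

definition Reg :: "nat \<Rightarrow> int \<Rightarrow> (real^2) set" where
  "Reg m i = {y \<in> U. \<bar>tau y - real_of_int i * s m\<bar> \<le> 2000 * s m \<and> infdist y Gam \<le> 2000 * s m}"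

lemma Reg_measurable [measurable]: "Reg m i \<in> sets borel"
proof -
  have "closed {y. \<bar>tau y - real_of_int i * s m\<bar> \<le> 2000 * s m \<and> infdist y Gam \<le> 2000 * s m}"
    by (intro closed_Collect_conj closed_Collect_le continuous_intros)
  moreover have "Reg m i = U \<inter> {y. \<bar>tau y - real_of_int i * s m\<bar> \<le> 2000 * s m \<and> infdist y Gam \<le> 2000 * s m}"
    by (auto simp: Reg_def)
  ultimately show ?thesis using open_U by simp
qed

text \<open>Each value on the curve is compared with an average over a box displaced in the
  direction \<open>n\<close>, through boxes on which the weight is at least (r/20)^\<theta>, and the
  two averages are compared with each other: three differences, hence the factor 3.\<close>

lemma pderiv2_osc:
  assumes v: "v \<in> {v1..v2}" "\<bar>tv v - real_of_int i * s m\<bar> \<le> 22 * s m"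
    and v': "v' \<in> {v1..v2}" "\<bar>tv v' - real_of_int i * s m\<bar> \<le> 22 * s m"
    and e: "e \<in> E" "\<bar>tau e - real_of_int i * s m\<bar> \<le> 22 * s m"
    and X: "X \<ge> 0" "(\<integral>\<^sup>+y\<in>Reg m i. ennreal (hess_norm1 g y powr p * wt y) \<partial>lborel) \<le> ennreal X"
  shows "\<bar>pderiv2 j F (gam v) - pderiv2 j F (gam v')\<bar>
    \<le> 3 * (C1 p * (256 * s m) powr ((p - 2 - th p) / p) * X powr (1/p))"
proof -
  interpret W: weakly_differentiable U "pderiv2 j F" "\<lambda>i. g i j" "hess_norm1 g" by (rule wd)
  \<comment> \<open>The displacement has to dominate the distance 92 \<open>s m\<close> of the two
    points: 92 + 256/8 is at most 5/8 * 256.\<close>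
  let ?S = "256 * s m"
  have sm: "s m > 0" by (rule s_pos)
  have sm0: "s m \<le> s0" using s_mono[of 0 m] by (simp add: s_0)
  \<comment> \<open>44 * 40/39 is below 46, and \<open>dist_gam\<close> doubles it.\<close>
  have dd: "dist (gam x) (gam y) \<le> 92 * s m"
    if "x \<in> {v1..v2}" "\<bar>tv x - real_of_int i * s m\<bar> \<le> 22 * s m" "y \<in> {v1..v2}" "\<bar>tv y - real_of_int i * s m\<bar> \<le> 22 * s m" for x y
  proof -
    have "\<bar>tv x - tv y\<bar> \<le> 22 * s m + 22 * s m"
      by (rule abs_diff_triangle[of _ "real_of_int i * s m"]) (use that in \<open>simp_all add: abs_minus_commute\<close>)
    from order_trans[OF tv_diff(1)[OF that(1,3)] this] have "39/40 * \<bar>x - y\<bar> \<le> 44 * s m" by simp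
    then have "2 * \<bar>x - y\<bar> \<le> 92 * s m" using sm by simp
    then show ?thesis using dist_gam[OF that(1,3)] by (rule order_trans[rotated])
  qed
  obtain ve where ve: "ve \<in> {v1..v2}" "e = gam ve" using par[OF e(1)] by blast
  have te: "tv ve = tau e" by (simp add: ve(2) inner_gam)
  have sq: "{w. \<forall>k. \<bar>w$k - gam x$k\<bar> \<le> 2 * ?S} \<subseteq> Reg m i"
    if x: "x \<in> {v1..v2}" "\<bar>tv x - real_of_int i * s m\<bar> \<le> 22 * s m" for x
  proof
    fix w assume "w \<in> {w. \<forall>k. \<bar>w$k - gam x$k\<bar> \<le> 2 * ?S}"
    then have "\<bar>w$1 - gam x$1\<bar> \<le> 2 * ?S" "\<bar>w$2 - gam x$2\<bar> \<le> 2 * ?S" by blast+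
    then have dw: "dist w (gam x) \<le> 1024 * s m" using dist_le_l1[of w "gam x"] by linarith
    have "dist (gam x) e \<le> 92 * s m" unfolding ve(2) by (rule dd) (use x ve te e in auto)
    then have "dist w e \<le> 1116 * s m" using dw dist_triangle[of w e "gam x"] by linarith
    then have "dist w e \<le> 2000 * s0" using sm sm0 by linarith
    then have U: "w \<in> U" by (rule room[OF e(1)])
    have "\<bar>tau w - tv x\<bar> \<le> 1024 * s m" using inner_le_dist(1)[of w "gam x"] dw by (simp add: inner_gam)
    from abs_diff_triangle[OF this x(2)] have t: "\<bar>tau w - real_of_int i * s m\<bar> \<le> 2000 * s m" using sm by simp
    have "infdist w Gam \<le> dist w (gam x)" using x(1) by (intro infdist_le) (auto simp: Gam_def)
    then have "infdist w Gam \<le> 2000 * s m" using dw sm by linarith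
    then show "w \<in> Reg m i" using U t by (simp add: Reg_def)
  qed
  have RU: "Reg m i \<subseteq> U" by (auto simp: Reg_def)
  have ww: "(1/20) powr th p * r powr th p \<le> wt y"
    if "x \<in> {v1..v2}" "0 < r" "dist y (gam x + r *\<^sub>R n) \<le> 9/10 * r" for x r y
  proof -
    have "(1/20) powr th p * r powr th p = (r/20) powr th p" using that by (simp add: powr_divide)
    also have "\<dots> \<le> infdist y Gam powr th p"
      using infdist_Gam_ge[OF that] that(2) th(1)[OF p] by (intro powr_mono2) auto
    finally show ?thesis by (simp add: wt_def)
  qed
  have one: "\<bar>pderiv2 j F (gam x) - W.savg (gam x + ?S *\<^sub>R n) (?S / 8)\<bar> \<le> C1 p * ?S powr ((p - 2 - th p) / p) * X powr (1/p)"
    if x: "x \<in> {v1..v2}" "\<bar>tv x - real_of_int i * s m\<bar> \<le> 22 * s m" for x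
    unfolding C1_def
  proof (rule W.abs_diff_savg_le[where w = wt])
    show "{w. \<forall>k. \<bar>w$k - gam x$k\<bar> \<le> 2 * ?S} \<subseteq> U" using sq[OF x] RU by blast
    have "(\<integral>\<^sup>+y\<in>{w. \<forall>k. \<bar>w$k - gam x$k\<bar> \<le> 2 * ?S}. ennreal (hess_norm1 g y powr p * wt y) \<partial>lborel)
      \<le> (\<integral>\<^sup>+y\<in>Reg m i. ennreal (hess_norm1 g y powr p * wt y) \<partial>lborel)"
      using sq[OF x] by (intro nn_integral_mono mult_left_mono) (auto simp: indicator_def)
    then show "(\<integral>\<^sup>+y\<in>{w. \<forall>k. \<bar>w$k - gam x$k\<bar> \<le> 2 * ?S}. ennreal (hess_norm1 g y powr p * wt y) \<partial>lborel) \<le> ennreal X"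
      using X(2) by (rule order_trans)
  qed (use p th[of p] sm un X x ww in \<open>auto simp: c.un\<close>)
  have two: "\<bar>W.savg (gam v + ?S *\<^sub>R n) (?S / 8) - W.savg (gam v' + ?S *\<^sub>R n) (?S / 8)\<bar> \<le> C1 p * ?S powr ((p - 2 - th p) / p) * X powr (1/p)"
  proof -
    let ?c = "gam v + ?S *\<^sub>R n" and ?c' = "gam v' + ?S *\<^sub>R n"
    let ?R = "cbox (\<chi> k. ?c$k - 5/8 * ?S) (\<chi> k. ?c$k + 5/8 * ?S)"
    have nk: "\<bar>n$k\<bar> \<le> 1" for k using component_le_norm_cart[of n k] c.un by simp
    have RR: "?R \<subseteq> Reg m i"
    proof (rule order_trans[OF _ sq[OF v]], rule subsetI)
      fix y assume y: "y \<in> ?R"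
      have "\<bar>y$k - gam v$k\<bar> \<le> 2 * ?S" for k
      proof -
        have "?c$k - 5/8 * ?S \<le> y$k" "y$k \<le> ?c$k + 5/8 * ?S" using y by (auto simp: mem_box_cart)
        then have "\<bar>y$k - ?c$k\<bar> \<le> 5/8 * ?S" by (simp add: abs_le_iff)
        moreover have "\<bar>?c$k - gam v$k\<bar> \<le> ?S" using mult_left_mono[OF nk[of k], of ?S] sm by (simp add: abs_mult)
        ultimately have "\<bar>y$k - gam v$k\<bar> \<le> 5/8 * ?S + ?S" by (rule abs_diff_triangle)
        then show ?thesis using sm by simp
      qed
      then show "y \<in> {w. \<forall>k. \<bar>w$k - gam v$k\<bar> \<le> 2 * ?S}" by simp
    qed
    have "\<bar>W.savg ?c (1/8 * ?S) - W.savg ?c' (?S / 8)\<bar>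
      \<le> 192 * KB * ((1/20) powr th p) powr (-1/p) * X powr (1/p) * ?S powr ((p - 2 - th p) / p)"
    proof (rule W.savg_diff_weighted[OF p _ _ refl RR _ _ wt_measurable _ X])
      show "?R \<subseteq> U" using RR RU by blast
      show "(1/20) powr th p * ?S powr th p \<le> wt y" if "y \<in> ?R" for y
        using ww[OF v(1) _ dist_le_of_coords[OF that]] sm by simp
      fix k
      have "\<bar>?c'$k - ?c$k\<bar> \<le> dist (gam v') (gam v)"
        using component_le_norm_cart[of "gam v' - gam v" k] by (simp add: dist_norm)
      also have "\<dots> \<le> 92 * s m" by (rule dd[OF v' v])
      finally show "\<bar>?c'$k - ?c$k\<bar> + ?S / 8 \<le> 5/8 * ?S" using sm by simp
    qed (use sm in auto)
    also have "\<dots> = (192 * KB * ((1/20) powr th p) powr (-1/p)) * (?S powr ((p - 2 - th p) / p) * X powr (1/p))" by simp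
    also have "\<dots> \<le> C1 p * (?S powr ((p - 2 - th p) / p) * X powr (1/p))"
      by (rule mult_right_mono[OF C1_ge(1)[OF p]]) simp
    finally show ?thesis by (simp add: mult.assoc)
  qed
  let ?B = "C1 p * ?S powr ((p - 2 - th p) / p) * X powr (1/p)"
  have "\<bar>pderiv2 j F (gam v) - pderiv2 j F (gam v')\<bar> \<le> ?B + (?B + ?B)"
    by (rule abs_diff_triangle[OF one[OF v] abs_diff_triangle[OF two]]) (use one[OF v'] in \<open>simp add: abs_minus_commute\<close>)
  also have "?B + (?B + ?B) = 3 * ?B" by simp
  finally show ?thesis by (simp only: mult.assoc)
qed

lemma grad_osc:
  assumes v: "v \<in> {v1..v2}" "\<bar>tv v - real_of_int i * s m\<bar> \<le> 22 * s m"
    and v': "v' \<in> {v1..v2}" "\<bar>tv v' - real_of_int i * s m\<bar> \<le> 22 * s m"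
    and e: "e \<in> E" "\<bar>tau e - real_of_int i * s m\<bar> \<le> 22 * s m"
    and X: "X \<ge> 0" "(\<integral>\<^sup>+y\<in>Reg m i. ennreal (hess_norm1 g y powr p * wt y) \<partial>lborel) \<le> ennreal X"
  shows "norm (grad F (gam v) - grad F (gam v')) \<le> 6 * C1 p * (256 * s m) powr ((p - 2 - th p) / p) * X powr (1/p)"
proof -
  have "norm (grad F (gam v) - grad F (gam v')) \<le> \<bar>pderiv2 1 F (gam v) - pderiv2 1 F (gam v')\<bar> + \<bar>pderiv2 2 F (gam v) - pderiv2 2 F (gam v')\<bar>"
    using norm_le_l1_cart[of "grad F (gam v) - grad F (gam v')"] by (simp add: sum_2 grad_def)
  then show ?thesis using pderiv2_osc[OF v v' e X, of 1] pderiv2_osc[OF v v' e X, of 2] by linarith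
qed

text \<open>The slope of \<psi> is controlled only on [v1, v2], while the intervals used for its
  derivative may stick out. Clamping gives every parameter a tangential position without increasing
  its distance to points of [v1, v2].\<close>

definition clampv :: "real \<Rightarrow> real" where "clampv y = max v1 (min v2 y)"

lemma clampv: "clampv y \<in> {v1..v2}" "v \<in> {v1..v2} \<Longrightarrow> \<bar>clampv y - v\<bar> \<le> \<bar>y - v\<bar>"
  using v12 by (auto simp: clampv_def max_def min_def)

definition Reg' :: "nat \<Rightarrow> int \<Rightarrow> (real \<times> real) set" where
  "Reg' m i = {z. \<bar>tv (clampv (fst z)) - real_of_int i * s m\<bar> \<le> 2000 * s m \<and> \<bar>fst z - snd z\<bar> \<le> 2000 * s m}"

lemma tv_clampv_continuous: "continuous_on UNIV (\<lambda>w. tv (clampv w))"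
proof -
  have "continuous_on UNIV \<psi>" using DERIV DERIV_isCont by (blast intro: continuous_at_imp_continuous_on)
  then have "continuous_on UNIV tv" unfolding tv_def[abs_def] by (intro continuous_intros)
  moreover have "continuous_on UNIV clampv" unfolding clampv_def[abs_def] by (intro continuous_intros)
  ultimately show ?thesis using continuous_on_compose2[of UNIV tv UNIV clampv] by simp
qed

lemma Reg'_measurable [measurable]: "Reg' m i \<in> sets (lborel \<Otimes>\<^sub>M lborel)"
proof -
  have c: "continuous_on UNIV (\<lambda>z::real\<times>real. tv (clampv (fst z)))"
    by (rule continuous_on_compose2[OF tv_clampv_continuous]) (auto intro: continuous_intros)
  have "closed (Reg' m i)" unfolding Reg'_def
    by (intro closed_Collect_conj closed_Collect_le continuous_intros c)
  then show ?thesis unfolding lborel_prod sets_lborel by (rule borel_closed)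
qed

lemma deriv_psi_osc:
  assumes v: "v \<in> {v1..v2}" "\<bar>tv v - real_of_int i * s m\<bar> \<le> 22 * s m"
    and v': "v' \<in> {v1..v2}" "\<bar>tv v' - real_of_int i * s m\<bar> \<le> 22 * s m"
    and X: "X \<ge> 0" "(\<integral>\<^sup>+z\<in>Reg' m i. ennreal (besk p (th p) \<psi> z) \<partial>(lborel \<Otimes>\<^sub>M lborel)) \<le> ennreal X"
  shows "\<bar>deriv \<psi> v - deriv \<psi> v'\<bar> \<le> CE p (th p) * (256 * s m) powr ((p - 2 - th p) / p) * X powr (1/p)"
  using v v'
proof (induction v v' rule: linorder_wlog)
  case (le v v')
  have sm: "s m > 0" by (rule s_pos)
  \<comment> \<open>46 \<open>s m\<close> bounds the distance of v and v';
    \<open>deriv_diff_le\<close> looks to the right of v, on an interval of twice this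
    length.\<close>
  let ?r = "46 * s m" and ?I = "{v..v + 2 * (46 * s m)}"
  have "\<bar>tv v - tv v'\<bar> \<le> 22 * s m + 22 * s m"
    by (rule abs_diff_triangle[of _ "real_of_int i * s m"]) (use le in \<open>simp_all add: abs_minus_commute\<close>)
  from order_trans[OF tv_diff(1)[OF le(2,4)] this] have "39/40 * \<bar>v - v'\<bar> \<le> 44 * s m" by simp
  then have d: "v' \<le> v + ?r" using sm le by simp
  have sub: "?I \<times> ?I \<subseteq> Reg' m i"
  proof
    fix z assume "z \<in> ?I \<times> ?I"
    then obtain w w' where z: "z = (w, w')" "w \<in> ?I" "w' \<in> ?I" by blast
    have "\<bar>w - w'\<bar> \<le> 92 * s m" using z by (auto simp: abs_le_iff)
    moreover have "\<bar>tv (clampv w) - real_of_int i * s m\<bar> \<le> 2000 * s m"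
    proof -
      have "\<bar>clampv w - v\<bar> \<le> \<bar>w - v\<bar>" using clampv(2) le by blast
      also have "\<dots> \<le> 92 * s m" using z by simp
      finally have "41/40 * \<bar>clampv w - v\<bar> \<le> 41/40 * (92 * s m)" by simp
      from order_trans[OF tv_diff(2)[OF clampv(1) le(2)] this]
      have "\<bar>tv (clampv w) - tv v\<bar> \<le> 41/40 * (92 * s m)" .
      from abs_diff_triangle[OF this] show ?thesis using le sm by fastforce
    qed
    ultimately show "z \<in> Reg' m i" using sm by (simp add: z(1) Reg'_def)
  qed
  have "(\<integral>\<^sup>+z\<in>?I \<times> ?I. ennreal (besk p (th p) \<psi> z) \<partial>(lborel \<Otimes>\<^sub>M lborel))
    \<le> (\<integral>\<^sup>+z\<in>Reg' m i. ennreal (besk p (th p) \<psi> z) \<partial>(lborel \<Otimes>\<^sub>M lborel))"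
    using sub by (intro nn_integral_mono mult_left_mono) (auto simp: indicator_def)
  from order_trans[OF this X(2)]
  have "\<bar>deriv \<psi> v - deriv \<psi> v'\<bar> \<le> CE p (th p) * ?r powr ((p - 2 - th p) / p) * X powr (1/p)"
    unfolding CE_def using p th[of p] sm le d X(1) by (intro deriv_diff_le) auto
  also have "\<dots> \<le> CE p (th p) * (256 * s m) powr ((p - 2 - th p) / p) * X powr (1/p)"
    using sm p th[of p] CE_pos[of p "th p"] by (intro mult_right_mono mult_left_mono powr_mono2) auto
  finally show ?case .
next
  case (sym v v')
  then show ?case by (simp add: abs_minus_commute)
qed

definition data :: "real^2 \<Rightarrow> real" where "data x = F x - (a0 \<bullet> x + b0)"

text \<open>On the window of a pair, the divided differences of the data all agree up to \<open>4 (\<omega> + \<Gamma> \<omega>')\<close>.\<close>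

lemma Lam_term:
  assumes l: "(m, i, d) \<in> Lam"
    and X: "X \<ge> 0" "(\<integral>\<^sup>+y\<in>Reg m i. ennreal (hess_norm1 g y powr p * wt y) \<partial>lborel) \<le> ennreal X"
    and X': "X' \<ge> 0" "(\<integral>\<^sup>+z\<in>Reg' m i. ennreal (besk p (th p) \<psi> z) \<partial>(lborel \<Otimes>\<^sub>M lborel)) \<le> ennreal X'"
  shows "(s m)\<^sup>2 * ((\<bar>dA data m i d\<bar> / s m) powr p + (\<bar>dP data m i d\<bar> / (s m)\<^sup>2) powr p)
    \<le> CZ p * (s m powr (- th p) * X + \<Gamma> powr p * (s m powr (- th p) * X'))"
proof -
  define e where "e = rep m i"
  define e' where "e' = par m i d"
  have sm: "s m > 0" by (rule s_pos)
  have p0: "p > 0" using p by simp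
  have CZ0: "CZ p \<ge> 0" by (simp add: CZ_def)
  have i: "i \<in> J m" "m \<le> N" using l by (auto simp: Lam_def)
  have eE: "e \<in> E" "\<bar>tau e - real_of_int i * s m\<bar> \<le> 3 * s m" using rep[OF i(1)] by (auto simp: e_def)
  have e'E: "e' \<in> E" using par_in_E[OF l] by (simp add: e'_def)
  \<comment> \<open>At the same level the grid point of the partner is at most one step away. At the
    coarser level it is at most 3 \<open>s m\<close> away, and the representative 3
    \<open>s (m - 1)\<close> = 6 \<open>s m\<close> further.\<close>
  have e't: "\<bar>tau e' - real_of_int i * s m\<bar> \<le> 9 * s m"
  proof (cases "d < 3")
    case True
    then have k: "i + int d - 1 \<in> J m" "e' = rep m (i + int d - 1)" using l by (auto simp: Lam_def e'_def par_def)
    have "\<bar>real_of_int (i + int d - 1) * s m - real_of_int i * s m\<bar> = \<bar>real_of_int (int d - 1)\<bar> * s m"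
      using sm by (simp add: left_diff_distrib[symmetric] abs_mult)
    also have "\<dots> \<le> 1 * s m" using True sm by (intro mult_right_mono) auto
    finally have "\<bar>real_of_int (i + int d - 1) * s m - real_of_int i * s m\<bar> \<le> s m" by simp
    from abs_diff_triangle[OF rep(2)[OF k(1)] this] show ?thesis using sm by (simp add: k(2))
  next
    case False
    let ?k = "i div 2 + int d - 4"
    have k: "?k \<in> J (m - 1)" "m \<ge> 1" "e' = rep (m - 1) ?k" "d < 6" using l False by (auto simp: Lam_def e'_def par_def)
    have s2: "s (m - 1) = 2 * s m" using s_pred k by blast
    have "\<bar>2 * ?k - i\<bar> \<le> 3"
    proof -
      have gen: "\<bar>2 * (q + D - 4) - i\<bar> \<le> 3" if "i = 2 * q + r" "0 \<le> r" "r \<le> 1" "3 \<le> D" "D \<le> 5" for q D r :: int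
        using that by simp
      show ?thesis by (rule gen[of _ "i mod 2"]) (use k(4) False in auto)
    qed
    then have "\<bar>real_of_int (2 * ?k - i)\<bar> * s m \<le> 3 * s m" using sm by (intro mult_right_mono) linarith+
    moreover have "real_of_int ?k * s (m - 1) - real_of_int i * s m = real_of_int (2 * ?k - i) * s m"
      unfolding s2 by (simp add: algebra_simps)
    ultimately have "\<bar>real_of_int ?k * s (m - 1) - real_of_int i * s m\<bar> \<le> 2 * s m + s m" using sm by (simp only: abs_mult)
    from abs_diff_triangle[OF rep(2)[OF k(1)] this] show ?thesis using sm unfolding k(3) s2 by linarith
  qed
  show ?thesis
  \<comment> \<open>Representatives may coincide, in particular if \<open>E\<close> is a single
    point; then both differences vanish. Otherwise both points have a genuine nearest
    neighbour.\<close>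
  proof (cases "e = e'")
    case True
    then have "dA data m i d = 0" "dP data m i d = 0"
      by (simp_all add: dA_def dP_def e_def[symmetric] e'_def[symmetric] P_def)
    then show ?thesis using CZ0 X(1) X'(1) p0 by simp
  next
    case ne: False
    have notsing: "E \<noteq> {e}" "E \<noteq> {e'}" using ne eE(1) e'E by auto
    have t1: "\<bar>tau e - tau e'\<bar> \<le> 3 * s m + 9 * s m"
      by (rule abs_diff_triangle[OF eE(2)]) (use e't in \<open>simp add: abs_minus_commute\<close>)
    note nbe = nb[OF notsing(1) eE(1)] and nbe' = nb[OF notsing(2) e'E]
    \<comment> \<open>The partner competes in the definition of \<open>nb\<close>, so the neighbours
      are as close as the pair itself; this keeps the window at the size of the scale however sparse
      \<open>E\<close> is.\<close>
    have n1: "\<bar>tau e - tau (nb e)\<bar> \<le> 12 * s m" using nbe(3)[OF e'E] ne t1 by force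
    have n2: "\<bar>tau e' - tau (nb e')\<bar> \<le> 12 * s m" using nbe'(3)[OF eE(1) ne] t1 by (simp add: abs_minus_commute)
    define K where "K = {e, e', nb e, nb e'}"
    have KE: "K \<subseteq> E" using eE e'E nbe nbe' by (auto simp: K_def)
    have Kt: "\<bar>tau x - real_of_int i * s m\<bar> \<le> 22 * s m" if "x \<in> K" for x
    proof -
      have "\<bar>tau (nb e) - real_of_int i * s m\<bar> \<le> 12 * s m + 3 * s m"
        by (rule abs_diff_triangle[OF _ eE(2)]) (use n1 in \<open>simp add: abs_minus_commute\<close>)
      moreover have "\<bar>tau (nb e') - real_of_int i * s m\<bar> \<le> 12 * s m + 9 * s m"
        by (rule abs_diff_triangle[OF _ e't]) (use n2 in \<open>simp add: abs_minus_commute\<close>)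
      ultimately have "\<bar>tau (nb e) - real_of_int i * s m\<bar> \<le> 22 * s m" "\<bar>tau (nb e') - real_of_int i * s m\<bar> \<le> 22 * s m"
        "\<bar>tau e - real_of_int i * s m\<bar> \<le> 22 * s m" "\<bar>tau e' - real_of_int i * s m\<bar> \<le> 22 * s m"
        using eE(2) e't sm by simp_all
      then show ?thesis using that by (auto simp: K_def)
    qed
    obtain vp where vp: "\<And>x. x \<in> E \<Longrightarrow> vp x \<in> {v1..v2}" "\<And>x. x \<in> E \<Longrightarrow> x = gam (vp x)"
      using par by metis
    \<comment> \<open>The parameter interval spanned by the four points. As \<open>tv\<close> is
      monotone, all of it stays within 22 \<open>s m\<close> of the grid point.\<close>
    define va vb where "va = Min (vp ` K)" and "vb = Max (vp ` K)"
    have finK: "finite (vp ` K)" "vp ` K \<noteq> {}" by (auto simp: K_def)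
    have vab: "va \<le> vp x" "vp x \<le> vb" if "x \<in> K" for x using that finK by (auto simp: va_def vb_def)
    obtain xa xb where xab: "xa \<in> K" "va = vp xa" "xb \<in> K" "vb = vp xb"
      using Min_in[OF finK] Max_in[OF finK] by (auto simp: va_def vb_def)
    have I: "va \<le> vb" "{va..vb} \<subseteq> {v1..v2}"
      using vab[OF xab(1)] xab vp(1) KE by (auto simp: subset_iff) (meson KE atLeastAtMost_iff order_trans subset_iff vp(1))+
    have tvx: "tv (vp x) = tau x" if "x \<in> E" for x using vp(2)[OF that] inner_gam(1) by metis
    have win: "v \<in> {v1..v2}" "\<bar>tv v - real_of_int i * s m\<bar> \<le> 22 * s m" if v: "v \<in> {va..vb}" for v
    proof -
      show vv: "v \<in> {v1..v2}" using v I by blast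
      have ab: "va \<in> {v1..v2}" "vb \<in> {v1..v2}" using I by auto
      have "tv va \<le> tv v" "tv v \<le> tv vb" using tv_diff(3)[OF ab(1) vv] tv_diff(3)[OF vv ab(2)] v by auto
      moreover have "tv va = tau xa" "tv vb = tau xb" using tvx xab KE by auto
      ultimately show "\<bar>tv v - real_of_int i * s m\<bar> \<le> 22 * s m"
        using Kt[OF xab(1)] Kt[OF xab(3)] by (simp add: abs_le_iff)
    qed
    define \<omega> where "\<omega> = 6 * C1 p * (256 * s m) powr ((p - 2 - th p) / p) * X powr (1/p)"
    define \<omega>' where "\<omega>' = CE p (th p) * (256 * s m) powr ((p - 2 - th p) / p) * X' powr (1/p)"
    define \<Omega> where "\<Omega> = 4 * (\<omega> + \<Gamma> * \<omega>')"
    have sm0: "s m \<le> s0" using s_mono[of 0 m] by (simp add: s_0)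
    have e20: "\<bar>tau e - real_of_int i * s m\<bar> \<le> 22 * s m" using eE(2) sm by simp
    have near_e: "dist (gam v) e \<le> 92 * s m" if v: "v \<in> {va..vb}" for v
    proof -
      have vpe: "vp e \<in> {v1..v2}" using vp(1) eE(1) by blast
      have "\<bar>tv v - tv (vp e)\<bar> \<le> 22 * s m + 22 * s m"
        by (rule abs_diff_triangle[OF win(2)[OF v]]) (use e20 tvx[OF eE(1)] in \<open>simp add: abs_minus_commute\<close>)
      from order_trans[OF tv_diff(1)[OF win(1)[OF v] vpe] this] have "39/40 * \<bar>v - vp e\<bar> \<le> 44 * s m" by simp
      then have "2 * \<bar>v - vp e\<bar> \<le> 92 * s m" using sm by simp
      moreover have "dist (gam v) (gam (vp e)) \<le> 2 * \<bar>v - vp e\<bar>" by (rule dist_gam[OF win(1)[OF v] vpe])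
      ultimately have "dist (gam v) (gam (vp e)) \<le> 92 * s m" by simp
      then show ?thesis using vp(2)[OF eE(1)] by simp
    qed
    have G0: "\<Gamma> \<ge> 0"
    proof -
      have "norm (grad F e - a0) \<le> \<Gamma>" by (rule grad_close[OF eE(1)]) (use s0 in simp)
      then show ?thesis using norm_ge_zero order_trans by blast
    qed
    have "\<exists>\<sigma>. \<forall>v\<in>{va..vb}. \<forall>w\<in>{va..vb}.
      \<bar>(F (gam v) - a0 \<bullet> gam v) - (F (gam w) - a0 \<bullet> gam w) - \<sigma> * (tv v - tv w)\<bar> \<le> 4 * (\<omega> + \<Gamma> * \<omega>') * \<bar>tv v - tv w\<bar>"
    proof (rule window_slope[OF I, where grad = "grad F"])
      fix v assume v: "v \<in> {va..vb}"
      have d: "dist (gam v) e \<le> 92 * s0" using near_e[OF v] sm0 by linarith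
      have "gam v \<in> U" by (rule room[OF eE(1)]) (use d s0 in simp)
      then show "(F has_derivative (\<lambda>d. grad F (gam v) \<bullet> d)) (at (gam v))" by (intro has_derivative_grad diffF)
      show "norm (grad F (gam v) - a0) \<le> \<Gamma>" by (rule grad_close[OF eE(1)]) (use d s0 in simp)
      fix w assume w: "w \<in> {va..vb}"
      show "norm (grad F (gam v) - grad F (gam w)) \<le> \<omega>"
        unfolding \<omega>_def by (rule grad_osc[OF win[OF v] win[OF w] eE(1) e20 X])
      show "\<bar>deriv \<psi> v - deriv \<psi> w\<bar> \<le> \<omega>'"
        unfolding \<omega>'_def by (rule deriv_psi_osc[OF win[OF v] win[OF w] X'])
    qed
    then obtain \<sigma> where \<sigma>: "\<And>v w. v \<in> {va..vb} \<Longrightarrow> w \<in> {va..vb} \<Longrightarrow>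
      \<bar>(F (gam v) - a0 \<bullet> gam v) - (F (gam w) - a0 \<bullet> gam w) - \<sigma> * (tv v - tv w)\<bar> \<le> \<Omega> * \<bar>tv v - tv w\<bar>"
      unfolding \<Omega>_def by blast
    have sl: "\<bar>data x - data y - \<sigma> * (tau x - tau y)\<bar> \<le> \<Omega> * \<bar>tau x - tau y\<bar>" if x: "x \<in> K" and y: "y \<in> K" for x y
    proof -
      have xy: "x \<in> E" "y \<in> E" using x y KE by auto
      have "vp x \<in> {va..vb}" "vp y \<in> {va..vb}" using vab x y by auto
      from \<sigma>[OF this] show ?thesis using vp(2)[OF xy(1)] vp(2)[OF xy(2)] tvx xy by (simp add: data_def)
    qed
    have \<omega>0: "\<omega> \<ge> 0" "\<omega>' \<ge> 0"
      using C1_ge(2)[OF p] CE_pos[OF p th(2)[OF p]] by (auto simp: \<omega>_def \<omega>'_def)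
    have \<Omega>0: "\<Omega> \<ge> 0" using \<omega>0 G0 by (simp add: \<Omega>_def)
    have Asl: "\<bar>A data x - \<sigma>\<bar> \<le> \<Omega>" if x: "x \<in> E" "E \<noteq> {x}" "x \<in> K" "nb x \<in> K" for x
    proof -
      have ne': "tau x - tau (nb x) \<noteq> 0" using tau_inj[OF x(1) nb(1)[OF x(2,1)]] nb(2)[OF x(2,1)] by auto
      have "A data x - \<sigma> = (data x - data (nb x) - \<sigma> * (tau x - tau (nb x))) / (tau x - tau (nb x))"
        using ne' x(2) by (simp add: A_def field_simps)
      then have "\<bar>A data x - \<sigma>\<bar> = \<bar>data x - data (nb x) - \<sigma> * (tau x - tau (nb x))\<bar> / \<bar>tau x - tau (nb x)\<bar>"
        by (simp add: abs_divide)
      also have "\<dots> \<le> \<Omega>" using sl[OF x(3,4)] ne' by (simp add: pos_divide_le_eq)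
      finally show ?thesis .
    qed
    have A1: "\<bar>A data e - \<sigma>\<bar> \<le> \<Omega>" by (rule Asl) (use eE notsing in \<open>auto simp: K_def\<close>)
    have A2: "\<bar>A data e' - \<sigma>\<bar> \<le> \<Omega>" by (rule Asl) (use e'E notsing in \<open>auto simp: K_def\<close>)
    have dAb: "\<bar>dA data m i d\<bar> \<le> 2 * \<Omega>"
    proof -
      have "\<bar>A data e - A data e'\<bar> \<le> \<Omega> + \<Omega>"
        by (rule abs_diff_triangle[OF A1]) (use A2 in \<open>simp add: abs_minus_commute\<close>)
      then show ?thesis by (simp add: dA_def e_def e'_def)
    qed
    have dPb: "\<bar>dP data m i d\<bar> \<le> 24 * s m * \<Omega>"
    proof -
      have eq: "dP data m i d = (data e - data e' - \<sigma> * (tau e - tau e')) + (\<sigma> - A data e') * (tau e - tau e')"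
        by (simp add: dP_def P_def e_def e'_def algebra_simps)
      have "\<bar>dP data m i d\<bar> \<le> \<Omega> * \<bar>tau e - tau e'\<bar> + \<Omega> * \<bar>tau e - tau e'\<bar>"
        unfolding eq
      proof (intro order_trans[OF abs_triangle_ineq] add_mono)
        show "\<bar>data e - data e' - \<sigma> * (tau e - tau e')\<bar> \<le> \<Omega> * \<bar>tau e - tau e'\<bar>" by (rule sl) (auto simp: K_def)
        show "\<bar>(\<sigma> - A data e') * (tau e - tau e')\<bar> \<le> \<Omega> * \<bar>tau e - tau e'\<bar>"
          unfolding abs_mult using A2 by (intro mult_right_mono) (simp_all add: abs_minus_commute)
      qed
      also have "\<dots> = 2 * \<Omega> * \<bar>tau e - tau e'\<bar>" by simp
      also have "\<dots> \<le> 2 * \<Omega> * (12 * s m)" using t1 \<Omega>0 by (intro mult_left_mono) auto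
      finally show ?thesis by (simp add: mult_ac)
    qed
    let ?q = "24 * \<Omega> / s m"
    have "(\<bar>dA data m i d\<bar> / s m) powr p \<le> ?q powr p"
    proof (rule powr_mono2)
      have "2 * \<Omega> \<le> 24 * \<Omega>" using \<Omega>0 by simp
      then show "\<bar>dA data m i d\<bar> / s m \<le> ?q" using dAb sm by (intro divide_right_mono) auto
    qed (use p0 sm in auto)
    moreover have "(\<bar>dP data m i d\<bar> / (s m)\<^sup>2) powr p \<le> ?q powr p"
    proof (rule powr_mono2)
      have "\<bar>dP data m i d\<bar> / (s m)\<^sup>2 \<le> 24 * s m * \<Omega> / (s m)\<^sup>2" using dPb sm by (intro divide_right_mono) auto
      also have "\<dots> = ?q" using sm by (simp add: power2_eq_square)
      finally show "\<bar>dP data m i d\<bar> / (s m)\<^sup>2 \<le> ?q" .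
    qed (use p0 sm in auto)
    ultimately have "(s m)\<^sup>2 * ((\<bar>dA data m i d\<bar> / s m) powr p + (\<bar>dP data m i d\<bar> / (s m)\<^sup>2) powr p) \<le> (s m)\<^sup>2 * (2 * ?q powr p)"
      by (intro mult_left_mono) auto
    also have "\<dots> \<le> (s m)\<^sup>2 * (2 * ((192 / s m) powr p * (\<omega> powr p + (\<Gamma> * \<omega>') powr p)))"
    proof (intro mult_left_mono)
      \<comment> \<open>24 * 4 (\<omega> + \<Gamma> \<omega>') is at most 192 times the maximum,
        whose p-th power is at most the sum of the two p-th powers.\<close>
      let ?M = "max \<omega> (\<Gamma> * \<omega>')"
      have "?q \<le> (192 / s m) * ?M"
      proof -
        have "24 * \<Omega> \<le> 192 * ?M" unfolding \<Omega>_def by simp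
        then show ?thesis using sm by (simp add: divide_right_mono)
      qed
      then have "?q powr p \<le> ((192 / s m) * ?M) powr p" using p0 \<Omega>0 sm by (intro powr_mono2) auto
      also have "\<dots> = (192 / s m) powr p * ?M powr p" by (rule powr_mult)
      also have "\<dots> \<le> (192 / s m) powr p * (\<omega> powr p + (\<Gamma> * \<omega>') powr p)"
        by (intro mult_left_mono) (auto simp: max_def)
      finally show "?q powr p \<le> (192 / s m) powr p * (\<omega> powr p + (\<Gamma> * \<omega>') powr p)" .
    qed auto
    also have "\<dots> \<le> CZ p * (s m powr (- th p) * X + \<Gamma> powr p * (s m powr (- th p) * X'))"
    proof -
      let ?E = "(256 * s m) powr (p - 2 - th p)"
      have pe: "((256 * s m) powr ((p - 2 - th p) / p)) powr p = ?E" using p0 by (simp add: powr_powr)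
      have XX: "(X powr (1/p)) powr p = X" "(X' powr (1/p)) powr p = X'" using X(1) X'(1) p0 by (simp_all add: powr_powr)
      have g: "(a * b * c) powr p = a powr p * b powr p * c powr p" for a b c :: real by (simp add: powr_mult)
      have w1: "\<omega> powr p = (6 * C1 p) powr p * ?E * X"
        unfolding \<omega>_def g pe XX ..
      have w2: "(\<Gamma> * \<omega>') powr p = \<Gamma> powr p * (CE p (th p) powr p * ?E * X')"
        unfolding powr_mult[of \<Gamma> \<omega>'] unfolding \<omega>'_def g pe XX ..
      \<comment> \<open>2 - p + (p - 2 - \<theta>) = -\<theta>: all powers of the scale cancel
        except the one that compensates the weight.\<close>
      have scale: "(s m)\<^sup>2 * ((192 / s m) powr p * ?E) = 192 powr p * 256 powr (p - 2 - th p) * s m powr (- th p)"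
      proof -
        have "(s m)\<^sup>2 = s m powr 2" using sm by (simp add: powr_numeral)
        moreover have "(192 / s m) powr p = 192 powr p * s m powr (-p)" using sm by (simp add: powr_divide powr_minus_divide)
        moreover have "?E = 256 powr (p - 2 - th p) * s m powr (p - 2 - th p)" by (rule powr_mult)
        moreover have "s m powr 2 * s m powr (-p) * s m powr (p - 2 - th p) = s m powr (- th p)"
          by (simp add: powr_add[symmetric])
        ultimately show ?thesis by (simp add: mult_ac)
      qed
      let ?c1 = "(6 * C1 p) powr p" and ?c2 = "CE p (th p) powr p"
      have c: "?c1 \<ge> 0" "?c2 \<ge> 0" by simp_all
      have "(s m)\<^sup>2 * (2 * ((192 / s m) powr p * (\<omega> powr p + (\<Gamma> * \<omega>') powr p)))
        = 2 * ((s m)\<^sup>2 * ((192 / s m) powr p * ?E)) * (?c1 * X + ?c2 * (\<Gamma> powr p * X'))"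
        unfolding w1 w2 by (simp add: algebra_simps)
      also have "\<dots> = 2 * (192 powr p * 256 powr (p - 2 - th p) * s m powr (- th p)) * (?c1 * X + ?c2 * (\<Gamma> powr p * X'))"
        unfolding scale ..
      also have "\<dots> \<le> 2 * (192 powr p * 256 powr (p - 2 - th p) * s m powr (- th p)) * ((?c1 + ?c2) * X + (?c1 + ?c2) * (\<Gamma> powr p * X'))"
        using c X(1) X'(1) by (intro mult_left_mono add_mono mult_right_mono) auto
      also have "\<dots> = CZ p * (s m powr (- th p) * X + \<Gamma> powr p * (s m powr (- th p) * X'))"
        unfolding CZ_def by (simp add: algebra_simps)
      finally show ?thesis .
    qed
    finally show ?thesis .
  qed
qed

end

section \<open>The trace inequality\<close>

context lipschitz_set
begin

text \<open>An abstract measure space, because there are two applications: the plane with the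
  distance to the curve, and pairs of parameters with their mutual distance. Sum and integral are
  interchanged and \<open>overlap_bound\<close> is applied at each point.\<close>

lemma overlap_sum:
  fixes M :: "'a measure" and t y f :: "'a \<Rightarrow> real" and R :: "nat \<Rightarrow> int \<Rightarrow> 'a set"
  assumes th: "\<theta> > 0" and V: "V \<ge> 0" "(\<integral>\<^sup>+x\<in>U. ennreal (f x) \<partial>M) \<le> ennreal V"
    and [measurable]: "U \<in> sets M" "f \<in> borel_measurable M" "y \<in> borel_measurable M" "\<And>m i. R m i \<in> sets M"
    and f: "\<And>x. f x \<ge> 0" and y: "\<And>x. y x \<ge> 0"
    and R: "\<And>m i x. x \<in> R m i \<Longrightarrow> x \<in> U \<and> \<bar>t x - real_of_int i * s m\<bar> \<le> 2000 * s m \<and> y x \<le> 2000 * s m"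
  defines "X \<equiv> \<lambda>m i. enn2real (\<integral>\<^sup>+x\<in>R m i. ennreal (f x * y x powr \<theta>) \<partial>M)"
  shows "(m, i, d) \<in> Lam \<Longrightarrow> (\<integral>\<^sup>+x\<in>R m i. ennreal (f x * y x powr \<theta>) \<partial>M) \<le> ennreal (X m i)"
    and "(\<Sum>(m, i, d)\<in>Lam. s m powr (- \<theta>) * X m i) \<le> CN \<theta> * V"
proof -
  define I where "I m i = (\<integral>\<^sup>+x\<in>R m i. ennreal (f x * y x powr \<theta>) \<partial>M)" for m i
  have CN0: "CN \<theta> \<ge> 0" unfolding CN_def using ge_one_powr_ge_zero[of 2 \<theta>] th by simp
  have tot: "(\<Sum>(m, i, d)\<in>Lam. ennreal (s m powr (- \<theta>)) * I m i) \<le> ennreal (CN \<theta> * V)"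
  proof -
    have "(\<Sum>(m, i, d)\<in>Lam. ennreal (s m powr (- \<theta>)) * I m i)
      = (\<Sum>l\<in>Lam. \<integral>\<^sup>+x. (case l of (m, i, d) \<Rightarrow> ennreal (s m powr (- \<theta>)) * (ennreal (f x * y x powr \<theta>) * indicator (R m i) x)) \<partial>M)"
      by (rule sum.cong) (auto simp: I_def nn_integral_cmult)
    also have "\<dots> = (\<integral>\<^sup>+x. (\<Sum>l\<in>Lam. case l of (m, i, d) \<Rightarrow> ennreal (s m powr (- \<theta>)) * (ennreal (f x * y x powr \<theta>) * indicator (R m i) x)) \<partial>M)"
    proof (rule nn_integral_sum[symmetric])
      fix l :: "nat \<times> int \<times> nat" show "(\<lambda>x. case l of (m, i, d) \<Rightarrow> ennreal (s m powr (- \<theta>)) * (ennreal (f x * y x powr \<theta>) * indicator (R m i) x)) \<in> borel_measurable M"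
        by (cases l) simp
    qed
    also have "\<dots> \<le> (\<integral>\<^sup>+x. ennreal (CN \<theta>) * (ennreal (f x) * indicator U x) \<partial>M)"
    proof (rule nn_integral_mono)
      fix x
      let ?b = "\<lambda>m i. \<bar>t x - real_of_int i * s m\<bar> \<le> 2000 * s m \<and> y x \<le> 2000 * s m"
      let ?c = "\<lambda>l :: nat \<times> int \<times> nat. case l of (m, i, d) \<Rightarrow> if ?b m i then s m powr (- \<theta>) * y x powr \<theta> else 0"
      have c0: "?c l \<ge> 0" for l by (cases l) simp
      show "(\<Sum>l\<in>Lam. case l of (m, i, d) \<Rightarrow> ennreal (s m powr (- \<theta>)) * (ennreal (f x * y x powr \<theta>) * indicator (R m i) x))
        \<le> ennreal (CN \<theta>) * (ennreal (f x) * indicator U x)"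
      proof (cases "x \<in> U")
        case True
        have "(\<Sum>l\<in>Lam. case l of (m, i, d) \<Rightarrow> ennreal (s m powr (- \<theta>)) * (ennreal (f x * y x powr \<theta>) * indicator (R m i) x))
          \<le> (\<Sum>l\<in>Lam. ennreal (f x * ?c l))"
        proof (rule sum_mono)
          fix l :: "nat \<times> int \<times> nat"
          obtain m i d where l: "l = (m, i, d)" by (cases l)
          show "(case l of (m, i, d) \<Rightarrow> ennreal (s m powr (- \<theta>)) * (ennreal (f x * y x powr \<theta>) * indicator (R m i) x)) \<le> ennreal (f x * ?c l)"
            using R[of x m i] by (cases "x \<in> R m i") (simp_all add: l ennreal_mult'[symmetric] mult_ac)
        qed
        also have "\<dots> = ennreal (f x * (\<Sum>l\<in>Lam. ?c l))"
          using f c0 by (simp add: sum_distrib_left)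
        also have "\<dots> \<le> ennreal (f x * CN \<theta>)"
          using overlap_bound[OF y th, of "t x"] f by (intro ennreal_leI mult_left_mono) auto
        also have "\<dots> = ennreal (CN \<theta>) * (ennreal (f x) * indicator U x)"
          using True f CN0 by (simp add: ennreal_mult'[symmetric] mult.commute)
        finally show ?thesis .
      next
        case False
        have "(\<Sum>l\<in>Lam. case l of (m, i, d) \<Rightarrow> ennreal (s m powr (- \<theta>)) * (ennreal (f x * y x powr \<theta>) * indicator (R m i) x)) = 0"
          by (rule sum.neutral) (use False R in \<open>auto simp: indicator_def\<close>)
        then show ?thesis by simp
      qed
    qed
    also have "\<dots> = ennreal (CN \<theta>) * (\<integral>\<^sup>+x\<in>U. ennreal (f x) \<partial>M)" by (intro nn_integral_cmult) simp
    also have "\<dots> \<le> ennreal (CN \<theta>) * ennreal V" by (intro mult_left_mono V) simp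
    also have "\<dots> = ennreal (CN \<theta> * V)" using CN0 by (simp add: ennreal_mult')
    finally show ?thesis .
  qed
  \<comment> \<open>\<open>enn2real\<close> sends infinity to 0, so finiteness of each integral has
    to be read off from the total bound before X can replace it.\<close>
  have fin: "I m i = ennreal (X m i)" if l: "(m, i, d) \<in> Lam" for m i d
  proof -
    have "(case (m, i, d) of (m, i, d) \<Rightarrow> ennreal (s m powr (- \<theta>)) * I m i) \<le> (\<Sum>(m, i, d)\<in>Lam. ennreal (s m powr (- \<theta>)) * I m i)"
      by (rule member_le_sum[OF l _ finite_Lam]) simp
    then have "ennreal (s m powr (- \<theta>)) * I m i \<le> ennreal (CN \<theta> * V)" using tot by simp
    then have "ennreal (s m powr (- \<theta>)) * I m i < top" using ennreal_less_top le_less_trans by blast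
    moreover have "ennreal (s m powr (- \<theta>)) > 0" using s_pos[of m] by simp
    ultimately have "I m i < top" by (metis ennreal_mult_eq_top_iff less_top not_gr_zero)
    then show ?thesis by (simp add: X_def I_def)
  qed
  then show "(m, i, d) \<in> Lam \<Longrightarrow> (\<integral>\<^sup>+x\<in>R m i. ennreal (f x * y x powr \<theta>) \<partial>M) \<le> ennreal (X m i)"
    by (simp add: I_def)
  have X0: "X m i \<ge> 0" for m i by (simp add: X_def)
  have "ennreal (\<Sum>(m, i, d)\<in>Lam. s m powr (- \<theta>) * X m i) = (\<Sum>l\<in>Lam. ennreal (case l of (m, i, d) \<Rightarrow> s m powr (- \<theta>) * X m i))"
    by (rule sum_ennreal[symmetric]) (use X0 in \<open>auto split: prod.splits\<close>)
  also have "\<dots> = (\<Sum>(m, i, d)\<in>Lam. ennreal (s m powr (- \<theta>)) * I m i)"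
    by (rule sum.cong) (auto simp: fin ennreal_mult')
  also have "\<dots> \<le> ennreal (CN \<theta> * V)" by (rule tot)
  finally show "(\<Sum>(m, i, d)\<in>Lam. s m powr (- \<theta>) * X m i) \<le> CN \<theta> * V"
    using CN0 V(1) by (subst (asm) ennreal_le_iff) auto
qed

end

context trace_setting
begin

lemma Lam_sum_le:
  "(\<Sum>(m, i, d)\<in>Lam. (s m)\<^sup>2 * ((\<bar>dA data m i d\<bar> / s m) powr p + (\<bar>dP data m i d\<bar> / (s m)\<^sup>2) powr p))
    \<le> CZ p * (CN (th p) * (V + \<Gamma> powr p * Bes))"
proof -
  have thp: "th p > 0" using th(1)[OF p] .
  define X where "X m i = enn2real (\<integral>\<^sup>+x\<in>Reg m i. ennreal (hess_norm1 g x powr p * infdist x Gam powr th p) \<partial>lborel)" for m i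
  let ?k = "\<lambda>z. \<bar>deriv \<psi> (fst z) - deriv \<psi> (snd z)\<bar> powr p / \<bar>fst z - snd z\<bar> powr p"
  define X' where "X' m i = enn2real (\<integral>\<^sup>+z\<in>Reg' m i. ennreal (?k z * \<bar>fst z - snd z\<bar> powr th p) \<partial>(lborel \<Otimes>\<^sub>M lborel))" for m i
  have c: "continuous_on UNIV (\<lambda>y. infdist y Gam)" by (intro continuous_intros)
  have im: "(\<lambda>y. infdist y Gam) \<in> borel_measurable lborel" using borel_measurable_continuous_onI[OF c] by simp
  have A: "(m, i, d) \<in> Lam \<Longrightarrow> (\<integral>\<^sup>+x\<in>Reg m i. ennreal (hess_norm1 g x powr p * infdist x Gam powr th p) \<partial>lborel) \<le> ennreal (X m i)"
    "(\<Sum>(m, i, d)\<in>Lam. s m powr (- th p) * X m i) \<le> CN (th p) * V" for m i d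
    unfolding X_def
    by (rule overlap_sum[OF thp V, where t = "\<lambda>x. tau x"];
        use open_U im Reg_measurable hess_norm1_measurable in \<open>auto simp: Reg_def infdist_nonneg\<close>)+
  note measurable_deriv[measurable]
  have km: "?k \<in> borel_measurable (lborel \<Otimes>\<^sub>M lborel)" by measurable
  have dm: "(\<lambda>z::real \<times> real. \<bar>fst z - snd z\<bar>) \<in> borel_measurable (lborel \<Otimes>\<^sub>M lborel)"
  proof -
    have "continuous_on UNIV (\<lambda>z::real \<times> real. \<bar>fst z - snd z\<bar>)" by (intro continuous_intros)
    from borel_measurable_continuous_onI[OF this] show ?thesis by (simp add: lborel_prod)
  qed
  have kV: "(\<integral>\<^sup>+z\<in>UNIV. ennreal (?k z) \<partial>(lborel \<Otimes>\<^sub>M lborel)) \<le> ennreal Bes"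
    using bes(2) unfolding besov_int_eq by simp
  have us: "UNIV \<in> sets (lborel \<Otimes>\<^sub>M lborel :: (real \<times> real) measure)"
    using sets.top[of "lborel \<Otimes>\<^sub>M lborel :: (real \<times> real) measure"] by (simp add: space_pair_measure)
  have B: "(m, i, d) \<in> Lam \<Longrightarrow> (\<integral>\<^sup>+z\<in>Reg' m i. ennreal (?k z * \<bar>fst z - snd z\<bar> powr th p) \<partial>(lborel \<Otimes>\<^sub>M lborel)) \<le> ennreal (X' m i)"
    "(\<Sum>(m, i, d)\<in>Lam. s m powr (- th p) * X' m i) \<le> CN (th p) * Bes" for m i d
    unfolding X'_def
    by (rule overlap_sum[OF thp bes(1) kV us km dm Reg'_measurable, where t = "\<lambda>z. tv (clampv (fst z))"]; simp add: Reg'_def)+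
  have CZ0: "CZ p \<ge> 0" by (simp add: CZ_def)
  have "(\<Sum>(m, i, d)\<in>Lam. (s m)\<^sup>2 * ((\<bar>dA data m i d\<bar> / s m) powr p + (\<bar>dP data m i d\<bar> / (s m)\<^sup>2) powr p))
    \<le> (\<Sum>(m, i, d)\<in>Lam. CZ p * (s m powr (- th p) * X m i + \<Gamma> powr p * (s m powr (- th p) * X' m i)))"
  proof (rule sum_mono, clarify)
    fix m i d assume l: "(m, i, d) \<in> Lam"
    show "(s m)\<^sup>2 * ((\<bar>dA data m i d\<bar> / s m) powr p + (\<bar>dP data m i d\<bar> / (s m)\<^sup>2) powr p)
      \<le> CZ p * (s m powr (- th p) * X m i + \<Gamma> powr p * (s m powr (- th p) * X' m i))"
    proof (rule Lam_term[OF l])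
      show "X m i \<ge> 0" "X' m i \<ge> 0" by (simp_all add: X_def X'_def)
      show "(\<integral>\<^sup>+y\<in>Reg m i. ennreal (hess_norm1 g y powr p * wt y) \<partial>lborel) \<le> ennreal (X m i)"
        unfolding wt_def by (rule A(1)[OF l])
      show "(\<integral>\<^sup>+z\<in>Reg' m i. ennreal (besk p (th p) \<psi> z) \<partial>(lborel \<Otimes>\<^sub>M lborel)) \<le> ennreal (X' m i)"
        unfolding besk_def by (rule B(1)[OF l])
    qed
  qed
  also have "\<dots> = CZ p * ((\<Sum>(m, i, d)\<in>Lam. s m powr (- th p) * X m i) + \<Gamma> powr p * (\<Sum>(m, i, d)\<in>Lam. s m powr (- th p) * X' m i))"
    by (simp add: sum_distrib_left sum.distrib[symmetric] case_prod_unfold distrib_left)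
  also have "\<dots> \<le> CZ p * (CN (th p) * V + \<Gamma> powr p * (CN (th p) * Bes))"
    by (intro mult_left_mono add_mono A(2) B(2) CZ0) simp
  also have "\<dots> = CZ p * (CN (th p) * (V + \<Gamma> powr p * Bes))" by (simp add: algebra_simps)
  finally show ?thesis .
qed

text \<open>The pairs are covered by \<open>Lam_sum_le\<close>. The coarsest level has no
  predecessor to compare with, so it is estimated by the sizes of the data and of the slopes and by
  the number of coarse intervals.\<close>

lemma energy_le:
  assumes D: "\<And>e. e \<in> E \<Longrightarrow> \<bar>data e\<bar> \<le> D0'" "\<And>e. e \<in> E \<Longrightarrow> \<bar>A data e\<bar> \<le> 2 * \<Gamma>" and M: "real (card (J 0)) \<le> M"
  shows "energy p data \<le> CZ p * (CN (th p) * (V + \<Gamma> powr p * Bes))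
    + M * (s0\<^sup>2 * ((2 * \<Gamma> / s0) powr p + (D0' / s0\<^sup>2) powr p))"
proof -
  have p0: "p \<ge> 0" using p by simp
  let ?B = "s0\<^sup>2 * ((2 * \<Gamma> / s0) powr p + (D0' / s0\<^sup>2) powr p)"
  have "(\<Sum>j\<in>J 0. (s 0)\<^sup>2 * ((\<bar>A data (rep 0 j)\<bar> / s 0) powr p + (\<bar>data (rep 0 j)\<bar> / (s 0)\<^sup>2) powr p))
    \<le> (\<Sum>j\<in>J 0. ?B)"
    unfolding s_0 using s0 p0 D rep(1)
    by (intro sum_mono mult_left_mono add_mono powr_mono2 divide_right_mono) auto
  also have "\<dots> = real (card (J 0)) * ?B" by simp
  also have "\<dots> \<le> M * ?B" by (rule mult_right_mono[OF M]) simp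
  finally show ?thesis unfolding energy_def using Lam_sum_le by (intro add_mono)
qed

end

text \<open>Morrey's inequality: \<open>savg_diff\<close> compares averages at two far apart points,
  \<open>abs_diff_savg_le\<close> with trivial weight relates them to point values.\<close>

definition CM :: "real \<Rightarrow> real" where
  "CM p = 2 * (384 * KB / (1 - (1/2) powr ((p - 2) / p)) + 3200 * KB)"

lemma CM_nonneg: "p > 2 \<Longrightarrow> CM p \<ge> 0"
  unfolding CM_def using KB(1) powr_less_mono2[of "(p - 2) / p" "1/2" 1] by simp

lemma (in weakly_differentiable) morrey:
  assumes p: "p > 2" and dl: "\<delta> > 0" and U: "U = interior (square c \<delta>)"
    and V: "V \<ge> 0" "(\<integral>\<^sup>+x\<in>U. ennreal (G x powr p) \<partial>lborel) \<le> ennreal V"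
    and x: "x \<in> square c (92/100 * \<delta>)" "y \<in> square c (92/100 * \<delta>)"
  shows "\<bar>h x - h y\<bar> \<le> CM p / 2 * \<delta> powr ((p - 2) / p) * V powr (1/p)"
proof -
  \<comment> \<open>Squares of half-side \<delta>/50 around points of the 0.92-square stay within
    0.48 \<delta> of the centre in each coordinate, hence inside \<open>U\<close>.\<close>
  let ?S = "\<delta> / 100" and ?e = "(p - 2) / p"
  let ?q = "(1/2::real) powr ?e"
  have q: "0 \<le> ?q" "?q < 1" using powr_less_mono2[of ?e "1/2" 1] p by auto
  have KB0: "KB \<ge> 0" using KB(1) by linarith
  have one: "\<bar>h z - savg z (?S / 8)\<bar> \<le> 192 * KB / (1 - ?q) * \<delta> powr ?e * V powr (1/p)"
    if z: "z \<in> square c (92/100 * \<delta>)" for z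
  proof -
    have zc: "\<bar>z$i - c$i\<bar> \<le> 46/100 * \<delta>" for i using z by (simp add: square_def)
    have sub: "{w. \<forall>i. \<bar>w$i - z$i\<bar> \<le> 2 * ?S} \<subseteq> U"
    proof
      fix w assume w: "w \<in> {w. \<forall>i. \<bar>w$i - z$i\<bar> \<le> 2 * ?S}"
      have "\<bar>w$i - c$i\<bar> < \<delta> / 2" for i
      proof -
        have "\<bar>w$i - z$i\<bar> \<le> 2 * ?S" using w by blast
        from abs_diff_triangle[OF this zc[of i]] show ?thesis using dl by simp
      qed
      then show "w \<in> U" by (simp add: U interior_square)
    qed
    \<comment> \<open>Weight 1 and displacement 0: the boxes shrink concentrically to z.\<close>
    have "\<bar>h z - savg (z + ?S *\<^sub>R 0) (?S / 8)\<bar>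
      \<le> 192 * KB * 1 powr (-1/p) / (1 - (1/2) powr ((p - 2 - 0) / p)) * ?S powr ((p - 2 - 0) / p) * V powr (1/p)"
    proof (rule abs_diff_savg_le[where w = "\<lambda>_. 1"])
      have "(\<integral>\<^sup>+y\<in>{w. \<forall>i. \<bar>w$i - z$i\<bar> \<le> 2 * ?S}. ennreal (G y powr p * 1) \<partial>lborel) \<le> (\<integral>\<^sup>+x\<in>U. ennreal (G x powr p) \<partial>lborel)"
        using sub by (intro nn_integral_mono) (auto simp: indicator_def)
      then show "(\<integral>\<^sup>+y\<in>{w. \<forall>i. \<bar>w$i - z$i\<bar> \<le> 2 * ?S}. ennreal (G y powr p * 1) \<partial>lborel) \<le> ennreal V"
        using V(2) by (rule order_trans)
    qed (use p dl sub V in auto)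
    also have "\<dots> = 192 * KB / (1 - ?q) * ?S powr ?e * V powr (1/p)" by simp
    also have "\<dots> \<le> 192 * KB / (1 - ?q) * \<delta> powr ?e * V powr (1/p)"
      using q KB0 dl p by (intro mult_right_mono mult_left_mono powr_mono2) auto
    finally show ?thesis by simp
  qed
  let ?R = "cbox (\<chi> i. c$i - 49/100 * \<delta>) (\<chi> i. c$i + 49/100 * \<delta>)"
  have RU: "?R \<subseteq> U"
  proof
    fix w assume w: "w \<in> ?R"
    have "\<bar>w$i - c$i\<bar> < \<delta> / 2" for i
    proof -
      have "c$i - 49/100 * \<delta> \<le> w$i" "w$i \<le> c$i + 49/100 * \<delta>" using w by (auto simp: mem_box_cart)
      then show ?thesis using dl unfolding abs_less_iff by simp
    qed
    then show "w \<in> U" by (simp add: U interior_square)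
  qed
  have area: "emeasure lborel ?R = ennreal ((98/100 * \<delta>) * (98/100 * \<delta>))"
  proof -
    have b: "(Basis :: (real^2) set) = (\<lambda>i. axis i 1) ` UNIV" by (auto simp: Basis_vec_def)
    have "inj (\<lambda>i::2. axis i (1::real))" by (auto simp: inj_on_def axis_eq_axis)
    then show ?thesis using dl
      by (subst emeasure_lborel_cbox) (auto simp: b prod.reindex inner_axis UNIV_2)
  qed
  have VR: "(\<integral>\<^sup>+x\<in>?R. ennreal (G x powr p) \<partial>lborel) \<le> ennreal V"
    by (rule order_trans[OF _ V(2)], intro nn_integral_mono mult_left_mono) (use RU in \<open>auto simp: indicator_def\<close>)
  have I: "(\<integral>\<^sup>+x\<in>?R. ennreal (G x) \<partial>lborel) \<le> ennreal (2 * V powr (1/p) * ((98/100 * \<delta>) * (98/100 * \<delta>)) powr (1 - 1/p))"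
    by (rule nn_integral_le_power_mean[OF _ _ area _ _ _ V(1) VR]) (use G_measurable G_nonneg p dl in auto)
  have bounds: "(\<chi> i. c$i - 49/100 * \<delta>)$i \<le> z$i - ?S / 8" "z$i + ?S / 8 \<le> (\<chi> i. c$i + 49/100 * \<delta>)$i"
    if "z \<in> square c (92/100 * \<delta>)" for z i
  proof -
    have "\<bar>z$i - c$i\<bar> \<le> 46/100 * \<delta>" using that by (simp add: square_def)
    then show "(\<chi> i. c$i - 49/100 * \<delta>)$i \<le> z$i - ?S / 8" "z$i + ?S / 8 \<le> (\<chi> i. c$i + 49/100 * \<delta>)$i"
      using dl unfolding abs_le_iff by simp_all
  qed
  have "ennreal \<bar>savg x (?S / 8) - savg y (?S / 8)\<bar> \<le> ennreal (KB * (1 / (?S / 8) + 1 / (?S / 8))) * (\<integral>\<^sup>+x\<in>?R. ennreal (G x) \<partial>lborel)"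
    by (rule savg_diff[OF _ _ RU bounds(1)[OF x(1)] bounds(2)[OF x(1)] bounds(1)[OF x(2)] bounds(2)[OF x(2)]]) (use dl in auto)
  also have "\<dots> \<le> ennreal (KB * (1 / (?S / 8) + 1 / (?S / 8))) * ennreal (2 * V powr (1/p) * ((98/100 * \<delta>) * (98/100 * \<delta>)) powr (1 - 1/p))"
    by (intro mult_left_mono I) simp
  also have "\<dots> = ennreal (KB * (1 / (?S / 8) + 1 / (?S / 8)) * (2 * V powr (1/p) * ((98/100 * \<delta>) * (98/100 * \<delta>)) powr (1 - 1/p)))"
    by (rule ennreal_mult'[symmetric]) (use KB0 dl in simp)
  finally have "\<bar>savg x (?S / 8) - savg y (?S / 8)\<bar> \<le> KB * (1 / (?S / 8) + 1 / (?S / 8)) * (2 * V powr (1/p) * ((98/100 * \<delta>) * (98/100 * \<delta>)) powr (1 - 1/p))"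
    using KB0 dl by (subst (asm) ennreal_le_iff) auto
  also have "\<dots> \<le> KB * (1 / (?S / 8) + 1 / (?S / 8)) * (2 * V powr (1/p) * \<delta> powr (2 - 2/p))"
  proof (intro mult_left_mono)
    have "((98/100 * \<delta>) * (98/100 * \<delta>)) powr (1 - 1/p) \<le> (\<delta> powr 2) powr (1 - 1/p)"
      using dl p by (intro powr_mono2) (auto simp: powr_numeral power2_eq_square)
    also have "\<dots> = \<delta> powr (2 - 2/p)" unfolding powr_powr by (simp add: right_diff_distrib)
    finally show "((98/100 * \<delta>) * (98/100 * \<delta>)) powr (1 - 1/p) \<le> \<delta> powr (2 - 2/p)" .
  qed (use KB0 dl in auto)
  also have "\<dots> = 3200 * KB * \<delta> powr ?e * V powr (1/p)"
  proof -
    have "?e = (2 - 2/p) + (-1)" using p by (simp add: field_simps)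
    then have "\<delta> powr ?e = \<delta> powr (2 - 2/p) * \<delta> powr (-1)" by (simp only: powr_add)
    also have "\<dots> = \<delta> powr (2 - 2/p) / \<delta>" using dl by (simp add: powr_minus_divide)
    finally show ?thesis by simp
  qed
  finally have two: "\<bar>savg x (?S / 8) - savg y (?S / 8)\<bar> \<le> 3200 * KB * \<delta> powr ?e * V powr (1/p)" .
  let ?B = "192 * KB / (1 - ?q) * \<delta> powr ?e * V powr (1/p)" and ?B2 = "3200 * KB * \<delta> powr ?e * V powr (1/p)"
  have "\<bar>h x - h y\<bar> \<le> ?B + (?B2 + ?B)"
    by (rule abs_diff_triangle[OF one[OF x(1)] abs_diff_triangle[OF two]]) (use one[OF x(2)] in \<open>simp add: abs_minus_commute\<close>)
  also have "\<dots> = CM p / 2 * \<delta> powr ?e * V powr (1/p)" by (simp add: CM_def algebra_simps)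
  finally show ?thesis .
qed

section \<open>The extension theorem\<close>

lemma weakly_differentiable_pderiv2:
  assumes F: "F \<in> L2p p Q" and g: "weak_hessian p Q F g"
  shows "weakly_differentiable (interior Q) (pderiv2 j F) (\<lambda>i. g i j) (hess_norm1 g)"
proof
  have [measurable]: "g i k \<in> borel_measurable lborel" for i k using g by (simp add: weak_hessian_def)
  show "open (interior Q)" by simp
  show "continuous_on (interior Q) (pderiv2 j F)" using F by (simp add: L2p_def)
  show "(LINT x:interior Q|lborel. pderiv2 j F x * pderiv2 i \<phi> x) = - (LINT x:interior Q|lborel. g i j x * \<phi> x)"
    if "test_fun (interior Q) \<phi>" for \<phi> i
    using g that unfolding weak_hessian_def by blast
  show "hess_norm1 g \<in> borel_measurable lborel" unfolding hess_norm1_def[abs_def] by measurable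
  show "\<bar>g i j x\<bar> \<le> hess_norm1 g x" for i x
  proof -
    have "\<bar>g i j x\<bar> \<le> (\<Sum>k\<in>UNIV. \<bar>g i k x\<bar>)" by (rule member_le_sum) auto
    also have "\<dots> \<le> hess_norm1 g x" unfolding hess_norm1_def
      by (rule member_le_sum[where f = "\<lambda>i. \<Sum>k\<in>UNIV. \<bar>g i k x\<bar>"]) (auto intro: sum_nonneg)
    finally show ?thesis .
  qed
qed

lemma hess_energy_nonneg: "hess_energy p Q g \<ge> 0"
  unfolding hess_energy_def set_lebesgue_integral_def by (intro sum_nonneg integral_nonneg_AE) auto

text \<open>The sum of the four entries is at most four times the largest, whose p-th power is one
  of the summands of the energy.\<close>

lemma nn_integral_hess_norm1_le:
  assumes g: "weak_hessian p Q F g" and p: "p > 0"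
  shows "(\<integral>\<^sup>+x\<in>interior Q. ennreal (hess_norm1 g x powr p) \<partial>lborel) \<le> ennreal (4 powr p * hess_energy p Q g)"
proof -
  let ?f = "\<lambda>x. \<Sum>i\<in>UNIV. \<Sum>j\<in>UNIV. \<bar>g i j x\<bar> powr p"
  have int: "set_integrable lborel Q (\<lambda>x. \<bar>g i j x\<bar> powr p)" for i j
    using g by (simp add: weak_hessian_def)
  have pt: "hess_norm1 g x powr p \<le> 4 powr p * ?f x" for x
  proof -
    let ?m = "max (max \<bar>g 1 1 x\<bar> \<bar>g 1 2 x\<bar>) (max \<bar>g 2 1 x\<bar> \<bar>g 2 2 x\<bar>)"
    have "hess_norm1 g x \<le> (?m + ?m) + (?m + ?m)"
      unfolding hess_norm1_def sum_2 by (intro add_mono) (simp_all add: le_max_iff_disj)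
    then have "hess_norm1 g x powr p \<le> (4 * ?m) powr p"
      using p by (intro powr_mono2) (auto simp: hess_norm1_def intro!: sum_nonneg)
    also have "\<dots> = 4 powr p * ?m powr p" by (rule powr_mult)
    also have "?m powr p \<le> ?f x" by (auto simp: sum_2 max_def)
    finally show ?thesis by simp
  qed
  have si: "set_integrable lborel Q ?f"
    unfolding set_integrable_def sum_distrib_left scaleR_sum_right
    by (intro Bochner_Integration.integrable_sum) (use int in \<open>simp add: set_integrable_def\<close>)
  have "(\<integral>\<^sup>+x\<in>interior Q. ennreal (hess_norm1 g x powr p) \<partial>lborel) \<le> (\<integral>\<^sup>+x. ennreal (indicator Q x *\<^sub>R (4 powr p * ?f x)) \<partial>lborel)"
    by (rule nn_integral_mono) (use pt interior_subset[of Q] in \<open>auto simp: indicator_def intro!: ennreal_leI\<close>)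
  also have "\<dots> = ennreal (LINT x:Q|lborel. 4 powr p * ?f x)"
    unfolding set_lebesgue_integral_def
    by (rule nn_integral_eq_integral)
      (use set_integrable_mult_right[of "4 powr p", OF si] in \<open>auto simp: set_integrable_def intro!: sum_nonneg mult_nonneg_nonneg\<close>)
  also have "(LINT x:Q|lborel. 4 powr p * ?f x) = 4 powr p * hess_energy p Q g"
  proof -
    have "(LINT x:Q|lborel. ?f x) = hess_energy p Q g"
      unfolding hess_energy_def sum_2 using int by (simp add: set_integral_add)
    then show ?thesis by simp
  qed
  finally show ?thesis .
qed

text \<open>The conclusion for one configuration and a given C, named so that empty and nonempty
  sets can be treated separately.\<close>

definition jet_extension :: "real \<Rightarrow> real \<Rightarrow> real^2 \<Rightarrow> real \<Rightarrow> (real^2) set \<Rightarrow> real^2 \<Rightarrow> bool" where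
  "jet_extension p C c \<delta> E0 x0 \<longleftrightarrow>
    (\<exists>(T :: (real^2 \<Rightarrow> real) \<Rightarrow> (real^2 \<Rightarrow> real) \<Rightarrow> (real^2 \<Rightarrow> real))
       (lam :: nat \<Rightarrow> (real^2 \<Rightarrow> real) \<Rightarrow> (real^2 \<Rightarrow> real) \<Rightarrow> real) (N0::nat).
       (\<forall>f f' L L' a. L \<in> affine_poly \<longrightarrow> L' \<in> affine_poly \<longrightarrow>
          (\<forall>x\<in>square c \<delta>. T (\<lambda>y. f y + a * f' y) (\<lambda>y. L y + a * L' y) x
                              = T f L x + a * T f' L' x)) \<and>
       (\<forall>f f' L. (\<forall>y\<in>E0. f y = f' y) \<longrightarrow> (\<forall>x\<in>square c \<delta>. T f L x = T f' L x)) \<and>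
       (\<forall>f L. L \<in> affine_poly \<longrightarrow> T f L \<in> L2p p (square c \<delta>)) \<and>
       (\<forall>i<N0. \<forall>f f' L L' a. L \<in> affine_poly \<longrightarrow> L' \<in> affine_poly \<longrightarrow>
          lam i (\<lambda>y. f y + a * f' y) (\<lambda>y. L y + a * L' y) = lam i f L + a * lam i f' L') \<and>
       (\<forall>i<N0. \<forall>f f' L. (\<forall>y\<in>E0. f y = f' y) \<longrightarrow> lam i f L = lam i f' L) \<and>
       real N0 \<le> C * (real (card E0))^2 \<and>
       (\<forall>f0 L0. L0 \<in> affine_poly \<longrightarrow>
          (\<forall>x\<in>E0. T f0 L0 x = f0 x) \<and>
          jet1 (T f0 L0) x0 = L0 \<and>
          L2p_norm p (square c \<delta>) (T f0 L0)
            \<le> C * Inf {L2p_norm p (square c \<delta>) F | F. F \<in> L2p p (square c \<delta>)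
                          \<and> (\<forall>x\<in>E0. F x = f0 x) \<and> jet1 F x0 = L0} \<and>
          (1 / C) * (\<Sum>i<N0. \<bar>lam i f0 L0\<bar> powr p) powr (1/p)
            \<le> L2p_norm p (square c \<delta>) (T f0 L0) \<and>
          L2p_norm p (square c \<delta>) (T f0 L0)
            \<le> C * (\<Sum>i<N0. \<bar>lam i f0 L0\<bar> powr p) powr (1/p)))"

text \<open>Subtracting L makes the prescribed jet vanish: the operator is L + S (f - L), and the
  functionals are evaluated at f - L. Near-optimality combines \<open>S_norm\<close> with
  \<open>trace\<close> for an arbitrary competitor; the lower bound in the comparison with the
  functionals is \<open>trace\<close> for the extension itself. \<open>trace\<close> is stated for
  each weak Hessian, the infimum in \<open>L2p_norm\<close> being taken inside.\<close>

lemma jet_extensionI: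
  fixes S :: "(real^2 \<Rightarrow> real) \<Rightarrow> real^2 \<Rightarrow> real" and lam :: "nat \<Rightarrow> (real^2 \<Rightarrow> real) \<Rightarrow> real"
  assumes p: "p > 0"
    and S_lin: "\<And>f f' a x. S (\<lambda>y. f y + a * f' y) x = S f x + a * S f' x"
    and S_cong: "\<And>f f'. \<forall>y\<in>E. f y = f' y \<Longrightarrow> S f = S f'"
    and S_int: "\<And>f e. e \<in> E \<Longrightarrow> S f e = f e"
    and lam_lin: "\<And>i f f' a. lam i (\<lambda>y. f y + a * f' y) = lam i f + a * lam i f'"
    and lam_cong: "\<And>i f f'. i < N \<Longrightarrow> \<forall>y\<in>E. f y = f' y \<Longrightarrow> lam i f = lam i f'"
    and S_L2p: "\<And>L f. L \<in> affine_poly \<Longrightarrow> (\<lambda>x. L x + S f x) \<in> L2p p (square c \<delta>)"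
    and S_norm: "\<And>L f. L \<in> affine_poly \<Longrightarrow>
      L2p_norm p (square c \<delta>) (\<lambda>x. L x + S f x) \<le> K * (\<Sum>i<N. \<bar>lam i f\<bar> powr p) powr (1/p)"
    and S_jet: "\<And>L f. L \<in> affine_poly \<Longrightarrow> jet1 (\<lambda>x. L x + S f x) x0 = L"
    and trace: "\<And>F g L. F \<in> L2p p (square c \<delta>) \<Longrightarrow> weak_hessian p (square c \<delta>) F g \<Longrightarrow> L \<in> affine_poly \<Longrightarrow>
      jet1 F x0 = L \<Longrightarrow> (\<Sum>i<N. \<bar>lam i (\<lambda>x. F x - L x)\<bar> powr p) \<le> K' * hess_energy p (square c \<delta>) g"
    and N: "N \<le> 4 * (card E)\<^sup>2"
    and C: "C \<ge> 4" "K \<ge> 0" "K' > 0" "C \<ge> K" "C \<ge> K' powr (1/p)" "C \<ge> K * K' powr (1/p)"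
  shows "jet_extension p C c \<delta> E x0"
proof -
  let ?Q = "square c \<delta>" and ?k = "K' powr (1/p)"
  define M where "M f = (\<Sum>i<N. \<bar>lam i f\<bar> powr p) powr (1/p)" for f
  have C0: "C > 0" using C by simp
  have k0: "?k > 0" using C by simp
  have M_cong: "M f = M f'" if "\<forall>y\<in>E. f y = f' y" for f f'
    unfolding M_def using lam_cong[OF _ that] by simp
  have nn: "L2p_norm p ?Q F \<ge> 0" if "F \<in> L2p p ?Q" for F
    by (rule L2p_norm_ge[OF that]) simp
  have tr: "M (\<lambda>x. f x - L x) \<le> ?k * L2p_norm p ?Q F"
    if F: "F \<in> L2p p ?Q" "L \<in> affine_poly" "jet1 F x0 = L" and f: "\<forall>x\<in>E. F x = f x" for f L :: "real^2 \<Rightarrow> real" and F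
  proof -
    have "M (\<lambda>x. f x - L x) / ?k \<le> L2p_norm p ?Q F"
    proof (rule L2p_norm_ge[OF F(1)])
      fix g assume g: "weak_hessian p ?Q F g"
      have "M (\<lambda>x. f x - L x) = M (\<lambda>x. F x - L x)" by (rule M_cong) (use f in simp)
      also have "\<dots> \<le> (K' * hess_energy p ?Q g) powr (1/p)"
        unfolding M_def using p by (intro powr_mono2 sum_nonneg trace F g) auto
      also have "\<dots> = ?k * hess_energy p ?Q g powr (1/p)" by (rule powr_mult)
      finally show "M (\<lambda>x. f x - L x) / ?k \<le> hess_energy p ?Q g powr (1/p)"
        using k0 by (simp add: pos_divide_le_eq mult.commute)
    qed
    then show ?thesis using k0 by (simp add: pos_divide_le_eq mult.commute)
  qed
  define T where "T f L = (\<lambda>x. L x + S (\<lambda>y. f y - L y) x)" for f L :: "real^2 \<Rightarrow> real"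
  have comb: "(\<lambda>y. f y + a * f' y - (L y + a * L' y)) = (\<lambda>y. (f y - L y) + a * (f' y - L' y))"
    for f f' L L' :: "real^2 \<Rightarrow> real" and a by (simp add: fun_eq_iff algebra_simps)
  have T_lin: "T (\<lambda>y. f y + a * f' y) (\<lambda>y. L y + a * L' y) x = T f L x + a * T f' L' x" for f f' L L' a x
    unfolding T_def comb S_lin by (simp add: algebra_simps)
  have T_cong: "T f L x = T f' L x" if "\<forall>y\<in>E. f y = f' y" for f f' L :: "real^2 \<Rightarrow> real" and x
    unfolding T_def using S_cong[of "\<lambda>y. f y - L y" "\<lambda>y. f' y - L y"] that by simp
  have T_int: "\<forall>x\<in>E. T f L x = f x" for f L unfolding T_def using S_int by simp
  have main: "(\<forall>x\<in>E. T f L x = f x) \<and> jet1 (T f L) x0 = L \<and>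
    L2p_norm p ?Q (T f L) \<le> C * Inf {L2p_norm p ?Q F | F. F \<in> L2p p ?Q \<and> (\<forall>x\<in>E. F x = f x) \<and> jet1 F x0 = L} \<and>
    (1 / C) * (\<Sum>i<N. \<bar>lam i (\<lambda>y. f y - L y)\<bar> powr p) powr (1/p) \<le> L2p_norm p ?Q (T f L) \<and>
    L2p_norm p ?Q (T f L) \<le> C * (\<Sum>i<N. \<bar>lam i (\<lambda>y. f y - L y)\<bar> powr p) powr (1/p)"
    if L: "L \<in> affine_poly" for f L :: "real^2 \<Rightarrow> real"
  proof (intro conjI)
    show "\<forall>x\<in>E. T f L x = f x" by (rule T_int)
    show jet: "jet1 (T f L) x0 = L" unfolding T_def by (rule S_jet[OF L])
    have mem: "T f L \<in> L2p p ?Q" unfolding T_def by (rule S_L2p[OF L])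
    have up: "L2p_norm p ?Q (T f L) \<le> K * M (\<lambda>y. f y - L y)" unfolding T_def M_def by (rule S_norm[OF L])
    let ?X = "{L2p_norm p ?Q F | F. F \<in> L2p p ?Q \<and> (\<forall>x\<in>E. F x = f x) \<and> jet1 F x0 = L}"
    have "L2p_norm p ?Q (T f L) / C \<le> Inf ?X"
    proof (rule cInf_greatest)
      show "?X \<noteq> {}" using mem T_int jet by blast
      fix r assume "r \<in> ?X"
      then obtain F where F: "F \<in> L2p p ?Q" "\<forall>x\<in>E. F x = f x" "jet1 F x0 = L" and r: "r = L2p_norm p ?Q F" by blast
      have "L2p_norm p ?Q (T f L) \<le> K * (?k * L2p_norm p ?Q F)"
        using up mult_left_mono[OF tr[OF F(1) L F(3,2)] C(2)] by (rule order_trans)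
      also have "\<dots> = (K * ?k) * L2p_norm p ?Q F" by simp
      also have "\<dots> \<le> C * L2p_norm p ?Q F" by (rule mult_right_mono[OF C(6) nn[OF F(1)]])
      finally show "L2p_norm p ?Q (T f L) / C \<le> r" using C0 by (simp add: r pos_divide_le_eq mult.commute)
    qed
    then show "L2p_norm p ?Q (T f L) \<le> C * Inf ?X" using C0 by (simp add: pos_divide_le_eq mult.commute)
    have "M (\<lambda>y. f y - L y) \<le> C * L2p_norm p ?Q (T f L)"
      using tr[OF mem L jet T_int] mult_right_mono[OF C(5) nn[OF mem]] by (rule order_trans)
    then show "(1 / C) * (\<Sum>i<N. \<bar>lam i (\<lambda>y. f y - L y)\<bar> powr p) powr (1/p) \<le> L2p_norm p ?Q (T f L)"
      using C0 unfolding M_def by (simp add: pos_divide_le_eq mult.commute)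
    have "K * M (\<lambda>y. f y - L y) \<le> C * M (\<lambda>y. f y - L y)" by (rule mult_right_mono[OF C(4)]) (simp add: M_def)
    with up show "L2p_norm p ?Q (T f L) \<le> C * (\<Sum>i<N. \<bar>lam i (\<lambda>y. f y - L y)\<bar> powr p) powr (1/p)"
      unfolding M_def by (rule order_trans)
  qed
  have "real N \<le> 4 * (real (card E))\<^sup>2"
    using of_nat_mono[OF N, where 'a = real] by simp
  also have "\<dots> \<le> C * (real (card E))\<^sup>2" by (rule mult_right_mono[OF C(1)]) simp
  finally have NC: "real N \<le> C * (real (card E))\<^sup>2" .
  show ?thesis
    unfolding jet_extension_def
  proof (intro exI[of _ T] exI[of _ "\<lambda>i f L. lam i (\<lambda>y. f y - L y)"] exI[of _ N] conjI)
    show "\<forall>f L. L \<in> affine_poly \<longrightarrow> T f L \<in> L2p p ?Q" unfolding T_def using S_L2p by blast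
    show "\<forall>f f' L. (\<forall>y\<in>E. f y = f' y) \<longrightarrow> (\<forall>x\<in>?Q. T f L x = T f' L x)" using T_cong by blast
    show "\<forall>i<N. \<forall>f f' L. (\<forall>y\<in>E. f y = f' y) \<longrightarrow> lam i (\<lambda>y. f y - L y) = lam i (\<lambda>y. f' y - L y)"
    proof (intro allI impI)
      fix i and f f' L :: "real^2 \<Rightarrow> real" assume "i < N" "\<forall>y\<in>E. f y = f' y"
      then show "lam i (\<lambda>y. f y - L y) = lam i (\<lambda>y. f' y - L y)" by (intro lam_cong) auto
    qed
    show "\<forall>i<N. \<forall>f f' L L' a. L \<in> affine_poly \<longrightarrow> L' \<in> affine_poly \<longrightarrow>
      lam i (\<lambda>y. f y + a * f' y - (L y + a * L' y)) = lam i (\<lambda>y. f y - L y) + a * lam i (\<lambda>y. f' y - L' y)"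
      unfolding comb lam_lin by simp
  qed (use T_lin main NC in blast)+
qed

lemma jet1_affine: "(\<And>y. L y = a \<bullet> y + b) \<Longrightarrow> jet1 L x = L"
proof -
  assume L: "\<And>y. L y = a \<bullet> y + b"
  have "(L has_derivative (\<lambda>d. a \<bullet> d)) (at x)"
    unfolding L[abs_def] by (auto intro!: derivative_eq_intros)
  then have "frechet_derivative L (at x) = (\<lambda>d. a \<bullet> d)" by (rule frechet_derivative_at[symmetric])
  then show ?thesis unfolding jet1_def by (simp add: L fun_eq_iff inner_diff_right)
qed

text \<open>Without data the extension is L itself, whose Hessian vanishes, and there are no
  functionals.\<close>

lemma jet_extension_empty:
  assumes p: "p > 0" and C: "C \<ge> 4"
  shows "jet_extension p C c \<delta> {} x0"
proof -
  \<comment> \<open>The one-point set only supplies the standard axes as a frame for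
    \<open>gradf_affine\<close>.\<close>
  interpret l: lipschitz_set "{0}" "axis 1 1" "axis 2 1" 1
    by unfold_locales (auto simp: inner_axis_axis)
  have L: "L \<in> L2p p (square c \<delta>) \<and> L2p_norm p (square c \<delta>) L \<le> 0 \<and> jet1 L x0 = L" if "L \<in> affine_poly" for L
  proof -
    obtain a b where L: "\<And>y. L y = a \<bullet> y + b" using \<open>L \<in> affine_poly\<close> by (auto simp: affine_poly_def)
    note w = weak_hessian_C2[OF l.gradf_affine[OF L] gradf_const gradf_const continuous_on_const continuous_on_const continuous_on_const p, of c \<delta>]
    have "L2p_norm p (square c \<delta>) L \<le> 0" using L2p_norm_le[OF w(1)] by (simp add: hess_energy_def hessf_def)
    then show ?thesis using w(2) jet1_affine[OF L] by blast
  qed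
  show ?thesis
    by (rule jet_extensionI[where S = "\<lambda>_ _. 0" and lam = "\<lambda>_ _. 0" and N = 0 and K = 0 and K' = 1])
      (use L p C hess_energy_nonneg in auto)
qed


section \<open>The trace bound for competitors\<close>

lemma grad_osc_square:
  assumes p: "p > 2" and dl: "\<delta> > 0" and F: "F \<in> L2p p (square c \<delta>)" and g: "weak_hessian p (square c \<delta>) F g"
    and x: "x \<in> square c (92/100 * \<delta>)" and y: "y \<in> square c (92/100 * \<delta>)"
  shows "norm (grad F x - grad F y)
    \<le> CM p * \<delta> powr ((p - 2) / p) * (4 powr p * hess_energy p (square c \<delta>) g) powr (1/p)"
proof -
  let ?V = "4 powr p * hess_energy p (square c \<delta>) g"
  have V: "?V \<ge> 0" using hess_energy_nonneg by simp
  have p0: "p > 0" using p by simp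
  have "\<bar>pderiv2 j F x - pderiv2 j F y\<bar> \<le> CM p / 2 * \<delta> powr ((p - 2) / p) * ?V powr (1/p)" for j
    by (rule weakly_differentiable.morrey[OF weakly_differentiable_pderiv2[OF F g] p dl refl V
          nn_integral_hess_norm1_le[OF g p0] x y])
  from add_mono[OF this[of 1] this[of 2]] show ?thesis
    using norm_le_l1_cart[of "grad F x - grad F y"] by (simp add: sum_2 grad_def)
qed

lemma grad_of_jet1:
  assumes d: "F differentiable (at x)" and L: "\<And>y. L y = a \<bullet> y + b" and j: "jet1 F x = L"
  shows "grad F x = a" "F x = L x"
proof -
  let ?D = "frechet_derivative F (at x)"
  have e: "F x + ?D (y - x) = a \<bullet> y + b" for y using j L by (simp add: jet1_def fun_eq_iff)
  have "?D 0 = 0" using d frechet_derivative_works has_derivative_linear linear_0 by blast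
  then show Fx: "F x = L x" using e[of x] L by simp
  have "?D d = a \<bullet> d" for d using e[of "x + d"] Fx L by (simp add: inner_add_right)
  then show "grad F x = a" by (simp add: grad_def pderiv2_def inner_axis vec_eq_iff)
qed

text \<open>The first summand is the sum over pairs, the second the coarsest level with its at most
  400007 intervals; 4^p passes from \<open>hess_norm1\<close> to the energy.\<close>

definition CT :: "real \<Rightarrow> real \<Rightarrow> real" where
  "CT p B = 4 powr p * (CZ p * (CN (th p) * (1 + CM p powr p * B))
     + 400007 * (2 * (20000000000 powr p * CM p powr p)))"

text \<open>Homogeneity: \<Gamma>^p is a multiple of \<delta>^(p-2) V and the Besov energy at most a
  multiple of \<delta>^(2-p), so their product is controlled by V without any power of \<delta>. The
  scale \<delta>/100000 gives windows of size \<delta>/50, inside the gap of \<delta>/20 between 0.9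
  Q and the boundary of Q.\<close>

lemma trace_bound:
  assumes p: "p > 2" and dl: "\<delta> > 0" and curve: "curve \<psi> u n \<alpha> \<beta> v1 v2"
    and l: "lipschitz_set E u n (\<delta> / 100000)"
    and par: "\<And>e. e \<in> E \<Longrightarrow> \<exists>v\<in>{v1..v2}. e = curve.gam \<psi> u n \<alpha> \<beta> k1 k2 v"
    and B: "B \<ge> 0" "besov_int p \<psi> \<le> ennreal (B * \<delta> powr (2 - p))"
    and E: "E \<subseteq> square q (9/10 * \<delta>)" and x0: "x0 \<in> square q (\<delta> / 2)"
    and F: "F \<in> L2p p (square q \<delta>)" and g: "weak_hessian p (square q \<delta>) F g"
    and L: "\<And>y. L y = a \<bullet> y + b" and j: "jet1 F x0 = L"
  shows "lipschitz_set.energy E u (\<delta> / 100000) p (\<lambda>x. F x - L x) \<le> CT p B * hess_energy p (square q \<delta>) g"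
proof -
  let ?H = "hess_energy p (square q \<delta>) g"
  define V where "V = 4 powr p * ?H"
  define \<Gamma> where "\<Gamma> = CM p * \<delta> powr ((p - 2) / p) * V powr (1/p)"
  let ?s0 = "\<delta> / 100000" and ?S = "square q (92/100 * \<delta>)" and ?U = "interior (square q \<delta>)"
  have p0: "p > 0" using p by simp
  have V0: "V \<ge> 0" using hess_energy_nonneg by (simp add: V_def)
  have G0: "\<Gamma> \<ge> 0" using CM_nonneg[OF p] by (simp add: \<Gamma>_def)
  have x0S: "x0 \<in> ?S"
    unfolding square_def
  proof (clarify)
    fix i have "\<bar>x0$i - q$i\<bar> \<le> \<delta> / 2 / 2" using x0 by (simp add: square_def)
    then show "\<bar>x0$i - q$i\<bar> \<le> 92/100 * \<delta> / 2" by (rule order_trans) (use dl in simp)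
  qed
  have near: "\<bar>y$i - q$i\<bar> \<le> 45/100 * \<delta> + r" if "e \<in> E" "dist y e \<le> r" for y e r i
  proof -
    have "\<bar>y$i - e$i\<bar> \<le> r" using component_le_norm_cart[of "y - e" i] that(2) by (simp add: dist_norm)
    moreover have "\<bar>e$i - q$i\<bar> \<le> 45/100 * \<delta>" using that(1) E by (auto simp: square_def)
    ultimately have "\<bar>y$i - q$i\<bar> \<le> r + 45/100 * \<delta>" by (rule abs_diff_triangle)
    then show ?thesis by simp
  qed
  have SU: "?S \<subseteq> ?U"
  proof
    fix x assume "x \<in> ?S"
    then have "\<bar>x$i - q$i\<bar> \<le> 92/100 * \<delta> / 2" for i by (simp add: square_def)
    from this have "\<bar>x$i - q$i\<bar> < \<delta> / 2" for i by (rule le_less_trans) (use dl in simp)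
    then show "x \<in> ?U" by (simp add: interior_square)
  qed
  have dF: "F differentiable (at x)" if "x \<in> ?U" for x using F that by (simp add: L2p_def)
  have gx0: "grad F x0 = a" and Fx0: "F x0 = L x0" using grad_of_jet1[OF dF L j] x0S SU by blast+
  have gr: "norm (grad F x - a) \<le> \<Gamma>" if "x \<in> ?S" for x
    unfolding gx0[symmetric] \<Gamma>_def V_def by (rule grad_osc_square[OF p dl F g that x0S])
  have ES: "E \<subseteq> ?S"
  proof
    fix e assume "e \<in> E"
    have "\<bar>e$i - q$i\<bar> \<le> 92/100 * \<delta> / 2" for i
      by (rule order_trans[OF near[OF \<open>e \<in> E\<close>, of e 0]]) (use dl in simp_all)
    then show "e \<in> ?S" by (simp add: square_def)
  qed
  have wd: "weakly_differentiable ?U (pderiv2 k F) (\<lambda>i. g i k) (hess_norm1 g)" for k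
    by (rule weakly_differentiable_pderiv2[OF F g])
  interpret curve \<psi> u n \<alpha> \<beta> v1 v2 k1 k2 by (rule curve)
  interpret lipschitz_set E u n ?s0 by (rule l)
  interpret trace_setting \<psi> u n \<alpha> \<beta> v1 v2 k1 k2 E ?s0 p ?U F g a b V \<Gamma> "B * \<delta> powr (2 - p)"
  proof (intro trace_setting.intro trace_setting_axioms.intro curve l p wd V0)
    show "\<exists>v\<in>{v1..v2}. e = gam v" if "e \<in> E" for e using that by (rule par)
    show "F differentiable (at x)" if "x \<in> ?U" for x using that by (rule dF)
    show "0 \<le> B * \<delta> powr (2 - p)" using B(1) by simp
    show "besov_int p \<psi> \<le> ennreal (B * \<delta> powr (2 - p))" by (rule B(2))
    show "(\<integral>\<^sup>+x\<in>?U. ennreal (hess_norm1 g x powr p) \<partial>lborel) \<le> ennreal V"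
      unfolding V_def by (rule nn_integral_hess_norm1_le[OF g p0])
    show "y \<in> ?U" if "e \<in> E" "dist y e \<le> 2000 * ?s0" for e y
    proof -
      have "\<bar>y$i - q$i\<bar> < \<delta> / 2" for i using near[OF that, of i] dl by simp
      then show ?thesis by (simp add: interior_square)
    qed
    show "norm (grad F y - a) \<le> \<Gamma>" if "e \<in> E" "dist y e \<le> 100 * ?s0" for e y
    proof (rule gr)
      have "\<bar>y$i - q$i\<bar> \<le> 92/100 * \<delta> / 2" for i using near[OF that, of i] dl by simp
      then show "y \<in> ?S" by (simp add: square_def)
    qed
  qed
  have dd: "\<bar>data x - data y\<bar> \<le> \<Gamma> * dist x y" if "x \<in> ?S" "y \<in> ?S" for x y
  proof -
    have "norm (data x - data y) \<le> \<Gamma> * norm (x - y)"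
    proof (rule differentiable_bound[where S = ?S and f' = "\<lambda>z d. (grad F z - a) \<bullet> d"])
      show "convex ?S" unfolding square_eq_cbox by (rule convex_box)
      show "(data has_derivative (\<lambda>d. (grad F z - a) \<bullet> d)) (at z within ?S)" if "z \<in> ?S" for z
      proof -
        have "(F has_derivative (\<lambda>d. grad F z \<bullet> d)) (at z within ?S)"
          using has_derivative_grad[OF dF] SU that by (blast intro: has_derivative_at_withinI)
        then show ?thesis unfolding data_def[abs_def] inner_diff_left
          by (auto intro!: derivative_eq_intros)
      qed
      show "onorm (\<lambda>d. (grad F z - a) \<bullet> d) \<le> \<Gamma>" if "z \<in> ?S" for z
        by (rule onorm_le, rule order_trans[OF Cauchy_Schwarz_ineq2[of "grad F z - a", folded real_norm_def]])
          (rule mult_right_mono[OF gr[OF that]], simp)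
    qed (use that in auto)
    then show ?thesis by (simp add: dist_norm)
  qed
  have diam: "dist x y \<le> 2 * \<delta>" if "x \<in> ?S" "y \<in> ?S" for x y
  proof -
    have c: "\<bar>x$i - q$i\<bar> \<le> 46/100 * \<delta>" "\<bar>q$i - y$i\<bar> \<le> 46/100 * \<delta>" for i
      using that by (simp_all add: square_def abs_minus_commute)
    have "\<bar>x$i - y$i\<bar> \<le> 46/100 * \<delta> + 46/100 * \<delta>" for i by (rule abs_diff_triangle[OF c])
    from add_mono[OF this[of 1] this[of 2]] show ?thesis using dist_le_l1[of x y] dl by simp
  qed
  have d0: "data x0 = 0" by (simp add: data_def Fx0 L)
  have D: "\<bar>data e\<bar> \<le> \<Gamma> * (2 * \<delta>)" if "e \<in> E" for e
  proof -
    have e: "e \<in> ?S" using that ES by blast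
    have "\<bar>data e\<bar> \<le> \<Gamma> * dist e x0" using dd[OF e x0S] d0 by simp
    also have "\<dots> \<le> \<Gamma> * (2 * \<delta>)" by (rule mult_left_mono[OF diam[OF e x0S] G0])
    finally show ?thesis .
  qed
  have DA: "\<bar>A data e\<bar> \<le> 2 * \<Gamma>" if e: "e \<in> E" for e
  proof (cases "E = {e}")
    case True
    then show ?thesis unfolding A_def using G0 by simp
  next
    case False
    let ?e = "nb e"
    have e': "?e \<in> E" "?e \<noteq> e" using nb(1,2)[OF False e] .
    have t: "tau e - tau ?e \<noteq> 0" using tau_inj[OF e e'(1)] e'(2) by auto
    \<comment> \<open>The set is 1-Lipschitz over \<open>tau\<close>, which is the origin of the 2
      in 2 \<Gamma>.\<close>
    have "dist e ?e \<le> \<bar>tau e - tau ?e\<bar> + \<bar>tau e - tau ?e\<bar>"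
      using dist_le_un[of e ?e] lip[OF e e'(1)] by simp
    then have "\<Gamma> * dist e ?e \<le> \<Gamma> * (\<bar>tau e - tau ?e\<bar> + \<bar>tau e - tau ?e\<bar>)" by (rule mult_left_mono[OF _ G0])
    moreover have "\<bar>data e - data ?e\<bar> \<le> \<Gamma> * dist e ?e" by (rule dd) (use ES e e' in auto)
    ultimately have "\<bar>data e - data ?e\<bar> \<le> 2 * \<Gamma> * \<bar>tau e - tau ?e\<bar>" by simp
    then show ?thesis unfolding A_def using False t by (simp add: abs_divide pos_divide_le_eq)
  qed
  have M: "real (card (J 0)) \<le> 400007"
  proof -
    obtain e1 where e1: "e1 \<in> E" using neE by blast
    \<comment> \<open>\<open>E\<close> has diameter at most 2 \<delta>, which is 200000 grid steps,
      and an index in \<open>J 0\<close> is within 3 steps of a point of \<open>E\<close>.\<close>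
    have "J 0 \<subseteq> {j::int. \<bar>tau e1 / ?s0 - real_of_int j\<bar> \<le> real 200003}"
    proof
      fix j assume "j \<in> J 0"
      then obtain e where e: "e \<in> E" "\<bar>tau e - real_of_int j * ?s0\<bar> \<le> 3 * ?s0" by (auto simp: J_def s_0)
      have "\<bar>tau e1 - tau e\<bar> \<le> 2 * \<delta>"
        using inner_le_dist(1)[of e1 e] diam[of e1 e] ES e e1 by (meson order_trans subsetD)
      from abs_diff_triangle[OF this e(2)] have "\<bar>tau e1 - real_of_int j * ?s0\<bar> \<le> 200003 * ?s0" by simp
      moreover have "\<bar>tau e1 / ?s0 - real_of_int j\<bar> = \<bar>tau e1 - real_of_int j * ?s0\<bar> / ?s0"
      proof -
        have "tau e1 / ?s0 - real_of_int j = (tau e1 - real_of_int j * ?s0) / ?s0" using dl by (simp add: field_simps)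
        then show ?thesis using s0 by (simp only: abs_divide abs_of_pos)
      qed
      ultimately show "j \<in> {j::int. \<bar>tau e1 / ?s0 - real_of_int j\<bar> \<le> real 200003}"
        using s0 by (simp add: pos_divide_le_eq)
    qed
    from card_mono[OF card_int_near(2) this] card_int_near(1)[of "tau e1 / ?s0" 200003]
    have "card (J 0) \<le> 2 * 200003 + 1" by (rule order_trans)
    then show ?thesis by simp
  qed
  have Gp: "\<Gamma> powr p = CM p powr p * \<delta> powr (p - 2) * V"
    using p0 V0 by (simp add: \<Gamma>_def powr_mult powr_powr)
  have dd1: "\<delta> powr (p - 2) * \<delta> powr (2 - p) = 1" using dl by (simp add: powr_add[symmetric])
  have "energy p data \<le> CZ p * (CN (th p) * (V + \<Gamma> powr p * (B * \<delta> powr (2 - p))))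
    + 400007 * (?s0\<^sup>2 * ((2 * \<Gamma> / ?s0) powr p + (\<Gamma> * (2 * \<delta>) / ?s0\<^sup>2) powr p))"
    by (rule energy_le[OF D DA M])
  also have "V + \<Gamma> powr p * (B * \<delta> powr (2 - p)) = (1 + CM p powr p * B) * V"
  proof -
    have "\<Gamma> powr p * (B * \<delta> powr (2 - p)) = CM p powr p * B * V * (\<delta> powr (p - 2) * \<delta> powr (2 - p))"
      unfolding Gp by (simp only: mult_ac)
    then show ?thesis unfolding dd1 by (simp add: algebra_simps)
  qed
  also have "?s0\<^sup>2 * ((2 * \<Gamma> / ?s0) powr p + (\<Gamma> * (2 * \<delta>) / ?s0\<^sup>2) powr p)
    \<le> 2 * (20000000000 powr p * CM p powr p) * V"
  proof -
    \<comment> \<open>2 * 10^10 arises from dividing 2 \<delta> \<Gamma> by the square of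
      \<delta>/100000.\<close>
    let ?q = "20000000000 * (\<Gamma> / \<delta>)"
    have q1: "2 * \<Gamma> / ?s0 \<le> ?q" "2 * \<Gamma> / ?s0 \<ge> 0" using G0 dl by (simp_all add: field_simps)
    have q2: "\<Gamma> * (2 * \<delta>) / ?s0\<^sup>2 = ?q" using dl by (simp add: power2_eq_square field_simps)
    have "?s0\<^sup>2 * ((2 * \<Gamma> / ?s0) powr p + (\<Gamma> * (2 * \<delta>) / ?s0\<^sup>2) powr p) \<le> \<delta>\<^sup>2 * (?q powr p + ?q powr p)"
      unfolding q2 using q1 p0 dl by (intro mult_mono add_mono powr_mono2 power_mono) auto
    also have "\<dots> = 2 * (20000000000 powr p * (\<delta>\<^sup>2 * (\<Gamma> / \<delta>) powr p))"
      unfolding powr_mult[of 20000000000 "\<Gamma> / \<delta>"] by (simp only: mult_2[symmetric] mult_ac)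
    also have "\<delta>\<^sup>2 * (\<Gamma> / \<delta>) powr p = CM p powr p * V * (\<delta> powr (p - 2) * \<delta> powr (2 - p))"
    proof -
      have "(\<Gamma> / \<delta>) powr p = \<Gamma> powr p * \<delta> powr (-p)" using dl G0 by (simp add: powr_divide powr_minus_divide)
      moreover have "\<delta>\<^sup>2 * \<delta> powr (-p) = \<delta> powr (2 - p)"
      proof -
        have "\<delta>\<^sup>2 = \<delta> powr 2" using dl by (simp add: powr_numeral)
        then show ?thesis by (simp add: powr_add[symmetric])
      qed
      ultimately show ?thesis unfolding Gp by (metis (no_types, opaque_lifting) mult.assoc mult.commute)
    qed
    finally show ?thesis unfolding dd1 by (simp add: mult_ac)
  qed
  finally have "energy p data \<le> CZ p * (CN (th p) * ((1 + CM p powr p * B) * V))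
    + 400007 * (2 * (20000000000 powr p * CM p powr p) * V)" by simp
  also have "\<dots> = CT p B * ?H" unfolding V_def CT_def by (simp add: algebra_simps)
  also have "data = (\<lambda>x. F x - L x)" by (simp add: data_def L fun_eq_iff)
  finally show ?thesis .
qed


lemma CN_nonneg: "\<theta> > 0 \<Longrightarrow> CN \<theta> \<ge> 0"
  unfolding CN_def using ge_one_powr_ge_zero[of 2 \<theta>] by simp

lemma CT_nonneg:
  assumes "p > 2" "B \<ge> 0"
  shows "CT p B \<ge> 0"
  unfolding CT_def CZ_def
  using CN_nonneg[OF th(1)[OF assms(1)]] assms(2) by (intro mult_nonneg_nonneg add_nonneg_nonneg) auto

lemma jet_extension_nonempty:
  fixes \<delta> :: real
  assumes p: "p > 2" and dl: "\<delta> > 0" and E: "finite E" "E \<noteq> {}" "E \<subseteq> square q (9/10 * \<delta>)"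
    and bes: "besov_set_norm p E \<le> 1 / (160 * CE p 0) * \<delta> powr (2/p - 1)"
    and x0: "x0 \<in> square q (\<delta> / 2)" and far: "\<And>y. y \<in> E \<Longrightarrow> dist x0 y \<ge> \<delta> / 100"
    and C: "C \<ge> 4" "C \<ge> K1" "C \<ge> K2 powr (1/p)" "C \<ge> K1 * K2 powr (1/p)"
      "K1 = 25600 * (4000000 * KB ^ 3)" "K2 = CT p ((2 / (160 * CE p 0)) powr p) + 1"
  shows "jet_extension p C q \<delta> E x0"
proof -
  \<comment> \<open>With this value the slope bound 4 CE c4 of \<open>curve_normal_form\<close> is
    exactly 1/40.\<close>
  let ?c4 = "1 / (160 * CE p 0)" and ?s0 = "\<delta> / 100000" and ?Q = "square q \<delta>"
  have CE0: "CE p 0 > 0" using CE_pos[of p 0] p by simp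
  have c4: "?c4 > 0" using CE0 by simp
  have diam: "dist x y \<le> 2 * \<delta>" if "x \<in> E" "y \<in> E" for x y
  proof -
    have c: "\<bar>x$i - q$i\<bar> \<le> 45/100 * \<delta>" "\<bar>q$i - y$i\<bar> \<le> 45/100 * \<delta>" for i
      using that E(3) by (auto simp: square_def abs_minus_commute)
    have "\<bar>x$i - y$i\<bar> \<le> 45/100 * \<delta> + 45/100 * \<delta>" for i by (rule abs_diff_triangle[OF c])
    from add_mono[OF this[of 1] this[of 2]] show ?thesis using dist_le_l1[of x y] dl by simp
  qed
  obtain u n :: "real^2" and \<psi> \<alpha> \<beta> v1 v2 k1 k2 where un: "norm u = 1" "norm n = 1" "u \<bullet> n = 0"
    and diff: "\<And>t. \<psi> differentiable (at t)" and ab: "\<bar>\<alpha>\<bar> \<le> 1" "\<bar>\<beta>\<bar> \<le> 1" and v12: "v1 \<le> v2"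
    and on: "\<And>e. e \<in> E \<Longrightarrow> \<exists>v\<in>{v1..v2}. u \<bullet> e = k1 + v + \<alpha> * \<psi> v \<and> n \<bullet> e = k2 + \<beta> * \<psi> v"
    and sl: "\<And>v. v \<in> {v1..v2} \<Longrightarrow> \<bar>deriv \<psi> v\<bar> \<le> 4 * CE p 0 * ?c4"
    and bi: "besov_int p \<psi> \<le> ennreal ((2 * ?c4) powr p * \<delta> powr (2 - p))"
    using curve_normal_form[OF p dl E(1,2) c4 diam bes] by blast
  have curve: "curve \<psi> u n \<alpha> \<beta> v1 v2"
  proof (unfold_locales)
    show "\<bar>deriv \<psi> v\<bar> \<le> 1/40" if "v \<in> {v1..v2}" for v using sl[OF that] CE0 by simp
  qed (use diff un ab v12 in auto)
  interpret cu: curve \<psi> u n \<alpha> \<beta> v1 v2 k1 k2 by (rule curve)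
  have par: "\<exists>v\<in>{v1..v2}. e = cu.gam v" if e: "e \<in> E" for e
  proof -
    obtain v where v: "v \<in> {v1..v2}" "u \<bullet> e = k1 + v + \<alpha> * \<psi> v" "n \<bullet> e = k2 + \<beta> * \<psi> v" using on[OF e] by blast
    have "e = cu.gam v" by (rule cu.inner_un_eq) (use v in \<open>simp_all add: cu.inner_gam cu.tv_def cu.ev_def\<close>)
    then show ?thesis using v(1) by blast
  qed
  have lip: "lipschitz_set E u n ?s0"
  proof (unfold_locales)
    show "\<bar>n \<bullet> e - n \<bullet> e'\<bar> \<le> \<bar>u \<bullet> e - u \<bullet> e'\<bar>" if ee: "e \<in> E" "e' \<in> E" for e e'
    proof -
      obtain v w where v: "v \<in> {v1..v2}" "e = cu.gam v" and w: "w \<in> {v1..v2}" "e' = cu.gam w"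
        using par[OF ee(1)] par[OF ee(2)] by blast
      have "\<bar>cu.ev v - cu.ev w\<bar> \<le> 1/39 * \<bar>cu.tv v - cu.tv w\<bar>" by (rule cu.ev_diff(2)[OF v(1) w(1)])
      also have "\<dots> \<le> \<bar>cu.tv v - cu.tv w\<bar>" by simp
      finally show ?thesis by (simp add: v w cu.inner_gam)
    qed
  qed (use E un dl in auto)
  interpret l: lipschitz_set E u n ?s0 by (rule lip)
  have p0: "p > 0" using p by simp
  from l.energy_functionals[OF p0] obtain lam :: "nat \<Rightarrow> (real^2 \<Rightarrow> real) \<Rightarrow> real" where
    lam: "\<And>i f f' a. lam i (\<lambda>x. f x + a * f' x) = lam i f + a * lam i f'"
      "\<And>i f f'. i < 4 * (card E)\<^sup>2 \<Longrightarrow> \<forall>x\<in>E. f x = f' x \<Longrightarrow> lam i f = lam i f'"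
      "\<And>f. (\<Sum>i<4 * (card E)\<^sup>2. \<bar>lam i f\<bar> powr p) = l.energy p f"
    by (elim exE conjE) presburger
  show ?thesis
  proof (rule jet_extensionI[where S = l.ext and lam = lam and N = "4 * (card E)\<^sup>2" and K = K1 and K' = K2])
    show "l.ext (\<lambda>y. f y + a * f' y) x = l.ext f x + a * l.ext f' x" for f f' a x by (rule l.ext_linear)
    show "l.ext f = l.ext f'" if "\<forall>y\<in>E. f y = f' y" for f f' by (rule l.ext_cong) (use that in auto)
    show "l.ext f e = f e" if "e \<in> E" for f e by (rule l.ext_interpolates[OF that])
    fix L assume "L \<in> affine_poly"
    then obtain a b where L: "\<And>y. L y = a \<bullet> y + b" by (auto simp: affine_poly_def)
    show "(\<lambda>x. L x + l.ext f x) \<in> L2p p ?Q" for f using l.ext_L2p(1)[OF _ L] p by simp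
    show "L2p_norm p ?Q (\<lambda>x. L x + l.ext f x) \<le> K1 * (\<Sum>i<4 * (card E)\<^sup>2. \<bar>lam i f\<bar> powr p) powr (1/p)" for f
      unfolding lam(3) C(5) using p by (intro l.ext_L2p(2)[OF _ L]) simp
    show "jet1 (\<lambda>x. L x + l.ext f x) x0 = L" for f
    proof (rule l.ext_jet[OF _ L])
      fix e assume "e \<in> E"
      \<comment> \<open>The cutoffs reach only 13 \<delta>/100000, far less than
        \<delta>/100.\<close>
      from far[OF this] show "dist x0 e \<ge> 13 * ?s0" using dl by simp
    qed
    fix F g assume F: "F \<in> L2p p ?Q" and g: "weak_hessian p ?Q F g" and j: "jet1 F x0 = L"
    have "l.energy p (\<lambda>x. F x - L x) \<le> CT p ((2 * ?c4) powr p) * hess_energy p ?Q g"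
      by (rule trace_bound[OF p dl curve lip par _ bi E(3) x0 F g L j]) simp_all
    also have "\<dots> \<le> K2 * hess_energy p ?Q g"
      unfolding C(6) by (rule mult_right_mono[OF _ hess_energy_nonneg]) simp
    finally show "(\<Sum>i<4 * (card E)\<^sup>2. \<bar>lam i (\<lambda>x. F x - L x)\<bar> powr p) \<le> K2 * hess_energy p ?Q g"
      unfolding lam(3) .
  next
    show "K2 > 0" using CT_nonneg[OF p, of "(2 / (160 * CE p 0)) powr p"] by (simp add: C(6))
    show "K1 \<ge> 0" using KB(1) by (simp add: C(5))
  qed (use p C lam in auto)
qed

theorem mainTheorem13:
  fixes p :: real
  assumes "2 < p"
  shows "\<exists>c4 > 0. \<exists>C > 0. \<forall>(c::real^2) (\<delta>::real) (E0::(real^2) set) (x0::real^2).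
    (0 < \<delta> \<and> finite E0 \<and> E0 \<subseteq> square c (0.9 * \<delta>)
     \<and> besov_set_norm p E0 \<le> c4 * \<delta> powr (2/p - 1)
     \<and> x0 \<in> square c (\<delta> / 2) \<and> (\<forall>y\<in>E0. dist x0 y \<ge> \<delta> / 100)) \<longrightarrow>
    (\<exists>(T :: (real^2 \<Rightarrow> real) \<Rightarrow> (real^2 \<Rightarrow> real) \<Rightarrow> (real^2 \<Rightarrow> real))
       (lam :: nat \<Rightarrow> (real^2 \<Rightarrow> real) \<Rightarrow> (real^2 \<Rightarrow> real) \<Rightarrow> real) (N0::nat).
       \<comment> \<open>T is a linear map (f0, L0) to L^{2,p}(Q), depending only on f0 restricted to E0\<close>
       (\<forall>f f' L L' a. L \<in> affine_poly \<longrightarrow> L' \<in> affine_poly \<longrightarrow>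
          (\<forall>x\<in>square c \<delta>. T (\<lambda>y. f y + a * f' y) (\<lambda>y. L y + a * L' y) x
                              = T f L x + a * T f' L' x)) \<and>
       (\<forall>f f' L. (\<forall>y\<in>E0. f y = f' y) \<longrightarrow> (\<forall>x\<in>square c \<delta>. T f L x = T f' L x)) \<and>
       (\<forall>f L. L \<in> affine_poly \<longrightarrow> T f L \<in> L2p p (square c \<delta>)) \<and>
       \<comment> \<open>the lambda_i are linear functionals on (f0, L0), depending only on f0 on E0\<close>
       (\<forall>i<N0. \<forall>f f' L L' a. L \<in> affine_poly \<longrightarrow> L' \<in> affine_poly \<longrightarrow>
          lam i (\<lambda>y. f y + a * f' y) (\<lambda>y. L y + a * L' y) = lam i f L + a * lam i f' L') \<and>
       (\<forall>i<N0. \<forall>f f' L. (\<forall>y\<in>E0. f y = f' y) \<longrightarrow> lam i f L = lam i f' L) \<and>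
       real N0 \<le> C * (real (card E0))^2 \<and>
       (\<forall>f0 L0. L0 \<in> affine_poly \<longrightarrow>
          (\<forall>x\<in>E0. T f0 L0 x = f0 x) \<and>
          jet1 (T f0 L0) x0 = L0 \<and>
          L2p_norm p (square c \<delta>) (T f0 L0)
            \<le> C * Inf {L2p_norm p (square c \<delta>) F | F. F \<in> L2p p (square c \<delta>)
                          \<and> (\<forall>x\<in>E0. F x = f0 x) \<and> jet1 F x0 = L0} \<and>
          (1 / C) * (\<Sum>i<N0. \<bar>lam i f0 L0\<bar> powr p) powr (1/p)
            \<le> L2p_norm p (square c \<delta>) (T f0 L0) \<and>
          L2p_norm p (square c \<delta>) (T f0 L0)
            \<le> C * (\<Sum>i<N0. \<bar>lam i f0 L0\<bar> powr p) powr (1/p)))"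
proof -
  define K1 where "K1 = 25600 * (4000000 * KB ^ 3)"
  define K2 where "K2 = CT p ((2 / (160 * CE p 0)) powr p) + 1"
  \<comment> \<open>The four lower bounds for C in \<open>jet_extensionI\<close>; 4 serves the
    number of functionals. All of them depend on p alone.\<close>
  define C where "C = Max {4, K1, K2 powr (1/p), K1 * K2 powr (1/p)}"
  have C: "C \<ge> 4" "C \<ge> K1" "C \<ge> K2 powr (1/p)" "C \<ge> K1 * K2 powr (1/p)" by (simp_all add: C_def)
  have E: "jet_extension p C c \<delta> E0 x0"
    if h: "0 < \<delta>" "finite E0" "E0 \<subseteq> square c (0.9 * \<delta>)" "besov_set_norm p E0 \<le> 1 / (160 * CE p 0) * \<delta> powr (2/p - 1)"
      "x0 \<in> square c (\<delta> / 2)" "\<forall>y\<in>E0. dist x0 y \<ge> \<delta> / 100" for c \<delta> E0 x0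
  proof (cases "E0 = {}")
    case True
    then show ?thesis using jet_extension_empty[of p C] assms C by simp
  next
    case False
    have "E0 \<subseteq> square c (9/10 * \<delta>)" using h(3) by simp
    from jet_extension_nonempty[OF assms h(1,2) False this h(4,5) _ C K1_def K2_def] show ?thesis
      using h(6) by blast
  qed
  have all: "\<forall>c \<delta> E0 x0. (0 < \<delta> \<and> finite E0 \<and> E0 \<subseteq> square c (0.9 * \<delta>)
     \<and> besov_set_norm p E0 \<le> 1 / (160 * CE p 0) * \<delta> powr (2/p - 1)
     \<and> x0 \<in> square c (\<delta> / 2) \<and> (\<forall>y\<in>E0. dist x0 y \<ge> \<delta> / 100)) \<longrightarrow> jet_extension p C c \<delta> E0 x0"
    using E by blast
  have pos: "1 / (160 * CE p 0) > 0" "C > 0" using CE_pos[of p 0] assms C by simp_all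
  show ?thesis
    by (rule exI[of _ "1 / (160 * CE p 0)"], rule conjI[OF pos(1)], rule exI[of _ C], rule conjI[OF pos(2)])
      (rule all[unfolded jet_extension_def])
qed

end
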